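(* Let $\mathcal{M}=(M,\mathcal{A}_M)$ be a $\mathbb{Z}_2$-supermanifold. Then the tangent bundle $\mathsf{T}\mathcal{M}$ of $\mathcal{M}$, interpreted as the ringed space $(M,\widehat{\Omega}_D(\mathcal{M}))$, is a $\mathbb{Z}_2^2$-supermanifold.
   Context: For $n\ge1$ and $i,j\in\mathbb{Z}_2^n$ put $\langle i,j\rangle=\sum_k i_kj_k$. A $\mathbb{Z}_2^n$-commutative associative unital $\mathbb{R}$-algebra is a $\mathbb{Z}_2^n$-graded associative unital $\mathbb{R}$-algebra with $ab=(-1)^{\langle\deg a,\deg b\rangle}ba$ for homogeneous $a,b$. Let $\xi^1,\dots,\xi^q$ be formal variables with degrees in $\mathbb{Z}_2^n\setminus\{0\}$. For $U\subset\mathbb{R}^p$ open, $C^\infty_U[[\xi^1,\dots,\xi^q]]$ denotes the sheaf $V\mapsto C^\infty(V)[[\xi^1,\dots,\xi^q]]$ of formal power series $\sum_\mu f_\mu(x)\xi^\mu$ with $f_\mu\in C^\infty(V)$, functions of $x$ having degree $0$ and being central, with $\xi^a\xi^b=(-1)^{\langle\deg\xi^a,\deg\xi^b\rangle}\xi^b\xi^a$ (variables with odd $\langle\deg\xi^a,\deg\xi^a\rangle$ thus occur with exponent at most 1). The pair $(U,C^\infty_U[[\xi^1,\dots,\xi^q]])$ is a $\mathbb{Z}_2^n$-superdomain; its dimension is $p|\mathbf{q}$, with $\mathbf{q}$ listing the numbers of $\xi^a$ of each degree in $\mathbb{Z}_2^n\setminus\{0\}$. A $\mathbb{Z}_2^n$-supermanifold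 of dimension $p|\mathbf{q}$ is a pair $(M,\mathcal{A}_M)$ of a Hausdorff second-countable topological space and a sheaf of $\mathbb{Z}_2^n$-commutative associative unital $\mathbb{R}$-algebras with local stalks (unique maximal homogeneous ideal), locally isomorphic (through isomorphisms of locally $\mathbb{Z}_2^n$-ringed spaces) to a $\mathbb{Z}_2^n$-superdomain of dimension $p|\mathbf{q}$. For $n=1$ these are the classical supermanifolds. Let $\mathcal{M}=(M,\mathcal{A}_M)$ be a $\mathbb{Z}_2$-supermanifold with local coordinates $(x^i,\xi^a)$, $x^i$ even and $\xi^a$ odd. The adapted coordinates of $\mathsf{T}\mathcal{M}$ are $(x^i,\xi^a,\dot x^j,\dot\xi^b)$, where $\dot x^j$, $\dot\xi^b$ (identified with the differentials $dx^j$, $d\xi^b$) transform linearly under coordinate changes as differentials do; they are given the $\mathbb{Z}_2^2$-degrees $(0,0),(0,1),(1,0),(1,1)$, respectively (first component: the differential-form degree mod 2; second component: the parity) and satisfy the $\mathbb{Z}_2^2$-commutation rule. Let $\Omega^1$ be the $\mathcal{A}_M$-module of super differential 1-forms, locally free on $dx^j,d\xi^b$. The algebra $\Omega_D(\mathcal{M})=\bigoplus_{k\ge0}\bigwedge^k\Omega^1$ of Deligne super differential forms on $\mathcal{M}$ is the $\mathbb{Z}_2^2$-commutative algebra (Deligne sign convention: $AB=(-1)^{mk+nl}BA$ for $A,B$ of bidegrees $(m,n),(k,l)\in\mathbb{Z}_2^2$, where $x^i,\xi^a,dx^j,d\xi^b$ have the bidegrees $(0,0),(0,1),(1,0),(1,1)$,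 respectively) that is locally the algebra of polynomials in $dx^j,d\xi^b$ with coefficients in $\mathcal{A}_M$; its completion is $$\widehat{\Omega}_D(\mathcal{M})=\prod_{k\ge0}\textstyle\bigwedge^k\Omega^1 ,$$ regarded as a sheaf on $M$ (whose sections are locally formal power series in $\xi^a,dx^j,d\xi^b$ with coefficients smooth in $x^i$). *)

theory Defs
  imports
    "HOL-Analysis.Analysis"
    "HOL-Library.Z2"
    "HOL-Algebra.Ideal"
    "HOL-Algebra.Module"
begin

section \<open>Graded-commutative algebras\<close>

text \<open>The group of degrees is \<^typ>\<open>bit ^ 'n\<close>, so the number of factors \<open>n = CARD('n)\<close> is at least 1.\<close>

definition koszul :: "bit ^ 'n::finite \<Rightarrow> bit ^ 'n \<Rightarrow> real" where
  "koszul i j = (if (\<Sum>k\<in>UNIV. i $ k * j $ k) = 0 then 1 else - 1)"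

definition real_ring :: "real ring" where
  "real_ring = \<lparr>carrier = UNIV, monoid.mult = (*), one = 1, zero = 0, add = (+)\<rparr>"

record ('b, 'n) graded_algebra = "(real, 'b) module" +
  gcomp :: "bit ^ ('n::finite) \<Rightarrow> 'b set"

locale graded_comm_algebra =
  Module.module real_ring A + Ring.ring A
  for A :: "('b, 'n::finite) graded_algebra" (structure) +
  assumes smult_mult_left:
      "\<lbrakk>a \<in> carrier A; b \<in> carrier A\<rbrakk> \<Longrightarrow> (r \<odot> a) \<otimes> b = r \<odot> (a \<otimes> b)"
    and smult_mult_right:
      "\<lbrakk>a \<in> carrier A; b \<in> carrier A\<rbrakk> \<Longrightarrow> a \<otimes> (r \<odot> b) = r \<odot> (a \<otimes> b)"
    and gcomp_submodule: "submodule (gcomp A d) real_ring A"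
    and gcomp_direct_sum:
      "a \<in> carrier A \<Longrightarrow> \<exists>!f. (\<forall>d. f d \<in> gcomp A d) \<and> a = (\<Oplus>d\<in>UNIV. f d)"
    and one_gcomp: "\<one> \<in> gcomp A 0"
    and mult_gcomp:
      "\<lbrakk>a \<in> gcomp A i; b \<in> gcomp A j\<rbrakk> \<Longrightarrow> a \<otimes> b \<in> gcomp A (i + j)"
    and graded_comm:
      "\<lbrakk>a \<in> gcomp A i; b \<in> gcomp A j\<rbrakk> \<Longrightarrow> a \<otimes> b = koszul i j \<odot> (b \<otimes> a)"

definition graded_hom ::
  "('a, 'n::finite) graded_algebra \<Rightarrow> ('b, 'n) graded_algebra \<Rightarrow> ('a \<Rightarrow> 'b) set" where
  "graded_hom A B = {h \<in> ring_hom A B.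
     (\<forall>r. \<forall>a\<in>carrier A. h (r \<odot>\<^bsub>A\<^esub> a) = r \<odot>\<^bsub>B\<^esub> h a) \<and>
     (\<forall>d. h ` gcomp A d \<subseteq> gcomp B d)}"

definition homogeneous_ideal :: "'b set \<Rightarrow> ('b, 'n::finite) graded_algebra \<Rightarrow> bool" where
  "homogeneous_ideal I A \<longleftrightarrow> ideal I A \<and>
     (\<forall>f. (\<forall>d. f d \<in> gcomp A d) \<and> (\<Oplus>\<^bsub>A\<^esub>d\<in>UNIV. f d) \<in> I \<longrightarrow> (\<forall>d. f d \<in> I))"

definition maximal_homogeneous_ideal :: "'b set \<Rightarrow> ('b, 'n::finite) graded_algebra \<Rightarrow> bool" where
  "maximal_homogeneous_ideal I A \<longleftrightarrow> homogeneous_ideal I A \<and> I \<noteq> carrier A \<and>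
     (\<forall>J. homogeneous_ideal J A \<and> I \<subseteq> J \<and> J \<noteq> carrier A \<longrightarrow> J = I)"

definition graded_local :: "('b, 'n::finite) graded_algebra \<Rightarrow> bool" where
  "graded_local A \<longleftrightarrow> (\<exists>!I. maximal_homogeneous_ideal I A)"


section \<open>Ringed spaces\<close>

text \<open>
  \<open>res M U V\<close> is the restriction from \<open>U\<close> to \<open>V\<close>. The values of \<open>sections\<close> and \<open>res\<close> matter only
  on open sets (and, for \<open>res\<close>, on sections). The record itself carries no axioms: it is
  used for presheaves too.
\<close>

record ('m, 'b, 'n) ringed_space =
  base :: "'m topology"
  sections :: "'m set \<Rightarrow> ('b, 'n::finite) graded_algebra"
  res :: "'m set \<Rightarrow> 'm set \<Rightarrow> 'b \<Rightarrow> 'b"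

abbreviation opens :: "('m, 'b, 'n::finite) ringed_space \<Rightarrow> 'm set \<Rightarrow> 'm set set" where
  "opens M U \<equiv> {V. openin (base M) V \<and> V \<subseteq> U}"

definition presheaf_of_algebras :: "('m, 'b, 'n::finite) ringed_space \<Rightarrow> bool" where
  "presheaf_of_algebras M \<longleftrightarrow>
     (\<forall>U. openin (base M) U \<longrightarrow> graded_comm_algebra (sections M U)) \<and>
     (\<forall>U. openin (base M) U \<longrightarrow> (\<forall>V\<in>opens M U.
        res M U V \<in> graded_hom (sections M U) (sections M V))) \<and>
     (\<forall>U. openin (base M) U \<longrightarrow> (\<forall>s\<in>carrier (sections M U). res M U U s = s)) \<and>
     (\<forall>U. openin (base M) U \<longrightarrow> (\<forall>V\<in>opens M U. \<forall>W\<in>opens M V.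
        \<forall>s\<in>carrier (sections M U). res M V W (res M U V s) = res M U W s))"

definition sheaf_of_algebras :: "('m, 'b, 'n::finite) ringed_space \<Rightarrow> bool" where
  "sheaf_of_algebras M \<longleftrightarrow> presheaf_of_algebras M \<and>
     (\<forall>\<U> s. (\<forall>V\<in>\<U>. openin (base M) V \<and> s V \<in> carrier (sections M V)) \<and>
        (\<forall>V\<in>\<U>. \<forall>W\<in>\<U>. res M V (V \<inter> W) (s V) = res M W (V \<inter> W) (s W)) \<longrightarrow>
        (\<exists>!t. t \<in> carrier (sections M (\<Union>\<U>)) \<and> (\<forall>V\<in>\<U>. res M (\<Union>\<U>) V t = s V)))"

text \<open>A germ is the set of all its representatives (neighbourhood, section).\<close>

definition germ ::
  "('m, 'b, 'n::finite) ringed_space \<Rightarrow> 'm \<Rightarrow> 'm set \<Rightarrow> 'b \<Rightarrow> ('m set \<times> 'b) set" where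
  "germ M x U s = {(V, t). openin (base M) V \<and> x \<in> V \<and> t \<in> carrier (sections M V) \<and>
     (\<exists>W\<in>opens M (U \<inter> V). x \<in> W \<and> res M U W s = res M V W t)}"

definition stalk ::
  "('m, 'b, 'n::finite) ringed_space \<Rightarrow> 'm \<Rightarrow> (('m set \<times> 'b) set, 'n) graded_algebra" where
  "stalk M x = \<lparr>
     carrier = {germ M x U s |U s. openin (base M) U \<and> x \<in> U \<and> s \<in> carrier (sections M U)},
     monoid.mult = (\<lambda>g h. \<Union>(U, s)\<in>g. \<Union>(V, t)\<in>h.
        germ M x (U \<inter> V) (res M U (U \<inter> V) s \<otimes>\<^bsub>sections M (U \<inter> V)\<^esub> res M V (U \<inter> V) t)),
     one = germ M x (topspace (base M)) \<one>\<^bsub>sections M (topspace (base M))\<^esub>,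
     zero = germ M x (topspace (base M)) \<zero>\<^bsub>sections M (topspace (base M))\<^esub>,
     add = (\<lambda>g h. \<Union>(U, s)\<in>g. \<Union>(V, t)\<in>h.
        germ M x (U \<inter> V) (res M U (U \<inter> V) s \<oplus>\<^bsub>sections M (U \<inter> V)\<^esub> res M V (U \<inter> V) t)),
     smult = (\<lambda>r g. \<Union>(U, s)\<in>g. germ M x U (r \<odot>\<^bsub>sections M U\<^esub> s)),
     gcomp = (\<lambda>d. {germ M x U s |U s. openin (base M) U \<and> x \<in> U \<and> s \<in> gcomp (sections M U) d})\<rparr>"

definition open_subspace ::
  "('m, 'b, 'n::finite) ringed_space \<Rightarrow> 'm set \<Rightarrow> ('m, 'b, 'n) ringed_space" where
  "open_subspace M U = M\<lparr>base := subtopology (base M) U\<rparr>"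

text \<open>
  A degree-preserving algebra isomorphism identifies the homogeneous ideals, so the maps that an
  isomorphism induces on local stalks respect the maximal homogeneous ideals automatically.
\<close>

definition isomorphic_ringed_spaces ::
  "('m, 'b, 'n::finite) ringed_space \<Rightarrow> ('k, 'c, 'n) ringed_space \<Rightarrow> bool" where
  "isomorphic_ringed_spaces M N \<longleftrightarrow>
     (\<exists>\<phi> \<psi>. homeomorphic_map (base M) (base N) \<phi> \<and>
       (let pre = (\<lambda>V. {x \<in> topspace (base M). \<phi> x \<in> V}) in
         (\<forall>V. openin (base N) V \<longrightarrow>
            \<psi> V \<in> graded_hom (sections N V) (sections M (pre V)) \<and>
            bij_betw (\<psi> V) (carrier (sections N V)) (carrier (sections M (pre V)))) \<and>
         (\<forall>V. openin (base N) V \<longrightarrow> (\<forall>W\<in>opens N V. \<forall>f\<in>carrier (sections N V).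
            \<psi> W (res N V W f) = res M (pre V) (pre W) (\<psi> V f)))))"


section \<open>Superdomains\<close>

text \<open>
  Points of \<open>\<real>\<^sup>p\<close> are the functions \<^typ>\<open>nat \<Rightarrow> real\<close> that vanish from index \<open>p\<close> on, as in
  \<^const>\<open>Euclidean_space\<close>; this allows \<open>p = 0\<close>.
\<close>

definition partial_deriv :: "nat \<Rightarrow> ((nat \<Rightarrow> real) \<Rightarrow> real) \<Rightarrow> (nat \<Rightarrow> real) \<Rightarrow> real" where
  "partial_deriv i f x = deriv (\<lambda>t. f (x(i := t))) (x i)"

definition smooth_functions :: "nat \<Rightarrow> (nat \<Rightarrow> real) set \<Rightarrow> ((nat \<Rightarrow> real) \<Rightarrow> real) set" where
  "smooth_functions p V = {f \<in> extensional V. \<forall>is. set is \<subseteq> {..<p} \<longrightarrow>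
     continuous_map (subtopology (Euclidean_space p) V) euclideanreal (foldr partial_deriv is f) \<and>
     (\<forall>i<p. \<forall>x\<in>V.
        (\<lambda>t. foldr partial_deriv is f (x(i := t))) field_differentiable (at (x i)))}"

text \<open>
  The formal variable \<open>\<xi>\<^sup>a\<close> has degree \<open>ds ! a\<close>, and \<open>\<mu>\<close> stands for the ordered monomial
  \<open>(\<xi>\<^sup>0)\<^bsup>\<mu> 0\<^esup> (\<xi>\<^sup>1)\<^bsup>\<mu> 1\<^esup> \<dots>\<close>.
\<close>

definition multi_indices :: "(bit ^ 'n::finite) list \<Rightarrow> (nat \<Rightarrow> nat) set" where
  "multi_indices ds = {\<mu>. (\<forall>a\<ge>length ds. \<mu> a = 0) \<and>
     (\<forall>a<length ds. koszul (ds ! a) (ds ! a) = - 1 \<longrightarrow> \<mu> a \<le> 1)}"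

definition monomial_degree :: "(bit ^ 'n::finite) list \<Rightarrow> (nat \<Rightarrow> nat) \<Rightarrow> bit ^ 'n" where
  "monomial_degree ds \<mu> = (\<Sum>a<length ds. \<Sum>_<\<mu> a. ds ! a)"

text \<open>
  The sign in \<open>\<xi>\<^sup>\<mu> \<xi>\<^sup>\<nu> = \<plusminus> \<xi>\<^bsup>\<mu> + \<nu>\<^esup>\<close>: each \<open>\<xi>\<^sup>b\<close> of the second factor moves to the left past the
  \<open>\<xi>\<^sup>a\<close> with \<open>a > b\<close> of the first. The product is zero if \<open>\<mu> + \<nu>\<close> is not an admissible
  multi-index.
\<close>

definition monomial_sign ::
  "(bit ^ 'n::finite) list \<Rightarrow> (nat \<Rightarrow> nat) \<Rightarrow> (nat \<Rightarrow> nat) \<Rightarrow> real" where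
  "monomial_sign ds \<mu> \<nu> =
     (\<Prod>b<length ds. \<Prod>a\<in>{b<..<length ds}. koszul (ds ! a) (ds ! b) ^ (\<mu> a * \<nu> b))"

type_synonym series = "(nat \<Rightarrow> nat) \<Rightarrow> (nat \<Rightarrow> real) \<Rightarrow> real"

definition power_series_algebra ::
  "nat \<Rightarrow> (bit ^ 'n::finite) list \<Rightarrow> (nat \<Rightarrow> real) set \<Rightarrow> (series, 'n) graded_algebra" where
  "power_series_algebra p ds V =
    (let I = multi_indices ds; S = (I \<rightarrow>\<^sub>E smooth_functions p V) in \<lparr>
     carrier = S,
     monoid.mult = (\<lambda>f g. \<lambda>\<rho>\<in>I. \<lambda>x\<in>V. \<Sum>\<mu> | \<mu> \<le> \<rho>.
        monomial_sign ds \<mu> (\<lambda>a. \<rho> a - \<mu> a) * f \<mu> x * g (\<lambda>a. \<rho> a - \<mu> a) x),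
     one = (\<lambda>\<mu>\<in>I. \<lambda>x\<in>V. if \<mu> = (\<lambda>_. 0) then 1 else 0),
     zero = (\<lambda>\<mu>\<in>I. \<lambda>x\<in>V. 0),
     add = (\<lambda>f g. \<lambda>\<mu>\<in>I. \<lambda>x\<in>V. f \<mu> x + g \<mu> x),
     smult = (\<lambda>r f. \<lambda>\<mu>\<in>I. \<lambda>x\<in>V. r * f \<mu> x),
     gcomp = (\<lambda>d. {f \<in> S. \<forall>\<mu>\<in>I. monomial_degree ds \<mu> \<noteq> d \<longrightarrow> (\<forall>x\<in>V. f \<mu> x = 0)})\<rparr>)"

definition superdomain ::
  "nat \<Rightarrow> (bit ^ 'n::finite) list \<Rightarrow> (nat \<Rightarrow> real) set \<Rightarrow> (nat \<Rightarrow> real, series, 'n) ringed_space" where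
  "superdomain p ds U = \<lparr>
     base = subtopology (Euclidean_space p) U,
     sections = power_series_algebra p ds,
     res = (\<lambda>V W f. \<lambda>\<mu>\<in>multi_indices ds. restrict (f \<mu>) W)\<rparr>"


section \<open>Supermanifolds\<close>

text \<open>\<open>q d\<close> is the number of formal variables of degree \<open>d\<close>.\<close>

definition supermanifold_of_dim ::
  "nat \<Rightarrow> (bit ^ 'n::finite \<Rightarrow> nat) \<Rightarrow> ('m, 'b, 'n) ringed_space \<Rightarrow> bool" where
  "supermanifold_of_dim p q M \<longleftrightarrow>
     Hausdorff_space (base M) \<and> second_countable (base M) \<and>
     sheaf_of_algebras M \<and>
     (\<forall>x\<in>topspace (base M). graded_local (stalk M x)) \<and>
     (\<forall>x\<in>topspace (base M). \<exists>U V ds.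
        openin (base M) U \<and> x \<in> U \<and> openin (Euclidean_space p) V \<and>
        0 \<notin> set ds \<and> (\<forall>d. count_list ds d = q d) \<and>
        isomorphic_ringed_spaces (open_subspace M U) (superdomain p ds V))"

definition supermanifold :: "('m, 'b, 'n::finite) ringed_space \<Rightarrow> bool" where
  "supermanifold M \<longleftrightarrow> (\<exists>p q. supermanifold_of_dim p q M)"


section \<open>Differential 1-forms\<close>

text \<open>
  Derivations over \<open>U\<close> are derivations of the sheaf restricted to \<open>U\<close>: compatible families of maps,
  one for each open \<open>V \<subseteq> U\<close>.
\<close>

type_synonym ('m, 'b) derivation = "'m set \<Rightarrow> 'b \<Rightarrow> 'b"

definition homogeneous_derivations ::
  "('m, 'b, 'n::finite) ringed_space \<Rightarrow> 'm set \<Rightarrow> bit ^ 'n \<Rightarrow> ('m, 'b) derivation set" where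
  "homogeneous_derivations M U \<gamma> =
    {D \<in> (\<Pi>\<^sub>E V\<in>opens M U. carrier (sections M V) \<rightarrow>\<^sub>E carrier (sections M V)).
      \<forall>V\<in>opens M U.
        (\<forall>a\<in>carrier (sections M V). \<forall>b\<in>carrier (sections M V).
           D V (a \<oplus>\<^bsub>sections M V\<^esub> b) = D V a \<oplus>\<^bsub>sections M V\<^esub> D V b) \<and>
        (\<forall>r. \<forall>a\<in>carrier (sections M V). D V (r \<odot>\<^bsub>sections M V\<^esub> a) = r \<odot>\<^bsub>sections M V\<^esub> D V a) \<and>
        (\<forall>\<delta>. D V ` gcomp (sections M V) \<delta> \<subseteq> gcomp (sections M V) (\<gamma> + \<delta>)) \<and>
        (\<forall>\<delta>. \<forall>a\<in>gcomp (sections M V) \<delta>. \<forall>b\<in>carrier (sections M V).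
           D V (a \<otimes>\<^bsub>sections M V\<^esub> b) =
             (D V a \<otimes>\<^bsub>sections M V\<^esub> b) \<oplus>\<^bsub>sections M V\<^esub>
             (koszul \<gamma> \<delta> \<odot>\<^bsub>sections M V\<^esub> (a \<otimes>\<^bsub>sections M V\<^esub> D V b))) \<and>
        (\<forall>W\<in>opens M V. \<forall>a\<in>carrier (sections M V). res M V W (D V a) = D W (res M V W a))}"

definition derivations ::
  "('m, 'b, 'n::finite) ringed_space \<Rightarrow> 'm set \<Rightarrow> ('m, 'b) derivation set" where
  "derivations M U =
    {\<lambda>V\<in>opens M U. \<lambda>a\<in>carrier (sections M V). \<Oplus>\<^bsub>sections M V\<^esub>\<gamma>\<in>UNIV. E \<gamma> V a |E.
      \<forall>\<gamma>. E \<gamma> \<in> homogeneous_derivations M U \<gamma>}"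

definition derivation_add ::
  "('m, 'b, 'n::finite) ringed_space \<Rightarrow> 'm set \<Rightarrow> ('m, 'b) derivation \<Rightarrow> ('m, 'b) derivation
     \<Rightarrow> ('m, 'b) derivation" where
  "derivation_add M U D E =
    (\<lambda>V\<in>opens M U. \<lambda>a\<in>carrier (sections M V). D V a \<oplus>\<^bsub>sections M V\<^esub> E V a)"

definition derivation_scale ::
  "('m, 'b, 'n::finite) ringed_space \<Rightarrow> 'm set \<Rightarrow> 'b \<Rightarrow> ('m, 'b) derivation
     \<Rightarrow> ('m, 'b) derivation" where
  "derivation_scale M U f D =
    (\<lambda>V\<in>opens M U. \<lambda>a\<in>carrier (sections M V). res M U V f \<otimes>\<^bsub>sections M V\<^esub> D V a)"

text \<open>
  \<open>\<Omega>\<^sup>1\<close> is the dual of the sheaf of derivations. A 1-form \<open>\<omega>\<close> is left linear, \<open>\<omega>(f D) = f \<omega>(D)\<close>,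
  so that \<open>(\<omega> f)(D) = \<omega>(D) f\<close> makes \<open>\<Omega>\<^sup>1\<close> a right module without signs; the differential of a
  function \<open>f\<close> is \<open>D \<mapsto> D f\<close>, of the same degree as \<open>f\<close>. The left module structure then results
  from the commutation rule.
\<close>

type_synonym ('m, 'b) one_form = "'m set \<Rightarrow> ('m, 'b) derivation \<Rightarrow> 'b"

definition one_forms ::
  "('m, 'b, 'n::finite) ringed_space \<Rightarrow> 'm set \<Rightarrow> ('m, 'b) one_form set" where
  "one_forms M U =
    {\<omega> \<in> (\<Pi>\<^sub>E V\<in>opens M U. derivations M V \<rightarrow>\<^sub>E carrier (sections M V)).
      \<forall>V\<in>opens M U.
        (\<forall>D\<in>derivations M V. \<forall>E\<in>derivations M V.
           \<omega> V (derivation_add M V D E) = \<omega> V D \<oplus>\<^bsub>sections M V\<^esub> \<omega> V E) \<and>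
        (\<forall>f\<in>carrier (sections M V). \<forall>D\<in>derivations M V.
           \<omega> V (derivation_scale M V f D) = f \<otimes>\<^bsub>sections M V\<^esub> \<omega> V D) \<and>
        (\<forall>W\<in>opens M V. \<forall>D\<in>derivations M V.
           res M V W (\<omega> V D) = \<omega> W (restrict D (opens M W)))}"

definition homogeneous_one_forms ::
  "('m, 'b, 'n::finite) ringed_space \<Rightarrow> 'm set \<Rightarrow> bit ^ 'n \<Rightarrow> ('m, 'b) one_form set" where
  "homogeneous_one_forms M U \<gamma> =
    {\<omega> \<in> one_forms M U. \<forall>V\<in>opens M U. \<forall>\<delta>. \<forall>D\<in>homogeneous_derivations M V \<delta>.
      \<omega> V D \<in> gcomp (sections M V) (\<gamma> + \<delta>)}"

definition one_form_add ::
  "('m, 'b, 'n::finite) ringed_space \<Rightarrow> 'm set \<Rightarrow> ('m, 'b) one_form \<Rightarrow> ('m, 'b) one_form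
     \<Rightarrow> ('m, 'b) one_form" where
  "one_form_add M U \<omega> \<eta> =
    (\<lambda>V\<in>opens M U. \<lambda>D\<in>derivations M V. \<omega> V D \<oplus>\<^bsub>sections M V\<^esub> \<eta> V D)"

definition one_form_scale ::
  "('m, 'b, 'n::finite) ringed_space \<Rightarrow> 'm set \<Rightarrow> ('m, 'b) one_form \<Rightarrow> 'b
     \<Rightarrow> ('m, 'b) one_form" where
  "one_form_scale M U \<omega> f =
    (\<lambda>V\<in>opens M U. \<lambda>D\<in>derivations M V. \<omega> V D \<otimes>\<^bsub>sections M V\<^esub> res M U V f)"


section \<open>The exterior algebra\<close>

text \<open>
  The exterior algebra of \<open>\<Omega>\<^sup>1(U)\<close> over \<open>\<A>(U)\<close> (with the Deligne signs) is the associative unital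
  real algebra generated by the functions and the 1-forms on \<open>U\<close>, subject to the relations of \<open>\<A>(U)\<close>,
  of the module \<open>\<Omega>\<^sup>1(U)\<close>, and to the sign rule for the bidegrees. It is built as the quotient of the
  formal expressions in the generators by the congruence that these relations generate.
\<close>

datatype ('a, 'w) expr =
    Fun 'a
  | Form 'w
  | Scal real "('a, 'w) expr"
  | Add "('a, 'w) expr" "('a, 'w) expr"
  | Mul "('a, 'w) expr" "('a, 'w) expr"

type_synonym ('m, 'b) form_expr = "('b, ('m, 'b) one_form) expr"

definition form_exprs ::
  "('m, 'b, 'n::finite) ringed_space \<Rightarrow> 'm set \<Rightarrow> ('m, 'b) form_expr set" where
  "form_exprs M U = {e. set1_expr e \<subseteq> carrier (sections M U) \<and> set2_expr e \<subseteq> one_forms M U}"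

definition bidegree :: "nat \<Rightarrow> bit ^ 1 \<Rightarrow> bit ^ 2" where
  "bidegree k \<gamma> = (\<chi> i. if i = 1 then of_nat k else \<gamma> $ 1)"

primrec has_form_degree :: "('a, 'w) expr \<Rightarrow> nat \<Rightarrow> bool" where
  "has_form_degree (Fun a) k \<longleftrightarrow> k = 0"
| "has_form_degree (Form \<omega>) k \<longleftrightarrow> k = 1"
| "has_form_degree (Scal r e) k \<longleftrightarrow> has_form_degree e k"
| "has_form_degree (Add e f) k \<longleftrightarrow> has_form_degree e k \<and> has_form_degree f k"
| "has_form_degree (Mul e f) k \<longleftrightarrow>
     (\<exists>i j. k = i + j \<and> has_form_degree e i \<and> has_form_degree f j)"

primrec has_bidegree ::
  "('m, 'b, 1) ringed_space \<Rightarrow> 'm set \<Rightarrow> ('m, 'b) form_expr \<Rightarrow> bit ^ 2 \<Rightarrow> bool" where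
  "has_bidegree M U (Fun a) d \<longleftrightarrow> (\<exists>\<gamma>. d = bidegree 0 \<gamma> \<and> a \<in> gcomp (sections M U) \<gamma>)"
| "has_bidegree M U (Form \<omega>) d \<longleftrightarrow> (\<exists>\<gamma>. d = bidegree 1 \<gamma> \<and> \<omega> \<in> homogeneous_one_forms M U \<gamma>)"
| "has_bidegree M U (Scal r e) d \<longleftrightarrow> has_bidegree M U e d"
| "has_bidegree M U (Add e f) d \<longleftrightarrow> has_bidegree M U e d \<and> has_bidegree M U f d"
| "has_bidegree M U (Mul e f) d \<longleftrightarrow>
     (\<exists>i j. d = i + j \<and> has_bidegree M U e i \<and> has_bidegree M U f j)"

inductive expr_eq ::
  "('m, 'b, 1) ringed_space \<Rightarrow> 'm set \<Rightarrow> ('m, 'b) form_expr \<Rightarrow> ('m, 'b) form_expr \<Rightarrow> bool"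
  for M :: "('m, 'b, 1) ringed_space" and U :: "'m set" where
  refl: "e \<in> form_exprs M U \<Longrightarrow> expr_eq M U e e"
| sym: "expr_eq M U e f \<Longrightarrow> expr_eq M U f e"
| trans: "expr_eq M U e f \<Longrightarrow> expr_eq M U f g \<Longrightarrow> expr_eq M U e g"
| cong_Scal: "expr_eq M U e e' \<Longrightarrow> expr_eq M U (Scal r e) (Scal r e')"
| cong_Add: "expr_eq M U e e' \<Longrightarrow> expr_eq M U f f' \<Longrightarrow> expr_eq M U (Add e f) (Add e' f')"
| cong_Mul: "expr_eq M U e e' \<Longrightarrow> expr_eq M U f f' \<Longrightarrow> expr_eq M U (Mul e f) (Mul e' f')"
| Add_assoc: "{e, f, g} \<subseteq> form_exprs M U \<Longrightarrow> expr_eq M U (Add (Add e f) g) (Add e (Add f g))"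
| Add_commute: "{e, f} \<subseteq> form_exprs M U \<Longrightarrow> expr_eq M U (Add e f) (Add f e)"
| Add_zero: "e \<in> form_exprs M U \<Longrightarrow> expr_eq M U (Add (Fun \<zero>\<^bsub>sections M U\<^esub>) e) e"
| Add_minus: "e \<in> form_exprs M U \<Longrightarrow> expr_eq M U (Add e (Scal (- 1) e)) (Fun \<zero>\<^bsub>sections M U\<^esub>)"
| Scal_Add: "{e, f} \<subseteq> form_exprs M U \<Longrightarrow>
    expr_eq M U (Scal r (Add e f)) (Add (Scal r e) (Scal r f))"
| Scal_plus: "e \<in> form_exprs M U \<Longrightarrow> expr_eq M U (Scal (r + s) e) (Add (Scal r e) (Scal s e))"
| Scal_Scal: "e \<in> form_exprs M U \<Longrightarrow> expr_eq M U (Scal r (Scal s e)) (Scal (r * s) e)"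
| Scal_one: "e \<in> form_exprs M U \<Longrightarrow> expr_eq M U (Scal 1 e) e"
| Mul_assoc: "{e, f, g} \<subseteq> form_exprs M U \<Longrightarrow> expr_eq M U (Mul (Mul e f) g) (Mul e (Mul f g))"
| Mul_one_left: "e \<in> form_exprs M U \<Longrightarrow> expr_eq M U (Mul (Fun \<one>\<^bsub>sections M U\<^esub>) e) e"
| Mul_one_right: "e \<in> form_exprs M U \<Longrightarrow> expr_eq M U (Mul e (Fun \<one>\<^bsub>sections M U\<^esub>)) e"
| Mul_Add_left: "{e, f, g} \<subseteq> form_exprs M U \<Longrightarrow>
    expr_eq M U (Mul (Add e f) g) (Add (Mul e g) (Mul f g))"
| Mul_Add_right: "{e, f, g} \<subseteq> form_exprs M U \<Longrightarrow>
    expr_eq M U (Mul e (Add f g)) (Add (Mul e f) (Mul e g))"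
| Mul_Scal_left: "{e, f} \<subseteq> form_exprs M U \<Longrightarrow> expr_eq M U (Mul (Scal r e) f) (Scal r (Mul e f))"
| Mul_Scal_right: "{e, f} \<subseteq> form_exprs M U \<Longrightarrow> expr_eq M U (Mul e (Scal r f)) (Scal r (Mul e f))"
| Fun_add: "{a, b} \<subseteq> carrier (sections M U) \<Longrightarrow>
    expr_eq M U (Fun (a \<oplus>\<^bsub>sections M U\<^esub> b)) (Add (Fun a) (Fun b))"
| Fun_smult: "a \<in> carrier (sections M U) \<Longrightarrow>
    expr_eq M U (Fun (r \<odot>\<^bsub>sections M U\<^esub> a)) (Scal r (Fun a))"
| Fun_mult: "{a, b} \<subseteq> carrier (sections M U) \<Longrightarrow>
    expr_eq M U (Fun (a \<otimes>\<^bsub>sections M U\<^esub> b)) (Mul (Fun a) (Fun b))"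
| Form_add: "{\<omega>, \<eta>} \<subseteq> one_forms M U \<Longrightarrow>
    expr_eq M U (Form (one_form_add M U \<omega> \<eta>)) (Add (Form \<omega>) (Form \<eta>))"
| Form_scale: "\<omega> \<in> one_forms M U \<Longrightarrow> a \<in> carrier (sections M U) \<Longrightarrow>
    expr_eq M U (Form (one_form_scale M U \<omega> a)) (Mul (Form \<omega>) (Fun a))"
| Fun_Form: "a \<in> gcomp (sections M U) \<gamma> \<Longrightarrow> \<omega> \<in> homogeneous_one_forms M U \<delta> \<Longrightarrow>
    expr_eq M U (Mul (Fun a) (Form \<omega>))
      (Scal (koszul (bidegree 0 \<gamma>) (bidegree 1 \<delta>)) (Mul (Form \<omega>) (Fun a)))"
| Form_Form: "\<omega> \<in> homogeneous_one_forms M U \<gamma> \<Longrightarrow> \<eta> \<in> homogeneous_one_forms M U \<delta> \<Longrightarrow>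
    expr_eq M U (Mul (Form \<omega>) (Form \<eta>))
      (Scal (koszul (bidegree 1 \<gamma>) (bidegree 1 \<delta>)) (Mul (Form \<eta>) (Form \<omega>)))"

definition expr_class ::
  "('m, 'b, 1) ringed_space \<Rightarrow> 'm set \<Rightarrow> ('m, 'b) form_expr \<Rightarrow> ('m, 'b) form_expr set" where
  "expr_class M U e = {f. expr_eq M U e f}"

definition exterior_algebra ::
  "('m, 'b, 1) ringed_space \<Rightarrow> 'm set \<Rightarrow> (('m, 'b) form_expr set, 2) graded_algebra" where
  "exterior_algebra M U = \<lparr>
     carrier = expr_class M U ` form_exprs M U,
     monoid.mult = (\<lambda>C D. \<Union>e\<in>C. \<Union>f\<in>D. expr_class M U (Mul e f)),
     one = expr_class M U (Fun \<one>\<^bsub>sections M U\<^esub>),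
     zero = expr_class M U (Fun \<zero>\<^bsub>sections M U\<^esub>),
     add = (\<lambda>C D. \<Union>e\<in>C. \<Union>f\<in>D. expr_class M U (Add e f)),
     smult = (\<lambda>r C. \<Union>e\<in>C. expr_class M U (Scal r e)),
     gcomp = (\<lambda>d. expr_class M U ` {e \<in> form_exprs M U. has_bidegree M U e d})\<rparr>"

definition exterior_power ::
  "('m, 'b, 1) ringed_space \<Rightarrow> 'm set \<Rightarrow> nat \<Rightarrow> ('m, 'b) form_expr set set" where
  "exterior_power M U k = expr_class M U ` {e \<in> form_exprs M U. has_form_degree e k}"

definition exterior_presheaf ::
  "('m, 'b, 1) ringed_space \<Rightarrow> ('m, ('m, 'b) form_expr set, 2) ringed_space" where
  "exterior_presheaf M = \<lparr>
     base = base M,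
     sections = exterior_algebra M,
     res = (\<lambda>U V C. \<Union>e\<in>C. expr_class M V
        (map_expr (res M U V) (\<lambda>\<omega>. restrict \<omega> (opens M V)) e))\<rparr>"


section \<open>The tangent bundle\<close>

text \<open>
  The sheaf \<open>\<And>\<^sup>k \<Omega>\<^sup>1\<close> is the sheafification of \<open>U \<mapsto> \<And>\<^sup>k \<Omega>\<^sup>1(U)\<close>: its sections are the families of
  germs that come locally from the presheaf. A section of the product over all \<open>k\<close> is a
  sequence of such families.
\<close>

definition exterior_power_sheaf ::
  "('m, 'b, 1) ringed_space \<Rightarrow> nat \<Rightarrow> 'm set \<Rightarrow>
     ('m \<Rightarrow> ('m set \<times> ('m, 'b) form_expr set) set) set" where
  "exterior_power_sheaf M k U = {s \<in> extensional U.
     \<forall>x\<in>U. \<exists>V\<in>opens M U. x \<in> V \<and>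
       (\<exists>C\<in>exterior_power M V k. \<forall>y\<in>V. s y = germ (exterior_presheaf M) y V C)}"

type_synonym ('m, 'b) completed_form =
  "nat \<Rightarrow> 'm \<Rightarrow> ('m set \<times> ('m, 'b) form_expr set) set"

definition completed_forms ::
  "('m, 'b, 1) ringed_space \<Rightarrow> 'm set \<Rightarrow> (('m, 'b) completed_form, 2) graded_algebra" where
  "completed_forms M U =
    (let S = {s. \<forall>k. s k \<in> exterior_power_sheaf M k U}; \<Lambda> = stalk (exterior_presheaf M) in \<lparr>
     carrier = S,
     monoid.mult = (\<lambda>s t. \<lambda>k. \<lambda>x\<in>U. \<Oplus>\<^bsub>\<Lambda> x\<^esub>i\<in>{..k}. s i x \<otimes>\<^bsub>\<Lambda> x\<^esub> t (k - i) x),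
     one = (\<lambda>k. \<lambda>x\<in>U. if k = 0 then \<one>\<^bsub>\<Lambda> x\<^esub> else \<zero>\<^bsub>\<Lambda> x\<^esub>),
     zero = (\<lambda>k. \<lambda>x\<in>U. \<zero>\<^bsub>\<Lambda> x\<^esub>),
     add = (\<lambda>s t. \<lambda>k. \<lambda>x\<in>U. s k x \<oplus>\<^bsub>\<Lambda> x\<^esub> t k x),
     smult = (\<lambda>r s. \<lambda>k. \<lambda>x\<in>U. r \<odot>\<^bsub>\<Lambda> x\<^esub> s k x),
     gcomp = (\<lambda>d. {s \<in> S. \<forall>k. \<forall>x\<in>U. s k x \<in> gcomp (\<Lambda> x) d})\<rparr>)"

definition tangent_bundle ::
  "('m, 'b, 1) ringed_space \<Rightarrow> ('m, ('m, 'b) completed_form, 2) ringed_space" where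
  "tangent_bundle M = \<lparr>
     base = base M,
     sections = completed_forms M,
     res = (\<lambda>U V s. \<lambda>k. restrict (s k) V)\<rparr>"

end

theory Submission
  imports Defs
begin

text \<open>
  In a chart with coordinates \<open>x\<^sup>i, \<xi>\<^sup>a\<close> a derivation is determined by its values on the
  coordinates (Hadamard's lemma), so the derivations are free on the partial derivatives and the 1-forms
  on the differentials. Moving the differentials to the right writes every class of expressions as a
  finite sum of ordered monomials in \<open>dx\<^sup>j, d\<xi>\<^sup>b\<close>; mapping the generators to the
  corresponding formal variables shows that the coefficients are unique, so that the exterior algebra is
  the algebra of those power series that are polynomial in the differentials. The part of a power
  series of each form degree is such a polynomial, and sending a power series to the germs of these parts
  identifies it with a completed form. Everything else is local: the laws of a graded algebra and the
  homogeneous components glue, and a stalk is local because a power series of degree 0 with nonzero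
  constant term at a point is invertible nearby, while elements of nonzero degree vanish at the point.
\<close>

text \<open>The relations that define the exterior algebra can only show that certain expressions
  are equal, so they yield spanning but never independence. Independence needs a model in which all
  relations hold; power series with the bidegrees as degrees are one, and they are also the intended
  answer. Spanning and the model together make the comparison map injective. Since
  \<open>d xi\<close> commutes with itself, its powers never end, and a power series in it is not
  the class of an expression. Only its part of a fixed form degree is, because finitely many
  monomials in the differentials have that degree. This is why all comparisons run degree by degree.
  Derivations are families over all smaller open sets. A derivation that kills the coordinates can
  therefore be examined on a box around each point, where Hadamard's lemma holds, without extending
  functions by cutoffs. A section of the completed sheaf comes with a neighbourhood for each point
  and each form degree, and these may shrink as the degree grows. The power series of a section is
  therefore assembled coefficient by coefficient, from values at single points.\<close>

abbreviation "PSA \<equiv> power_series_algebra"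
abbreviation "MI \<equiv> multi_indices"
abbreviation "msign \<equiv> monomial_sign"
abbreviation "mdeg \<equiv> monomial_degree"
abbreviation "HDer \<equiv> homogeneous_derivations"
abbreviation "dadd \<equiv> derivation_add"
abbreviation "dscale \<equiv> derivation_scale"
abbreviation "HForm \<equiv> homogeneous_one_forms"
abbreviation "Ext \<equiv> exterior_algebra"
abbreviation "ExtPow \<equiv> exterior_power"
abbreviation "ExtP \<equiv> exterior_presheaf"

section \<open>Smooth functions\<close>

lemma openin_Euclidean_space_iff:
 "openin (Euclidean_space p) V \<longleftrightarrow> (EX T. open T & V = T Int {x. \<forall>i\<ge>p. x i = 0})"
 by (auto simp: Euclidean_space_def openin_subtopology euclidean_product_topology)

lemma continuous_on_fun_upd:
 "continuous_on S f ==> continuous_on S g ==> continuous_on S (%x. (f x)(i := g x :: real))"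
 for f :: "'a::topological_space => nat => real"
 apply (rule continuous_on_coordinatewise_then_product)
 subgoal for j by (cases "j = i") (auto intro: continuous_on_product_then_coordinatewise)
 done

text \<open>A derivative along the \<open>i\<close>-th axis at a point of \<open>V\<close> thus
  depends only on the values of the function on \<open>V\<close>.\<close>

lemma openin_Euclidean_space_slice:
 assumes "openin (Euclidean_space p) V" "x : V" "i < p" shows "\<forall>\<^sub>F t in nhds (x i). x(i := t) : V"
proof -
 obtain T where T: "open T" "V = T Int {x. \<forall>i\<ge>p. x i = 0}"
  using assms(1) openin_Euclidean_space_iff by auto
 have "continuous_on UNIV (%t. x(i := t))" by (intro continuous_on_fun_upd continuous_intros)
 then have "open ((%t. x(i := t)) -` T)" using T(1) open_vimage by blast
 moreover have "x i : (%t. x(i := t)) -` T" using assms T by simp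
 ultimately show ?thesis using T(2) assms by (auto simp: eventually_nhds)
qed

text \<open>A relation rather than the value of \<open>partial_deriv\<close>: existence of the
  derivative is included, and \<open>g\<close> is constrained on \<open>V\<close> only, so that it
  may be given by any convenient formula.\<close>

definition has_partial ::
 "(nat => real) set => nat => ((nat => real) => real) => ((nat => real) => real) => bool" where
 "has_partial V i f g \<longleftrightarrow>
  (ALL x:V. ((%t. f (x(i := t))) has_real_derivative g x) (at (x i)))"

lemma has_partial_cong:
 assumes "openin (Euclidean_space p) V" "i < p" "has_partial V i f g"
  and "!!x. x : V ==> f x = f' x" "!!x. x : V ==> g x = g' x" shows "has_partial V i f' g'"
 unfolding has_partial_def proof
 fix x assume x: "x : V"
 have "\<forall>\<^sub>F t in nhds (x i). f (x(i := t)) = f' (x(i := t))"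
  using openin_Euclidean_space_slice[OF assms(1) x assms(2)] assms(4) by (auto elim: eventually_mono)
 then show "((%t. f' (x(i := t))) has_real_derivative g' x) (at (x i))"
  using assms(3,5) x DERIV_cong_ev[OF HOL.refl _ HOL.refl] unfolding has_partial_def by fastforce
qed

lemma partial_deriv_eqI:
 "has_partial V i f g ==> x : V ==> partial_deriv i f x = g x"
 by (auto simp: has_partial_def partial_deriv_def intro: DERIV_imp_deriv)

text \<open>Coinductive, so that smoothness is proved by exhibiting a class of continuous functions
  on \<open>V\<close> that contains a partial derivative of each of its members in every direction
  \<open>i < p\<close>.\<close>

coinductive smooth ::
 "nat => (nat => real) set => ((nat => real) => real) => bool" for p V where
 "continuous_on V f ==> (!!i. i < p ==> EX g. smooth p V g & has_partial V i f g) ==>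
  smooth p V f"

lemma smooth_imp_continuous: "smooth p V f ==> continuous_on V f" by (auto elim: smooth.cases)

lemma smooth_obtain_partial:
 assumes "smooth p V f" "i < p"
 obtains g where "smooth p V g" "has_partial V i f g" using assms by (auto elim: smooth.cases)

text \<open>The derivative of a product is a sum of products, so the products of smooth functions
  are not by themselves a class to which coinduction applies. Closing under all operations gives
  such a class, and with it all closure properties at once.\<close>

inductive smooth_closure ::
 "nat => (nat => real) set => ((nat => real) => real) => bool" for p V where
 base: "smooth p V f ==> smooth_closure p V f"
| const: "smooth_closure p V (%_. c)"
| coord: "smooth_closure p V (%x. x j)"
| add: "smooth_closure p V f ==> smooth_closure p V g ==> smooth_closure p V (%x. f x + g x)"
| mult: "smooth_closure p V f ==> smooth_closure p V g ==> smooth_closure p V (%x. f x * g x)"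
| inv: "smooth_closure p V f ==> (!!x. x : V ==> f x ~= 0) ==> smooth_closure p V (%x. inverse (f x))"
| cong: "smooth_closure p V f ==> (!!x. x : V ==> f x = g x) ==> smooth_closure p V g"

lemma continuous_on_coordinate: "continuous_on V (%x::nat => real. x j)"
 by (rule continuous_on_product_then_coordinatewise) (rule continuous_on_id)

lemma smooth_closure_partial:
 assumes "openin (Euclidean_space p) V" "smooth_closure p V f"
 shows "continuous_on V f & (\<forall>i<p. EX g. smooth_closure p V g & has_partial V i f g)" using assms(2)
proof induction
 case (base f)
 then show ?case by (meson smooth_closure.base smooth_imp_continuous smooth_obtain_partial)
next
 case (const c)
 have "has_partial V i (%_. c) (%_. 0)" for i by (simp add: has_partial_def)
 moreover have "smooth_closure p V (%_. 0)" by (rule smooth_closure.const)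
 ultimately show ?case by (intro conjI allI impI exI[of _ "%_. 0"]) auto
next
 case (coord j)
 have "has_partial V i (%x. x j) (%_. if i = j then 1 else 0)" for i by (auto simp: has_partial_def)
 moreover have "smooth_closure p V (%_. if i = j then 1 else 0)" for i by (rule smooth_closure.const)
 ultimately show ?case by (metis continuous_on_coordinate)
next
 case (add f g)
 have "EX h. smooth_closure p V h & has_partial V i (%x. f x + g x) h" if "i < p" for i proof -
  from add that obtain f' g' where fg: "smooth_closure p V f'" "has_partial V i f f'"
   "smooth_closure p V g'" "has_partial V i g g'" by blast
  then have "has_partial V i (%x. f x + g x) (%x. f' x + g' x)"
   by (auto simp: has_partial_def intro!: derivative_intros)
  then show ?thesis using fg smooth_closure.add by blast
 qed
 then show ?case using add by (auto intro: continuous_on_add)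
next
 case (mult f g)
 have "EX h. smooth_closure p V h & has_partial V i (%x. f x * g x) h" if "i < p" for i proof -
  from mult that obtain f' g' where fg: "smooth_closure p V f'" "has_partial V i f f'"
   "smooth_closure p V g'" "has_partial V i g g'" by blast
  then have "has_partial V i (%x. f x * g x) (%x. f' x * g x + g' x * f x)"
   unfolding has_partial_def using DERIV_mult by fastforce
  moreover have "smooth_closure p V (%x. f' x * g x + g' x * f x)"
   using fg mult.hyps by (intro smooth_closure.add smooth_closure.mult)
  ultimately show ?thesis by blast
 qed
 then show ?case using mult by (auto intro: continuous_on_mult)
next
 case (inv f)
 have "EX h. smooth_closure p V h & has_partial V i (%x. inverse (f x)) h" if "i < p" for i proof -
  from inv that obtain f' where f': "smooth_closure p V f'" "has_partial V i f f'" by blast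
  \<comment> \<open>The derivative is written with products, inverses and the constant
    \<open>-1\<close> only, so that it is visibly a member of the closure.\<close>
  have "has_partial V i (%x. inverse (f x)) (%x. (-1) * (inverse (f x) * f' x * inverse (f x)))"
   unfolding has_partial_def proof
   fix x assume x: "x : V"
   then have "((%t. f (x(i := t))) has_real_derivative f' x) (at (x i))" using f' by (auto simp: has_partial_def)
   from DERIV_inverse'[OF this] x inv(2)
   show "((%t. inverse (f (x(i := t)))) has_real_derivative
   (-1) * (inverse (f x) * f' x * inverse (f x))) (at (x i))" by simp
  qed
  moreover have "smooth_closure p V (%x. (-1) * (inverse (f x) * f' x * inverse (f x)))"
   using f' inv.hyps by (intro smooth_closure.mult smooth_closure.inv smooth_closure.const)
  ultimately show ?thesis by blast
 qed
 then show ?case using inv by (auto intro: continuous_on_inverse)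
next
 case (cong f g)
 have "has_partial V i g h" if "i < p" "has_partial V i f h" for i h
  using has_partial_cong[OF assms(1) that cong(2)] by auto
 then show ?case using cong by (metis (no_types, lifting) continuous_on_cong)
qed

text \<open>Every member has its partial derivatives inside the closure, which is the coinduction
  step.\<close>

lemma smooth_closure_iff:
 assumes "openin (Euclidean_space p) V" shows "smooth_closure p V f \<longleftrightarrow> smooth p V f" proof
 assume "smooth_closure p V f"
 then show "smooth p V f" by (coinduction arbitrary: f) (use smooth_closure_partial[OF assms] in blast)
qed (rule smooth_closure.base)

lemma smooth_const: "openin (Euclidean_space p) V ==> smooth p V (%_. c)"
 and smooth_coord: "openin (Euclidean_space p) V ==> smooth p V (%x. x j)"
 using smooth_closure.const[THEN smooth_closure_iff[THEN iffD1, rotated]]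
  smooth_closure.coord[THEN smooth_closure_iff[THEN iffD1, rotated]] by auto

lemma smooth_add:
  "openin (Euclidean_space p) V ==> smooth p V f ==> smooth p V g ==> smooth p V (%x. f x + g x)" and smooth_mult:
  "openin (Euclidean_space p) V ==> smooth p V f ==> smooth p V g ==> smooth p V (%x. f x * g x)"
 and smooth_inverse: "openin (Euclidean_space p) V ==> smooth p V f ==>
  (!!x. x : V ==> f x ~= 0) ==> smooth p V (%x. inverse (f x))"
 and smooth_cong: "openin (Euclidean_space p) V ==> smooth p V f ==>
  (!!x. x : V ==> f x = g x) ==> smooth p V g"
  apply (metis smooth_closure_iff smooth_closure.add)
  apply (metis smooth_closure_iff smooth_closure.mult)
 apply (metis smooth_closure_iff smooth_closure.inv)
 apply (metis smooth_closure_iff smooth_closure.cong)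
 done

lemma smooth_sum:
 assumes "openin (Euclidean_space p) V" "!!i. i : A ==> smooth p V (f i)"
 shows "smooth p V (%x. \<Sum>i\<in>A. f i x)" using assms(2) by (induction A rule: infinite_finite_induct)
  (auto intro: smooth_const[OF assms(1)] smooth_add[OF assms(1)])

lemma smooth_subset:
 assumes "W <= V" "smooth p V f" shows "smooth p W f" using assms(2) proof (coinduction arbitrary: f)
 case smooth
 have "has_partial W i f g" if "has_partial V i f g" for i g using that assms(1) by (auto simp: has_partial_def)
 then show ?case using smooth assms(1) by (metis continuous_on_subset smooth_imp_continuous smooth_obtain_partial)
qed

lemma smooth_partial_deriv:
 assumes "openin (Euclidean_space p) V" "smooth p V f" "i < p"
 shows "smooth p V (partial_deriv i f)" "has_partial V i f (partial_deriv i f)" proof -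
 obtain g where g: "smooth p V g" "has_partial V i f g" using assms smooth_obtain_partial by blast
 show "smooth p V (partial_deriv i f)" using smooth_cong[OF assms(1) g(1)] partial_deriv_eqI[OF g(2)] by auto
 show "has_partial V i f (partial_deriv i f)"
  using has_partial_cong[OF assms(1,3) g(2)] partial_deriv_eqI[OF g(2)] by auto
qed

text \<open>The iterated partial derivatives of \<open>f\<close> form the class for the coinduction.
  Conversely, \<open>partial_deriv\<close> agrees on \<open>V\<close> with any partial derivative in
  the sense of \<open>has_partial\<close>, so the iterates inherit smoothness.\<close>

lemma smooth_functions_iff:
 assumes V: "openin (Euclidean_space p) V"
 shows "f : smooth_functions p V \<longleftrightarrow> f : extensional V & smooth p V f" proof -
 have sub: "V <= {x. \<forall>i\<ge>p. x i = 0}" using openin_subset[OF V] by (simp add: topspace_Euclidean_space)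
 have cont: "continuous_map (subtopology (Euclidean_space p) V) euclideanreal g \<longleftrightarrow> continuous_on V g" for g
 proof -
  have "subtopology (Euclidean_space p) V = top_of_set V"
   unfolding Euclidean_space_def subtopology_subtopology euclidean_product_topology
   using sub by (simp add: Int_absorb1)
  then show ?thesis by simp
 qed
 have "smooth p V f" if f: "f : smooth_functions p V" proof -
  have "EX js. set js <= {..<p} & f = foldr partial_deriv js f" by (intro exI[of _ "[]"]) auto
  then show ?thesis
  proof (rule smooth.coinduct[where X="%g. EX js. set js <= {..<p} & g = foldr partial_deriv js f"], goal_cases)
   case (1 g)
   then obtain js where js: "set js <= {..<p}" "g = foldr partial_deriv js f" by blast
   have "continuous_on V g" using f js cont by (auto simp: smooth_functions_def)
   moreover have "(EX js. set js <= {..<p} & partial_deriv i g = foldr partial_deriv js f) \<and>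
   has_partial V i g (partial_deriv i g)" if "i < p" for i proof
   show "EX js. set js <= {..<p} & partial_deriv i g = foldr partial_deriv js f"
   using that js by (intro exI[of _ "i # js"]) auto
   show "has_partial V i g (partial_deriv i g)" using f js that
   by (auto simp: has_partial_def smooth_functions_def partial_deriv_def field_differentiable_derivI)
   qed
   ultimately show ?case by (metis (no_types, lifting))
  qed
 qed
 moreover have "f : smooth_functions p V" if f: "f : extensional V" "smooth p V f" proof -
  have *: "smooth p V (foldr partial_deriv js f)" if "set js <= {..<p}" for js
   using that f(2) by (induction js) (auto intro: smooth_partial_deriv[OF V])
  have "(%t. g (x(i := t))) field_differentiable (at (x i))" if "smooth p V g" "i < p" "x : V" for g i x
   using smooth_obtain_partial[OF that(1,2)] that(3) unfolding has_partial_def field_differentiable_def by metis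
  with * f(1) show ?thesis unfolding smooth_functions_def by (simp add: cont) (use smooth_imp_continuous in blast)
 qed
 ultimately show ?thesis by (auto simp: smooth_functions_def)
qed

text \<open>Continuity and partial derivatives at a point are determined by any neighbourhood, so
  the locally smooth functions are closed under \<open>partial_deriv\<close> and serve as the class.
  The lemma will give smoothness of coefficients that are known only near each point.\<close>

lemma smooth_locally:
 assumes V: "openin (Euclidean_space p) V"
  and loc: "!!x. x : V ==> EX W. openin (Euclidean_space p) W & x : W & W <= V & smooth p W f" shows "smooth p V f"
proof -
 define X where "X f \<longleftrightarrow> (ALL x:V. EX W. openin (Euclidean_space p) W & x : W & W <= V & smooth p W f)" for f
 have sub: "V <= {x. \<forall>i\<ge>p. x i = 0}" using openin_subset[OF V] by (simp add: topspace_Euclidean_space)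
 have step: "continuous_on V f & (\<forall>i<p. X (partial_deriv i f) & has_partial V i f (partial_deriv i f))"
  if f: "X f" for f proof (intro conjI allI impI)
  show "continuous_on V f" unfolding continuous_on_eq_continuous_within proof
   fix x assume x: "x : V"
   then obtain W where W: "openin (Euclidean_space p) W" "x : W" "W <= V" "smooth p W f"
   using f unfolding X_def by metis
   then obtain T where T: "open T" "W = T Int {x. \<forall>i\<ge>p. x i = 0}"
   using openin_Euclidean_space_iff by auto
   have "at x within V = at x within W" by (rule at_within_nhd[of x T]) (use T W sub in auto)
   then show "continuous (at x within V) f"
   using W smooth_imp_continuous continuous_on_eq_continuous_within by metis
  qed
 next
  fix i assume i: "i < p"
  show "X (partial_deriv i f)" using that smooth_partial_deriv(1)[OF _ _ i] unfolding X_def by metis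
  show "has_partial V i f (partial_deriv i f)"
   using that smooth_partial_deriv(2)[OF _ _ i] unfolding X_def has_partial_def by metis
 qed
 have "X f" using loc by (auto simp: X_def)
 then show ?thesis by (rule smooth.coinduct[where X=X]) (metis step)
qed

subsection \<open>Hadamard's lemma\<close>

text \<open>Such a box is mapped to itself when single coordinates are moved towards those of a
  point \<open>y\<close> in it, as the proof of Hadamard's lemma does.\<close>

definition ebox :: "nat => (nat => real) => real => (nat => real) set" where
 "ebox p y ep = {x. (\<forall>i<p. \<bar>x i - y i\<bar> < ep) & (\<forall>i\<ge>p. x i = 0)}"

lemma openin_ebox: "openin (Euclidean_space p) (ebox p y ep)" proof -
 have "open {x::nat => real. \<bar>x i - y i\<bar> < ep}" for i
  by (intro open_Collect_less continuous_intros continuous_on_coordinate)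
 then have "open (\<Inter>i\<in>{..<p}. {x. \<bar>x i - y i\<bar> < ep})" by (intro open_INT) auto
 moreover have "ebox p y ep = (\<Inter>i\<in>{..<p}. {x. \<bar>x i - y i\<bar> < ep}) Int {x. \<forall>i\<ge>p. x i = 0}"
  by (auto simp: ebox_def)
 ultimately show ?thesis using openin_Euclidean_space_iff by blast
qed

lemma ebox_neighbourhood:
 assumes V: "openin (Euclidean_space p) V" "y : V"
 obtains ep where "ep > 0" "ebox p y ep <= V" "y : ebox p y ep" proof -
 obtain T where T: "open T" "V = T Int {x. \<forall>i\<ge>p. x i = 0}" using V openin_Euclidean_space_iff by auto
 have "openin (product_topology (%_. euclidean) UNIV) T" "y : T" using T V by (auto simp: open_fun_def)
 from product_topology_open_contains_basis[OF this]
 obtain X where X: "y : (\<Pi>\<^sub>E i\<in>UNIV. X i)" "!!i. open (X i)" "(\<Pi>\<^sub>E i\<in>UNIV. X i) <= T"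
  by auto
 have "EX d>0. ALL t. \<bar>t - y i\<bar> < d --> t : X i" for i proof -
  have "y i : X i" using X(1) by auto
  then obtain d where "d > 0" "ball (y i) d <= X i" using X(2) open_contains_ball by blast
  then show ?thesis by (intro exI[of _ d]) (auto simp: dist_real_def abs_minus_commute subset_iff)
 qed
 then obtain d where d: "!!i. d i > 0" "!!i t. \<bar>t - y i\<bar> < d i ==> t : X i" by metis
 \<comment> \<open>The inserted \<open>1\<close> keeps the minimum defined and positive for
   \<open>p = 0\<close>.\<close>
 define e where "e = Min (insert 1 (d ` {..<p}))"
 have e: "e > 0" "!!i. i < p ==> e \<le> d i" using d(1) by (auto simp: e_def)
 have y0: "\<forall>i\<ge>p. y i = 0" using V T by auto
 have "ebox p y e <= V" proof
  fix x assume x: "x : ebox p y e"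
  have "x i : X i" for i proof (cases "i < p")
   case True
   then have "\<bar>x i - y i\<bar> < d i" using x e(2)[of i] by (auto simp: ebox_def)
   then show ?thesis by (rule d)
  next
   case False
   then show ?thesis using x y0 d by (auto simp: ebox_def)
  qed
  then have "x : T" using X(3) by auto
  then show "x : V" using T(2) x by (auto simp: ebox_def)
 qed
 moreover have "y : ebox p y e" using y0 e by (auto simp: ebox_def)
 ultimately show ?thesis using that e by blast
qed

lemma smooth_freeze:
 assumes i: "i < p" and F: "smooth p (ebox p y ep) F" and y: "y : ebox p y ep"
 shows "smooth p (ebox p y ep) (%x. F (x(i := y i)))" proof -
 let ?B = "ebox p y ep"
 have B: "x(i := y i) : ?B" if "x : ?B" for x using that i y by (auto simp: ebox_def)
 define X where "X G \<longleftrightarrow> (EX F. smooth p ?B F & G = (%x. F (x(i := y i))))" for G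
 have "X (%x. F (x(i := y i)))" using F X_def by auto
 then show ?thesis proof (rule smooth.coinduct[where X=X])
  fix G assume "X G"
  then obtain F where F: "smooth p ?B F" "G = (%x. F (x(i := y i)))" unfolding X_def by auto
  have "continuous_on ?B G" unfolding F(2) by (rule continuous_on_compose2[OF smooth_imp_continuous[OF F(1)]
   continuous_on_fun_upd[OF continuous_on_id continuous_on_const]]) (auto intro: B)
  moreover have "EX G'. (X G' | smooth p ?B G') & has_partial ?B j G G'" if j: "j < p" for j proof (cases "j = i")
   case True
   then show ?thesis by (intro exI[of _ "%_. 0"]) (auto simp: has_partial_def F(2) intro: smooth_const openin_ebox)
  next
   case False
   obtain F' where F': "smooth p ?B F'" "has_partial ?B j F F'" using smooth_obtain_partial[OF F(1) j] .
   have "has_partial ?B j G (%x. F' (x(i := y i)))" unfolding has_partial_def proof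
   fix x assume "x : ?B"
   from F'(2)[unfolded has_partial_def, rule_format, OF B[OF this]] False
   show "((%t. G (x(j := t))) has_real_derivative F' (x(i := y i))) (at (x j))" by (simp add: F(2) fun_upd_twist)
   qed
   then show ?thesis using F'(1) unfolding X_def by blast
  qed
  ultimately show "EX f. G = f & continuous_on ?B f \<and>
   (\<forall>i<p. EX g. (X g | smooth p ?B g) & has_partial ?B i f g)" by simp
 qed
qed

context
 fixes p i :: nat and y :: "nat => real" and ep :: real and B :: "(nat => real) set"
 assumes i: "i < p" and y: "y : ebox p y ep"
 defines "B \<equiv> ebox p y ep"
begin

definition shrink :: "real => (nat => real) => nat => real" where
 "shrink t x = x(i := y i + t * (x i - y i))"

lemma shrink_ebox:
 assumes "x : B" "t : {0..1}" shows "shrink t x : B" proof -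
 have "\<bar>t * (x i - y i)\<bar> \<le> 1 * \<bar>x i - y i\<bar>"
  unfolding abs_mult by (rule mult_right_mono) (use assms in auto)
 moreover have "\<bar>x i - y i\<bar> < ep" using assms i by (auto simp: B_def ebox_def)
 ultimately show ?thesis using assms i by (auto simp: B_def ebox_def shrink_def)
qed

lemma continuous_on_shrink:
 assumes "smooth p B F" shows "continuous_on (B \<times> cbox 0 1) (%(x, t). t ^ k * F (shrink t x))" proof -
 have "continuous_on (B \<times> cbox 0 1) (%z. F (shrink (snd z) (fst z)))"
 proof (rule continuous_on_compose2[OF smooth_imp_continuous[OF assms]])
  have "continuous_on (B \<times> cbox 0 1) (%z::(nat => real) \<times> real. fst z i)"
   by (rule continuous_on_compose2[OF continuous_on_coordinate[of UNIV i]])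
   (auto intro: continuous_intros)
  then show "continuous_on (B \<times> cbox 0 1) (%z. shrink (snd z) (fst z))"
   unfolding shrink_def by (intro continuous_on_fun_upd continuous_intros)
 qed (auto intro: shrink_ebox)
 then show ?thesis by (auto simp: case_prod_beta intro!: continuous_intros)
qed

text \<open>With \<open>k = 0\<close> and a partial derivative in place of \<open>F\<close> this is
  the quotient in Hadamard's lemma. Higher powers of \<open>t\<close> arise as soon as it is
  differentiated in the direction \<open>i\<close>, so smoothness is shown for all \<open>k\<close>
  together.\<close>

definition moment :: "nat => ((nat => real) => real) => (nat => real) => real" where
 "moment k F x = integral (cbox 0 1) (%t. t ^ k * F (shrink t x))"

text \<open>Differentiation under the integral sign. As \<open>shrink t\<close> scales the distance
  to \<open>y\<close> in the \<open>i\<close>-th coordinate by \<open>t\<close>, the chain rule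
  contributes a factor \<open>t\<close> exactly for \<open>j = i\<close>.\<close>

lemma has_partial_moment:
 assumes F: "smooth p B F" and F': "smooth p B F'" "has_partial B j F F'" and j: "j < p"
 shows "has_partial B j (moment k F) (moment (if j = i then Suc k else k) F')" unfolding has_partial_def proof
 fix x assume x: "x : B"
 let ?k = "if j = i then Suc k else k"
 define U where "U = ball (y j) ep"
 have xU: "x j : U" and U: "x(j := s) : B" if "s : U" for s
  using x j that by (auto simp: U_def B_def ebox_def dist_real_def)
 have xU: "x j : U" using x j by (auto simp: U_def B_def ebox_def dist_real_def)
 have der: "((%s. t ^ k * F (shrink t (x(j := s)))) has_field_derivative
   t ^ ?k * F' (shrink t (x(j := s)))) (at s within U)" if s: "s : U" and t: "t : cbox 0 1" for s t proof -
  define z where "z = shrink t (x(j := s))"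
  have "z : B" unfolding z_def using shrink_ebox U[OF s] t by auto
  then have zF: "((%r. F (z(j := r))) has_real_derivative F' z) (at (z j))"
   using F'(2) by (auto simp: has_partial_def)
  have "((%s. F (shrink t (x(j := s)))) has_real_derivative
   (if j = i then t else 1) * F' z) (at s)" proof (cases "j = i")
   case True
   have eq: "shrink t (x(j := r)) = z(j := y i + t * (r - y i))" for r using True by (auto simp: shrink_def z_def)
   have "((%r. y i + t * (r - y i)) has_real_derivative t) (at s)" by (auto intro!: derivative_eq_intros)
   moreover have "z j = y i + t * (s - y i)" using True by (simp add: shrink_def z_def)
   ultimately have "((%r. F (z(j := y i + t * (r - y i)))) has_real_derivative F' z * t) (at s)"
   using DERIV_chain2[of "%r. F (z(j := r))" "F' z" "%r. y i + t * (r - y i)" s t] zF by simp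
   then show ?thesis unfolding eq using True by (simp add: mult.commute)
  next
   case False
   have eq: "shrink t (x(j := r)) = z(j := r)" for r using False by (auto simp: shrink_def z_def)
   have "z j = s" using False by (simp add: shrink_def z_def)
   then show ?thesis using zF False unfolding eq by simp
  qed
  from DERIV_cmult[OF this, of "t ^ k"]
  have "((%s. t ^ k * F (shrink t (x(j := s)))) has_real_derivative t ^ ?k * F' z) (at s)"
   by (cases "j = i") (simp_all add: algebra_simps)
  then show ?thesis unfolding z_def by (rule DERIV_subset[OF _ subset_UNIV])
 qed
 have cont: "continuous_on (U \<times> cbox 0 1) (%(s, t). t ^ l * G (shrink t (x(j := s))))"
  if "smooth p B G" for G l proof -
  have "continuous_on (U \<times> cbox 0 1) (%z. (x(j := fst z), snd z :: real))"
   by (intro continuous_on_Pair continuous_on_fun_upd continuous_intros)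
  moreover have "(%z. (x(j := fst z), snd z)) ` (U \<times> cbox 0 1) <= B \<times> cbox 0 1" using U by auto
  ultimately have "continuous_on (U \<times> cbox 0 1)
   (%z. (%(x, t). t ^ l * G (shrink t x)) (x(j := fst z), snd z))"
   by (rule continuous_on_compose2[OF continuous_on_shrink[OF that, of l]])
  then show ?thesis by (simp add: case_prod_beta)
 qed
 have int: "(%t. t ^ k * F (shrink t (x(j := s)))) integrable_on cbox 0 1" if "s : U" for s
 proof (rule integrable_continuous)
  have "continuous_on (cbox 0 1) (%t::real. (s, t))" by (intro continuous_intros)
  moreover have "(%t. (s, t)) ` cbox 0 1 <= U \<times> cbox 0 1" using that by auto
  ultimately have "continuous_on (cbox 0 1) (%t. (%(s, t). t ^ k * F (shrink t (x(j := s)))) (s, t))"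
   by (rule continuous_on_compose2[OF cont[OF F, of k]])
  then show "continuous_on (cbox 0 1) (%t. t ^ k * F (shrink t (x(j := s))))" by simp
 qed
 have "((%s. integral (cbox 0 1) (%t. t ^ k * F (shrink t (x(j := s))))) has_field_derivative
   integral (cbox 0 1) (%t. t ^ ?k * F' (shrink t (x(j := x j))))) (at (x j) within U)"
  by (rule leibniz_rule_field_derivative[OF der int cont[OF F'(1)] xU])
   (auto simp: U_def)
 then have "((%s. moment k F (x(j := s))) has_field_derivative moment ?k F' x) (at (x j) within U)"
  unfolding moment_def by simp
 then show "((%s. moment k F (x(j := s))) has_real_derivative moment ?k F' x) (at (x j))"
  using at_within_open[OF xU] by (simp add: U_def)
qed

lemma smooth_moment:
 assumes F: "smooth p B F" shows "smooth p B (moment k F)" proof -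
 define X where "X G \<longleftrightarrow> (EX k F. smooth p B F & G = moment k F)" for G
 have "X (moment k F)" using F X_def by auto
 then show ?thesis proof (rule smooth.coinduct[where X=X])
  fix G assume "X G"
  then obtain k F where F: "smooth p B F" "G = moment k F" unfolding X_def by auto
  have "continuous_on B G"
   unfolding F(2) moment_def by (rule integral_continuous_on_param[OF continuous_on_shrink[OF F(1)]])
  moreover have "EX G'. (X G' | smooth p B G') & has_partial B j G G'" if j: "j < p" for j proof -
   obtain F' where F': "smooth p B F'" "has_partial B j F F'" using smooth_obtain_partial[OF F(1) j] .
   from has_partial_moment[OF F(1) F' j, of k] F'(1) show ?thesis unfolding F(2) X_def by blast
  qed
  ultimately show "EX f. G = f & continuous_on B f \<and>
   (\<forall>i<p. EX g. (X g | smooth p B g) & has_partial B i f g)" by simp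
 qed
qed

lemma hadamard_coordinate:
 assumes F: "smooth p B F" shows "EX g. smooth p B g & (ALL x:B. F x = F (x(i := y i)) + (x i - y i) * g x)" proof -
 obtain F' where F': "smooth p B F'" "has_partial B i F F'" using smooth_obtain_partial[OF F i] .
 have "F x = F (x(i := y i)) + (x i - y i) * moment 0 F' x" if x: "x : B" for x proof -
  have "((%t. F (shrink t x)) has_vector_derivative (x i - y i) * F' (shrink t x)) (at t within {0..1})"
   if t: "t : {0..1}" for t proof -
   let ?z = "shrink t x"
   have "((%r. F (?z(i := r))) has_real_derivative F' ?z) (at (?z i))"
   using F'(2) shrink_ebox[OF x t] by (auto simp: has_partial_def)
   moreover have "?z i = y i + t * (x i - y i)" by (simp add: shrink_def)
   moreover have "((%t. y i + t * (x i - y i)) has_real_derivative x i - y i) (at t)"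
   by (auto intro!: derivative_eq_intros)
   ultimately have "((%t. F (?z(i := y i + t * (x i - y i)))) has_real_derivative F' ?z * (x i - y i)) (at t)"
   using DERIV_chain2[of "%r. F (?z(i := r))" "F' ?z" "%t. y i + t * (x i - y i)" t] by simp
   moreover have "?z(i := y i + r * (x i - y i)) = shrink r x" for r by (auto simp: shrink_def)
   ultimately have "((%t. F (shrink t x)) has_real_derivative F' ?z * (x i - y i)) (at t)" by simp
   then show ?thesis unfolding has_real_derivative_iff_has_vector_derivative
   by (simp add: mult.commute has_vector_derivative_at_within)
  qed
  from fundamental_theorem_of_calculus[OF _ this]
  have "((%t. (x i - y i) * F' (shrink t x)) has_integral F (shrink 1 x) - F (shrink 0 x)) {0..1}" by auto
  from integral_unique[OF this]
  have "F (shrink 1 x) - F (shrink 0 x) = (x i - y i) * moment 0 F' x" by (simp add: moment_def)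
  moreover have "shrink 1 x = x" "shrink 0 x = x(i := y i)" by (auto simp: shrink_def)
  ultimately show ?thesis by simp
 qed
 then show ?thesis using smooth_moment[OF F'(1)] by blast
qed

end

text \<open>The coordinates are frozen one after another. After \<open>k\<close> steps
  \<open>h\<close> is \<open>f\<close> with its first \<open>k\<close> arguments replaced by those
  of \<open>y\<close>, and each step has split off one term of the sum.\<close>

lemma hadamard:
 assumes f: "smooth p (ebox p y ep) f" and y: "y : ebox p y ep"
 obtains g where "!!i. i < p ==> smooth p (ebox p y ep) (g i)"
  "!!x. x : ebox p y ep ==> f x = f y + (\<Sum>i<p. (x i - y i) * g i x)" proof -
 let ?B = "ebox p y ep"
 have "EX h g. smooth p ?B h & (\<forall>i<p. smooth p ?B (g i)) \<and>
  (ALL x:?B. f x = h x + (\<Sum>i<k. (x i - y i) * g i x)) \<and>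
  (ALL x:?B. h x = f (%i. if i < k then y i else x i))" if "k \<le> p" for k using that proof (induction k)
  case 0
  have "\<forall>i<p. smooth p ?B (%_. 0)" by (auto intro: smooth_const openin_ebox)
  then show ?case using f by (intro exI[of _ f] exI[of _ "%_ _. 0"]) simp
 next
  case (Suc k)
  from Suc.IH[OF Suc_leD[OF Suc.prems]] obtain h g where h: "smooth p ?B h"
   "\<forall>i<p. smooth p ?B (g i)"
   "ALL x:?B. f x = h x + (\<Sum>i<k. (x i - y i) * g i x)"
   "ALL x:?B. h x = f (%i. if i < k then y i else x i)" by (elim exE conjE) blast
  have k: "k < p" using Suc by simp
  obtain g' where g': "smooth p ?B g'"
   "!!x. x : ?B ==> h x = h (x(k := y k)) + (x k - y k) * g' x"
   using hadamard_coordinate[OF k y h(1)] by (elim exE conjE) blast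
  have 1: "f x = h (x(k := y k)) + (\<Sum>i<Suc k. (x i - y i) * (g(k := g')) i x)" if "x : ?B" for x
   using h(3) g'(2) that by simp
  have 2: "h (x(k := y k)) = f (%i. if i < Suc k then y i else x i)" if "x : ?B" for x proof -
   have "x(k := y k) : ?B" using that k y by (auto simp: ebox_def)
   moreover have "(%i. if i < k then y i else (x(k := y k)) i) = (%i. if i < Suc k then y i else x i)"
   by (auto simp: less_Suc_eq)
   ultimately show ?thesis using h(4) by simp
  qed
  show ?case using smooth_freeze[OF k h(1) y] h(2) g'(1) 1 2
   by (intro exI[of _ "%x. h (x(k := y k))"] exI[of _ "g(k := g')"]) (simp del: sum.lessThan_Suc)
 qed
 from this[OF order.refl] obtain h g where h: "\<forall>i<p. smooth p ?B (g i)"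
   "ALL x:?B. f x = h x + (\<Sum>i<p. (x i - y i) * g i x)"
   "ALL x:?B. h x = f (%i. if i < p then y i else x i)" by (elim exE conjE) blast
 have eq: "(%i. if i < p then y i else x i) = y" if "x : ?B" for x
  by (rule ext) (use that y in \<open>auto simp: ebox_def not_less\<close>)
 have "f x = f y + (\<Sum>i<p. (x i - y i) * g i x)" if "x : ?B" for x using h(2,3) eq[OF that] that by simp
 with h(1) show ?thesis by (intro that) auto
qed

section \<open>Algebras of formal power series\<close>

subsection \<open>Signs\<close>

text \<open>The homomorphism from \<open>bit\<close> to the signs; with it the multiplicativity of
  \<open>koszul\<close> in each argument follows from the bilinearity of the pairing.\<close>

definition bsign :: "bit => real" where
 "bsign b = (if b = 0 then 1 else - 1)"

lemma bsign_add: "bsign (a + b) = bsign a * bsign b" by (cases "a = 0"; cases "b = 0") (auto simp: bsign_def)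

lemma koszul_bsign: "koszul i j = bsign (\<Sum>k\<in>UNIV. i $ k * j $ k)" by (simp only: koszul_def bsign_def)

lemma koszul_add_left: "koszul (i + j) k = koszul i k * koszul j k"
 unfolding koszul_bsign vector_add_component distrib_right sum.distrib bsign_add ..

lemma koszul_add_right: "koszul k (i + j) = koszul k i * koszul k j"
 unfolding koszul_bsign vector_add_component distrib_left sum.distrib bsign_add ..

lemma koszul_commute: "koszul i j = koszul j i" unfolding koszul_bsign by (simp only: mult.commute)

lemma koszul_zero [simp]: "koszul 0 i = 1" "koszul i 0 = 1" by (simp_all add: koszul_def)

lemma koszul_cases: "koszul i j = 1 | koszul i j = - 1" by (simp add: koszul_def)

lemma koszul_square [simp]: "koszul i j * koszul i j = 1" "koszul i j * (koszul i j * c) = c"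
 using koszul_cases[of i j] by auto

lemma koszul_sum_left: "koszul (\<Sum>a\<in>A. f a) j = (\<Prod>a\<in>A. koszul (f a) j)"
 by (induction A rule: infinite_finite_induct) (auto simp: koszul_add_left)

lemma koszul_sum_right: "koszul j (\<Sum>a\<in>A. f a) = (\<Prod>a\<in>A. koszul j (f a))"
 by (induction A rule: infinite_finite_induct) (auto simp: koszul_add_right)

lemma koszul_monomial_degree:
 "koszul (mdeg ds mu) (mdeg ds nu) =
  (\<Prod>b<length ds. \<Prod>a<length ds. koszul (ds ! a) (ds ! b) ^ (mu a * nu b))" proof -
 have *: "(\<Prod>a<length ds. k a ^ mu a) ^ m = (\<Prod>a<length ds. k a ^ (mu a * m))" for k :: "nat => real" and m
  by (simp add: prod_power_distrib power_mult)
 show ?thesis unfolding monomial_degree_def koszul_sum_left koszul_sum_right by (simp add: *)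
qed

lemma monomial_degree_add:
 "mdeg ds (%a. mu a + nu a) = mdeg ds mu + mdeg ds nu" proof -
 have "(\<Sum>_<m + n. d) = (\<Sum>_<m. d) + (\<Sum>_<n. d)" for m n :: nat and d :: "bit ^ 'a"
  by (simp add: distrib_right)
 then show ?thesis unfolding monomial_degree_def by (simp only: sum.distrib)
qed

lemma monomial_degree_zero [simp]: "mdeg ds (%_. 0) = 0" by (simp add: monomial_degree_def)

text \<open>Over the full square of indices the two products can be swapped and their ranges cut
  independently, which the triangular form does not offer.\<close>

lemma monomial_sign_alt:
 "msign ds mu nu = (\<Prod>b<length ds. \<Prod>a<length ds.
  if b < a then koszul (ds ! a) (ds ! b) ^ (mu a * nu b) else 1)" proof -
 have "(\<Prod>a\<in>{b<..<length ds}. f a) = (\<Prod>a<length ds. if b < a then f a else 1)" for b and f :: "nat => real"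
 proof -
  have "{b<..<length ds} = {a : {..<length ds}. b < a}" by auto
  then show ?thesis using prod.inter_filter[of "{..<length ds}" f "%a. b < a"] by simp
 qed
 then show ?thesis unfolding monomial_sign_def by simp
qed

lemma monomial_sign_add_left:
 "msign ds (%a. mu a + nu a) rh = msign ds mu rh * msign ds nu rh"
 by (simp add: monomial_sign_def distrib_right power_add prod.distrib)

lemma monomial_sign_add_right:
 "msign ds rh (%a. mu a + nu a) = msign ds rh mu * msign ds rh nu"
 by (simp add: monomial_sign_def distrib_left power_add prod.distrib)

lemma monomial_sign_zero [simp]:
 "msign ds (%_. 0) nu = 1" "msign ds mu (%_. 0) = 1" by (simp_all add: monomial_sign_def)

lemma mi_zero [simp]: "(%_. 0) : MI ds" by (simp add: multi_indices_def)

lemma mi_mono: "rh : MI ds ==> mu \<le> rh ==> mu : MI ds"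
 unfolding multi_indices_def le_fun_def by (auto intro: order.trans) (metis le_zero_eq)

lemma mi_add:
 assumes "(%a. mu a + nu a) : MI ds" shows "mu : MI ds" "nu : MI ds"
 by (rule mi_mono[OF assms]; simp add: le_fun_def)+

text \<open>The Koszul sign of the degrees is a product over all pairs of indices. The pairs with
  \<open>a < b\<close> cancel against the sign of the opposite product, since signs square to 1. A
  diagonal factor is 1, because a variable with sign -1 occurs at most once in an admissible
  product. What remains are the pairs with \<open>b < a\<close>.\<close>

lemma monomial_sign_commute:
 assumes "(%a. mu a + nu a) : MI ds" shows "msign ds mu nu =
  koszul (mdeg ds mu) (mdeg ds nu) * msign ds nu mu" proof -
 define n where "n = length ds"
 define K where "K a b = koszul (ds ! a) (ds ! b) ^ (mu a * nu b)" for a b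
 have KK: "K a b * K a b = 1" for a b unfolding K_def power_mult_distrib[symmetric] by simp
 have diag: "K a a = 1" if "a < n" for a proof (cases "koszul (ds ! a) (ds ! a) = 1")
  case True
  then show ?thesis by (simp add: K_def)
 next
  case False
  then have "mu a + nu a \<le> 1"
   using assms that koszul_cases[of "ds ! a" "ds ! a"] by (auto simp: multi_indices_def n_def)
  then have "mu a * nu a = 0" by (cases "mu a") auto
  then show ?thesis by (auto simp: K_def)
 qed
 have "msign ds nu mu = (\<Prod>b<n. \<Prod>a<n. if b < a then K b a else 1)" unfolding monomial_sign_alt n_def K_def
  by (intro prod.cong HOL.refl) (auto simp: koszul_commute mult.commute)
 also have "... = (\<Prod>b<n. \<Prod>a<n. if a < b then K a b else 1)" by (subst prod.swap) simp
 finally have "koszul (mdeg ds mu) (mdeg ds nu) * msign ds nu mu =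
   (\<Prod>b<n. \<Prod>a<n. K a b * (if a < b then K a b else 1))"
  unfolding koszul_monomial_degree by (simp add: n_def K_def prod.distrib)
 also have "... = (\<Prod>b<n. \<Prod>a<n. if b < a then K a b else 1)"
  using KK diag by (intro prod.cong HOL.refl) (auto simp: not_less le_less)
 also have "... = msign ds mu nu" unfolding monomial_sign_alt n_def K_def ..
 finally show ?thesis ..
qed

subsection \<open>Convolution\<close>

text \<open>The product of \<open>power_series_algebra\<close> at a fixed point, where the laws
  become identities between families of reals.\<close>

definition conv ::
 "(bit ^ 'n::finite) list => ((nat => nat) => real) => ((nat => nat) => real) => (nat => nat) => real" where
 "conv ds f g rh = (\<Sum>mu | mu \<le> rh.
  msign ds mu (%a. rh a - mu a) * f mu * g (%a. rh a - mu a))"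

text \<open>Sums over this set are symmetric in the two factors and avoid truncated
  subtraction.\<close>

definition splits :: "(nat => nat) => ((nat => nat) \<times> (nat => nat)) set" where
 "splits rh = {(mu, nu). (%a. mu a + nu a) = rh}"

lemma bij_betw_splits: "bij_betw (%mu. (mu, %a. rh a - mu a)) {mu. mu \<le> rh} (splits rh)"
 by (rule bij_betw_byWitness[where f'=fst]) (auto simp: splits_def le_fun_def)

lemma finite_le_multi_index:
 assumes "rh : MI ds" shows "finite {mu. mu \<le> rh}" proof -
 have "{mu. mu \<le> rh} <= (%f a. if a < length ds then f a else 0) ` (\<Pi>\<^sub>E a\<in>{..<length ds}. {..rh a})"
 proof
  fix mu assume "mu : {mu. mu \<le> rh}"
  then have mu: "!!a. mu a \<le> rh a" by (simp add: le_fun_def)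
  have "mu a = 0" if "a \<ge> length ds" for a using mu[of a] that assms by (simp add: multi_indices_def)
  then have "mu = (%a. if a < length ds then restrict mu {..<length ds} a else 0)" by (auto simp: fun_eq_iff)
  moreover have "restrict mu {..<length ds} : (\<Pi>\<^sub>E a\<in>{..<length ds}. {..rh a})" using mu by auto
  ultimately show "mu : (%f a. if a < length ds then f a else 0) ` (\<Pi>\<^sub>E a\<in>{..<length ds}. {..rh a})"
   by (rule image_eqI)
 qed
 then show ?thesis by (rule finite_subset) (auto intro!: finite_imageI finite_PiE)
qed

lemma finite_splits: "rh : MI ds ==> finite (splits rh)"
 using bij_betw_finite[OF bij_betw_splits] finite_le_multi_index by blast

lemma conv_splits: "conv ds f g rh = (\<Sum>(mu, nu)\<in>splits rh. msign ds mu nu * f mu * g nu)"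
 unfolding conv_def using sum.reindex_bij_betw[OF bij_betw_splits[of rh],
   of "%(mu, nu). msign ds mu nu * f mu * g nu"] by simp

lemma splits_multi_indices:
 "rh : MI ds ==> (mu, nu) : splits rh ==> mu : MI ds & nu : MI ds" using mi_add unfolding splits_def by blast

lemma conv_cong:
 assumes "rh : MI ds" and "!!mu. mu : MI ds ==> f mu = f' mu" "!!mu. mu : MI ds ==> g mu = g' mu"
 shows "conv ds f g rh = conv ds f' g' rh" unfolding conv_splits proof (rule sum.cong[OF HOL.refl], clarify)
 fix mu nu assume "(mu, nu) : splits rh"
 then show "msign ds mu nu * f mu * g nu = msign ds mu nu * f' mu * g' nu"
  using splits_multi_indices[OF assms(1)] assms(2,3) by simp
qed

text \<open>Both sides are sums over all decompositions of \<open>rh\<close> into three summands.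
  The signs agree because \<open>monomial_sign\<close> is multiplicative in each argument.\<close>

lemma conv_assoc:
 assumes rh: "rh : MI ds" shows "conv ds (conv ds f g) h rh = conv ds f (conv ds g h) rh" proof -
 let ?s = "msign ds"
 have fin: "finite (splits mu)" "finite (splits nu)" if "(mu, nu) : splits rh" for mu nu
  using that splits_multi_indices[OF rh] finite_splits by blast+
 have "conv ds (conv ds f g) h rh = (\<Sum>(\<sigma>, kp)\<in>splits rh. \<Sum>(mu, nu)\<in>splits \<sigma>.
   ?s \<sigma> kp * (?s mu nu * f mu * g nu) * h kp)" unfolding conv_splits[of _ _ h] conv_splits[of _ f g]
  by (simp add: sum_distrib_left sum_distrib_right case_prod_beta mult.assoc)
 also have "... = (\<Sum>((\<sigma>, kp), (mu, nu))\<in>(SIGMA z:splits rh. splits (fst z)).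
   ?s \<sigma> kp * (?s mu nu * f mu * g nu) * h kp)"
  using fin finite_splits[OF rh] by (subst sum.Sigma[symmetric]) (auto simp: case_prod_beta)
 also have "... = (\<Sum>((mu, ta), (nu, kp))\<in>(SIGMA z:splits rh. splits (snd z)).
   ?s mu ta * f mu * (?s nu kp * g nu * h kp))" proof (rule sum.reindex_bij_witness[where
   i="%((mu, ta), (nu, kp)). ((%a. mu a + nu a, kp), (mu, nu))" and
   j="%((\<sigma>, kp), (mu, nu)). ((mu, %a. nu a + kp a), (nu, kp))"], goal_cases)
  case (5 z)
  then show ?case by (auto simp: splits_def monomial_sign_add_left monomial_sign_add_right)
 qed (auto simp: splits_def add.assoc)
 also have "... = (\<Sum>(mu, ta)\<in>splits rh. \<Sum>(nu, kp)\<in>splits ta.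
   ?s mu ta * f mu * (?s nu kp * g nu * h kp))"
  using fin finite_splits[OF rh] by (subst sum.Sigma[symmetric]) (auto simp: case_prod_beta)
 also have "... = conv ds f (conv ds g h) rh" unfolding conv_splits[of _ f] conv_splits[of _ g h]
  by (simp add: sum_distrib_left sum_distrib_right case_prod_beta)
 finally show ?thesis .
qed

lemma conv_add_left: "conv ds (%mu. f mu + g mu) h rh = conv ds f h rh + conv ds g h rh"
 and conv_add_right: "conv ds h (%mu. f mu + g mu) rh = conv ds h f rh + conv ds h g rh"
 and conv_scale_left: "conv ds (%mu. r * f mu) h rh = r * conv ds f h rh"
 and conv_scale_right: "conv ds h (%mu. r * f mu) rh = r * conv ds h f rh"
 by (simp_all add: conv_def sum.distrib algebra_simps sum_distrib_left)

lemma conv_unit_left: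
 assumes "rh : MI ds" shows "conv ds (%mu. if mu = (%_. 0) then c else 0) f rh = c * f rh" proof -
 have "conv ds (%mu. if mu = (%_. 0) then c else 0) f rh =
   (\<Sum>mu | mu \<le> rh. if mu = (%_. 0) then c * f rh else 0)" unfolding conv_def by (intro sum.cong) auto
 also have "... = c * f rh" using finite_le_multi_index[OF assms] by (simp add: le_fun_def)
 finally show ?thesis .
qed

lemma conv_unit_right:
 assumes "rh : MI ds" shows "conv ds f (%mu. if mu = (%_. 0) then c else 0) rh = c * f rh" proof -
 have *: "(%a. rh a - mu a) = (%_. 0) \<longleftrightarrow> mu = rh" if "mu \<le> rh" for mu
  using that by (auto simp: le_fun_def fun_eq_iff le_antisym)
 have "conv ds f (%mu. if mu = (%_. 0) then c else 0) rh =
   (\<Sum>mu | mu \<le> rh. if mu = rh then c * f rh else 0)" unfolding conv_def by (intro sum.cong) (auto simp: *)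
 also have "... = c * f rh" using finite_le_multi_index[OF assms] by simp
 finally show ?thesis .
qed

text \<open>Only pairs of monomials of degrees \<open>i\<close> and \<open>j\<close> contribute, and
  all of these commute up to the same sign.\<close>

lemma conv_commute:
 assumes rh: "rh : MI ds" and f: "!!mu. mu : MI ds ==> mdeg ds mu ~= i ==> f mu = 0"
  and g: "!!mu. mu : MI ds ==> mdeg ds mu ~= j ==> g mu = 0" shows "conv ds f g rh = koszul i j * conv ds g f rh"
proof -
 have "conv ds f g rh = (\<Sum>(nu, mu)\<in>splits rh. msign ds mu nu * f mu * g nu)" unfolding conv_splits
  by (rule sum.reindex_bij_witness[where i=prod.swap and j=prod.swap]) (auto simp: splits_def add.commute)
 also have "... = (\<Sum>(nu, mu)\<in>splits rh. koszul i j * (msign ds nu mu * g nu * f mu))"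
 proof (rule sum.cong[OF HOL.refl], clarify)
  fix nu mu assume s: "(nu, mu) : splits rh"
  then have I: "nu : MI ds" "mu : MI ds" "(%a. mu a + nu a) : MI ds"
   using splits_multi_indices[OF rh] rh by (auto simp: splits_def add.commute)
  show "msign ds mu nu * f mu * g nu = koszul i j * (msign ds nu mu * g nu * f mu)"
  proof (cases "mdeg ds mu = i & mdeg ds nu = j")
   case True
   then show ?thesis using monomial_sign_commute[OF I(3)] by simp
  next
   case False
   then show ?thesis using f[OF I(2)] g[OF I(1)] by auto
  qed
 qed
 also have "... = koszul i j * conv ds g f rh" unfolding conv_splits by (simp add: sum_distrib_left case_prod_beta)
 finally show ?thesis .
qed

subsection \<open>Graded-commutative algebras\<close>

text \<open>Sums over all degrees range over \<open>UNIV\<close> for vectors of bits, and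
  \<open>finsum\<close> is meaningful only over a finite set.\<close>

instance bit :: finite proof
 have "(UNIV :: bit set) = {0, 1}" by (metis (full_types) UNIV_eq_I bit_not_zero_iff insert_iff)
 then show "finite (UNIV :: bit set)" by (metis finite.emptyI finite_insert)
qed

lemma cring_real_ring: "cring real_ring" proof (rule cringI)
 show "abelian_group real_ring" proof (rule abelian_groupI)
  fix x :: real
  show "EX y:carrier real_ring. y \<oplus>\<^bsub>real_ring\<^esub> x = \<zero>\<^bsub>real_ring\<^esub>"
   by (intro bexI[of _ "- x"]) (auto simp: real_ring_def)
 qed (auto simp: real_ring_def)
 show "comm_monoid real_ring" by (rule comm_monoidI) (auto simp: real_ring_def)
qed (auto simp: real_ring_def algebra_simps)

lemma real_ring_simps [simp]:
 "carrier real_ring = UNIV" "x \<otimes>\<^bsub>real_ring\<^esub> y = x * y" "\<one>\<^bsub>real_ring\<^esub> = 1"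
 "\<zero>\<^bsub>real_ring\<^esub> = 0" "x \<oplus>\<^bsub>real_ring\<^esub> y = x + y"
 by (simp_all add: real_ring_def)

text \<open>The negative of an element is its multiple by \<open>-1\<close>, so homogeneous parts
  closed under sums and scalars are subgroups, and only equational laws remain to be
  checked.\<close>

lemma graded_comm_algebraI:
 fixes A :: "('b, 'n::finite) graded_algebra" (structure)
 assumes "ring A" and smult: "!!r a. a : carrier A ==> r \<odot> a : carrier A"
   "!!r s a. a : carrier A ==> (r + s) \<odot> a = r \<odot> a \<oplus> s \<odot> a"
   "!!r a b. a : carrier A ==> b : carrier A ==> r \<odot> (a \<oplus> b) = r \<odot> a \<oplus> r \<odot> b"
   "!!r s a. a : carrier A ==> (r * s) \<odot> a = r \<odot> (s \<odot> a)"
   "!!a. a : carrier A ==> 1 \<odot> a = a"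
   "!!r a b. a : carrier A ==> b : carrier A ==> (r \<odot> a) \<otimes> b = r \<odot> (a \<otimes> b)"
   "!!r a b. a : carrier A ==> b : carrier A ==> a \<otimes> (r \<odot> b) = r \<odot> (a \<otimes> b)"
  and gcomp: "!!d. gcomp A d <= carrier A" "!!d. \<zero> : gcomp A d"
   "!!d a b. a : gcomp A d ==> b : gcomp A d ==> a \<oplus> b : gcomp A d"
   "!!d r a. a : gcomp A d ==> r \<odot> a : gcomp A d"
   "!!a. a : carrier A ==> \<exists>!f. (ALL d. f d : gcomp A d) & a = (\<Oplus>d\<in>UNIV. f d)"
   "\<one> : gcomp A 0"
   "!!i j a b. a : gcomp A i ==> b : gcomp A j ==> a \<otimes> b : gcomp A (i + j)"
   "!!i j a b. a : gcomp A i ==> b : gcomp A j ==> a \<otimes> b = koszul i j \<odot> (b \<otimes> a)"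
 shows "graded_comm_algebra A" proof -
 interpret ring A by fact
 have mod: "module real_ring A" by (rule moduleI) (auto simp: cring_real_ring abelian_group_axioms smult)
 have inv: "\<ominus> a = (- 1) \<odot> a" if a: "a : carrier A" for a proof (rule minus_equality)
  have "(- 1) \<odot> a \<oplus> a = (- 1 + 1) \<odot> a" using smult(2,5) a by metis
  also have "... = \<zero>" using module.smult_l_null[OF mod a] by simp
  finally show "(- 1) \<odot> a \<oplus> a = \<zero>" .
 qed (use a smult in auto)
 have sub: "submodule (gcomp A d) real_ring A" for d proof (rule module.submoduleI[OF mod])
  show "\<ominus> a : gcomp A d" if "a : gcomp A d" for a using that gcomp(1,4) inv by (metis subsetD)
 qed (use gcomp(1-4) in auto)
 show ?thesis by (intro graded_comm_algebra.intro graded_comm_algebra_axioms.intro mod ring_axioms sub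
   smult(6,7) gcomp(5-))
qed

section \<open>Homogeneous components in a graded-commutative algebra\<close>

context graded_comm_algebra
begin

lemma gcomp_closed: "a : gcomp A d ==> a : carrier A" using gcomp_submodule submoduleE(1) by blast

lemma gcomp_zero: "\<zero> : gcomp A d" using submoduleE(2)[OF gcomp_submodule] submoduleE(4,5)[OF gcomp_submodule]
 by (metis ex_in_conv gcomp_closed r_neg submoduleE(3)[OF gcomp_submodule])

lemma gcomp_add: "a : gcomp A d ==> b : gcomp A d ==> a \<oplus> b : gcomp A d"
 using gcomp_submodule submoduleE(5) by blast

lemma gcomp_smult: "a : gcomp A d ==> r \<odot> a : gcomp A d"
 using gcomp_submodule submoduleE(4) by (metis UNIV_I real_ring_simps(1))

lemma smult_closed': "a : carrier A ==> r \<odot> a : carrier A" by (rule smult_closed) auto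

lemma smult_add_left: "a : carrier A ==> (r + s) \<odot> a = r \<odot> a \<oplus> s \<odot> a"
 using smult_l_distr[of r s a] by simp

lemma smult_add_right: "a : carrier A ==> b : carrier A ==> r \<odot> (a \<oplus> b) = r \<odot> a \<oplus> r \<odot> b"
 using smult_r_distr[of r a b] by simp

lemma smult_smult: "a : carrier A ==> r \<odot> (s \<odot> a) = (r * s) \<odot> a"
 using smult_assoc1[of r s a] by simp

lemma smult_one': "a : carrier A ==> 1 \<odot> a = a" using smult_one[of a] by simp

lemma smult_zero_left: "a : carrier A ==> 0 \<odot> a = \<zero>" using smult_l_null[of a] by simp

lemma smult_zero_right: "r \<odot> \<zero> = \<zero>" using smult_r_null[of r] by simp

lemma minus_eq_smult: "a : carrier A ==> \<ominus> a = (- 1) \<odot> a" proof (rule M.minus_equality)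
 assume a: "a : carrier A"
 have "(- 1) \<odot> a \<oplus> a = (- 1 + 1) \<odot> a" using smult_add_left smult_one' a by metis
 then show "(- 1) \<odot> a \<oplus> a = \<zero>" using smult_zero_left[OF a] by simp
qed (auto intro: smult_closed')

lemma gcomp_minus: "a : gcomp A d ==> \<ominus> a : gcomp A d" using gcomp_smult gcomp_closed minus_eq_smult by metis

lemma gcomp_finsum:
 "(!!i. i : X ==> f i : gcomp A d) ==> finsum A f X : gcomp A d" proof (induction X rule: infinite_finite_induct)
 case (insert x F)
 then have "f : F \<rightarrow> carrier A" "f x : carrier A" using gcomp_closed by auto
 with insert show ?case by (auto intro: gcomp_add)
qed (auto intro: gcomp_zero)

definition component :: "bit ^ 'n => 'b => 'b" where
 "component d a = (THE f. (ALL d. f d : gcomp A d) & a = (\<Oplus>d\<in>UNIV. f d)) d"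

lemma component:
 assumes "a : carrier A" shows "component d a : gcomp A d" "(\<Oplus>d\<in>UNIV. component d a) = a"
 using theI'[OF gcomp_direct_sum[OF assms]] by (auto simp: component_def)

lemma component_closed: "a : carrier A ==> component d a : carrier A" using component(1) gcomp_closed by blast

lemma component_unique:
 assumes "!!d. f d : gcomp A d" "a = (\<Oplus>d\<in>UNIV. f d)" shows "component d a = f d" proof -
 have "a : carrier A" using assms gcomp_closed by (auto intro!: finsum_closed)
 from the1_equality[OF gcomp_direct_sum[OF this], of f] assms show ?thesis by (auto simp: component_def)
qed

lemma component_gcomp:
 assumes "a : gcomp A d" shows "component e a = (if e = d then a else \<zero>)" proof (rule component_unique)
 have "(\<Oplus>e\<in>UNIV. if e = d then a else \<zero>) = (\<Oplus>e\<in>UNIV. if d = e then a else \<zero>)"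
  by (intro arg_cong2[where f="finsum A"]) auto
 also have "... = a" using finsum_singleton[of d UNIV "%_. a"] assms gcomp_closed by auto
 finally show "a = (\<Oplus>e\<in>UNIV. if e = d then a else \<zero>)" ..
qed (use assms gcomp_zero in auto)

lemma homogeneous_induct [consumes 1, case_names homogeneous add]:
 assumes "a : carrier A" and "!!d a. a : gcomp A d ==> P a"
  and "!!a b. a : carrier A ==> b : carrier A ==> P a ==> P b ==> P (a \<oplus> b)" shows "P a" proof -
 have "P (\<Oplus>d\<in>X. component d a)" if "finite X" for X using that proof induction
  case empty
  then show ?case using assms(2)[OF gcomp_zero[of 0]] by simp
 next
  case (insert x X)
  have *: "component d a : carrier A" for d using component(1)[OF assms(1)] gcomp_closed by blast
  with insert show ?case using assms(2)[OF component(1)[OF assms(1)]] assms(3) by simp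
 qed
 from this[of UNIV] show ?thesis using component[OF assms(1)] by simp
qed

end

section \<open>Degree-preserving homomorphisms\<close>

lemma graded_hom_simps:
 assumes "h : graded_hom A B" shows "a : carrier A ==> h a : carrier B"
  "a : carrier A ==> b : carrier A ==> h (a \<otimes>\<^bsub>A\<^esub> b) = h a \<otimes>\<^bsub>B\<^esub> h b"
  "a : carrier A ==> b : carrier A ==> h (a \<oplus>\<^bsub>A\<^esub> b) = h a \<oplus>\<^bsub>B\<^esub> h b"
  "h \<one>\<^bsub>A\<^esub> = \<one>\<^bsub>B\<^esub>"
  "a : carrier A ==> h (r \<odot>\<^bsub>A\<^esub> a) = r \<odot>\<^bsub>B\<^esub> h a"
  "a : gcomp A d ==> h a : gcomp B d" using assms by (auto simp: graded_hom_def ring_hom_def image_subset_iff)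

lemma graded_hom_zero:
 assumes "h : graded_hom A B" "graded_comm_algebra A" "graded_comm_algebra B"
 shows "h \<zero>\<^bsub>A\<^esub> = \<zero>\<^bsub>B\<^esub>" proof -
 interpret A: graded_comm_algebra A by fact
 interpret B: graded_comm_algebra B by fact
 have "h \<zero>\<^bsub>A\<^esub> = h (0 \<odot>\<^bsub>A\<^esub> \<zero>\<^bsub>A\<^esub>)"
  by (simp add: A.smult_zero_left)
 also have "... = 0 \<odot>\<^bsub>B\<^esub> h \<zero>\<^bsub>A\<^esub>"
  by (rule graded_hom_simps(5)[OF assms(1)]) simp
 also have "... = \<zero>\<^bsub>B\<^esub>" by (rule B.smult_zero_left) (rule graded_hom_simps(1)[OF assms(1)], simp)
 finally show ?thesis .
qed

lemma graded_hom_finsum: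
 assumes h: "h : graded_hom A B" and A: "graded_comm_algebra A" and B: "graded_comm_algebra B"
  and f: "!!i. i : X ==> f i : carrier A"
 shows "h (\<Oplus>\<^bsub>A\<^esub>i\<in>X. f i) = (\<Oplus>\<^bsub>B\<^esub>i\<in>X. h (f i))" proof -
 interpret A: graded_comm_algebra A by fact
 interpret B: graded_comm_algebra B by fact
 show ?thesis using f proof (induction X rule: infinite_finite_induct)
  case (insert x X)
  then have "f : X \<rightarrow> carrier A" "f x : carrier A"
   "(%i. h (f i)) : X \<rightarrow> carrier B" "h (f x) : carrier B" using graded_hom_simps(1)[OF h] by auto
  with insert show ?case by (simp add: graded_hom_simps(3)[OF h])
 qed (simp_all add: graded_hom_zero[OF h A B])
qed

lemma graded_hom_component:
 assumes h: "h : graded_hom A B" and A: "graded_comm_algebra A" and B: "graded_comm_algebra B" and a: "a : carrier A"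
 shows "h (graded_comm_algebra.component A d a) = graded_comm_algebra.component B d (h a)" proof -
 interpret A: graded_comm_algebra A by fact
 interpret B: graded_comm_algebra B by fact
 have "(\<Oplus>\<^bsub>B\<^esub>d\<in>UNIV. h (A.component d a)) = h (\<Oplus>\<^bsub>A\<^esub>d\<in>UNIV. A.component d a)"
  by (rule graded_hom_finsum[OF h A B, symmetric])
   (use A.component(1)[OF a] A.gcomp_closed in blast)
 then show ?thesis using A.component[OF a] graded_hom_simps(6)[OF h] by (intro B.component_unique[symmetric]) auto
qed

text \<open>The inverse respects degrees automatically: for homogeneous \<open>b\<close>, the
  component of the preimage in the degree of \<open>b\<close> has the image \<open>b\<close> as
  well, hence it is the whole preimage.\<close>

lemma graded_hom_inverse:
 assumes h: "h : graded_hom A B" and A: "graded_comm_algebra A" and B: "graded_comm_algebra B"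
  and bij: "bij_betw h (carrier A) (carrier B)" shows "inv_into (carrier A) h : graded_hom B A" proof -
 interpret A: graded_comm_algebra A by fact
 interpret B: graded_comm_algebra B by fact
 let ?g = "inv_into (carrier A) h"
 have g: "?g b : carrier A" "h (?g b) = b" if "b : carrier B" for b
  using that bij by (auto simp: bij_betw_def inv_into_into f_inv_into_f)
 have eq: "?g b = a" if "a : carrier A" "h a = b" for a b using that bij by (auto simp: bij_betw_def)
 have "?g b : gcomp A d" if b: "b : gcomp B d" for b d proof -
  have bc: "b : carrier B" using b B.gcomp_closed by blast
  have "h (A.component d (?g b)) = b" unfolding graded_hom_component[OF h A B g(1)[OF bc]] g(2)[OF bc]
   using B.component_gcomp[OF b] by simp
  moreover have "A.component d (?g b) : gcomp A d" using A.component(1) g(1)[OF bc] by blast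
  ultimately show ?thesis using eq A.gcomp_closed by metis
 qed
 then show ?thesis unfolding graded_hom_def ring_hom_def
  by (auto simp: g graded_hom_simps[OF h] A.smult_closed' intro!: eq)
qed

subsection \<open>The algebra of power series\<close>

lemma ps_simps:
 "carrier (PSA p ds V) = (MI ds \<rightarrow>\<^sub>E smooth_functions p V)"
 "F \<otimes>\<^bsub>PSA p ds V\<^esub> G =
  (\<lambda>rh\<in>MI ds. \<lambda>x\<in>V. conv ds (%mu. F mu x) (%mu. G mu x) rh)"
 "\<one>\<^bsub>PSA p ds V\<^esub> = (\<lambda>mu\<in>MI ds. \<lambda>x\<in>V. if mu = (%_. 0) then 1 else 0)"
 "\<zero>\<^bsub>PSA p ds V\<^esub> = (\<lambda>mu\<in>MI ds. \<lambda>x\<in>V. 0)"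
 "F \<oplus>\<^bsub>PSA p ds V\<^esub> G = (\<lambda>mu\<in>MI ds. \<lambda>x\<in>V. F mu x + G mu x)"
 "r \<odot>\<^bsub>PSA p ds V\<^esub> F = (\<lambda>mu\<in>MI ds. \<lambda>x\<in>V. r * F mu x)"
 by (simp_all add: power_series_algebra_def Let_def conv_def)

lemma ps_eqI:
 assumes "F : carrier (PSA p ds V)" "G : carrier (PSA p ds V)" and "!!mu x. mu : MI ds ==> x : V ==> F mu x = G mu x"
 shows "F = G" proof
 fix mu
 show "F mu = G mu" proof (cases "mu : MI ds")
  case True
  then have "F mu : smooth_functions p V" "G mu : smooth_functions p V"
   using PiE_mem[OF assms(1)[unfolded ps_simps(1)]]
   PiE_mem[OF assms(2)[unfolded ps_simps(1)]] by blast+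
  then have "F mu : extensional V" "G mu : extensional V" unfolding smooth_functions_def by blast+
  then show ?thesis using assms(3)[OF True] by (rule extensionalityI)
 next
  case False
  then show ?thesis using PiE_arb[OF assms(1)[unfolded ps_simps(1)]]
   PiE_arb[OF assms(2)[unfolded ps_simps(1)]] by simp
 qed
qed

lemma gcomp_ps:
 "F : gcomp (PSA p ds V) d \<longleftrightarrow> F : carrier (PSA p ds V) \<and>
  (ALL mu:MI ds. mdeg ds mu ~= d --> (ALL x:V. F mu x = 0))" by (auto simp: power_series_algebra_def Let_def)

context
 fixes p :: nat and ds :: "(bit ^ 'n::finite) list" and V :: "(nat => real) set"
 assumes V: "openin (Euclidean_space p) V"
begin

abbreviation "PS \<equiv> PSA p ds V"

lemma ps_memI:
 assumes "!!mu. mu : MI ds ==> smooth p V (%x. f mu x)"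
 shows "(\<lambda>mu\<in>MI ds. \<lambda>x\<in>V. f mu x) : carrier PS" proof -
 have "(\<lambda>x\<in>V. f mu x) : smooth_functions p V" if "mu : MI ds" for mu unfolding smooth_functions_iff[OF V]
  using smooth_cong[OF V assms[OF that]] by auto
 then show ?thesis by (auto simp: ps_simps)
qed

lemma ps_smooth:
 "F : carrier PS ==> mu : MI ds ==> smooth p V (F mu)" using smooth_functions_iff[OF V] by (auto simp: ps_simps)

lemma smooth_conv:
 assumes "F : carrier PS" "G : carrier PS" "rh : MI ds"
 shows "smooth p V (%x. conv ds (%mu. F mu x) (%mu. G mu x) rh)" unfolding conv_splits case_prod_beta
proof (rule smooth_sum[OF V])
 fix z assume "z : splits rh"
 then have "fst z : MI ds" "snd z : MI ds" using splits_multi_indices[OF assms(3), of "fst z" "snd z"] by auto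
 then show "smooth p V (%x. msign ds (fst z) (snd z) * F (fst z) x * G (snd z) x)"
  by (rule smooth_mult[OF V smooth_mult[OF V smooth_const[OF V] ps_smooth[OF assms(1)]]
   ps_smooth[OF assms(2)]])
qed

lemma ps_closed:
 "F : carrier PS ==> G : carrier PS ==> F \<otimes>\<^bsub>PS\<^esub> G : carrier PS"
 "F : carrier PS ==> G : carrier PS ==> F \<oplus>\<^bsub>PS\<^esub> G : carrier PS"
 "F : carrier PS ==> r \<odot>\<^bsub>PS\<^esub> F : carrier PS"
 "\<one>\<^bsub>PS\<^esub> : carrier PS"
 "\<zero>\<^bsub>PS\<^esub> : carrier PS" unfolding ps_simps(2-6) proof -
 show "(\<lambda>rh\<in>MI ds. \<lambda>x\<in>V. conv ds (%mu. F mu x) (%mu. G mu x) rh) : carrier PS"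
  "(\<lambda>mu\<in>MI ds. \<lambda>x\<in>V. F mu x + G mu x) : carrier PS" if "F : carrier PS" "G : carrier PS"
  using smooth_conv[OF that] smooth_add[OF V ps_smooth[OF that(1)] ps_smooth[OF that(2)]] by (simp_all add: ps_memI)
 show "(\<lambda>mu\<in>MI ds. \<lambda>x\<in>V. r * F mu x) : carrier PS" if "F : carrier PS"
  using smooth_mult[OF V smooth_const[OF V] ps_smooth[OF that]] by (simp add: ps_memI)
 show "(\<lambda>mu\<in>MI ds. \<lambda>x\<in>V. if mu = (%_. 0) then 1 else 0) : carrier PS"
  "(\<lambda>mu\<in>MI ds. \<lambda>x\<in>V. 0) : carrier PS" using smooth_const[OF V] by (simp_all add: ps_memI)
qed

lemma ps_apply:
 assumes "mu : MI ds" "x : V" shows "(F \<otimes>\<^bsub>PS\<^esub> G) mu x = conv ds (%mu. F mu x) (%mu. G mu x) mu"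
  "(F \<oplus>\<^bsub>PS\<^esub> G) mu x = F mu x + G mu x"
  "(r \<odot>\<^bsub>PS\<^esub> F) mu x = r * F mu x"
  "\<one>\<^bsub>PS\<^esub> mu x = (if mu = (%_. 0) then 1 else 0)"
  "\<zero>\<^bsub>PS\<^esub> mu x = 0" using assms by (simp_all add: ps_simps)

text \<open>Rewriting under \<open>conv\<close>. The operations have their intended values only at
  indices in \<open>MI ds\<close> and points of \<open>V\<close>, so they are unfolded there through
  \<open>conv_cong\<close>.\<close>

lemma conv_power_series:
 assumes "rh : MI ds" "x : V"
 shows "conv ds (%mu. (F \<otimes>\<^bsub>PS\<^esub> G) mu x) h rh = conv ds (conv ds (%mu. F mu x) (%mu. G mu x)) h rh"
  "conv ds h (%mu. (F \<otimes>\<^bsub>PS\<^esub> G) mu x) rh = conv ds h (conv ds (%mu. F mu x) (%mu. G mu x)) rh"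
  "conv ds (%mu. (F \<oplus>\<^bsub>PS\<^esub> G) mu x) h rh = conv ds (%mu. F mu x) h rh + conv ds (%mu. G mu x) h rh"
  "conv ds h (%mu. (F \<oplus>\<^bsub>PS\<^esub> G) mu x) rh = conv ds h (%mu. F mu x) rh + conv ds h (%mu. G mu x) rh"
  "conv ds (%mu. (r \<odot>\<^bsub>PS\<^esub> F) mu x) h rh = r * conv ds (%mu. F mu x) h rh"
  "conv ds h (%mu. (r \<odot>\<^bsub>PS\<^esub> F) mu x) rh = r * conv ds h (%mu. F mu x) rh"
  "conv ds (%mu. \<one>\<^bsub>PS\<^esub> mu x) h rh = h rh"
  "conv ds h (%mu. \<one>\<^bsub>PS\<^esub> mu x) rh = h rh" proof -
 note cong = conv_cong[OF assms(1)]
 show "conv ds (%mu. (F \<otimes>\<^bsub>PS\<^esub> G) mu x) h rh = conv ds (conv ds (%mu. F mu x) (%mu. G mu x)) h rh"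
  "conv ds h (%mu. (F \<otimes>\<^bsub>PS\<^esub> G) mu x) rh = conv ds h (conv ds (%mu. F mu x) (%mu. G mu x)) rh"
  by (rule cong; simp add: ps_apply assms(2))+
 have "conv ds (%mu. (F \<oplus>\<^bsub>PS\<^esub> G) mu x) h rh = conv ds (%mu. F mu x + G mu x) h rh"
  "conv ds h (%mu. (F \<oplus>\<^bsub>PS\<^esub> G) mu x) rh = conv ds h (%mu. F mu x + G mu x) rh"
  "conv ds (%mu. (r \<odot>\<^bsub>PS\<^esub> F) mu x) h rh = conv ds (%mu. r * F mu x) h rh"
  "conv ds h (%mu. (r \<odot>\<^bsub>PS\<^esub> F) mu x) rh = conv ds h (%mu. r * F mu x) rh"
  "conv ds (%mu. \<one>\<^bsub>PS\<^esub> mu x) h rh = conv ds (%mu. if mu = (%_. 0) then 1 else 0) h rh"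
  "conv ds h (%mu. \<one>\<^bsub>PS\<^esub> mu x) rh = conv ds h (%mu. if mu = (%_. 0) then 1 else 0) rh"
  by (rule cong; simp add: ps_apply assms(2))+
 then show "conv ds (%mu. (F \<oplus>\<^bsub>PS\<^esub> G) mu x) h rh = conv ds (%mu. F mu x) h rh + conv ds (%mu. G mu x) h rh"
  "conv ds h (%mu. (F \<oplus>\<^bsub>PS\<^esub> G) mu x) rh = conv ds h (%mu. F mu x) rh + conv ds h (%mu. G mu x) rh"
  "conv ds (%mu. (r \<odot>\<^bsub>PS\<^esub> F) mu x) h rh = r * conv ds (%mu. F mu x) h rh"
  "conv ds h (%mu. (r \<odot>\<^bsub>PS\<^esub> F) mu x) rh = r * conv ds h (%mu. F mu x) rh"
  "conv ds (%mu. \<one>\<^bsub>PS\<^esub> mu x) h rh = h rh"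
  "conv ds h (%mu. \<one>\<^bsub>PS\<^esub> mu x) rh = h rh"
  using conv_unit_left[OF assms(1), of 1 h] conv_unit_right[OF assms(1), of h 1]
  by (simp_all only: conv_add_left conv_add_right conv_scale_left conv_scale_right mult_1)
qed

lemma ring_power_series: "ring PS" proof (rule ringI)
 show "abelian_group PS" proof (rule abelian_groupI)
  fix F assume F: "F : carrier PS"
  show "EX G:carrier PS. G \<oplus>\<^bsub>PS\<^esub> F = \<zero>\<^bsub>PS\<^esub>" proof
   show "(- 1) \<odot>\<^bsub>PS\<^esub> F \<oplus>\<^bsub>PS\<^esub> F = \<zero>\<^bsub>PS\<^esub>"
   by (rule ps_eqI[of _ p ds V]) (use F in \<open>simp_all add: ps_closed ps_apply\<close>)
  qed (use F in \<open>simp add: ps_closed\<close>)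
 qed (auto intro!: ps_eqI[of _ p ds V] simp: ps_closed ps_apply)
 show "Group.monoid PS" by (rule monoidI)
   (auto intro!: ps_eqI[of _ p ds V] simp: ps_closed ps_apply conv_power_series conv_assoc)
qed (auto intro!: ps_eqI[of _ p ds V] simp: ps_closed ps_apply conv_power_series)

lemma finsum_power_series_apply:
 assumes "!!i. i : X ==> f i : carrier PS" "mu : MI ds" "x : V"
 shows "(\<Oplus>\<^bsub>PS\<^esub>i\<in>X. f i) mu x = (\<Sum>i\<in>X. f i mu x)" proof -
 interpret ring PS by (rule ring_power_series)
 show ?thesis using assms(1) proof (induction X rule: infinite_finite_induct)
  case (insert y X)
  then have "f : X \<rightarrow> carrier PS" "f y : carrier PS" by auto
  with insert show ?case by (simp add: ps_apply assms(2,3))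
 qed (simp_all add: ps_apply assms(2,3))
qed

lemma conv_homogeneous:
 assumes "F : gcomp PS i" "G : gcomp PS j" "rh : MI ds" "x : V" and "mdeg ds rh ~= i + j"
 shows "conv ds (%mu. F mu x) (%mu. G mu x) rh = 0" unfolding conv_splits case_prod_beta
proof (rule sum.neutral, rule ballI)
 fix z assume z: "z : splits rh"
 then have I: "fst z : MI ds" "snd z : MI ds" using splits_multi_indices[OF assms(3), of "fst z" "snd z"] by auto
 have "mdeg ds (fst z) + mdeg ds (snd z) = mdeg ds rh"
  using z by (auto simp: splits_def monomial_degree_add[symmetric])
 then have "mdeg ds (fst z) ~= i | mdeg ds (snd z) ~= j" using assms(5) by auto
 then show "msign ds (fst z) (snd z) * F (fst z) x * G (snd z) x = 0" using assms I by (auto simp: gcomp_ps)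
qed

lemma graded_comm_algebra_power_series: "graded_comm_algebra PS"
proof (rule graded_comm_algebraI[OF ring_power_series])
 interpret ring PS by (rule ring_power_series)
 note simps = ps_closed ps_apply conv_power_series gcomp_ps
 show "r \<odot>\<^bsub>PS\<^esub> a : carrier PS" if "a : carrier PS" for r a using that by (simp add: simps)
 show "(r + s) \<odot>\<^bsub>PS\<^esub> a = r \<odot>\<^bsub>PS\<^esub> a \<oplus>\<^bsub>PS\<^esub> s \<odot>\<^bsub>PS\<^esub> a"
  "(r * s) \<odot>\<^bsub>PS\<^esub> a = r \<odot>\<^bsub>PS\<^esub> (s \<odot>\<^bsub>PS\<^esub> a)"
  "1 \<odot>\<^bsub>PS\<^esub> a = a" if "a : carrier PS" for r s a
  using that by (auto intro!: ps_eqI[of _ p ds V] simp: simps algebra_simps)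
 show "r \<odot>\<^bsub>PS\<^esub> (a \<oplus>\<^bsub>PS\<^esub> b) = r \<odot>\<^bsub>PS\<^esub> a \<oplus>\<^bsub>PS\<^esub> r \<odot>\<^bsub>PS\<^esub> b"
  "(r \<odot>\<^bsub>PS\<^esub> a) \<otimes>\<^bsub>PS\<^esub> b = r \<odot>\<^bsub>PS\<^esub> (a \<otimes>\<^bsub>PS\<^esub> b)"
  "a \<otimes>\<^bsub>PS\<^esub> (r \<odot>\<^bsub>PS\<^esub> b) = r \<odot>\<^bsub>PS\<^esub> (a \<otimes>\<^bsub>PS\<^esub> b)"
  if "a : carrier PS" "b : carrier PS" for r a b
  using that by (auto intro!: ps_eqI[of _ p ds V] simp: simps algebra_simps)
 show "gcomp PS d <= carrier PS" for d by (auto simp: simps)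
 show "\<zero>\<^bsub>PS\<^esub> : gcomp PS d" for d by (auto simp: simps)
 show "a \<oplus>\<^bsub>PS\<^esub> b : gcomp PS d" if "a : gcomp PS d" "b : gcomp PS d" for a b d
  using that by (auto simp: simps)
 show "r \<odot>\<^bsub>PS\<^esub> a : gcomp PS d" if "a : gcomp PS d" for r a d using that by (auto simp: simps)
 show "\<one>\<^bsub>PS\<^esub> : gcomp PS 0" by (auto simp: simps)
 show "a \<otimes>\<^bsub>PS\<^esub> b : gcomp PS (i + j)" if "a : gcomp PS i" "b : gcomp PS j" for i j a b
  using that conv_homogeneous[OF that] by (auto simp: simps)
 show "a \<otimes>\<^bsub>PS\<^esub> b = koszul i j \<odot>\<^bsub>PS\<^esub> (b \<otimes>\<^bsub>PS\<^esub> a)" if "a : gcomp PS i" "b : gcomp PS j" for i j a b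
 proof (rule ps_eqI[of _ p ds V])
  fix mu x assume "mu : MI ds" "x : V"
  moreover have "conv ds (%mu. a mu x) (%mu. b mu x) mu = koszul i j * conv ds (%mu. b mu x) (%mu. a mu x) mu"
   by (rule conv_commute) (use that \<open>mu : _\<close> \<open>x : V\<close> in \<open>auto simp: gcomp_ps\<close>)
  ultimately show "(a \<otimes>\<^bsub>PS\<^esub> b) mu x = (koszul i j \<odot>\<^bsub>PS\<^esub> (b \<otimes>\<^bsub>PS\<^esub> a)) mu x"
   by (simp add: ps_apply)
 qed (use that in \<open>auto simp: simps\<close>)
 show "\<exists>!f. (ALL d. f d : gcomp PS d) & a = (\<Oplus>\<^bsub>PS\<^esub>d\<in>UNIV. f d)" if a: "a : carrier PS" for a
 proof (rule ex1I)
  define f where "f d = (\<lambda>mu\<in>MI ds. \<lambda>x\<in>V. (if mdeg ds mu = d then 1 else 0) * a mu x)" for d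
  have f: "f d : carrier PS" for d unfolding f_def
   by (rule ps_memI) (auto intro: smooth_mult[OF V] smooth_const[OF V] ps_smooth[OF a])
  have "a = (\<Oplus>\<^bsub>PS\<^esub>d\<in>UNIV. f d)" proof (rule ps_eqI[of _ p ds V, OF a])
   show "(\<Oplus>\<^bsub>PS\<^esub>d\<in>UNIV. f d) : carrier PS" using f by (intro finsum_closed) auto
   fix mu x assume *: "mu : MI ds" "x : V"
   show "a mu x = (\<Oplus>\<^bsub>PS\<^esub>d\<in>UNIV. f d) mu x"
   unfolding finsum_power_series_apply[of UNIV f, OF f *] by (simp add: f_def * if_distrib[of "%c. c * _"] cong: if_cong)
  qed
  moreover have "f d : gcomp PS d" for d using f by (auto simp: gcomp_ps f_def)
  ultimately show "(ALL d. f d : gcomp PS d) & a = (\<Oplus>\<^bsub>PS\<^esub>d\<in>UNIV. f d)" by simp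
  fix g assume g: "(ALL d. g d : gcomp PS d) & a = (\<Oplus>\<^bsub>PS\<^esub>d\<in>UNIV. g d)"
  then have gc: "g d : carrier PS" for d by (auto simp: gcomp_ps)
  show "g = f" proof
   fix d
   show "g d = f d" proof (rule ps_eqI[of _ p ds V, OF gc f])
   fix mu x assume *: "mu : MI ds" "x : V"
   \<comment> \<open>Only the summand whose degree is that of the monomial has a coefficient here,
     which makes the decomposition unique.\<close>
   have "a mu x = (\<Sum>d\<in>UNIV. g d mu x)" using g finsum_power_series_apply[OF gc *] by simp
   also have "... = (\<Sum>d\<in>UNIV. if d = mdeg ds mu then g (mdeg ds mu) mu x else 0)"
   using g * by (intro sum.cong) (auto simp: gcomp_ps)
   finally have "a mu x = g (mdeg ds mu) mu x" by simp
   then show "g d mu x = f d mu x" using g * by (auto simp: f_def gcomp_ps)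
   qed
  qed
 qed
qed

end

lemma ps_restrict_hom:
 assumes V: "openin (Euclidean_space p) V" and W: "openin (Euclidean_space p) W" "W <= V"
 shows "(%f. \<lambda>mu\<in>MI ds. restrict (f mu) W) \<in>
  graded_hom (PSA p ds V) (PSA p ds W)" proof -
 have mem: "(\<lambda>mu\<in>MI ds. restrict (f mu) W) : carrier (PSA p ds W)" if "f : carrier (PSA p ds V)" for f
  by (rule ps_memI[OF W(1)])
   (use smooth_subset[OF W(2) ps_smooth[OF V that]] in simp)
 show ?thesis unfolding graded_hom_def ring_hom_def using W(2)
  by (auto simp: mem gcomp_ps ps_closed[OF V] subset_iff ps_apply[OF V]
   ps_apply[OF W(1)] ps_closed[OF W(1)] intro!: ps_eqI[of _ p ds W] conv_cong)
qed

subsection \<open>Partial derivatives of power series\<close>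

abbreviation unit_index :: "nat => nat => nat" where
 "unit_index a \<equiv> (%b. if b = a then 1 else 0)"

abbreviation incr :: "nat => (nat => nat) => nat => nat" where
 "incr a mu \<equiv> (%b. mu b + unit_index a b)"

lemma monomial_degree_unit_index:
 assumes "a < length ds" shows "mdeg ds (unit_index a) = ds ! a" proof -
 have "mdeg ds (unit_index a) = (\<Sum>b<length ds. if b = a then ds ! b else 0)"
  unfolding monomial_degree_def by (intro sum.cong) auto
 then show ?thesis using assms by simp
qed

lemma monomial_sign_square [simp]: "msign ds mu nu * msign ds mu nu = 1"
 unfolding monomial_sign_def prod.distrib[symmetric] power_mult_distrib[symmetric] by simp

lemma monomial_sign_square' [simp]: "msign ds mu nu * (msign ds mu nu * c) = c"
 using monomial_sign_square[of ds mu nu] by (metis mult.assoc mult_1)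

text \<open>
 Writing \<open>f = f\<^sub>0 + \<xi>\<^sup>a f\<^sub>1\<close> with \<open>f\<^sub>0\<close>, \<open>f\<^sub>1\<close> free of the odd variable \<open>\<xi>\<^sup>a\<close>, the left derivative
 is \<open>f\<^sub>1\<close>.
\<close>

definition odd_deriv ::
 "(bit ^ 'n::finite) list => nat => ((nat => nat) => real) => (nat => nat) => real" where
 "odd_deriv ds a f mu = (if mu a = 0 then msign ds (unit_index a) mu * f (incr a mu) else 0)"

context
 fixes ds :: "(bit ^ 'n::finite) list" and a :: nat
 assumes a: "a < length ds" and odd: "koszul (ds ! a) (ds ! a) = - 1"
begin

lemma mi_le_one: "mu : MI ds ==> mu a \<le> 1" using a odd by (auto simp: multi_indices_def)

lemma incr_multi_index: "mu : MI ds ==> mu a = 0 ==> incr a mu : MI ds" using a odd by (auto simp: multi_indices_def)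

lemma monomial_sign_unit_index:
 assumes "incr a mu : MI ds"
 shows "msign ds mu (unit_index a) = koszul (ds ! a) (mdeg ds mu) * msign ds (unit_index a) mu"
 using monomial_sign_commute[OF assms] a by (simp add: monomial_degree_unit_index koszul_commute)

text \<open>The sign is the price of moving the derivative past \<open>f\<close>. If
  \<open>xi^a\<close> does not occur in \<open>rh\<close>, the coefficient of the product at
  \<open>incr a rh\<close> splits according to the factor that contains \<open>xi^a\<close>. If it
  occurs, the derivative has no such term, and the two summands on the right cancel because
  \<open>xi^a\<close> is odd.\<close>

lemma odd_deriv_conv:
 assumes rh: "rh : MI ds" and f: "!!mu. mu : MI ds ==> mdeg ds mu ~= d ==> f mu = 0"
 shows "odd_deriv ds a (conv ds f g) rh =
  conv ds (odd_deriv ds a f) g rh + koszul (ds ! a) d * conv ds f (odd_deriv ds a g) rh" proof -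
 let ?s = "msign ds" and ?e = "unit_index a" and ?k = "koszul (ds ! a) d"
 have fk: "koszul (ds ! a) (mdeg ds mu) * f mu = ?k * f mu" if "mu : MI ds" for mu
  using f[OF that] by (cases "mdeg ds mu = d") auto
 show ?thesis proof (cases "rh a = 0")
  case True
  then have I: "incr a rh : MI ds" using rh incr_multi_index by blast
  have 0: "mu a = 0" "nu a = 0" if "(mu, nu) : splits rh" for mu nu
   using that True by (auto simp: splits_def fun_eq_iff dest: spec[of _ a])
  \<comment> \<open>The additional \<open>xi^a\<close> belongs to exactly one of the two factors of
    a splitting.\<close>
  have "splits (incr a rh) = (%(mu, nu). (incr a mu, nu)) ` splits rh \<union> (%(mu, nu). (mu, incr a nu)) ` splits rh"
   (is "?L = ?X \<union> ?Y") proof (intro equalityI subsetI)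
   fix z assume "z : ?L"
   then obtain mu nu where z: "z = (mu, nu)" "!!b. mu b + nu b = incr a rh b" by (auto simp: splits_def fun_eq_iff)
   from z(2)[of a] True consider "mu a = 1" "nu a = 0" | "mu a = 0" "nu a = 1" by fastforce
   then show "z : ?X \<union> ?Y" proof cases
   case 1
   have "z = (%(mu, nu). (incr a mu, nu)) (mu(a := 0), nu)" using 1 by (auto simp: z(1) fun_eq_iff)
   moreover have "(mu(a := 0), nu) : splits rh" using z(2) 1 True by (auto simp: splits_def fun_eq_iff)
   ultimately show ?thesis by blast
   next
   case 2
   have "z = (%(mu, nu). (mu, incr a nu)) (mu, nu(a := 0))" using 2 by (auto simp: z(1) fun_eq_iff)
   moreover have "(mu, nu(a := 0)) : splits rh" using z(2) 2 True by (auto simp: splits_def fun_eq_iff)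
   ultimately show ?thesis by blast
   qed
  qed (auto simp: splits_def fun_eq_iff)
  moreover have "?X Int ?Y = {}" using 0 by (fastforce simp: fun_eq_iff)
  ultimately have "conv ds f g (incr a rh) =
   (\<Sum>(mu, nu)\<in>?X. ?s mu nu * f mu * g nu) + (\<Sum>(mu, nu)\<in>?Y. ?s mu nu * f mu * g nu)"
   unfolding conv_splits using finite_splits[OF rh] by (simp add: sum.union_disjoint)
  also have "(\<Sum>(mu, nu)\<in>?X. ?s mu nu * f mu * g nu) = (\<Sum>(mu, nu)\<in>splits rh. ?s (incr a mu) nu * f (incr a mu) * g nu)"
   by (subst sum.reindex) (auto simp: inj_on_def fun_eq_iff case_prod_beta intro!: sum.cong)
  also have "(\<Sum>(mu, nu)\<in>?Y. ?s mu nu * f mu * g nu) = (\<Sum>(mu, nu)\<in>splits rh. ?s mu (incr a nu) * f mu * g (incr a nu))"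
   by (subst sum.reindex) (auto simp: inj_on_def fun_eq_iff case_prod_beta intro!: sum.cong)
  finally have "odd_deriv ds a (conv ds f g) rh =
   (\<Sum>(mu, nu)\<in>splits rh. ?s ?e rh * (?s (incr a mu) nu * f (incr a mu) * g nu)) +
   (\<Sum>(mu, nu)\<in>splits rh. ?s ?e rh * (?s mu (incr a nu) * f mu * g (incr a nu)))"
   using True by (simp add: odd_deriv_def distrib_left sum_distrib_left case_prod_beta)
  also have "(\<Sum>(mu, nu)\<in>splits rh. ?s ?e rh * (?s (incr a mu) nu * f (incr a mu) * g nu)) =
   conv ds (odd_deriv ds a f) g rh" unfolding conv_splits proof (rule sum.cong[OF HOL.refl], clarify)
   fix mu nu assume s: "(mu, nu) : splits rh"
   then have rheq: "rh = (%b. mu b + nu b)" by (auto simp: splits_def)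
   show "?s ?e rh * (?s (incr a mu) nu * f (incr a mu) * g nu) = ?s mu nu * odd_deriv ds a f mu * g nu"
   using 0[OF s] unfolding rheq by (simp add: odd_deriv_def monomial_sign_add_left monomial_sign_add_right)
  qed
  also have "(\<Sum>(mu, nu)\<in>splits rh. ?s ?e rh * (?s mu (incr a nu) * f mu * g (incr a nu))) =
   ?k * conv ds f (odd_deriv ds a g) rh" unfolding conv_splits sum_distrib_left
  proof (rule sum.cong[OF HOL.refl], clarify)
   fix mu nu assume s: "(mu, nu) : splits rh"
   then have rheq: "rh = (%b. mu b + nu b)" and mu: "mu : MI ds"
   using splits_multi_indices[OF rh] by (auto simp: splits_def)
   have "?s mu ?e = koszul (ds ! a) (mdeg ds mu) * ?s ?e mu"
   using 0[OF s] mu by (intro monomial_sign_unit_index incr_multi_index)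
   then have "?s ?e rh * (?s mu (incr a nu) * f mu * g (incr a nu)) =
   (koszul (ds ! a) (mdeg ds mu) * f mu) * (?s mu nu * (?s ?e nu * g (incr a nu)))"
   unfolding rheq by (simp add: monomial_sign_add_left monomial_sign_add_right)
   then show "?s ?e rh * (?s mu (incr a nu) * f mu * g (incr a nu)) =
   ?k * (?s mu nu * f mu * odd_deriv ds a g nu)" unfolding fk[OF mu] using 0[OF s] by (simp add: odd_deriv_def)
  qed
  finally show ?thesis .
 next
  case False
  then have 1: "rh a = 1" using mi_le_one[OF rh] by simp
  \<comment> \<open>Here the left side is zero, and the two terms on the right have to cancel. Both
    are sums over \<open>T\<close>, the splittings of \<open>rh\<close> with \<open>xi^a\<close>
    removed.\<close>
  define T where "T = {(mu, nu). (%b. mu b + nu b + ?e b) = rh}"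
  have T0: "mu a = 0" "nu a = 0" if "(mu, nu) : T" for mu nu
   using that 1 by (auto simp: T_def fun_eq_iff dest: spec[of _ a])
  have left: "conv ds (odd_deriv ds a f) g rh =
   (\<Sum>(mu, nu)\<in>T. ?s mu (incr a nu) * (?s ?e mu * f (incr a mu)) * g (incr a nu))" proof -
   have "conv ds (odd_deriv ds a f) g rh =
   (\<Sum>(mu, nu)\<in>(%(mu, nu). (mu, incr a nu)) ` T. ?s mu nu * odd_deriv ds a f mu * g nu)"
   unfolding conv_splits proof (rule sum.mono_neutral_right[OF finite_splits[OF rh]])
   show "(%(mu, nu). (mu, incr a nu)) ` T <= splits rh" by (auto simp: T_def splits_def add.assoc)
   show "ALL i:splits rh - (%(mu, nu). (mu, incr a nu)) ` T.
   (case i of (mu, nu) => ?s mu nu * odd_deriv ds a f mu * g nu) = 0" proof (rule ballI, clarify)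
   fix mu nu assume s: "(mu, nu) : splits rh" "(mu, nu) \<notin> (%(mu, nu). (mu, incr a nu)) ` T"
   have "mu a ~= 0" proof
   assume "mu a = 0"
   then have "nu a = 1" using s(1) 1 by (auto simp: splits_def)
   then have "(mu, nu) = (%(mu, nu). (mu, incr a nu)) (mu, nu(a := 0))" by (auto simp: fun_eq_iff)
   moreover have "(mu, nu(a := 0)) : T"
   using s(1) \<open>nu a = 1\<close> by (auto simp: splits_def T_def fun_eq_iff) (metis One_nat_def Suc_eq_plus1 add.commute)
   ultimately show False using s(2) by blast
   qed
   then show "?s mu nu * odd_deriv ds a f mu * g nu = 0" by (simp add: odd_deriv_def)
   qed
   qed
   also have "... = (\<Sum>(mu, nu)\<in>T. ?s mu (incr a nu) * odd_deriv ds a f mu * g (incr a nu))"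
   by (subst sum.reindex) (auto simp: inj_on_def fun_eq_iff case_prod_beta intro!: sum.cong)
   also have "... = (\<Sum>(mu, nu)\<in>T. ?s mu (incr a nu) * (?s ?e mu * f (incr a mu)) * g (incr a nu))"
   by (rule sum.cong[OF HOL.refl], clarify) (simp add: odd_deriv_def T0)
   finally show ?thesis .
  qed
  have right: "conv ds f (odd_deriv ds a g) rh =
   (\<Sum>(mu, nu)\<in>T. ?s (incr a mu) nu * f (incr a mu) * (?s ?e nu * g (incr a nu)))" proof -
   have "conv ds f (odd_deriv ds a g) rh =
   (\<Sum>(mu, nu)\<in>(%(mu, nu). (incr a mu, nu)) ` T. ?s mu nu * f mu * odd_deriv ds a g nu)"
   unfolding conv_splits proof (rule sum.mono_neutral_right[OF finite_splits[OF rh]])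
   show "(%(mu, nu). (incr a mu, nu)) ` T <= splits rh"
   by (auto simp: T_def splits_def add.assoc add.commute add.left_commute)
   show "ALL i:splits rh - (%(mu, nu). (incr a mu, nu)) ` T.
   (case i of (mu, nu) => ?s mu nu * f mu * odd_deriv ds a g nu) = 0" proof (rule ballI, clarify)
   fix mu nu assume s: "(mu, nu) : splits rh" "(mu, nu) \<notin> (%(mu, nu). (incr a mu, nu)) ` T"
   have "nu a ~= 0" proof
   assume "nu a = 0"
   then have "mu a = 1" using s(1) 1 by (auto simp: splits_def)
   then have "(mu, nu) = (%(mu, nu). (incr a mu, nu)) (mu(a := 0), nu)" by (auto simp: fun_eq_iff)
   moreover have "(mu(a := 0), nu) : T"
   using s(1) \<open>mu a = 1\<close> by (auto simp: splits_def T_def fun_eq_iff) (metis One_nat_def Suc_eq_plus1 add.commute)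
   ultimately show False using s(2) by blast
   qed
   then show "?s mu nu * f mu * odd_deriv ds a g nu = 0" by (simp add: odd_deriv_def)
   qed
   qed
   also have "... = (\<Sum>(mu, nu)\<in>T. ?s (incr a mu) nu * f (incr a mu) * odd_deriv ds a g nu)"
   by (subst sum.reindex) (auto simp: inj_on_def fun_eq_iff case_prod_beta intro!: sum.cong)
   also have "... = (\<Sum>(mu, nu)\<in>T. ?s (incr a mu) nu * f (incr a mu) * (?s ?e nu * g (incr a nu)))"
   by (rule sum.cong[OF HOL.refl], clarify) (simp add: odd_deriv_def T0)
   finally show ?thesis .
  qed
  have "(\<Sum>(mu, nu)\<in>T. ?s mu (incr a nu) * (?s ?e mu * f (incr a mu)) * g (incr a nu)) =
   (\<Sum>(mu, nu)\<in>T. - ?k * (?s (incr a mu) nu * f (incr a mu) * (?s ?e nu * g (incr a nu))))"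
  proof (rule sum.cong[OF HOL.refl], clarify)
   fix mu nu assume T: "(mu, nu) : T"
   then have "(incr a mu, nu) : splits rh" by (auto simp: T_def splits_def add.assoc add.commute add.left_commute)
   then have I: "incr a mu : MI ds" using splits_multi_indices[OF rh] by blast
   have "?s mu ?e * ?s ?e mu * f (incr a mu) = koszul (ds ! a) (mdeg ds mu) * f (incr a mu)"
   unfolding monomial_sign_unit_index[OF I] by simp
   \<comment> \<open>The minus sign arises because \<open>incr a mu\<close> contains one more odd
     \<open>xi^a\<close> than \<open>mu\<close>.\<close>
   also have "... = - (koszul (ds ! a) (mdeg ds (incr a mu)) * f (incr a mu))"
   unfolding monomial_degree_add koszul_add_right monomial_degree_unit_index[OF a] odd by simp
   also have "... = - ?k * f (incr a mu)" unfolding fk[OF I] by simp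
   finally have *: "?s mu ?e * ?s ?e mu * f (incr a mu) = - ?k * f (incr a mu)" .
   have "?s mu (incr a nu) * (?s ?e mu * f (incr a mu)) * g (incr a nu) =
   ?s mu nu * (?s mu ?e * ?s ?e mu * f (incr a mu)) * g (incr a nu)" by (simp add: monomial_sign_add_right)
   also have "... = - ?k * (?s (incr a mu) nu * f (incr a mu) * (?s ?e nu * g (incr a nu)))"
   unfolding * by (simp add: monomial_sign_add_left)
   finally show "?s mu (incr a nu) * (?s ?e mu * f (incr a mu)) * g (incr a nu) =
   - ?k * (?s (incr a mu) nu * f (incr a mu) * (?s ?e nu * g (incr a nu)))" .
  qed
  then show ?thesis unfolding left right using False
   by (simp add: odd_deriv_def sum_distrib_left case_prod_beta sum_negf)
 qed
qed

end

section \<open>Partial derivatives of coefficients of sums and products\<close>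

lemma has_partial_add:
 "has_partial V i f f' ==> has_partial V i g g' ==> has_partial V i (%x. f x + g x) (%x. f' x + g' x)"
 by (auto simp: has_partial_def intro: DERIV_add)

lemma has_partial_mult:
 "has_partial V i f f' ==> has_partial V i g g' ==>
  has_partial V i (%x. f x * g x) (%x. f' x * g x + f x * g' x)"
 unfolding has_partial_def using DERIV_mult' by (fastforce simp: add.commute)

lemma has_partial_cmult: "has_partial V i f f' ==> has_partial V i (%x. c * f x) (%x. c * f' x)"
 by (auto simp: has_partial_def intro: DERIV_cmult)

lemma has_partial_sum:
 "(!!k. k : X ==> has_partial V i (f k) (f' k)) ==> has_partial V i (%x. \<Sum>k\<in>X. f k x) (%x. \<Sum>k\<in>X. f' k x)"
 by (auto simp: has_partial_def intro!: DERIV_sum)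

lemma has_partial_conv:
 assumes "rh : MI ds" and "!!mu. mu : MI ds ==> has_partial V i (F mu) (F' mu)"
  and "!!mu. mu : MI ds ==> has_partial V i (G mu) (G' mu)"
 shows "has_partial V i (%x. conv ds (%mu. F mu x) (%mu. G mu x) rh)
  (%x. conv ds (%mu. F' mu x) (%mu. G mu x) rh + conv ds (%mu. F mu x) (%mu. G' mu x) rh)"
 unfolding conv_splits case_prod_beta sum.distrib[symmetric] proof (rule has_partial_sum)
 fix z assume z: "z : splits rh"
 then have I: "fst z : MI ds" "snd z : MI ds" using splits_multi_indices[OF assms(1), of "fst z" "snd z"] by auto
 show "has_partial V i (%x. msign ds (fst z) (snd z) * F (fst z) x * G (snd z) x)
   (%x. msign ds (fst z) (snd z) * F' (fst z) x * G (snd z) x +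
   msign ds (fst z) (snd z) * F (fst z) x * G' (snd z) x)"
  by (rule has_partial_mult[OF has_partial_cmult[OF assms(2)[OF I(1)]] assms(3)[OF I(2)]])
qed

text \<open>A given monomial can be split off \<open>rh\<close> on the right in at most one
  way.\<close>

lemma conv_delta_right:
 assumes "rh : MI ds" shows "conv ds f (%mu. if mu = bt then c else 0) rh =
  (if bt \<le> rh then msign ds (%a. rh a - bt a) bt * f (%a. rh a - bt a) * c else 0)" proof -
 have "conv ds f (%mu. if mu = bt then c else 0) rh =
   (\<Sum>mu | mu \<le> rh. if mu = (%a. rh a - bt a) & bt \<le> rh then msign ds mu bt * f mu * c else 0)"
  unfolding conv_def proof (rule sum.cong[OF HOL.refl])
  fix mu assume "mu : {mu. mu \<le> rh}"
  then have "(%a. rh a - mu a) = bt \<longleftrightarrow> mu = (%a. rh a - bt a) & bt \<le> rh"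
   by (auto simp: le_fun_def fun_eq_iff) (metis diff_diff_cancel, metis diff_le_self)
  then show "msign ds mu (%a. rh a - mu a) * f mu * (if (%a. rh a - mu a) = bt then c else 0) =
   (if mu = (%a. rh a - bt a) & bt \<le> rh then msign ds mu bt * f mu * c else 0)" by auto
 qed
 also have "... = (if bt \<le> rh then msign ds (%a. rh a - bt a) bt * f (%a. rh a - bt a) * c else 0)"
 proof (cases "bt \<le> rh")
  case True
  moreover have "(%a. rh a - bt a) \<le> rh" by (simp add: le_fun_def)
  ultimately show ?thesis using finite_le_multi_index[OF assms] by simp
 qed simp
 finally show ?thesis .
qed

lemma add_self_bit_vec [simp]: "(d :: bit ^ 'n) + d = 0" proof -
 have "b + b = 0" for b :: bit by (cases "b = 0") auto
 then show ?thesis by (simp only: vec_eq_iff vector_add_component zero_index simp_thms)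
qed

text \<open>The coordinates have a common numbering: \<open>x^j\<close> for \<open>j < p\<close>,
  followed by the formal variables, where \<open>xi^a\<close> has the number
  \<open>p + a\<close>.\<close>

definition coord_degree :: "nat => (bit ^ 'n::finite) list => nat => bit ^ 'n" where
 "coord_degree p ds j = (if j < p then 0 else ds ! (j - p))"

definition series_coord :: "nat => (bit ^ 'n::finite) list => (nat => real) set => nat => series" where
 "series_coord p ds V j = (\<lambda>mu\<in>MI ds. \<lambda>x\<in>V.
  if j < p then if mu = (%_. 0) then x j else 0 else if mu = unit_index (j - p) then 1 else 0)"

definition series_deriv ::
 "nat => (bit ^ 'n::finite) list => (nat => real) set => nat => series => series" where
 "series_deriv p ds V j F = (\<lambda>mu\<in>MI ds. \<lambda>x\<in>V.
  if j < p then partial_deriv j (F mu) x else odd_deriv ds (j - p) (%nu. F nu x) mu)"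

context
 fixes p :: nat and ds :: "(bit ^ 'n::finite) list" and V :: "(nat => real) set"
 assumes V: "openin (Euclidean_space p) V" and odd: "!!a. a < length ds ==> koszul (ds ! a) (ds ! a) = - 1"
begin

abbreviation "PV \<equiv> PSA p ds V"

lemma has_partial_series:
 assumes "F : carrier PV" "mu : MI ds" "j < p" shows "has_partial V j (F mu) (partial_deriv j (F mu))"
 using smooth_partial_deriv(2)[OF V ps_smooth[OF V assms(1,2)] assms(3)] .

lemma series_deriv_closed:
 assumes F: "F : carrier PV" and j: "j < p + length ds" shows "series_deriv p ds V j F : carrier PV"
 unfolding series_deriv_def proof (rule ps_memI[OF V])
 fix mu assume mu: "mu : MI ds"
 show "smooth p V (%x. if j < p then partial_deriv j (F mu) x else odd_deriv ds (j - p) (%nu. F nu x) mu)"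
 proof (cases "j < p")
  case True
  then show ?thesis using smooth_partial_deriv(1)[OF V ps_smooth[OF V F mu] True] by simp
 next
  case False
  then have a: "j - p < length ds" using j by simp
  show ?thesis proof (cases "mu (j - p) = 0")
   case True
   from smooth_mult[OF V smooth_const[OF V] ps_smooth[OF V F incr_multi_index[OF a odd[OF a] mu True]]]
   show ?thesis using False True by (simp add: odd_deriv_def)
  next
   case neq: False
   then show ?thesis using False smooth_const[OF V] by (simp add: odd_deriv_def)
  qed
 qed
qed

lemma series_deriv_apply:
 assumes "mu : MI ds" "x : V" shows "series_deriv p ds V j F mu x =
  (if j < p then partial_deriv j (F mu) x else odd_deriv ds (j - p) (%nu. F nu x) mu)"
 using assms by (simp add: series_deriv_def)

lemma odd_deriv_cong:
 assumes "a < length ds" "mu : MI ds" "!!mu. mu : MI ds ==> f mu = g mu"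
 shows "odd_deriv ds a f mu = odd_deriv ds a g mu"
 using assms(3) incr_multi_index[OF assms(1) odd[OF assms(1)] assms(2)] by (simp add: odd_deriv_def)

lemma series_deriv_add:
 assumes F: "F : carrier PV" "G : carrier PV" and j: "j < p + length ds"
 shows "series_deriv p ds V j (F \<oplus>\<^bsub>PV\<^esub> G) = series_deriv p ds V j F \<oplus>\<^bsub>PV\<^esub> series_deriv p ds V j G"
proof (rule ps_eqI[of _ p ds V])
 fix mu x assume *: "mu : MI ds" "x : V"
 show "series_deriv p ds V j (F \<oplus>\<^bsub>PV\<^esub> G) mu x = (series_deriv p ds V j F \<oplus>\<^bsub>PV\<^esub> series_deriv p ds V j G) mu x"
 proof (cases "j < p")
  case True
  have "has_partial V j ((F \<oplus>\<^bsub>PV\<^esub> G) mu) (%x. partial_deriv j (F mu) x + partial_deriv j (G mu) x)"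
   by (rule has_partial_cong[OF V True has_partial_add[OF has_partial_series[OF F(1) *(1) True]
   has_partial_series[OF F(2) *(1) True]]]) (simp_all add: ps_apply[OF V *(1)])
  from partial_deriv_eqI[OF this *(2)] show ?thesis
   using True by (simp add: ps_apply[OF V *] series_deriv_apply[OF *])
 next
  case False
  then have a: "j - p < length ds" using j by simp
  have "odd_deriv ds (j - p) (%nu. (F \<oplus>\<^bsub>PV\<^esub> G) nu x) mu = odd_deriv ds (j - p) (%nu. F nu x + G nu x) mu"
   by (rule odd_deriv_cong[OF a *(1)]) (simp add: ps_apply[OF V _ *(2)])
  then show ?thesis using False by (simp add: ps_apply[OF V *] series_deriv_apply[OF *])
   (simp add: odd_deriv_def algebra_simps)
 qed
qed (use assms in \<open>simp_all add: series_deriv_closed ps_closed[OF V]\<close>)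

lemma series_deriv_smult:
 assumes F: "F : carrier PV" and j: "j < p + length ds"
 shows "series_deriv p ds V j (r \<odot>\<^bsub>PV\<^esub> F) = r \<odot>\<^bsub>PV\<^esub> series_deriv p ds V j F"
proof (rule ps_eqI[of _ p ds V])
 fix mu x assume *: "mu : MI ds" "x : V"
 show "series_deriv p ds V j (r \<odot>\<^bsub>PV\<^esub> F) mu x = (r \<odot>\<^bsub>PV\<^esub> series_deriv p ds V j F) mu x"
 proof (cases "j < p")
  case True
  have "has_partial V j ((r \<odot>\<^bsub>PV\<^esub> F) mu) (%x. r * partial_deriv j (F mu) x)"
   by (rule has_partial_cong[OF V True has_partial_cmult[where c=r, OF has_partial_series[OF F(1) *(1) True]]])
   (simp_all add: ps_apply[OF V *(1)])
  from partial_deriv_eqI[OF this *(2)] show ?thesis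
   using True by (simp add: ps_apply[OF V *] series_deriv_apply[OF *])
 next
  case False
  then have a: "j - p < length ds" using j by simp
  have "odd_deriv ds (j - p) (%nu. (r \<odot>\<^bsub>PV\<^esub> F) nu x) mu = odd_deriv ds (j - p) (%nu. r * F nu x) mu"
   by (rule odd_deriv_cong[OF a *(1)]) (simp add: ps_apply[OF V _ *(2)])
  then show ?thesis using False by (simp add: ps_apply[OF V *] series_deriv_apply[OF *])
   (simp add: odd_deriv_def algebra_simps)
 qed
qed (use assms in \<open>simp_all add: series_deriv_closed ps_closed[OF V]\<close>)

text \<open>The odd derivative removes one factor \<open>xi^a\<close>, and in a group of exponent 2
  subtracting its degree is the same as adding it.\<close>

lemma series_deriv_gcomp:
 assumes F: "F : gcomp PV dl" and j: "j < p + length ds"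
 shows "series_deriv p ds V j F : gcomp PV (coord_degree p ds j + dl)" proof -
 have Fc: "F : carrier PV" using F by (simp add: gcomp_ps)
 have "series_deriv p ds V j F mu x = 0"
  if *: "mu : MI ds" "x : V" and deg: "mdeg ds mu ~= coord_degree p ds j + dl" for mu x proof (cases "j < p")
  case True
  have "ALL x:V. F mu x = 0" using F deg True *(1) by (simp add: coord_degree_def gcomp_ps)
  then have "has_partial V j (F mu) (%_. 0)"
   using has_partial_cong[OF V True, of "%_. 0" "%_. 0" "F mu" "%_. 0"] by (simp add: has_partial_def)
  from partial_deriv_eqI[OF this *(2)] show ?thesis using True by (simp add: series_deriv_apply[OF *])
 next
  case False
  then have a: "j - p < length ds" using j by simp
  show ?thesis proof (cases "mu (j - p) = 0")
   case True
   have "mdeg ds (incr (j - p) mu) = mdeg ds mu + ds ! (j - p)"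
   using monomial_degree_add[of ds mu "unit_index (j - p)"] by (simp add: monomial_degree_unit_index[OF a])
   moreover have "mdeg ds mu + ds ! (j - p) ~= dl" proof
   assume "mdeg ds mu + ds ! (j - p) = dl"
   then have "mdeg ds mu = ds ! (j - p) + dl" by (metis add.assoc add.commute add_0_left add_self_bit_vec)
   then show False using deg False by (simp add: coord_degree_def)
   qed
   ultimately have "F (incr (j - p) mu) x = 0"
   using F incr_multi_index[OF a odd[OF a] *(1) True] *(2) by (simp add: gcomp_ps)
   then show ?thesis using False by (simp add: series_deriv_apply[OF *] odd_deriv_def)
  next
   case neq: False
   then show ?thesis using False by (simp add: series_deriv_apply[OF *] odd_deriv_def)
  qed
 qed
 then show ?thesis using series_deriv_closed[OF Fc j] by (simp add: gcomp_ps)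
qed

text \<open>For \<open>j < p\<close> every coefficient obeys the Leibniz rule without signs; for an
  odd variable this is \<open>odd_deriv_conv\<close>.\<close>

lemma series_deriv_mult:
 assumes F: "F : gcomp PV dl" and G: "G : carrier PV" and j: "j < p + length ds"
 shows "series_deriv p ds V j (F \<otimes>\<^bsub>PV\<^esub> G) = (series_deriv p ds V j F \<otimes>\<^bsub>PV\<^esub> G) \<oplus>\<^bsub>PV\<^esub>
  (koszul (coord_degree p ds j) dl \<odot>\<^bsub>PV\<^esub> (F \<otimes>\<^bsub>PV\<^esub> series_deriv p ds V j G))" (is "?L = ?R")
proof -
 have Fc: "F : carrier PV" using F by (simp add: gcomp_ps)
 note closed = series_deriv_closed[OF _ j] ps_closed[OF V] Fc G
 show ?thesis proof (rule ps_eqI[of _ p ds V])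
  fix mu x assume *: "mu : MI ds" "x : V"
  have R: "?R mu x = conv ds (%nu. series_deriv p ds V j F nu x) (%nu. G nu x) mu +
   koszul (coord_degree p ds j) dl * conv ds (%nu. F nu x) (%nu. series_deriv p ds V j G nu x) mu"
   by (simp add: ps_apply[OF V *])
  show "?L mu x = ?R mu x" proof (cases "j < p")
   case True
   have "has_partial V j ((F \<otimes>\<^bsub>PV\<^esub> G) mu)
   (%x. conv ds (%nu. partial_deriv j (F nu) x) (%nu. G nu x) mu +
   conv ds (%nu. F nu x) (%nu. partial_deriv j (G nu) x) mu)"
   by (rule has_partial_cong[OF V True has_partial_conv[OF *(1) has_partial_series[OF Fc _ True]
   has_partial_series[OF G _ True]]]) (simp_all add: ps_apply[OF V *(1)])
   from partial_deriv_eqI[OF this *(2)]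
   have "?L mu x = conv ds (%nu. partial_deriv j (F nu) x) (%nu. G nu x) mu +
   conv ds (%nu. F nu x) (%nu. partial_deriv j (G nu) x) mu"
   using True by (simp add: series_deriv_apply[OF *])
   also have "conv ds (%nu. partial_deriv j (F nu) x) (%nu. G nu x) mu =
   conv ds (%nu. series_deriv p ds V j F nu x) (%nu. G nu x) mu"
   by (rule conv_cong[OF *(1)]) (use True in \<open>simp_all add: series_deriv_apply[OF _ *(2)]\<close>)
   also have "conv ds (%nu. F nu x) (%nu. partial_deriv j (G nu) x) mu =
   conv ds (%nu. F nu x) (%nu. series_deriv p ds V j G nu x) mu"
   by (rule conv_cong[OF *(1)]) (use True in \<open>simp_all add: series_deriv_apply[OF _ *(2)]\<close>)
   finally show ?thesis unfolding R using True by (simp add: coord_degree_def)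
  next
   case False
   then have a: "j - p < length ds" using j by simp
   have "?L mu x = odd_deriv ds (j - p) (conv ds (%nu. F nu x) (%nu. G nu x)) mu"
   unfolding series_deriv_apply[OF *] using False
   by (simp del: One_nat_def) (rule odd_deriv_cong[OF a *(1)], rule ps_apply(1)[OF V _ *(2)])
   also have "... = conv ds (odd_deriv ds (j - p) (%nu. F nu x)) (%nu. G nu x) mu +
   koszul (ds ! (j - p)) dl * conv ds (%nu. F nu x) (odd_deriv ds (j - p) (%nu. G nu x)) mu"
   by (rule odd_deriv_conv[OF a odd[OF a] *(1)]) (use F *(2) in \<open>simp add: gcomp_ps\<close>)
   also have "conv ds (odd_deriv ds (j - p) (%nu. F nu x)) (%nu. G nu x) mu =
   conv ds (%nu. series_deriv p ds V j F nu x) (%nu. G nu x) mu"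
   by (rule conv_cong[OF *(1)]) (use False in \<open>simp_all add: series_deriv_apply[OF _ *(2)]\<close>)
   also have "conv ds (%nu. F nu x) (odd_deriv ds (j - p) (%nu. G nu x)) mu =
   conv ds (%nu. F nu x) (%nu. series_deriv p ds V j G nu x) mu"
   by (rule conv_cong[OF *(1)]) (use False in \<open>simp_all add: series_deriv_apply[OF _ *(2)]\<close>)
   finally show ?thesis unfolding R using False by (simp add: coord_degree_def)
  qed
 qed (simp_all add: closed)
qed

lemma series_deriv_restrict:
 assumes F: "F : carrier PV" and j: "j < p + length ds" and W: "openin (Euclidean_space p) W" "W <= V"
 shows "series_deriv p ds W j (\<lambda>mu\<in>MI ds. restrict (F mu) W) =
  (\<lambda>mu\<in>MI ds. restrict (series_deriv p ds V j F mu) W)" proof (intro ext)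
 fix mu x
 show "series_deriv p ds W j (\<lambda>mu\<in>MI ds. restrict (F mu) W) mu x =
  (\<lambda>mu\<in>MI ds. restrict (series_deriv p ds V j F mu) W) mu x" proof (cases "mu : MI ds & x : W")
  case True
  then have *: "mu : MI ds" "x : V" "x : W" using W by auto
  show ?thesis proof (cases "j < p")
   case True
   have "has_partial W j (F mu) (partial_deriv j (F mu))"
   using has_partial_series[OF F *(1) True] W(2) by (auto simp: has_partial_def)
   from partial_deriv_eqI[OF has_partial_cong[OF W(1) True this, of "restrict (F mu) W"] *(3)]
   have "partial_deriv j (restrict (F mu) W) x = partial_deriv j (F mu) x" by simp
   then show ?thesis using True * by (simp add: series_deriv_def)
  next
   case False
   then have a: "j - p < length ds" using j by simp
   from False * odd_deriv_cong[OF a *(1), of "%nu. (\<lambda>mu\<in>MI ds. restrict (F mu) W) nu x" "%nu. F nu x"]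
   show ?thesis by (simp add: series_deriv_def)
  qed
 qed (auto simp: series_deriv_def)
qed

lemma series_coord_gcomp:
 assumes j: "j < p + length ds" shows "series_coord p ds V j : gcomp PV (coord_degree p ds j)" proof -
 have "smooth p V (%x. if j < p then if mu = (%_. 0) then x j else 0
  else if mu = unit_index (j - p) then 1 else 0)" for mu using smooth_const[OF V] smooth_coord[OF V]
  by (cases "j < p"; cases "mu = (%_. 0)"; cases "mu = unit_index (j - p)") simp_all
 then have "series_coord p ds V j : carrier PV" unfolding series_coord_def by (intro ps_memI[OF V])
 then show ?thesis using j by (auto simp: gcomp_ps series_coord_def coord_degree_def monomial_degree_unit_index)
qed

lemma series_deriv_coord:
 assumes i: "i < p + length ds" and j: "j < p + length ds"
 shows "series_deriv p ds V i (series_coord p ds V j) = (if i = j then \<one>\<^bsub>PV\<^esub> else \<zero>\<^bsub>PV\<^esub>)"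
proof (rule ps_eqI[of _ p ds V])
 show "series_deriv p ds V i (series_coord p ds V j) : carrier PV"
  using series_coord_gcomp[OF j] by (intro series_deriv_closed i) (simp add: gcomp_ps)
 fix mu x assume *: "mu : MI ds" "x : V"
 show "series_deriv p ds V i (series_coord p ds V j) mu x = (if i = j then \<one>\<^bsub>PV\<^esub> else \<zero>\<^bsub>PV\<^esub>) mu x"
 proof (cases "i < p")
  case True
  have "has_partial V i (%x. if j < p then if mu = (%_. 0) then x j else 0
   else if mu = unit_index (j - p) then 1 else 0) (%_. if i = j & mu = (%_. 0) then 1 else 0)"
   by (cases "j < p"; cases "i = j"; cases "mu = (%_. 0)"; cases "mu = unit_index (j - p)")
   (use True in \<open>simp_all add: has_partial_def\<close>)
  from partial_deriv_eqI[OF has_partial_cong[OF V True this, of "series_coord p ds V j mu"] *(2)]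
  have "partial_deriv i (series_coord p ds V j mu) x = (if i = j & mu = (%_. 0) then 1 else 0)"
   using *(1) by (simp add: series_coord_def)
  then show ?thesis using True by (simp add: series_deriv_apply[OF *] ps_apply[OF V *])
 next
  case False
  define a where "a = i - p"
  have a: "a < length ds" using i False by (simp add: a_def)
  have eq: "odd_deriv ds a (%nu. series_coord p ds V j nu x) mu =
   odd_deriv ds a (%nu. if j < p then if nu = (%_. 0) then x j else 0
   else if nu = unit_index (j - p) then 1 else 0) mu"
   by (rule odd_deriv_cong[OF a *(1)]) (use *(2) in \<open>simp add: series_coord_def\<close>)
  have ne: "incr a mu ~= (%_. 0)" by (auto simp: fun_eq_iff intro!: exI[of _ a])
  have unit: "incr a mu = unit_index (j - p) \<longleftrightarrow> j - p = a & mu = (%_. 0)" proof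
   assume "incr a mu = unit_index (j - p)"
   then have h: "mu b + unit_index a b = unit_index (j - p) b" for b by metis
   have "j - p = a" using h[of a] by (auto split: if_splits)
   moreover have "mu b = 0" for b using h[of b] \<open>j - p = a\<close> by auto
   ultimately show "j - p = a & mu = (%_. 0)" by auto
  qed auto
  have ij: "\<not> j < p ==> j - p = a \<longleftrightarrow> i = j" "j < p ==> i ~= j"
   using False by (auto simp: a_def)
  have "odd_deriv ds a (%nu. if j < p then if nu = (%_. 0) then x j else 0
   else if nu = unit_index (j - p) then 1 else 0) mu = (if i = j & mu = (%_. 0) then 1 else 0)"
  proof (cases "j < p")
   case True
   then show ?thesis by (simp only: odd_deriv_def ne ij if_True if_False simp_thms mult_zero_right if_cancel)
  next
   case False
   then show ?thesis unfolding odd_deriv_def using ij by (simp only: unit if_False) auto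
  qed
  with eq have "odd_deriv ds a (%nu. series_coord p ds V j nu x) mu = (if i = j & mu = (%_. 0) then 1 else 0)"
   by simp
  then show ?thesis using False by (simp add: series_deriv_apply[OF *] ps_apply[OF V *] a_def)
 qed
qed (simp_all add: ps_closed[OF V])

end

lemma series_coord_restrict:
 "W <= V ==> (\<lambda>mu\<in>MI ds. restrict (series_coord p ds V j mu) W) = series_coord p ds W j"
 by (auto simp: series_coord_def fun_eq_iff)

subsection \<open>Derivations that vanish on the coordinates\<close>

definition series_fun :: "(bit ^ 'n::finite) list => (nat => real) set => ((nat => real) => real) => series" where
 "series_fun ds V f = (\<lambda>mu\<in>MI ds. \<lambda>x\<in>V. if mu = (%_. 0) then f x else 0)"

definition series_monom :: "(bit ^ 'n::finite) list => (nat => real) set => (nat => nat) => series" where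
 "series_monom ds V nu = (\<lambda>mu\<in>MI ds. \<lambda>x\<in>V. if mu = nu then 1 else 0)"

lemma series_fun_gcomp:
 assumes V: "openin (Euclidean_space p) V" and f: "smooth p V f" shows "series_fun ds V f : gcomp (PSA p ds V) 0"
proof -
 have "smooth p V (%x. if mu = (%_. 0) then f x else 0)" for mu :: "nat => nat"
  using f smooth_const[OF V] by (cases "mu = (%_. 0)") simp_all
 then have "series_fun ds V f : carrier (PSA p ds V)" unfolding series_fun_def by (intro ps_memI[OF V])
 then show ?thesis by (auto simp: gcomp_ps series_fun_def)
qed

lemma series_monom_gcomp:
 assumes V: "openin (Euclidean_space p) V" shows "series_monom ds V nu : gcomp (PSA p ds V) (mdeg ds nu)" proof -
 have "series_monom ds V nu : carrier (PSA p ds V)"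
  unfolding series_monom_def by (intro ps_memI[OF V] smooth_const[OF V])
 then show ?thesis by (auto simp: gcomp_ps series_monom_def)
qed

lemma conv_series_monom:
 assumes "rh : MI ds" "x : V" shows "conv ds f (%mu. series_monom ds V bt mu x) rh =
  (if bt \<le> rh then msign ds (%a. rh a - bt a) bt * f (%a. rh a - bt a) else 0)" proof -
 have "conv ds f (%mu. series_monom ds V bt mu x) rh = conv ds f (%mu. if mu = bt then 1 else 0) rh"
  by (rule conv_cong[OF assms(1)]) (simp_all add: series_monom_def assms)
 then show ?thesis by (simp add: conv_delta_right[OF assms(1)])
qed

lemma finite_multi_indices:
 assumes "!!a. a < length ds ==> koszul (ds ! a) (ds ! a) = - 1" shows "finite (MI ds)" proof -
 have "(%a. if a < length ds then 1 else 0) : MI ds" by (auto simp: multi_indices_def)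
 moreover have "MI ds <= {mu. mu \<le> (%a. if a < length ds then 1 else 0)}"
  using assms by (auto simp: multi_indices_def le_fun_def)
 ultimately show ?thesis using finite_le_multi_index finite_subset by blast
qed

text \<open>Monomials are killed by induction on their total degree. For a function \<open>f\<close>
  of \<open>x\<close>, Hadamard's lemma near \<open>y\<close> gives
  \<open>f = f y + (sum of (x^i - y^i) g_i)\<close>; as \<open>D\<close> kills the constant and each
  \<open>x^i - y^i\<close>, its value on \<open>f\<close> is a combination of the
  \<open>x^i - y^i\<close> and vanishes at \<open>y\<close>. A power series in odd variables is a
  finite sum of functions times monomials. The decomposition of \<open>f\<close> exists only over a
  box, which is why \<open>D\<close> is a family over open sets.\<close>

lemma series_derivation_eq_zero:
 fixes ds :: "(bit ^ 'n::finite) list"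
 assumes odd: "!!a. a < length ds ==> koszul (ds ! a) (ds ! a) = - 1" and W: "openin (Euclidean_space p) W"
  and closed: "!!V F. openin (Euclidean_space p) V ==> V <= W ==>
   F : carrier (PSA p ds V) ==> D V F : carrier (PSA p ds V)"
  and add: "!!V F G. openin (Euclidean_space p) V ==> V <= W ==>
   F : carrier (PSA p ds V) ==> G : carrier (PSA p ds V) ==>
   D V (F \<oplus>\<^bsub>PSA p ds V\<^esub> G) = D V F \<oplus>\<^bsub>PSA p ds V\<^esub> D V G"
  and smult: "!!V r F. openin (Euclidean_space p) V ==> V <= W ==>
   F : carrier (PSA p ds V) ==>
   D V (r \<odot>\<^bsub>PSA p ds V\<^esub> F) = r \<odot>\<^bsub>PSA p ds V\<^esub> D V F"
  and mult: "!!V dl F G. openin (Euclidean_space p) V ==> V <= W ==>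
   F : gcomp (PSA p ds V) dl ==> G : carrier (PSA p ds V) ==>
   D V (F \<otimes>\<^bsub>PSA p ds V\<^esub> G) =
   (D V F \<otimes>\<^bsub>PSA p ds V\<^esub> G) \<oplus>\<^bsub>PSA p ds V\<^esub>
   (koszul gm dl \<odot>\<^bsub>PSA p ds V\<^esub> (F \<otimes>\<^bsub>PSA p ds V\<^esub> D V G))"
  and res: "!!V F. openin (Euclidean_space p) V ==> V <= W ==> F : carrier (PSA p ds W) ==>
   D V (\<lambda>mu\<in>MI ds. restrict (F mu) V) = (\<lambda>mu\<in>MI ds. restrict (D W F mu) V)"
  and coord: "!!j. j < p + length ds ==> D W (series_coord p ds W j) = \<zero>\<^bsub>PSA p ds W\<^esub>"
  and F: "F : carrier (PSA p ds W)" shows "D W F = \<zero>\<^bsub>PSA p ds W\<^esub>" proof -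
 let ?I = "MI ds"
 have gcc: "G : carrier (PSA p ds V)" if "G : gcomp (PSA p ds V) d" for G V d using that by (simp add: gcomp_ps)
 have coord': "D V (series_coord p ds V j) = \<zero>\<^bsub>PSA p ds V\<^esub>"
  if V: "openin (Euclidean_space p) V" "V <= W" and j: "j < p + length ds" for V j proof -
  have "D V (series_coord p ds V j) = (\<lambda>mu\<in>?I. restrict (\<zero>\<^bsub>PSA p ds W\<^esub> mu) V)"
   using res[OF V gcc[OF series_coord_gcomp[OF W odd j]]]
   unfolding series_coord_restrict[OF V(2)] coord[OF j] by simp
  also have "... = \<zero>\<^bsub>PSA p ds V\<^esub>" using V(2) by (auto simp: ps_simps fun_eq_iff)
  finally show ?thesis .
 qed
 \<comment> \<open>The rule for sums appears once for each type of index that occurs below, since a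
   local fact is not polymorphic in it.\<close>
 have zero: "D V \<zero>\<^bsub>PSA p ds V\<^esub> = \<zero>\<^bsub>PSA p ds V\<^esub>"
  and one: "D V \<one>\<^bsub>PSA p ds V\<^esub> = \<zero>\<^bsub>PSA p ds V\<^esub>"
  and prod: "!!F G d. F : gcomp (PSA p ds V) d ==> G : carrier (PSA p ds V) ==>
   D V F = \<zero>\<^bsub>PSA p ds V\<^esub> ==> D V (F \<otimes>\<^bsub>PSA p ds V\<^esub> G) =
   koszul gm d \<odot>\<^bsub>PSA p ds V\<^esub> (F \<otimes>\<^bsub>PSA p ds V\<^esub> D V G)"
  and finsum: "!!X (g :: nat => series). (!!i. i : X ==> g i : carrier (PSA p ds V)) ==>
   D V (\<Oplus>\<^bsub>PSA p ds V\<^esub>i\<in>X. g i) = (\<Oplus>\<^bsub>PSA p ds V\<^esub>i\<in>X. D V (g i))"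
  and finsum': "!!X (g :: (nat => nat) => series). (!!i. i : X ==> g i : carrier (PSA p ds V)) ==>
   D V (\<Oplus>\<^bsub>PSA p ds V\<^esub>i\<in>X. g i) = (\<Oplus>\<^bsub>PSA p ds V\<^esub>i\<in>X. D V (g i))"
  if V: "openin (Euclidean_space p) V" "V <= W" for V proof -
  interpret P: graded_comm_algebra "PSA p ds V"
   by (rule graded_comm_algebra_power_series[OF V(1)])
  have "D V \<zero>\<^bsub>PSA p ds V\<^esub> =
   0 \<odot>\<^bsub>PSA p ds V\<^esub> D V \<zero>\<^bsub>PSA p ds V\<^esub>"
   using smult[OF V P.zero_closed, of 0] P.smult_zero_left[OF P.zero_closed] by simp
  also have "... = \<zero>\<^bsub>PSA p ds V\<^esub>" by (rule P.smult_zero_left) (rule closed[OF V P.zero_closed])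
  finally show zero: "D V \<zero>\<^bsub>PSA p ds V\<^esub> = \<zero>\<^bsub>PSA p ds V\<^esub>" .
  have D1: "D V \<one>\<^bsub>PSA p ds V\<^esub> : carrier (PSA p ds V)" by (rule closed[OF V P.one_closed])
  then have "D V \<one>\<^bsub>PSA p ds V\<^esub> =
   D V \<one>\<^bsub>PSA p ds V\<^esub> \<oplus>\<^bsub>PSA p ds V\<^esub> D V \<one>\<^bsub>PSA p ds V\<^esub>"
   using mult[OF V P.one_gcomp P.one_closed] by (simp add: P.smult_one')
  then show "D V \<one>\<^bsub>PSA p ds V\<^esub> = \<zero>\<^bsub>PSA p ds V\<^esub>"
   using D1 by (metis P.add.r_cancel_one')
  show "D V (F \<otimes>\<^bsub>PSA p ds V\<^esub> G) =
   koszul gm d \<odot>\<^bsub>PSA p ds V\<^esub> (F \<otimes>\<^bsub>PSA p ds V\<^esub> D V G)"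
   if F: "F : gcomp (PSA p ds V) d" and G: "G : carrier (PSA p ds V)"
   and 0: "D V F = \<zero>\<^bsub>PSA p ds V\<^esub>" for F G d unfolding mult[OF V F G] 0
   using G P.gcomp_closed[OF F] closed[OF V G] by (simp add: P.smult_closed')
  show "D V (\<Oplus>\<^bsub>PSA p ds V\<^esub>i\<in>X. g i) = (\<Oplus>\<^bsub>PSA p ds V\<^esub>i\<in>X. D V (g i))"
   if "!!i. i : X ==> g i : carrier (PSA p ds V)" for X and g :: "nat => series" using that
  proof (induction X rule: infinite_finite_induct)
   case (insert x X)
   then have "g : X \<rightarrow> carrier (PSA p ds V)" "g x : carrier (PSA p ds V)"
   "(%i. D V (g i)) : X \<rightarrow> carrier (PSA p ds V)"
   "D V (g x) : carrier (PSA p ds V)" using closed[OF V] by auto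
   with insert show ?case by (simp add: add[OF V])
  qed (simp_all add: zero)
  show "D V (\<Oplus>\<^bsub>PSA p ds V\<^esub>i\<in>X. g i) = (\<Oplus>\<^bsub>PSA p ds V\<^esub>i\<in>X. D V (g i))"
   if "!!i. i : X ==> g i : carrier (PSA p ds V)" for X and g :: "(nat => nat) => series" using that
  proof (induction X rule: infinite_finite_induct)
   case (insert x X)
   then have "g : X \<rightarrow> carrier (PSA p ds V)" "g x : carrier (PSA p ds V)"
   "(%i. D V (g i)) : X \<rightarrow> carrier (PSA p ds V)"
   "D V (g x) : carrier (PSA p ds V)" using closed[OF V] by auto
   with insert show ?case by (simp add: add[OF V])
  qed (simp_all add: zero)
 qed
 interpret P: graded_comm_algebra "PSA p ds W"
  by (rule graded_comm_algebra_power_series[OF W])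
 have monom: "D W (series_monom ds W nu) = \<zero>\<^bsub>PSA p ds W\<^esub>" if "nu : ?I" for nu using that
 proof (induction "\<Sum>a<length ds. nu a" arbitrary: nu rule: less_induct)
  case less
  show ?case proof (cases "nu = (%_. 0)")
   case True
   have "series_monom ds W nu = \<one>\<^bsub>PSA p ds W\<^esub>"
   unfolding True by (simp add: series_monom_def ps_simps)
   then show ?thesis using one[OF W] by simp
  next
   case False
   then obtain a where a: "nu a ~= 0" by auto
   then have al: "a < length ds" using less.prems by (auto simp: multi_indices_def not_less[symmetric])
   \<comment> \<open>One factor \<open>xi^a\<close> is split off: \<open>D\<close> kills it as a
     coordinate, and the smaller monomial by induction.\<close>
   define nu' where "nu' = nu(a := nu a - 1)"
   have nu: "nu = (%b. unit_index a b + nu' b)" using a by (auto simp: nu'_def fun_eq_iff)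
   then have I': "nu' : ?I" using less.prems mi_add(2) by metis
   have "(\<Sum>b<length ds. nu' b) < (\<Sum>b<length ds. nu b)"
   by (rule sum_strict_mono_ex1) (use a al in \<open>auto simp: nu'_def\<close>)
   from less.hyps[OF this I'] have IH: "D W (series_monom ds W nu') = \<zero>\<^bsub>PSA p ds W\<^esub>" .
   let ?c = "series_coord p ds W (p + a)" and ?s = "msign ds (unit_index a) nu'"
   have c: "?c : gcomp (PSA p ds W) (coord_degree p ds (p + a))"
   using al by (intro series_coord_gcomp[OF W odd]) auto
   have m: "series_monom ds W kp : carrier (PSA p ds W)" for kp by (rule gcc[OF series_monom_gcomp[OF W]])
   have m_eq: "series_monom ds W nu = ?s \<odot>\<^bsub>PSA p ds W\<^esub> (?c \<otimes>\<^bsub>PSA p ds W\<^esub> series_monom ds W nu')"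
   proof (rule ps_eqI[of _ p ds W])
   fix mu x assume *: "mu : ?I" "x : W"
   have "(%b. mu b - nu' b) = unit_index a \<longleftrightarrow> mu = nu" if "nu' \<le> mu" proof
   assume "(%b. mu b - nu' b) = unit_index a"
   then have "mu b - nu' b = unit_index a b" for b by (rule fun_cong)
   moreover have "nu' b \<le> mu b" for b using that by (simp add: le_fun_def)
   ultimately have "mu b = unit_index a b + nu' b" for b by (metis le_add_diff_inverse2)
   then show "mu = nu" unfolding nu by (rule ext)
   qed (auto simp: nu)
   moreover have "nu' \<le> mu" if "mu = nu" unfolding that nu by (simp add: le_fun_def)
   moreover have "(%b. mu b - nu' b) : ?I" by (rule mi_mono[OF *(1)]) (simp add: le_fun_def)
   moreover have "(?c \<otimes>\<^bsub>PSA p ds W\<^esub> series_monom ds W nu') mu x =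
   (if nu' \<le> mu then msign ds (%b. mu b - nu' b) nu' * ?c (%b. mu b - nu' b) x else 0)"
   unfolding ps_apply(1)[OF W *] conv_series_monom[OF *] ..
   ultimately show "series_monom ds W nu mu x =
   (?s \<odot>\<^bsub>PSA p ds W\<^esub> (?c \<otimes>\<^bsub>PSA p ds W\<^esub> series_monom ds W nu')) mu x"
   unfolding ps_apply(3)[OF W *] using * by (auto simp: series_coord_def series_monom_def)
   qed (use c m in \<open>auto intro!: P.smult_closed' P.m_closed intro: gcc\<close>)
   show ?thesis
   unfolding m_eq using smult[OF W order.refl P.m_closed[OF gcc[OF c] m]] prod[OF W order.refl c m coord'[OF W order.refl]] al
   by (simp add: IH gcc[OF c] P.smult_zero_right)
  qed
 qed
 have func: "D W (series_fun ds W f) = \<zero>\<^bsub>PSA p ds W\<^esub>" if f: "smooth p W f" for f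
 proof (rule ps_eqI[of _ p ds W])
  show "D W (series_fun ds W f) : carrier (PSA p ds W)"
   by (rule closed[OF W order.refl gcc[OF series_fun_gcomp[OF W f]]])
  fix mu y assume mu: "mu : ?I" and y: "y : W"
  \<comment> \<open>The value at \<open>y\<close> may be computed over a box around
    \<open>y\<close>, since \<open>D\<close> commutes with restriction.\<close>
  obtain ep where ep: "ep > 0" "ebox p y ep <= W" "y : ebox p y ep" using ebox_neighbourhood[OF W y] .
  define B where "B = ebox p y ep"
  have B: "openin (Euclidean_space p) B" "B <= W" "y : B" using ep openin_ebox by (auto simp: B_def)
  interpret B: graded_comm_algebra "PSA p ds B"
   by (rule graded_comm_algebra_power_series[OF B(1)])
  let ?P = "PSA p ds B"
  obtain g where g: "!!i. i < p ==> smooth p B (g i)"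
   "!!x. x : B ==> f x = f y + (\<Sum>i<p. (x i - y i) * g i x)"
   using hadamard[OF smooth_subset[OF ep(2) f] ep(3)] unfolding B_def by metis
  \<comment> \<open>\<open>t i\<close> is \<open>x^i - y^i\<close>. It is killed by
    \<open>D\<close>, passes through \<open>D\<close> without a sign because its degree is 0, and
    vanishes at \<open>y\<close>.\<close>
  define t where "t i = series_coord p ds B i \<oplus>\<^bsub>?P\<^esub> (- y i) \<odot>\<^bsub>?P\<^esub> \<one>\<^bsub>?P\<^esub>" for i
  have sc: "series_coord p ds B i : gcomp ?P 0" if "i < p" for i
   using series_coord_gcomp[OF B(1) odd, of i] that by (simp add: coord_degree_def)
  then have t: "t i : gcomp ?P 0" if "i < p" for i
   unfolding t_def using that by (intro B.gcomp_add B.gcomp_smult B.one_gcomp)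
  have Dt: "D B (t i) = \<zero>\<^bsub>?P\<^esub>" if "i < p" for i unfolding t_def
   using add[OF B(1,2) gcc[OF sc[OF that]] B.smult_closed'[OF B.one_closed]]
   smult[OF B(1,2) B.one_closed] coord'[OF B(1,2)] one[OF B(1,2)] that by (simp add: B.smult_zero_right)
  have gi: "series_fun ds B (g i) : carrier ?P" if "i < p" for i
   by (rule gcc[OF series_fun_gcomp[OF B(1) g(1)[OF that]]])
  have tg: "t i \<otimes>\<^bsub>?P\<^esub> series_fun ds B (g i) : carrier ?P" if "i < p" for i
   using gi[OF that] gcc[OF t[OF that]] by simp
  have tv: "t i mu x = (if mu = (%_. 0) then x i - y i else 0)" if "mu : ?I" "x : B" "i < p" for i mu x
   using that by (simp add: t_def ps_apply[OF B(1)] series_coord_def)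
  have tconv: "conv ds (%mu. t i mu x) h mu = (x i - y i) * h mu" if "x : B" "i < p" "mu : ?I" for i x h mu proof -
   have "conv ds (%mu. t i mu x) h mu = conv ds (%mu. if mu = (%_. 0) then x i - y i else 0) h mu"
   by (rule conv_cong[OF that(3)]) (simp_all add: tv that)
   then show ?thesis by (simp add: conv_unit_left[OF that(3)])
  qed
  let ?S = "\<Oplus>\<^bsub>?P\<^esub>i\<in>{..<p}. t i \<otimes>\<^bsub>?P\<^esub> series_fun ds B (g i)"
  have S: "?S : carrier ?P" using tg by (intro B.finsum_closed) auto
  have expand: "series_fun ds B f = f y \<odot>\<^bsub>?P\<^esub> \<one>\<^bsub>?P\<^esub> \<oplus>\<^bsub>?P\<^esub> ?S"
  proof (rule ps_eqI[of _ p ds B])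
   show "series_fun ds B f : carrier ?P" using series_fun_gcomp[OF B(1) smooth_subset[OF B(2) f]] gcc by blast
   show "f y \<odot>\<^bsub>?P\<^esub> \<one>\<^bsub>?P\<^esub> \<oplus>\<^bsub>?P\<^esub> ?S : carrier ?P"
   using S by (simp add: B.smult_closed')
   fix mu x assume *: "mu : ?I" "x : B"
   have "?S mu x = (\<Sum>i<p. (t i \<otimes>\<^bsub>?P\<^esub> series_fun ds B (g i)) mu x)"
   by (rule finsum_power_series_apply[OF B(1) _ *]) (use tg in auto)
   also have "... = (\<Sum>i<p. (x i - y i) * series_fun ds B (g i) mu x)"
   by (rule sum.cong) (simp_all add: ps_apply[OF B(1) *] tconv *)
   finally show "series_fun ds B f mu x = (f y \<odot>\<^bsub>?P\<^esub> \<one>\<^bsub>?P\<^esub> \<oplus>\<^bsub>?P\<^esub> ?S) mu x"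
   using g(2)[OF *(2)] * by (auto simp: ps_apply[OF B(1) *] series_fun_def)
  qed
  have "D B (series_fun ds B f) = (\<Oplus>\<^bsub>?P\<^esub>i\<in>{..<p}. D B (t i \<otimes>\<^bsub>?P\<^esub> series_fun ds B (g i)))"
  proof -
   have "D B (series_fun ds B f) = D B (f y \<odot>\<^bsub>?P\<^esub> \<one>\<^bsub>?P\<^esub>) \<oplus>\<^bsub>?P\<^esub> D B ?S"
   unfolding expand by (rule add[OF B(1,2) B.smult_closed'[OF B.one_closed] S])
   also have "D B (f y \<odot>\<^bsub>?P\<^esub> \<one>\<^bsub>?P\<^esub>) = \<zero>\<^bsub>?P\<^esub>"
   unfolding smult[OF B(1,2) B.one_closed] one[OF B(1,2)] by (rule B.smult_zero_right)
   also have "\<zero>\<^bsub>?P\<^esub> \<oplus>\<^bsub>?P\<^esub> D B ?S = D B ?S"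
   using closed[OF B(1,2) S] by simp
   also have "... = (\<Oplus>\<^bsub>?P\<^esub>i\<in>{..<p}. D B (t i \<otimes>\<^bsub>?P\<^esub> series_fun ds B (g i)))"
   by (rule finsum[OF B(1,2)]) (use tg in auto)
   finally show ?thesis .
  qed
  then have "D B (series_fun ds B f) mu y = (\<Sum>i<p. D B (t i \<otimes>\<^bsub>?P\<^esub> series_fun ds B (g i)) mu y)"
   using finsum_power_series_apply[OF B(1) _ mu B(3), of "{..<p}" "%i. D B (t i \<otimes>\<^bsub>?P\<^esub> series_fun ds B (g i))"]
   closed[OF B(1,2) tg] by simp
  also have "... = 0" proof (rule sum.neutral, rule ballI)
   fix i assume "i : {..<p}"
   then have i: "i < p" by simp
   show "D B (t i \<otimes>\<^bsub>?P\<^esub> series_fun ds B (g i)) mu y = 0"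
   unfolding prod[OF B(1,2) t[OF i] gi[OF i] Dt[OF i]] ps_apply[OF B(1) mu B(3)]
   tconv[OF B(3) i mu] by simp
  qed
  finally have "D B (series_fun ds B f) mu y = 0" .
  moreover have "series_fun ds B f = (\<lambda>mu\<in>?I. restrict (series_fun ds W f mu) B)"
   using B(2) by (auto simp: series_fun_def fun_eq_iff)
  ultimately have "(\<lambda>mu\<in>?I. restrict (D W (series_fun ds W f) mu) B) mu y = 0"
   using res[OF B(1,2) gcc[OF series_fun_gcomp[OF W f]]] by metis
  then show "D W (series_fun ds W f) mu y = \<zero>\<^bsub>PSA p ds W\<^esub> mu y"
   using mu y B(3) by (simp add: ps_apply[OF W])
 qed simp
 let ?P = "PSA p ds W"
 have ff: "series_fun ds W (F mu) : gcomp ?P 0" if "mu : ?I" for mu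
  by (rule series_fun_gcomp[OF W ps_smooth[OF W F that]])
 have mm: "series_monom ds W mu : carrier ?P" for mu by (rule gcc[OF series_monom_gcomp[OF W]])
 have fm: "series_fun ds W (F mu) \<otimes>\<^bsub>?P\<^esub> series_monom ds W mu : carrier ?P" if "mu : ?I" for mu
  using gcc[OF ff[OF that]] mm by simp
 \<comment> \<open>A finite sum, since all variables are odd and so there are only finitely many
   monomials.\<close>
 have expand: "F = (\<Oplus>\<^bsub>?P\<^esub>mu\<in>?I. series_fun ds W (F mu) \<otimes>\<^bsub>?P\<^esub> series_monom ds W mu)"
 proof (rule ps_eqI[of _ p ds W, OF F])
  show "(\<Oplus>\<^bsub>?P\<^esub>mu\<in>?I. series_fun ds W (F mu) \<otimes>\<^bsub>?P\<^esub> series_monom ds W mu) : carrier ?P"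
   using fm by (intro P.finsum_closed) auto
  fix rh x assume *: "rh : ?I" "x : W"
  have "(\<Oplus>\<^bsub>?P\<^esub>mu\<in>?I. series_fun ds W (F mu) \<otimes>\<^bsub>?P\<^esub> series_monom ds W mu) rh x =
   (\<Sum>mu\<in>?I. (series_fun ds W (F mu) \<otimes>\<^bsub>?P\<^esub> series_monom ds W mu) rh x)"
   by (rule finsum_power_series_apply[OF W fm *])
  also have "... = (\<Sum>mu\<in>?I. if mu = rh then F rh x else 0)" proof (rule sum.cong[OF HOL.refl])
   fix mu assume mu: "mu : ?I"
   have "conv ds (%nu. series_fun ds W (F mu) nu x) (%nu. series_monom ds W mu nu x) rh =
   conv ds (%nu. if nu = (%_. 0) then F mu x else 0) (%nu. series_monom ds W mu nu x) rh"
   by (rule conv_cong[OF *(1)]) (use *(2) in \<open>simp_all add: series_fun_def\<close>)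
   then show "(series_fun ds W (F mu) \<otimes>\<^bsub>?P\<^esub> series_monom ds W mu) rh x = (if mu = rh then F rh x else 0)"
   using * by (auto simp: ps_apply[OF W *] conv_unit_left[OF *(1)] series_monom_def)
  qed
  also have "... = F rh x" using *(1) finite_multi_indices[OF odd] by simp
  finally show "F rh x = (\<Oplus>\<^bsub>?P\<^esub>mu\<in>?I. series_fun ds W (F mu) \<otimes>\<^bsub>?P\<^esub> series_monom ds W mu) rh x"
   by simp
 qed
 have "D W F = (\<Oplus>\<^bsub>?P\<^esub>mu\<in>?I. D W (series_fun ds W (F mu) \<otimes>\<^bsub>?P\<^esub> series_monom ds W mu))"
  by (subst expand) (rule finsum'[OF W order.refl fm])
 also have "... = (\<Oplus>\<^bsub>?P\<^esub>mu\<in>?I. \<zero>\<^bsub>?P\<^esub>)"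
 proof (rule P.finsum_cong'[OF HOL.refl])
  fix mu assume mu: "mu : ?I"
  have "D W (series_fun ds W (F mu) \<otimes>\<^bsub>?P\<^esub> series_monom ds W mu) =
   koszul gm 0 \<odot>\<^bsub>?P\<^esub> (series_fun ds W (F mu) \<otimes>\<^bsub>?P\<^esub> D W (series_monom ds W mu))"
   by (rule prod[OF W order.refl ff[OF mu] mm func[OF ps_smooth[OF W F mu]]])
  also have "... = \<zero>\<^bsub>?P\<^esub>" using gcc[OF ff[OF mu]] by (simp add: monom[OF mu] P.smult_zero_right)
  finally show "D W (series_fun ds W (F mu) \<otimes>\<^bsub>?P\<^esub> series_monom ds W mu) = \<zero>\<^bsub>?P\<^esub>" .
 qed simp
 also have "... = \<zero>\<^bsub>?P\<^esub>" by simp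
 finally show ?thesis .
qed

section \<open>Stalks\<close>

text \<open>Operations on germs and on classes of expressions are unions over all representatives;
  when the result does not depend on the representative, the union is that result.\<close>

lemma Union_eq_const: "a : A ==> (!!z. z : A ==> f z = c) ==> (\<Union>z\<in>A. f z) = c" by auto

text \<open>Exactly the structure that the arithmetic of germs uses. It is available for the
  exterior presheaf, of which it is not known at this stage that the homogeneous parts form a direct
  sum.\<close>

locale presheaf_of_rings =
 fixes P :: "('m, 'b, 'n::finite) ringed_space"
 assumes ring_sections: "openin (base P) U ==> ring (sections P U)"
  and res_ring_hom: "openin (base P) U ==> V : opens P U ==>
   res P U V : ring_hom (sections P U) (sections P V)"
  and sections_smult_closed: "openin (base P) U ==> s : carrier (sections P U) ==>
   r \<odot>\<^bsub>sections P U\<^esub> s : carrier (sections P U)"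
  and res_smult: "openin (base P) U ==> V : opens P U ==> s : carrier (sections P U) ==>
   res P U V (r \<odot>\<^bsub>sections P U\<^esub> s) = r \<odot>\<^bsub>sections P V\<^esub> res P U V s"
  and res_id: "openin (base P) U ==> s : carrier (sections P U) ==> res P U U s = s"
  and res_res: "openin (base P) U ==> V : opens P U ==> W : opens P V ==>
   s : carrier (sections P U) ==> res P V W (res P U V s) = res P U W s"
begin

lemma res_closed:
 "openin (base P) U ==> V : opens P U ==> s : carrier (sections P U) ==>
  res P U V s : carrier (sections P V)" using res_ring_hom[of U V] by (simp add: ring_hom_def Pi_iff)

lemma res_mult:
 "openin (base P) U ==> V : opens P U ==> s : carrier (sections P U) ==> t : carrier (sections P U) ==>
  res P U V (s \<otimes>\<^bsub>sections P U\<^esub> t) = res P U V s \<otimes>\<^bsub>sections P V\<^esub> res P U V t"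
 using res_ring_hom[of U V] by (simp add: ring_hom_def)

lemma res_add:
 "openin (base P) U ==> V : opens P U ==> s : carrier (sections P U) ==> t : carrier (sections P U) ==>
  res P U V (s \<oplus>\<^bsub>sections P U\<^esub> t) = res P U V s \<oplus>\<^bsub>sections P V\<^esub> res P U V t"
 using res_ring_hom[of U V] by (simp add: ring_hom_def)

lemma res_one:
 "openin (base P) U ==> V : opens P U ==> res P U V \<one>\<^bsub>sections P U\<^esub> = \<one>\<^bsub>sections P V\<^esub>"
 using res_ring_hom[of U V] by (simp add: ring_hom_def)

lemma res_zero:
 assumes "openin (base P) U" "V : opens P U"
 shows "res P U V \<zero>\<^bsub>sections P U\<^esub> = \<zero>\<^bsub>sections P V\<^esub>"
 using ring_hom_zero[OF res_ring_hom[OF assms]] ring_sections assms by blast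

section \<open>Germs and their equality\<close>

definition local_section :: "'m => 'm set => 'b => bool" where
 "local_section x U s \<longleftrightarrow> openin (base P) U & x : U & s : carrier (sections P U)"

lemma germ_mem:
 "(V, t) : germ P x U s \<longleftrightarrow> local_section x V t \<and>
  (EX W:opens P (U Int V). x : W & res P U W s = res P V W t)" by (auto simp: germ_def local_section_def)

lemma germ_mem_self:
 assumes "local_section x U s" shows "(U, s) : germ P x U s"
 unfolding germ_mem using assms by (auto simp: local_section_def)

lemma germ_mem_sym:
 assumes "local_section x U s" "(V, t) : germ P x U s" shows "(U, s) : germ P x V t"
 using assms unfolding germ_mem by (metis Int_commute)

lemma germ_mem_trans:
 assumes s: "local_section x U s" and t: "(V, t) : germ P x U s" and u: "(V', u) : germ P x V t"
 shows "(V', u) : germ P x U s" proof -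
 obtain W where W: "openin (base P) W" "W <= U Int V" "x : W" "res P U W s = res P V W t"
  using t unfolding germ_mem by blast
 obtain W' where W': "openin (base P) W'" "W' <= V Int V'" "x : W'" "res P V W' t = res P V' W' u"
  using u unfolding germ_mem by blast
 have o: "openin (base P) U" "openin (base P) V" "openin (base P) V'" "openin (base P) (W Int W')"
  and c: "s : carrier (sections P U)" "t : carrier (sections P V)" "u : carrier (sections P V')"
  using s t u W W' by (auto simp: germ_mem local_section_def)
 have "res P U (W Int W') s = res P W (W Int W') (res P U W s)" using o c W by (intro res_res[symmetric]) auto
 also have "... = res P V (W Int W') t" unfolding W(4) using o c W by (intro res_res) auto
 also have "... = res P W' (W Int W') (res P V W' t)" using o c W' by (intro res_res[symmetric]) auto
 also have "... = res P V' (W Int W') u" unfolding W'(4) using o c W' by (intro res_res) auto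
 finally show ?thesis using o W W' u unfolding germ_mem by (intro conjI bexI[of _ "W Int W'"]) auto
qed

lemma germ_eqI:
 assumes "local_section x U s" "(V, t) : germ P x U s" shows "germ P x V t = germ P x U s" proof -
 have t: "local_section x V t" using assms by (simp add: germ_mem)
 show ?thesis using germ_mem_trans[OF assms] germ_mem_trans[OF t germ_mem_sym[OF assms]] by auto
qed

lemma germ_eq_iff:
 assumes "local_section x U s" "local_section x V t"
 shows "germ P x U s = germ P x V t \<longleftrightarrow> (EX W:opens P (U Int V). x : W & res P U W s = res P V W t)"
proof
 assume "germ P x U s = germ P x V t"
 then have "(V, t) : germ P x U s" using germ_mem_self[OF assms(2)] by simp
 then show "EX W:opens P (U Int V). x : W & res P U W s = res P V W t" unfolding germ_mem by (rule conjunct2)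
next
 assume "EX W:opens P (U Int V). x : W & res P U W s = res P V W t"
 then have "(V, t) : germ P x U s" unfolding germ_mem using assms(2) by (intro conjI)
 from germ_eqI[OF assms(1) this] show "germ P x U s = germ P x V t" ..
qed

lemma germ_restrict:
 assumes "local_section x U s" "openin (base P) V" "V <= U" "x : V" shows "germ P x V (res P U V s) = germ P x U s"
proof (rule germ_eqI[OF assms(1)])
 have c: "res P U V s : carrier (sections P V)" using assms by (intro res_closed) (auto simp: local_section_def)
 moreover have "res P V V (res P U V s) = res P U V s" by (rule res_id[OF assms(2) c])
 ultimately show "(V, res P U V s) : germ P x U s"
  using assms unfolding germ_mem local_section_def by (intro conjI bexI[of _ V]) auto
qed

text \<open>Independence of representatives, for addition and multiplication together: over a common
  smaller neighbourhood the results of both choices restrict to the same section.\<close>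

lemma germ_binary_operation:
 assumes closed: "!!U s t. openin (base P) U ==> s : carrier (sections P U) ==>
   t : carrier (sections P U) ==> f U s t : carrier (sections P U)"
  and res_f: "!!U V s t. openin (base P) U ==> V : opens P U ==> s : carrier (sections P U) ==>
   t : carrier (sections P U) ==> res P U V (f U s t) = f V (res P U V s) (res P U V t)"
  and s: "local_section x U s" and t: "local_section x V t"
 shows "(\<Union>(U', s')\<in>germ P x U s. \<Union>(V', t')\<in>germ P x V t.
   germ P x (U' Int V') (f (U' Int V') (res P U' (U' Int V') s') (res P V' (U' Int V') t'))) =
  germ P x (U Int V) (f (U Int V) (res P U (U Int V) s) (res P V (U Int V) t))" proof -
 have loc: "local_section x (U' Int V') (f (U' Int V') (res P U' (U' Int V') s') (res P V' (U' Int V') t'))"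
  if "local_section x U' s'" "local_section x V' t'" for U' V' s' t'
  using that unfolding local_section_def by (intro conjI closed res_closed) auto
 have const: "germ P x (U' Int V') (f (U' Int V') (res P U' (U' Int V') s') (res P V' (U' Int V') t')) =
   germ P x (U Int V) (f (U Int V) (res P U (U Int V) s) (res P V (U Int V) t))"
  if s': "(U', s') : germ P x U s" and t': "(V', t') : germ P x V t" for U' s' V' t' proof -
  obtain W where W: "openin (base P) W" "W <= U Int U'" "x : W" "res P U W s = res P U' W s'"
   using s' unfolding germ_mem by blast
  obtain W' where W': "openin (base P) W'" "W' <= V Int V'" "x : W'" "res P V W' t = res P V' W' t'"
   using t' unfolding germ_mem by blast
  have l: "local_section x U' s'" "local_section x V' t'" using s' t' by (auto simp: germ_mem)
  define X where "X = W Int W'"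
  have X: "openin (base P) X" "x : X" "X <= U" "X <= U'" "X <= V" "X <= V'" "X <= W" "X <= W'"
   using W W' by (auto simp: X_def)
  have restr: "res P (A Int B) X (f (A Int B) (res P A (A Int B) a) (res P B (A Int B) b)) =
   f X (res P A X a) (res P B X b)" if "local_section x A a" "local_section x B b" "X <= A" "X <= B" for A B a b
  proof -
   have o: "openin (base P) A" "openin (base P) B" "openin (base P) (A Int B)"
   "a : carrier (sections P A)" "b : carrier (sections P B)" using that by (auto simp: local_section_def)
   have "res P (A Int B) X (f (A Int B) (res P A (A Int B) a) (res P B (A Int B) b)) =
   f X (res P (A Int B) X (res P A (A Int B) a)) (res P (A Int B) X (res P B (A Int B) b))"
   using o X that by (intro res_f res_closed) auto
   also have "res P (A Int B) X (res P A (A Int B) a) = res P A X a" using o X that by (intro res_res) auto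
   also have "res P (A Int B) X (res P B (A Int B) b) = res P B X b" using o X that by (intro res_res) auto
   finally show ?thesis .
  qed
  have "res P U X s = res P W X (res P U W s)"
   using s X W by (intro res_res[symmetric]) (auto simp: local_section_def)
  also have "... = res P U' X s'" unfolding W(4) using l X W by (intro res_res) (auto simp: local_section_def)
  finally have eq1: "res P U X s = res P U' X s'" .
  have "res P V X t = res P W' X (res P V W' t)"
   using t X W' by (intro res_res[symmetric]) (auto simp: local_section_def)
  also have "... = res P V' X t'" unfolding W'(4) using l X W' by (intro res_res) (auto simp: local_section_def)
  finally have eq2: "res P V X t = res P V' X t'" .
  show ?thesis unfolding germ_eq_iff[OF loc[OF l] loc[OF s t]]
   using X restr[OF l] restr[OF s t] eq1 eq2 by (intro bexI[of _ X]) auto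
 qed
 show ?thesis proof (rule Union_eq_const[OF germ_mem_self[OF s]], clarify)
  fix U' s' assume s': "(U', s') : germ P x U s"
  show "(\<Union>(V', t')\<in>germ P x V t.
   germ P x (U' Int V') (f (U' Int V') (res P U' (U' Int V') s') (res P V' (U' Int V') t'))) =
   germ P x (U Int V) (f (U Int V) (res P U (U Int V) s) (res P V (U Int V) t))"
   by (rule Union_eq_const[OF germ_mem_self[OF t]], clarify) (rule const[OF s'])
 qed
qed

section \<open>The ring structure of a stalk\<close>

lemma stalk_carrier: "g : carrier (stalk P x) \<longleftrightarrow> (EX U s. local_section x U s & g = germ P x U s)"
 by (auto simp: stalk_def local_section_def)

lemma stalk_gcomp:
 "g : gcomp (stalk P x) d \<longleftrightarrow>
  (EX U s. openin (base P) U & x : U & s : gcomp (sections P U) d & g = germ P x U s)" by (auto simp: stalk_def)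

lemma germ_closed: "local_section x U s ==> germ P x U s : carrier (stalk P x)" unfolding stalk_carrier by blast

lemma local_section_closed:
 assumes "local_section x U s" "local_section x U t"
 shows "local_section x U (s \<otimes>\<^bsub>sections P U\<^esub> t)" "local_section x U (s \<oplus>\<^bsub>sections P U\<^esub> t)"
  "local_section x U (r \<odot>\<^bsub>sections P U\<^esub> s)" proof -
 interpret ring "sections P U"
  using assms ring_sections by (simp add: local_section_def)
 show "local_section x U (s \<otimes>\<^bsub>sections P U\<^esub> t)" "local_section x U (s \<oplus>\<^bsub>sections P U\<^esub> t)"
  "local_section x U (r \<odot>\<^bsub>sections P U\<^esub> s)"
  using assms sections_smult_closed by (auto simp: local_section_def)
qed

lemma local_section_one: "openin (base P) U ==> x : U ==> local_section x U \<one>\<^bsub>sections P U\<^esub>"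
 and local_section_zero: "openin (base P) U ==> x : U ==> local_section x U \<zero>\<^bsub>sections P U\<^esub>"
 using ring.ring_simprules(2,6)[OF ring_sections] by (auto simp: local_section_def)

lemma stalk_mult:
 assumes "local_section x U s" "local_section x U t"
 shows "germ P x U s \<otimes>\<^bsub>stalk P x\<^esub> germ P x U t = germ P x U (s \<otimes>\<^bsub>sections P U\<^esub> t)"
proof -
 have "germ P x U s \<otimes>\<^bsub>stalk P x\<^esub> germ P x U t =
   germ P x (U Int U) (res P U (U Int U) s \<otimes>\<^bsub>sections P (U Int U)\<^esub> res P U (U Int U) t)"
  unfolding stalk_def monoid.simps
  by (rule germ_binary_operation[where f="%U. monoid.mult (sections P U)", OF _ res_mult assms])
   (auto intro: ring.ring_simprules(5)[OF ring_sections])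
 then show ?thesis using assms res_id by (simp add: local_section_def)
qed

lemma stalk_add:
 assumes "local_section x U s" "local_section x U t"
 shows "germ P x U s \<oplus>\<^bsub>stalk P x\<^esub> germ P x U t = germ P x U (s \<oplus>\<^bsub>sections P U\<^esub> t)"
proof -
 have "germ P x U s \<oplus>\<^bsub>stalk P x\<^esub> germ P x U t =
   germ P x (U Int U) (res P U (U Int U) s \<oplus>\<^bsub>sections P (U Int U)\<^esub> res P U (U Int U) t)"
  unfolding stalk_def ring.simps
  by (rule germ_binary_operation[where f="%U. ring.add (sections P U)", OF _ res_add assms])
   (auto intro: ring.ring_simprules(1)[OF ring_sections])
 then show ?thesis using assms res_id by (simp add: local_section_def)
qed

lemma stalk_smult:
 assumes s: "local_section x U s"
 shows "r \<odot>\<^bsub>stalk P x\<^esub> germ P x U s = germ P x U (r \<odot>\<^bsub>sections P U\<^esub> s)"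
proof -
 have "germ P x V (r \<odot>\<^bsub>sections P V\<^esub> t) = germ P x U (r \<odot>\<^bsub>sections P U\<^esub> s)"
  if t: "(V, t) : germ P x U s" for V t proof -
  have t': "local_section x V t" using t by (simp add: germ_mem)
  obtain W where W: "openin (base P) W" "W <= U Int V" "x : W" "res P U W s = res P V W t"
   using t unfolding germ_mem by blast
  show ?thesis unfolding germ_eq_iff[OF local_section_closed(3)[OF t' t'] local_section_closed(3)[OF s s]]
   using W s t' by (intro bexI[of _ W]) (auto simp: local_section_def res_smult)
 qed
 then have "(\<Union>(V, t)\<in>germ P x U s. germ P x V (r \<odot>\<^bsub>sections P V\<^esub> t)) = germ P x U (r \<odot>\<^bsub>sections P U\<^esub> s)"
  by (intro Union_eq_const[OF germ_mem_self[OF s]]) clarify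
 then show ?thesis by (simp add: stalk_def)
qed

lemma stalk_one:
 assumes "openin (base P) U" "x : U"
 shows "\<one>\<^bsub>stalk P x\<^esub> = germ P x U \<one>\<^bsub>sections P U\<^esub>" proof -
 have T: "openin (base P) (topspace (base P))" "U <= topspace (base P)" using assms by (auto dest: openin_subset)
 then show ?thesis using germ_restrict[OF local_section_one[OF T(1)] assms(1) T(2) assms(2)] assms
  by (simp add: stalk_def res_one subset_iff)
qed

lemma stalk_zero:
 assumes "openin (base P) U" "x : U"
 shows "\<zero>\<^bsub>stalk P x\<^esub> = germ P x U \<zero>\<^bsub>sections P U\<^esub>" proof -
 have T: "openin (base P) (topspace (base P))" "U <= topspace (base P)" using assms by (auto dest: openin_subset)
 then show ?thesis using germ_restrict[OF local_section_zero[OF T(1)] assms(1) T(2) assms(2)] assms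
  by (simp add: stalk_def res_zero subset_iff)
qed

text \<open>Germs are brought to a common open set, where the laws of the ring of sections
  apply.\<close>

lemma stalk_common:
 assumes "g : carrier (stalk P x)" "h : carrier (stalk P x)"
 obtains U s t where "local_section x U s" "local_section x U t" "g = germ P x U s" "h = germ P x U t" proof -
 obtain V s W t where *: "local_section x V s" "g = germ P x V s" "local_section x W t" "h = germ P x W t"
  using assms unfolding stalk_carrier by blast
 then have o: "openin (base P) (V Int W)" "x : V Int W" by (auto simp: local_section_def)
 have "local_section x (V Int W) (res P V (V Int W) s)" "local_section x (V Int W) (res P W (V Int W) t)"
  using * o by (auto simp: local_section_def intro: res_closed)
 moreover have "g = germ P x (V Int W) (res P V (V Int W) s)" "h = germ P x (V Int W) (res P W (V Int W) t)"
  using * o germ_restrict by auto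
 ultimately show ?thesis using that by blast
qed

lemma stalk_common3:
 assumes "g : carrier (stalk P x)" "h : carrier (stalk P x)" "k : carrier (stalk P x)"
 obtains U s t u where "local_section x U s" "local_section x U t" "local_section x U u"
  "g = germ P x U s" "h = germ P x U t" "k = germ P x U u" proof -
 obtain V s t where V: "local_section x V s" "local_section x V t" "g = germ P x V s" "h = germ P x V t"
  using stalk_common[OF assms(1,2)] .
 obtain W u where W: "local_section x W u" "k = germ P x W u" using assms(3) unfolding stalk_carrier by blast
 have o: "openin (base P) (V Int W)" "x : V Int W" using V W by (auto simp: local_section_def)
 have "local_section x (V Int W) (res P V (V Int W) s)" "local_section x (V Int W) (res P V (V Int W) t)"
  "local_section x (V Int W) (res P W (V Int W) u)" using V W o by (auto simp: local_section_def intro: res_closed)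
 moreover have "g = germ P x (V Int W) (res P V (V Int W) s)" "h = germ P x (V Int W) (res P V (V Int W) t)"
  "k = germ P x (V Int W) (res P W (V Int W) u)" using V W o germ_restrict by auto
 ultimately show ?thesis using that by blast
qed

lemma ring_stalk:
 assumes x: "x : topspace (base P)" shows "ring (stalk P x)" proof -
 let ?T = "topspace (base P)"
 note simps = stalk_mult stalk_add local_section_closed germ_closed
 have sec: "ring (sections P U)" "stalk P x = stalk P x" "\<one>\<^bsub>stalk P x\<^esub> = germ P x U \<one>\<^bsub>sections P U\<^esub>"
  "\<zero>\<^bsub>stalk P x\<^esub> = germ P x U \<zero>\<^bsub>sections P U\<^esub>" "local_section x U \<one>\<^bsub>sections P U\<^esub>"
  "local_section x U \<zero>\<^bsub>sections P U\<^esub>" "s : carrier (sections P U)" if "local_section x U s" for U s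
  using that ring_sections stalk_one stalk_zero local_section_one local_section_zero
  by (auto simp: local_section_def)
 have one: "\<one>\<^bsub>stalk P x\<^esub> : carrier (stalk P x)" and zero: "\<zero>\<^bsub>stalk P x\<^esub> : carrier (stalk P x)"
  using x stalk_one[of ?T x] stalk_zero[of ?T x] local_section_one[of ?T x] local_section_zero[of ?T x]
  by (auto simp: stalk_carrier)
 show ?thesis proof (rule ringI)
  show "abelian_group (stalk P x)" proof (rule abelian_groupI)
   fix g h assume g: "g : carrier (stalk P x)" and h: "h : carrier (stalk P x)"
   then obtain U s t where U: "local_section x U s" "local_section x U t" "g = germ P x U s" "h = germ P x U t"
   using stalk_common by metis
   show "g \<oplus>\<^bsub>stalk P x\<^esub> h : carrier (stalk P x)" using U by (simp add: simps)
   show "g \<oplus>\<^bsub>stalk P x\<^esub> h = h \<oplus>\<^bsub>stalk P x\<^esub> g"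
   using U ring.ring_simprules(10)[OF sec(1)[OF U(1)]] sec(7) by (simp add: simps)
   fix k assume k: "k : carrier (stalk P x)"
   obtain U s t u where U: "local_section x U s" "local_section x U t" "local_section x U u"
   "g = germ P x U s" "h = germ P x U t" "k = germ P x U u" using stalk_common3[OF g h k] .
   show "(g \<oplus>\<^bsub>stalk P x\<^esub> h) \<oplus>\<^bsub>stalk P x\<^esub> k = g \<oplus>\<^bsub>stalk P x\<^esub> (h \<oplus>\<^bsub>stalk P x\<^esub> k)"
   using U ring.ring_simprules(7)[OF sec(1)[OF U(1)]] sec(7) by (simp add: simps)
  next
   fix g assume "g : carrier (stalk P x)"
   then obtain U s where U: "local_section x U s" "g = germ P x U s" unfolding stalk_carrier by blast
   interpret ring "sections P U" using sec(1)[OF U(1)] .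
   have m: "local_section x U (\<ominus>\<^bsub>sections P U\<^esub> s)" using U by (simp add: local_section_def)
   show "\<zero>\<^bsub>stalk P x\<^esub> \<oplus>\<^bsub>stalk P x\<^esub> g = g"
   using U sec(7) by (simp add: simps sec(4,6)[OF U(1)])
   show "EX y:carrier (stalk P x). y \<oplus>\<^bsub>stalk P x\<^esub> g = \<zero>\<^bsub>stalk P x\<^esub>"
   using U m sec(7)
   by (intro bexI[of _ "germ P x U (\<ominus>\<^bsub>sections P U\<^esub> s)"]) (simp_all add: simps sec(4)[OF U(1)] l_neg)
  qed (rule zero)
  show "Group.monoid (stalk P x)" proof (rule monoidI)
   fix g h assume g: "g : carrier (stalk P x)" and h: "h : carrier (stalk P x)"
   then obtain U s t where U: "local_section x U s" "local_section x U t" "g = germ P x U s" "h = germ P x U t"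
   using stalk_common by metis
   show "g \<otimes>\<^bsub>stalk P x\<^esub> h : carrier (stalk P x)" using U by (simp add: simps)
   fix k assume k: "k : carrier (stalk P x)"
   obtain U s t u where U: "local_section x U s" "local_section x U t" "local_section x U u"
   "g = germ P x U s" "h = germ P x U t" "k = germ P x U u" using stalk_common3[OF g h k] .
   interpret ring "sections P U" using sec(1)[OF U(1)] .
   show "(g \<otimes>\<^bsub>stalk P x\<^esub> h) \<otimes>\<^bsub>stalk P x\<^esub> k = g \<otimes>\<^bsub>stalk P x\<^esub> (h \<otimes>\<^bsub>stalk P x\<^esub> k)"
   using U sec(7) by (simp add: simps m_assoc)
  next
   fix g assume "g : carrier (stalk P x)"
   then obtain U s where U: "local_section x U s" "g = germ P x U s" unfolding stalk_carrier by blast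
   interpret ring "sections P U" using sec(1)[OF U(1)] .
   show "\<one>\<^bsub>stalk P x\<^esub> \<otimes>\<^bsub>stalk P x\<^esub> g = g" "g \<otimes>\<^bsub>stalk P x\<^esub> \<one>\<^bsub>stalk P x\<^esub> = g"
   using U sec(7) by (simp_all add: simps sec(3,5)[OF U(1)])
  qed (rule one)
 next
  fix g h k assume *: "g : carrier (stalk P x)" "h : carrier (stalk P x)" "k : carrier (stalk P x)"
  obtain U s t u where U: "local_section x U s" "local_section x U t" "local_section x U u"
   "g = germ P x U s" "h = germ P x U t" "k = germ P x U u" using stalk_common3[OF *] .
  interpret ring "sections P U" using sec(1)[OF U(1)] .
  show "(g \<oplus>\<^bsub>stalk P x\<^esub> h) \<otimes>\<^bsub>stalk P x\<^esub> k = g \<otimes>\<^bsub>stalk P x\<^esub> k \<oplus>\<^bsub>stalk P x\<^esub> h \<otimes>\<^bsub>stalk P x\<^esub> k"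
   "k \<otimes>\<^bsub>stalk P x\<^esub> (g \<oplus>\<^bsub>stalk P x\<^esub> h) = k \<otimes>\<^bsub>stalk P x\<^esub> g \<oplus>\<^bsub>stalk P x\<^esub> k \<otimes>\<^bsub>stalk P x\<^esub> h"
   using U sec(7) by (simp_all add: simps l_distr r_distr)
 qed
qed

lemma germ_finsum:
 assumes U: "openin (base P) U" "x : U" and s: "!!i. i : X ==> s i : carrier (sections P U)"
 shows "(\<Oplus>\<^bsub>stalk P x\<^esub>i\<in>X. germ P x U (s i)) = germ P x U (\<Oplus>\<^bsub>sections P U\<^esub>i\<in>X. s i)"
proof -
 interpret U: ring "sections P U" using ring_sections U by blast
 interpret S: ring "stalk P x" using ring_stalk U openin_subset by blast
 show ?thesis using s proof (induction X rule: infinite_finite_induct)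
  case (insert y X)
  then have *: "s : X \<rightarrow> carrier (sections P U)" "s y : carrier (sections P U)" by auto
  then have "local_section x U (s i)" if "i : insert y X" for i using that U by (auto simp: local_section_def)
  then have "(%i. germ P x U (s i)) : X \<rightarrow> carrier (stalk P x)" "germ P x U (s y) : carrier (stalk P x)"
   using germ_closed by auto
  with insert * show ?case using U by (simp add: stalk_add local_section_def)
 qed (simp_all add: stalk_zero[OF U])
qed

end

lemma presheaf_of_rings_if_presheaf_of_algebras:
 assumes "presheaf_of_algebras M" shows "presheaf_of_rings M" proof -
 have alg: "graded_comm_algebra (sections M U)" if "openin (base M) U" for U
  using assms that by (simp add: presheaf_of_algebras_def)
 show ?thesis proof (rule presheaf_of_rings.intro, goal_cases)
  case (1 U)
  then interpret graded_comm_algebra "sections M U" by (rule alg)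
  show ?case by (rule ring_axioms)
 next
  case (3 U s r)
  then interpret graded_comm_algebra "sections M U" by (intro alg)
  show ?case by (rule smult_closed'[OF 3(2)])
 qed (use assms in \<open>simp_all add: presheaf_of_algebras_def graded_hom_def\<close>)
qed

section \<open>Derivations and 1-forms\<close>

locale algebra_presheaf =
 fixes M :: "('m, 'b, 'n::finite) ringed_space"
 assumes presheaf: "presheaf_of_algebras M"
begin

sublocale presheaf_of_rings M by (rule presheaf_of_rings_if_presheaf_of_algebras[OF presheaf])

abbreviation A :: "'m set => ('b, 'n) graded_algebra" where
 "A \<equiv> sections M"

lemma graded_A: "openin (base M) U ==> graded_comm_algebra (A U)"
 using presheaf by (simp add: presheaf_of_algebras_def)

lemma res_graded_hom:
 "openin (base M) U ==> V : opens M U ==> res M U V : graded_hom (A U) (A V)"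
 using presheaf by (simp add: presheaf_of_algebras_def)

lemma res_gcomp:
 "openin (base M) U ==> V : opens M U ==> a : gcomp (A U) d ==> res M U V a : gcomp (A V) d"
 by (rule graded_hom_simps(6)[OF res_graded_hom])

lemma opens_open: "V : opens M U ==> openin (base M) V" by auto

lemma opens_self: "openin (base M) U ==> U : opens M U" by auto

section \<open>Homogeneous derivations\<close>

lemma hderI:
 assumes "D : extensional (opens M U)" and "!!V. V : opens M U ==> D V : extensional (carrier (A V))"
  and "!!V a. V : opens M U ==> a : carrier (A V) ==> D V a : carrier (A V)"
  and "!!V a b. V : opens M U ==> a : carrier (A V) ==> b : carrier (A V) ==>
   D V (a \<oplus>\<^bsub>A V\<^esub> b) = D V a \<oplus>\<^bsub>A V\<^esub> D V b"
  and "!!V r a. V : opens M U ==> a : carrier (A V) ==> D V (r \<odot>\<^bsub>A V\<^esub> a) = r \<odot>\<^bsub>A V\<^esub> D V a"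
  and "!!V dl a. V : opens M U ==> a : gcomp (A V) dl ==> D V a : gcomp (A V) (gm + dl)"
  and "!!V dl a b. V : opens M U ==> a : gcomp (A V) dl ==> b : carrier (A V) ==>
   D V (a \<otimes>\<^bsub>A V\<^esub> b) = (D V a \<otimes>\<^bsub>A V\<^esub> b) \<oplus>\<^bsub>A V\<^esub> (koszul gm dl \<odot>\<^bsub>A V\<^esub> (a \<otimes>\<^bsub>A V\<^esub> D V b))"
  and "!!V W a. V : opens M U ==> W : opens M V ==> a : carrier (A V) ==>
   res M V W (D V a) = D W (res M V W a)" shows "D : HDer M U gm" proof -
 have "D V : carrier (A V) \<rightarrow>\<^sub>E carrier (A V)" if "V : opens M U" for V
  using assms(2,3)[OF that] by (simp add: PiE_def Pi_iff)
 then have "D : (\<Pi>\<^sub>E V\<in>opens M U. carrier (A V) \<rightarrow>\<^sub>E carrier (A V))"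
  using assms(1) unfolding PiE_def[of "opens M U"] Pi_def[of "opens M U"] by blast
 moreover have "D V ` gcomp (A V) dl <= gcomp (A V) (gm + dl)" if "V : opens M U" for V dl
  using assms(6)[OF that] by blast
 ultimately show ?thesis unfolding homogeneous_derivations_def using assms(4,5,7,8) by simp
qed

lemma hderD:
 assumes D: "D : HDer M U gm" shows "D : extensional (opens M U)"
  and "V : opens M U ==> D V : extensional (carrier (A V))"
  and "V : opens M U ==> a : carrier (A V) ==> D V a : carrier (A V)"
  and "V : opens M U ==> a : carrier (A V) ==> b : carrier (A V) ==>
   D V (a \<oplus>\<^bsub>A V\<^esub> b) = D V a \<oplus>\<^bsub>A V\<^esub> D V b"
  and "V : opens M U ==> a : carrier (A V) ==> D V (r \<odot>\<^bsub>A V\<^esub> a) = r \<odot>\<^bsub>A V\<^esub> D V a"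
  and "V : opens M U ==> a : gcomp (A V) dl ==> D V a : gcomp (A V) (gm + dl)"
  and "V : opens M U ==> a : gcomp (A V) dl ==> b : carrier (A V) ==>
   D V (a \<otimes>\<^bsub>A V\<^esub> b) = (D V a \<otimes>\<^bsub>A V\<^esub> b) \<oplus>\<^bsub>A V\<^esub> (koszul gm dl \<odot>\<^bsub>A V\<^esub> (a \<otimes>\<^bsub>A V\<^esub> D V b))"
  and "V : opens M U ==> W : opens M V ==> a : carrier (A V) ==>
   res M V W (D V a) = D W (res M V W a)" proof -
 have E: "D : (\<Pi>\<^sub>E V\<in>opens M U. carrier (A V) \<rightarrow>\<^sub>E carrier (A V))"
  using D by (simp add: homogeneous_derivations_def)
 then show "D : extensional (opens M U)" by (simp add: PiE_def)
 have DV: "V : opens M U ==> D V : carrier (A V) \<rightarrow>\<^sub>E carrier (A V)" for V using E by (rule PiE_mem)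
 show "V : opens M U ==> D V : extensional (carrier (A V))" using DV by (simp add: PiE_def)
 show "V : opens M U ==> a : carrier (A V) ==> D V a : carrier (A V)" using DV by (rule PiE_mem)
qed (use D in \<open>simp_all add: homogeneous_derivations_def image_subset_iff\<close>)

lemma derivation_add_apply:
 "V : opens M U ==> a : carrier (A V) ==> dadd M U D E V a = D V a \<oplus>\<^bsub>A V\<^esub> E V a"
 by (simp add: derivation_add_def)

lemma derivation_scale_apply:
 "V : opens M U ==> a : carrier (A V) ==> dscale M U f D V a = res M U V f \<otimes>\<^bsub>A V\<^esub> D V a"
 by (simp add: derivation_scale_def)

lemma hder_add:
 assumes U: "openin (base M) U" and D: "D : HDer M U gm" and E: "E : HDer M U gm" shows "dadd M U D E : HDer M U gm"
proof (rule hderI)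
 fix V assume V: "V : opens M U"
 interpret A: graded_comm_algebra "A V"
  using graded_A V by blast
 note D' = hderD[OF D] and E' = hderD[OF E]
 note closed = D'(3)[OF V] E'(3)[OF V]
 note app = derivation_add_apply[OF V]
 show "dadd M U D E V : extensional (carrier (A V))" using V by (simp add: derivation_add_def)
 show "dadd M U D E V a : carrier (A V)" if "a : carrier (A V)" for a using that closed by (simp add: app)
 show "dadd M U D E V (a \<oplus>\<^bsub>A V\<^esub> b) = dadd M U D E V a \<oplus>\<^bsub>A V\<^esub> dadd M U D E V b"
  if "a : carrier (A V)" "b : carrier (A V)" for a b
  using that closed by (simp add: app D'(4)[OF V] E'(4)[OF V] A.add.m_ac)
 show "dadd M U D E V (r \<odot>\<^bsub>A V\<^esub> a) = r \<odot>\<^bsub>A V\<^esub> dadd M U D E V a"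
  if "a : carrier (A V)" for r a
  using that closed by (simp add: app D'(5)[OF V] E'(5)[OF V] A.smult_add_right A.smult_closed')
 show "dadd M U D E V a : gcomp (A V) (gm + dl)" if "a : gcomp (A V) dl" for dl a
  using that A.gcomp_closed[OF that] by (simp add: app D'(6)[OF V] E'(6)[OF V] A.gcomp_add)
 show "dadd M U D E V (a \<otimes>\<^bsub>A V\<^esub> b) = (dadd M U D E V a \<otimes>\<^bsub>A V\<^esub> b) \<oplus>\<^bsub>A V\<^esub>
   (koszul gm dl \<odot>\<^bsub>A V\<^esub> (a \<otimes>\<^bsub>A V\<^esub> dadd M U D E V b))"
  if a: "a : gcomp (A V) dl" and b: "b : carrier (A V)" for dl a b using b A.gcomp_closed[OF a] closed
  by (simp add: app D'(7)[OF V a] E'(7)[OF V a] A.smult_add_right A.smult_closed' A.l_distr A.r_distr A.add.m_ac)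
 show "res M V W (dadd M U D E V a) = dadd M U D E W (res M V W a)"
  if W: "W : opens M V" and a: "a : carrier (A V)" for W a
  unfolding app[OF a] res_add[OF opens_open[OF V] W closed[OF a]] D'(8)[OF V W a] E'(8)[OF V W a]
  by (rule derivation_add_apply[symmetric]) (use V W a res_closed in auto)
qed (simp add: derivation_add_def)

text \<open>Moving \<open>f\<close> past an argument costs the sign of their degrees, which together
  with the sign of \<open>D\<close> is the sign of the total degree \<open>dl + gm\<close>.\<close>

lemma hder_scale:
 assumes U: "openin (base M) U" and f: "f : gcomp (A U) dl" and D: "D : HDer M U gm"
 shows "dscale M U f D : HDer M U (dl + gm)" proof (rule hderI)
 fix V assume V: "V : opens M U"
 interpret A: graded_comm_algebra "A V"
  using graded_A V by blast
 note D' = hderD[OF D]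
 let ?f = "res M U V f"
 have f': "?f : gcomp (A V) dl" by (rule res_gcomp[OF U V f])
 note closed = D'(3)[OF V] A.gcomp_closed[OF f']
 note app = derivation_scale_apply[OF V]
 show "dscale M U f D V : extensional (carrier (A V))" using V by (simp add: derivation_scale_def)
 show "dscale M U f D V a : carrier (A V)" if "a : carrier (A V)" for a using that closed by (simp add: app)
 show "dscale M U f D V (a \<oplus>\<^bsub>A V\<^esub> b) = dscale M U f D V a \<oplus>\<^bsub>A V\<^esub> dscale M U f D V b"
  if "a : carrier (A V)" "b : carrier (A V)" for a b using that closed by (simp add: app D'(4)[OF V] A.r_distr)
 show "dscale M U f D V (r \<odot>\<^bsub>A V\<^esub> a) = r \<odot>\<^bsub>A V\<^esub> dscale M U f D V a"
  if "a : carrier (A V)" for r a using that closed by (simp add: app D'(5)[OF V] A.smult_mult_right A.smult_closed')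
 show "dscale M U f D V a : gcomp (A V) (dl + gm + kp)" if "a : gcomp (A V) kp" for kp a
  using A.mult_gcomp[OF f' D'(6)[OF V that]] A.gcomp_closed[OF that] by (simp add: app add.assoc)
 show "dscale M U f D V (a \<otimes>\<^bsub>A V\<^esub> b) = (dscale M U f D V a \<otimes>\<^bsub>A V\<^esub> b) \<oplus>\<^bsub>A V\<^esub>
   (koszul (dl + gm) kp \<odot>\<^bsub>A V\<^esub> (a \<otimes>\<^bsub>A V\<^esub> dscale M U f D V b))"
  if a: "a : gcomp (A V) kp" and b: "b : carrier (A V)" for kp a b proof -
  note c = closed b A.gcomp_closed[OF a]
  have "?f \<otimes>\<^bsub>A V\<^esub> (a \<otimes>\<^bsub>A V\<^esub> D V b) = koszul dl kp \<odot>\<^bsub>A V\<^esub> (a \<otimes>\<^bsub>A V\<^esub> (?f \<otimes>\<^bsub>A V\<^esub> D V b))"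
   using A.graded_comm[OF f' a] c by (simp add: A.m_assoc[symmetric] A.smult_mult_left)
  then show ?thesis
   using c by (simp add: app D'(7)[OF V a b] A.r_distr A.smult_closed' A.smult_mult_right A.smult_smult
   koszul_add_left A.m_assoc mult.commute)
 qed
 show "res M V W (dscale M U f D V a) = dscale M U f D W (res M V W a)"
  if W: "W : opens M V" and a: "a : carrier (A V)" for W a proof -
  interpret AU: graded_comm_algebra "A U"
   using graded_A U by blast
  have "res M V W (?f \<otimes>\<^bsub>A V\<^esub> D V a) = res M V W ?f \<otimes>\<^bsub>A W\<^esub> res M V W (D V a)"
   by (rule res_mult[OF opens_open[OF V] W closed(2) closed(1)[OF a]])
  also have "... = res M U W f \<otimes>\<^bsub>A W\<^esub> D W (res M V W a)"
   unfolding res_res[OF U V W AU.gcomp_closed[OF f]] D'(8)[OF V W a] ..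
  finally show ?thesis unfolding app[OF a] by (subst derivation_scale_apply) (use V W a res_closed in auto)
 qed
qed (simp add: derivation_scale_def)

definition zero_derivation :: "'m set => ('m, 'b) derivation" where
 "zero_derivation U = (\<lambda>V\<in>opens M U. \<lambda>a\<in>carrier (A V). \<zero>\<^bsub>A V\<^esub>)"

text \<open>Zero has every degree, so a homogeneous derivation can be completed to a family over all
  degrees, as the definition of \<open>derivations\<close> demands.\<close>

lemma zero_derivation_homogeneous:
 assumes U: "openin (base M) U" shows "zero_derivation U : HDer M U gm" proof (rule hderI)
 fix V assume V: "V : opens M U"
 interpret A: graded_comm_algebra "A V"
  using graded_A V by blast
 have app: "zero_derivation U V a = \<zero>\<^bsub>A V\<^esub>" if "a : carrier (A V)" for a
  using V that by (simp add: zero_derivation_def)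
 show "zero_derivation U V : extensional (carrier (A V))" using V by (simp add: zero_derivation_def)
 show "zero_derivation U V a : gcomp (A V) (gm + dl)" if "a : gcomp (A V) dl" for dl a
  using A.gcomp_closed[OF that] by (simp add: app A.gcomp_zero)
 show "zero_derivation U V (a \<otimes>\<^bsub>A V\<^esub> b) = (zero_derivation U V a \<otimes>\<^bsub>A V\<^esub> b) \<oplus>\<^bsub>A V\<^esub>
   (koszul gm dl \<odot>\<^bsub>A V\<^esub> (a \<otimes>\<^bsub>A V\<^esub> zero_derivation U V b))"
  if "a : gcomp (A V) dl" "b : carrier (A V)" for dl a b
  using that(2) A.gcomp_closed[OF that(1)] by (simp add: app A.smult_zero_right)
 show "res M V W (zero_derivation U V a) = zero_derivation U W (res M V W a)"
  if W: "W : opens M V" and a: "a : carrier (A V)" for W a unfolding app[OF a] res_zero[OF opens_open[OF V] W]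
  using V W a res_closed[OF opens_open[OF V] W a] by (auto simp: zero_derivation_def)
qed (auto simp: zero_derivation_def graded_comm_algebra.smult_closed'[OF graded_A]
  graded_comm_algebra.smult_zero_right[OF graded_A] ring.ring_simprules[OF ring_sections])

section \<open>Derivations as sums of homogeneous derivations\<close>

lemma derivations_iff:
 "D : derivations M U \<longleftrightarrow> (EX E. (ALL gm. E gm : HDer M U gm) \<and>
  D = (\<lambda>V\<in>opens M U. \<lambda>a\<in>carrier (A V). \<Oplus>\<^bsub>A V\<^esub>gm\<in>UNIV. E gm V a))"
 by (auto simp: derivations_def)

lemma derivation_eqI:
 assumes "D : extensional (opens M U)" "E : extensional (opens M U)"
  and "!!V. V : opens M U ==> D V : extensional (carrier (A V))"
  and "!!V. V : opens M U ==> E V : extensional (carrier (A V))"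
  and "!!V a. V : opens M U ==> a : carrier (A V) ==> D V a = E V a" shows "D = E"
 by (rule extensionalityI[OF assms(1,2)], rule extensionalityI[OF assms(3,4)]) (use assms(5) in auto)

lemma hder_derivation:
 assumes U: "openin (base M) U" and D: "D : HDer M U gm" shows "D : derivations M U" proof -
 define E where "E dl = (if dl = gm then D else zero_derivation U)" for dl
 have E: "E dl : HDer M U dl" for dl using D zero_derivation_homogeneous[OF U] by (simp add: E_def)
 have "D = (\<lambda>V\<in>opens M U. \<lambda>a\<in>carrier (A V). \<Oplus>\<^bsub>A V\<^esub>dl\<in>UNIV. E dl V a)"
 proof (rule derivation_eqI[OF hderD(1)[OF D] _ hderD(2)[OF D]])
  fix V a assume V: "V : opens M U" and a: "a : carrier (A V)"
  interpret A: graded_comm_algebra "A V"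
   using graded_A V by blast
  have "E dl V a = (if gm = dl then D V a else \<zero>\<^bsub>A V\<^esub>)" for dl
   using V a by (auto simp: E_def zero_derivation_def)
  then have "(\<Oplus>\<^bsub>A V\<^esub>dl\<in>UNIV. E dl V a) = D V a"
   using A.finsum_singleton[of gm UNIV "%_. D V a"] hderD(3)[OF D V a] by simp
  then show "D V a = (\<lambda>V\<in>opens M U. \<lambda>a\<in>carrier (A V). \<Oplus>\<^bsub>A V\<^esub>dl\<in>UNIV. E dl V a) V a"
   using V a by simp
 qed auto
 with E show ?thesis unfolding derivations_iff by blast
qed

lemma derivation_add_closed:
 assumes U: "openin (base M) U" and D: "D : derivations M U" and D': "D' : derivations M U"
 shows "dadd M U D D' : derivations M U" proof -
 obtain E where E: "!!gm. E gm : HDer M U gm"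
  "D = (\<lambda>V\<in>opens M U. \<lambda>a\<in>carrier (A V). \<Oplus>\<^bsub>A V\<^esub>gm\<in>UNIV. E gm V a)"
  using D unfolding derivations_iff by blast
 obtain E' where E': "!!gm. E' gm : HDer M U gm"
  "D' = (\<lambda>V\<in>opens M U. \<lambda>a\<in>carrier (A V). \<Oplus>\<^bsub>A V\<^esub>gm\<in>UNIV. E' gm V a)"
  using D' unfolding derivations_iff by blast
 have "dadd M U D D' =
   (\<lambda>V\<in>opens M U. \<lambda>a\<in>carrier (A V). \<Oplus>\<^bsub>A V\<^esub>gm\<in>UNIV. dadd M U (E gm) (E' gm) V a)"
 proof (rule derivation_eqI)
  fix V a assume V: "V : opens M U" and a: "a : carrier (A V)"
  interpret A: graded_comm_algebra "A V"
   using graded_A V by blast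
  have "(%gm. E gm V a) : UNIV \<rightarrow> carrier (A V)" "(%gm. E' gm V a) : UNIV \<rightarrow> carrier (A V)"
   using hderD(3)[OF E(1) V a] hderD(3)[OF E'(1) V a] by auto
  from A.finsum_addf[OF this]
  show "dadd M U D D' V a = (\<lambda>V\<in>opens M U. \<lambda>a\<in>carrier (A V).
   \<Oplus>\<^bsub>A V\<^esub>gm\<in>UNIV. dadd M U (E gm) (E' gm) V a) V a"
   using V a by (simp add: derivation_add_def E(2) E'(2))
 qed (auto simp: derivation_add_def)
 then show ?thesis unfolding derivations_iff using hder_add[OF U E(1) E'(1)]
  by (intro exI[of _ "%gm. dadd M U (E gm) (E' gm)"]) simp
qed

text \<open>The sum over the finitely many degrees is built up one degree at a time, starting from
  the zero derivation, which is itself homogeneous.\<close>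

lemma derivations_induct [consumes 2, case_names homogeneous add]:
 assumes U: "openin (base M) U" and D: "D : derivations M U" and hom: "!!gm D. D : HDer M U gm ==> P D"
  and add: "!!D E. D : derivations M U ==> E : derivations M U ==> P D ==> P E ==> P (dadd M U D E)" shows "P D"
proof -
 obtain E where E: "!!gm. E gm : HDer M U gm"
  "D = (\<lambda>V\<in>opens M U. \<lambda>a\<in>carrier (A V). \<Oplus>\<^bsub>A V\<^esub>gm\<in>UNIV. E gm V a)"
  using D unfolding derivations_iff by blast
 define S where "S X = (\<lambda>V\<in>opens M U. \<lambda>a\<in>carrier (A V). \<Oplus>\<^bsub>A V\<^esub>gm\<in>X. E gm V a)" for X
 have "S X : derivations M U & P (S X)" if "finite X" for X using that proof induction
  case empty
  have "S {} = (\<lambda>V\<in>opens M U. \<lambda>a\<in>carrier (A V). \<zero>\<^bsub>A V\<^esub>)" unfolding S_def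
  proof (rule derivation_eqI)
   fix V a assume V: "V : opens M U" and a: "a : carrier (A V)"
   interpret A: graded_comm_algebra "A V"
   using graded_A V by blast
   show "(\<lambda>V\<in>opens M U. \<lambda>a\<in>carrier (A V). \<Oplus>\<^bsub>A V\<^esub>gm\<in>{}. E gm V a) V a =
   (\<lambda>V\<in>opens M U. \<lambda>a\<in>carrier (A V). \<zero>\<^bsub>A V\<^esub>) V a" using V a by simp
  qed auto
  then have "S {} = zero_derivation U" by (simp add: zero_derivation_def)
  then show ?case using zero_derivation_homogeneous[OF U, of 0] hom hder_derivation[OF U] by metis
 next
  case (insert x X)
  have "S (insert x X) = dadd M U (E x) (S X)" proof (rule derivation_eqI)
   fix V a assume V: "V : opens M U" and a: "a : carrier (A V)"
   interpret A: graded_comm_algebra "A V"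
   using graded_A V by blast
   have "(%gm. E gm V a) : X \<rightarrow> carrier (A V)" "E x V a : carrier (A V)"
   using hderD(3)[OF E(1) V a] by auto
   with insert show "S (insert x X) V a = dadd M U (E x) (S X) V a"
   using V a by (simp add: S_def derivation_add_def)
  qed (auto simp: S_def derivation_add_def)
  then show ?case using insert derivation_add_closed[OF U] hder_derivation[OF U E(1)] hom[OF E(1)] add by simp
 qed
 from this[of UNIV] show ?thesis using E(2) by (simp add: S_def)
qed

lemma derivationD:
 assumes U: "openin (base M) U" and D: "D : derivations M U" shows "D : extensional (opens M U)"
  and "V : opens M U ==> D V : extensional (carrier (A V))"
  and "V : opens M U ==> a : carrier (A V) ==> D V a : carrier (A V)"
  and "V : opens M U ==> W : opens M V ==> a : carrier (A V) ==>
   res M V W (D V a) = D W (res M V W a)" proof -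
 show ext: "D : extensional (opens M U)" and "V : opens M U ==> D V : extensional (carrier (A V))"
  using D unfolding derivations_iff by auto
 have closed: "ALL V a. V : opens M U --> a : carrier (A V) --> D V a : carrier (A V)" if "D : derivations M U" for D
  using U that proof (induction rule: derivations_induct)
  case (homogeneous gm D)
  then show ?case using hderD(3) by blast
 next
  case (add D E)
  have "dadd M U D E V a : carrier (A V)" if "V : opens M U" "a : carrier (A V)" for V a
   unfolding derivation_add_apply[OF that]
   by (rule ring.ring_simprules(1)[OF ring_sections]) (use add that in auto)
  then show ?case by blast
 qed
 from closed[OF D] show "V : opens M U ==> a : carrier (A V) ==> D V a : carrier (A V)" by blast
 have "ALL V W a. V : opens M U --> W : opens M V --> a : carrier (A V) -->
   res M V W (D V a) = D W (res M V W a)" using U D proof (induction rule: derivations_induct)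
  case (homogeneous gm D)
  then show ?case using hderD(8) by blast
 next
  case (add D E)
  have "res M V W (dadd M U D E V a) = dadd M U D E W (res M V W a)"
   if V: "V : opens M U" and W: "W : opens M V" and a: "a : carrier (A V)" for V W a proof -
   have c: "D V a : carrier (A V)" "E V a : carrier (A V)" using closed[OF add(1)] closed[OF add(2)] V a by blast+
   have "W : opens M U" "res M V W a : carrier (A W)" using V W res_closed[OF opens_open[OF V] W a] by auto
   then show ?thesis unfolding derivation_add_apply[OF V a] res_add[OF opens_open[OF V] W c]
   using add V W a by (simp add: derivation_add_apply)
  qed
  then show ?case by blast
 qed
 then show "V : opens M U ==> W : opens M V ==> a : carrier (A V) ==>
   res M V W (D V a) = D W (res M V W a)" by blast
qed

lemma derivation_scale_closed:
 assumes U: "openin (base M) U" and f: "f : carrier (A U)" and D: "D : derivations M U"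
 shows "dscale M U f D : derivations M U" using U D proof (induction rule: derivations_induct)
 case (homogeneous gm D)
 interpret AU: graded_comm_algebra "A U"
  using graded_A U by blast
 from f show ?case proof (induction rule: AU.homogeneous_induct)
  case (homogeneous d a)
  then show ?case using hder_derivation[OF U hder_scale[OF U]] \<open>D : _\<close> by blast
 next
  case (add a b)
  have "dscale M U (a \<oplus>\<^bsub>A U\<^esub> b) D =
   dadd M U (dscale M U a D) (dscale M U b D)" proof (rule derivation_eqI)
   fix V c assume V: "V : opens M U" and c: "c : carrier (A V)"
   interpret A: graded_comm_algebra "A V"
   using graded_A V by blast
   show "dscale M U (a \<oplus>\<^bsub>A U\<^esub> b) D V c =
   dadd M U (dscale M U a D) (dscale M U b D) V c"
   unfolding derivation_add_apply[OF V c] derivation_scale_apply[OF V c]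
   res_add[OF U V add(1,2)]
   using hderD(3)[OF \<open>D : _\<close> V c] res_closed[OF U V] add by (simp add: A.l_distr)
  qed (auto simp: derivation_add_def derivation_scale_def)
  then show ?case using add derivation_add_closed[OF U] by simp
 qed
next
 case (add D E)
 have "dscale M U f (dadd M U D E) =
   dadd M U (dscale M U f D) (dscale M U f E)" proof (rule derivation_eqI)
  fix V c assume V: "V : opens M U" and c: "c : carrier (A V)"
  interpret A: graded_comm_algebra "A V"
   using graded_A V by blast
  show "dscale M U f (dadd M U D E) V c =
   dadd M U (dscale M U f D) (dscale M U f E) V c"
   unfolding derivation_add_apply[OF V c] derivation_scale_apply[OF V c]
   using derivationD(3)[OF U add(1) V c] derivationD(3)[OF U add(2) V c] res_closed[OF U V f]
   by (simp add: A.r_distr)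
 qed (auto simp: derivation_add_def derivation_scale_def)
 then show ?case using add derivation_add_closed[OF U] by simp
qed

lemma hder_restrict:
 assumes "D : HDer M U gm" "W : opens M U" shows "restrict D (opens M W) : HDer M W gm" proof (rule hderI)
 fix V assume V: "V : opens M W"
 then have VU: "V : opens M U" using assms(2) by auto
 note D = hderD[OF assms(1)]
 have *: "restrict D (opens M W) X = D X" if "X : opens M V" for X using that V by auto
 have VV: "V : opens M V" using V by auto
 show "restrict D (opens M W) V : extensional (carrier (A V))" unfolding *[OF VV] by (rule D(2)[OF VU])
 show "restrict D (opens M W) V a : carrier (A V)" if "a : carrier (A V)" for a
  unfolding *[OF VV] by (rule D(3)[OF VU that])
 show "restrict D (opens M W) V (a \<oplus>\<^bsub>A V\<^esub> b) = restrict D (opens M W) V a \<oplus>\<^bsub>A V\<^esub> restrict D (opens M W) V b"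
  if "a : carrier (A V)" "b : carrier (A V)" for a b unfolding *[OF VV] by (rule D(4)[OF VU that])
 show "restrict D (opens M W) V (r \<odot>\<^bsub>A V\<^esub> a) = r \<odot>\<^bsub>A V\<^esub> restrict D (opens M W) V a"
  if "a : carrier (A V)" for r a unfolding *[OF VV] by (rule D(5)[OF VU that])
 show "restrict D (opens M W) V a : gcomp (A V) (gm + dl)" if "a : gcomp (A V) dl" for dl a
  unfolding *[OF VV] by (rule D(6)[OF VU that])
 show "restrict D (opens M W) V (a \<otimes>\<^bsub>A V\<^esub> b) = (restrict D (opens M W) V a \<otimes>\<^bsub>A V\<^esub> b) \<oplus>\<^bsub>A V\<^esub>
   (koszul gm dl \<odot>\<^bsub>A V\<^esub> (a \<otimes>\<^bsub>A V\<^esub> restrict D (opens M W) V b))"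
  if "a : gcomp (A V) dl" "b : carrier (A V)" for dl a b unfolding *[OF VV] by (rule D(7)[OF VU that])
 show "res M V X (restrict D (opens M W) V a) = restrict D (opens M W) X (res M V X a)"
  if "X : opens M V" "a : carrier (A V)" for X a unfolding *[OF VV] *[OF that(1)] by (rule D(8)[OF VU that])
qed simp

lemma derivation_add_restrict:
 assumes "W : opens M U" shows "restrict (dadd M U D E) (opens M W) =
  dadd M W (restrict D (opens M W)) (restrict E (opens M W))" proof
 fix V
 show "restrict (dadd M U D E) (opens M W) V =
   dadd M W (restrict D (opens M W)) (restrict E (opens M W)) V" proof (cases "V : opens M W")
  case True
  then have "V : opens M U" using assms by auto
  then show ?thesis using True by (simp add: derivation_add_def)
 qed (auto simp: derivation_add_def)
qed

lemma derivation_restrict: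
 assumes U: "openin (base M) U" and D: "D : derivations M U" and W: "W : opens M U"
 shows "restrict D (opens M W) : derivations M W" using U D proof (induction rule: derivations_induct)
 case (homogeneous gm D)
 then show ?case using hder_derivation[OF opens_open[OF W] hder_restrict[OF _ W]] by blast
next
 case (add D E)
 then show ?case unfolding derivation_add_restrict[OF W] by (intro derivation_add_closed[OF opens_open[OF W]])
qed

section \<open>1-forms, their operations and their restrictions\<close>

lemma one_formI:
 assumes "om : extensional (opens M U)" and "!!V. V : opens M U ==> om V : extensional (derivations M V)"
  and "!!V D. V : opens M U ==> D : derivations M V ==> om V D : carrier (A V)"
  and "!!V D E. V : opens M U ==> D : derivations M V ==> E : derivations M V ==>
   om V (dadd M V D E) = om V D \<oplus>\<^bsub>A V\<^esub> om V E"
  and "!!V f D. V : opens M U ==> f : carrier (A V) ==> D : derivations M V ==>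
   om V (dscale M V f D) = f \<otimes>\<^bsub>A V\<^esub> om V D"
  and "!!V W D. V : opens M U ==> W : opens M V ==> D : derivations M V ==>
   res M V W (om V D) = om W (restrict D (opens M W))" shows "om : one_forms M U" proof -
 have "om V : derivations M V \<rightarrow>\<^sub>E carrier (A V)" if "V : opens M U" for V
  using assms(2,3)[OF that] by (simp add: PiE_def Pi_iff)
 then have "om : (\<Pi>\<^sub>E V\<in>opens M U. derivations M V \<rightarrow>\<^sub>E carrier (A V))"
  using assms(1) unfolding PiE_def[of "opens M U"] Pi_def[of "opens M U"] by blast
 then show ?thesis unfolding one_forms_def using assms(4-6) by simp
qed

lemma one_formD:
 assumes om: "om : one_forms M U" shows "om : extensional (opens M U)"
  and "V : opens M U ==> om V : extensional (derivations M V)"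
  and "V : opens M U ==> D : derivations M V ==> om V D : carrier (A V)"
  and "V : opens M U ==> D : derivations M V ==> E : derivations M V ==>
   om V (dadd M V D E) = om V D \<oplus>\<^bsub>A V\<^esub> om V E"
  and "V : opens M U ==> f : carrier (A V) ==> D : derivations M V ==>
   om V (dscale M V f D) = f \<otimes>\<^bsub>A V\<^esub> om V D"
  and "V : opens M U ==> W : opens M V ==> D : derivations M V ==>
   res M V W (om V D) = om W (restrict D (opens M W))" proof -
 have E: "om : (\<Pi>\<^sub>E V\<in>opens M U. derivations M V \<rightarrow>\<^sub>E carrier (A V))"
  using om by (simp add: one_forms_def)
 then show "om : extensional (opens M U)" by (simp add: PiE_def)
 have V: "V : opens M U ==> om V : derivations M V \<rightarrow>\<^sub>E carrier (A V)" for V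
  using E by (rule PiE_mem)
 show "V : opens M U ==> om V : extensional (derivations M V)" using V by (simp add: PiE_def)
 show "V : opens M U ==> D : derivations M V ==> om V D : carrier (A V)" using V by (rule PiE_mem)
qed (use om in \<open>simp_all add: one_forms_def\<close>)

lemma one_form_eqI:
 assumes "om : one_forms M U" "et : one_forms M U"
  and "!!V D. V : opens M U ==> D : derivations M V ==> om V D = et V D" shows "om = et"
 by (rule extensionalityI[OF one_formD(1)[OF assms(1)] one_formD(1)[OF assms(2)]],
   rule extensionalityI[OF one_formD(2)[OF assms(1)] one_formD(2)[OF assms(2)]]) (use assms(3) in auto)

lemma one_form_add_closed:
 assumes om: "om : one_forms M U" and et: "et : one_forms M U" shows "one_form_add M U om et : one_forms M U"
proof (rule one_formI)
 fix V assume V: "V : opens M U"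
 then have oV: "openin (base M) V" by simp
 interpret A: graded_comm_algebra "A V"
  using graded_A oV .
 have app: "one_form_add M U om et V D = om V D \<oplus>\<^bsub>A V\<^esub> et V D" if "D : derivations M V" for D
  using that V by (simp add: one_form_add_def)
 note c = one_formD(3)[OF om V] one_formD(3)[OF et V]
 show "one_form_add M U om et V : extensional (derivations M V)" using V by (simp add: one_form_add_def)
 show "one_form_add M U om et V D : carrier (A V)" if "D : derivations M V" for D using that c by (simp add: app)
 show "one_form_add M U om et V (dadd M V D E) =
   one_form_add M U om et V D \<oplus>\<^bsub>A V\<^esub> one_form_add M U om et V E"
  if D: "D : derivations M V" and E: "E : derivations M V" for D E
  unfolding app[OF D] app[OF E] app[OF derivation_add_closed[OF oV D E]]
   one_formD(4)[OF om V D E] one_formD(4)[OF et V D E] using c[OF D] c[OF E] by (simp add: A.add.m_ac)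
 show "one_form_add M U om et V (dscale M V f D) = f \<otimes>\<^bsub>A V\<^esub> one_form_add M U om et V D"
  if f: "f : carrier (A V)" and D: "D : derivations M V" for f D
  unfolding app[OF D] app[OF derivation_scale_closed[OF oV f D]]
   one_formD(5)[OF om V f D] one_formD(5)[OF et V f D] using c[OF D] f by (simp add: A.r_distr)
 show "res M V W (one_form_add M U om et V D) = one_form_add M U om et W (restrict D (opens M W))"
  if W: "W : opens M V" and D: "D : derivations M V" for W D
  unfolding app[OF D] res_add[OF oV W c(1)[OF D] c(2)[OF D]]
   one_formD(6)[OF om V W D] one_formD(6)[OF et V W D]
  using V W derivation_restrict[OF oV D W] by (auto simp: one_form_add_def)
qed (simp add: one_form_add_def)

lemma one_form_scale_closed:
 assumes U: "openin (base M) U" and om: "om : one_forms M U" and f: "f : carrier (A U)"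
 shows "one_form_scale M U om f : one_forms M U" proof (rule one_formI)
 fix V assume V: "V : opens M U"
 then have oV: "openin (base M) V" by simp
 interpret A: graded_comm_algebra "A V"
  using graded_A oV .
 have app: "one_form_scale M U om f V D = om V D \<otimes>\<^bsub>A V\<^esub> res M U V f" if "D : derivations M V" for D
  using that V by (simp add: one_form_scale_def)
 note c = one_formD(3)[OF om V] res_closed[OF U V f]
 show "one_form_scale M U om f V : extensional (derivations M V)" using V by (simp add: one_form_scale_def)
 show "one_form_scale M U om f V D : carrier (A V)" if "D : derivations M V" for D using that c by (simp add: app)
 show "one_form_scale M U om f V (dadd M V D E) =
   one_form_scale M U om f V D \<oplus>\<^bsub>A V\<^esub> one_form_scale M U om f V E"
  if D: "D : derivations M V" and E: "E : derivations M V" for D E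
  unfolding app[OF D] app[OF E] app[OF derivation_add_closed[OF oV D E]]
   one_formD(4)[OF om V D E] using c(1)[OF D] c(1)[OF E] c(2) by (simp add: A.l_distr)
 show "one_form_scale M U om f V (dscale M V g D) = g \<otimes>\<^bsub>A V\<^esub> one_form_scale M U om f V D"
  if g: "g : carrier (A V)" and D: "D : derivations M V" for g D
  unfolding app[OF D] app[OF derivation_scale_closed[OF oV g D]] one_formD(5)[OF om V g D]
  using c(1)[OF D] c(2) g by (simp add: A.m_assoc)
 show "res M V W (one_form_scale M U om f V D) = one_form_scale M U om f W (restrict D (opens M W))"
  if W: "W : opens M V" and D: "D : derivations M V" for W D unfolding app[OF D] res_mult[OF oV W c(1)[OF D] c(2)]
   one_formD(6)[OF om V W D] res_res[OF U V W f]
  using V W derivation_restrict[OF oV D W] by (auto simp: one_form_scale_def)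
qed (simp add: one_form_scale_def)

lemma one_form_restrict:
 assumes om: "om : one_forms M U" and W: "W : opens M U" shows "restrict om (opens M W) : one_forms M W"
proof (rule one_formI)
 fix V assume V: "V : opens M W"
 then have VU: "V : opens M U" using W by auto
 have *: "restrict om (opens M W) X = om X" if "X : opens M V" for X using that V by auto
 have VV: "V : opens M V" using V by auto
 show "restrict om (opens M W) V : extensional (derivations M V)" unfolding *[OF VV] by (rule one_formD(2)[OF om VU])
 show "restrict om (opens M W) V D : carrier (A V)" if "D : derivations M V" for D
  unfolding *[OF VV] by (rule one_formD(3)[OF om VU that])
 show "restrict om (opens M W) V (dadd M V D E) =
   restrict om (opens M W) V D \<oplus>\<^bsub>A V\<^esub> restrict om (opens M W) V E"
  if "D : derivations M V" "E : derivations M V" for D E unfolding *[OF VV] by (rule one_formD(4)[OF om VU that])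
 show "restrict om (opens M W) V (dscale M V f D) = f \<otimes>\<^bsub>A V\<^esub> restrict om (opens M W) V D"
  if "f : carrier (A V)" "D : derivations M V" for f D unfolding *[OF VV] by (rule one_formD(5)[OF om VU that])
 show "res M V X (restrict om (opens M W) V D) = restrict om (opens M W) X (restrict D (opens M X))"
  if "X : opens M V" "D : derivations M V" for X D
  unfolding *[OF VV] *[OF that(1)] by (rule one_formD(6)[OF om VU that])
qed simp

definition zero_form :: "'m set => ('m, 'b) one_form" where
 "zero_form U = (\<lambda>V\<in>opens M U. \<lambda>D\<in>derivations M V. \<zero>\<^bsub>A V\<^esub>)"

lemma zero_form_closed: "zero_form U : one_forms M U" proof (rule one_formI)
 fix V assume V: "V : opens M U"
 then have oV: "openin (base M) V" by simp
 interpret A: graded_comm_algebra "A V"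
  using graded_A oV .
 have app: "zero_form U V D = \<zero>\<^bsub>A V\<^esub>" if "D : derivations M V" for D
  using that V by (simp add: zero_form_def)
 show "zero_form U V : extensional (derivations M V)" using V by (simp add: zero_form_def)
 show "zero_form U V D : carrier (A V)" if "D : derivations M V" for D using that by (simp add: app)
 show "zero_form U V (dadd M V D E) = zero_form U V D \<oplus>\<^bsub>A V\<^esub> zero_form U V E"
  if "D : derivations M V" "E : derivations M V" for D E
  using that derivation_add_closed[OF oV that] by (simp add: app)
 show "zero_form U V (dscale M V f D) = f \<otimes>\<^bsub>A V\<^esub> zero_form U V D"
  if "f : carrier (A V)" "D : derivations M V" for f D
  using that derivation_scale_closed[OF oV that] by (simp add: app)
 show "res M V W (zero_form U V D) = zero_form U W (restrict D (opens M W))"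
  if W: "W : opens M V" and D: "D : derivations M V" for W D unfolding app[OF D] res_zero[OF oV W]
  using V W derivation_restrict[OF oV D W] by (auto simp: zero_form_def)
qed (simp add: zero_form_def)

lemma zero_form_homogeneous: "zero_form U : HForm M U gm" proof -
 have "zero_form U V D : gcomp (A V) (gm + dl)" if V: "V : opens M U" and D: "D : HDer M V dl" for V D dl proof -
  interpret A: graded_comm_algebra "A V"
   using graded_A V by blast
  have "D : derivations M V" using hder_derivation[OF opens_open[OF V] D] .
  then show ?thesis using V A.gcomp_zero by (simp add: zero_form_def)
 qed
 then show ?thesis using zero_form_closed by (simp add: homogeneous_one_forms_def)
qed

lemma homogeneous_one_form_restrict:
 assumes om: "om : HForm M U gm" and W: "W : opens M U" shows "restrict om (opens M W) : HForm M W gm" proof -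
 have "restrict om (opens M W) V D : gcomp (A V) (gm + dl)" if V: "V : opens M W" and D: "D : HDer M V dl" for V D dl
 proof -
  have "V : opens M U" using V W by auto
  then have "om V D : gcomp (A V) (gm + dl)" using om D unfolding homogeneous_one_forms_def by blast
  then show ?thesis using V by simp
 qed
 moreover have "om : one_forms M U" using om by (simp add: homogeneous_one_forms_def)
 ultimately show ?thesis using one_form_restrict[OF _ W] by (simp add: homogeneous_one_forms_def)
qed

lemma one_form_add_restrict:
 assumes "W : opens M U" shows "restrict (one_form_add M U om et) (opens M W) =
  one_form_add M W (restrict om (opens M W)) (restrict et (opens M W))" proof
 fix V
 show "restrict (one_form_add M U om et) (opens M W) V =
   one_form_add M W (restrict om (opens M W)) (restrict et (opens M W)) V" proof (cases "V : opens M W")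
  case True
  then have "V : opens M U" using assms by auto
  then show ?thesis using True by (simp add: one_form_add_def)
 qed (auto simp: one_form_add_def)
qed

lemma one_form_scale_restrict:
 assumes U: "openin (base M) U" and W: "W : opens M U" and f: "f : carrier (A U)"
 shows "restrict (one_form_scale M U om f) (opens M W) =
  one_form_scale M W (restrict om (opens M W)) (res M U W f)" proof
 fix V
 show "restrict (one_form_scale M U om f) (opens M W) V =
   one_form_scale M W (restrict om (opens M W)) (res M U W f) V" proof (cases "V : opens M W")
  case True
  then have "V : opens M U" using W by auto
  then show ?thesis using True res_res[OF U W True f] by (simp add: one_form_scale_def)
 qed (auto simp: one_form_scale_def)
qed

end

section \<open>The exterior algebra\<close>

lemma form_exprs_simps [simp]:
 "Fun a : form_exprs M U \<longleftrightarrow> a : carrier (sections M U)"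
 "Form om : form_exprs M U \<longleftrightarrow> om : one_forms M U"
 "Scal r e : form_exprs M U \<longleftrightarrow> e : form_exprs M U"
 "Add e f : form_exprs M U \<longleftrightarrow> e : form_exprs M U & f : form_exprs M U"
 "Mul e f : form_exprs M U \<longleftrightarrow> e : form_exprs M U & f : form_exprs M U"
 by (auto simp: form_exprs_def)

locale exterior = algebra_presheaf M for M :: "('m, 'b, 1) ringed_space"
begin

section \<open>The exterior algebra over one open set\<close>

context
 fixes U :: "'m set"
 assumes U: "openin (base M) U"
begin

interpretation AU: graded_comm_algebra "A U"
 by (rule graded_A[OF U])

lemma homogeneous_one_form_closed: "om : HForm M U gm ==> om : one_forms M U" by (simp add: homogeneous_one_forms_def)

abbreviation "cls \<equiv> expr_class M U"
abbreviation "EA \<equiv> Ext M U"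

lemma expr_class_eqI: "expr_eq M U e f ==> cls e = cls f"
 unfolding expr_class_def by (auto intro: expr_eq.trans expr_eq.sym)

lemma expr_class_self: "e : form_exprs M U ==> e : cls e" by (simp add: expr_class_def expr_eq.refl)

lemma expr_class_mem: "f : cls e ==> expr_eq M U e f" by (simp add: expr_class_def)

lemma exterior_carrier: "C : carrier EA \<longleftrightarrow> (EX e:form_exprs M U. C = cls e)"
 by (auto simp: exterior_algebra_def)

lemma exterior_mult:
 assumes "e : form_exprs M U" "f : form_exprs M U" shows "cls e \<otimes>\<^bsub>EA\<^esub> cls f = cls (Mul e f)"
proof -
 have "(\<Union>f'\<in>cls f. cls (Mul e' f')) = cls (Mul e f)" if "e' : cls e" for e'
  by (rule Union_eq_const[OF expr_class_self[OF assms(2)]])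
   (intro expr_class_eqI expr_eq.cong_Mul expr_eq.sym[OF expr_class_mem] that)
 then have "(\<Union>e'\<in>cls e. \<Union>f'\<in>cls f. cls (Mul e' f')) = cls (Mul e f)"
  by (rule Union_eq_const[OF expr_class_self[OF assms(1)]])
 then show ?thesis by (simp add: exterior_algebra_def)
qed

lemma exterior_add:
 assumes "e : form_exprs M U" "f : form_exprs M U" shows "cls e \<oplus>\<^bsub>EA\<^esub> cls f = cls (Add e f)"
proof -
 have "(\<Union>f'\<in>cls f. cls (Add e' f')) = cls (Add e f)" if "e' : cls e" for e'
  by (rule Union_eq_const[OF expr_class_self[OF assms(2)]])
   (intro expr_class_eqI expr_eq.cong_Add expr_eq.sym[OF expr_class_mem] that)
 then have "(\<Union>e'\<in>cls e. \<Union>f'\<in>cls f. cls (Add e' f')) = cls (Add e f)"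
  by (rule Union_eq_const[OF expr_class_self[OF assms(1)]])
 then show ?thesis by (simp add: exterior_algebra_def)
qed

lemma exterior_smult:
 assumes "e : form_exprs M U" shows "r \<odot>\<^bsub>EA\<^esub> cls e = cls (Scal r e)" proof -
 have "(\<Union>e'\<in>cls e. cls (Scal r e')) = cls (Scal r e)"
  by (rule Union_eq_const[OF expr_class_self[OF assms(1)]])
   (intro expr_class_eqI expr_eq.cong_Scal expr_eq.sym[OF expr_class_mem])
 then show ?thesis by (simp add: exterior_algebra_def)
qed

lemma exterior_one: "\<one>\<^bsub>EA\<^esub> = cls (Fun \<one>\<^bsub>A U\<^esub>)"
 and exterior_zero: "\<zero>\<^bsub>EA\<^esub> = cls (Fun \<zero>\<^bsub>A U\<^esub>)"
 by (simp_all add: exterior_algebra_def)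

lemma exterior_closed:
 "C : carrier EA ==> D : carrier EA ==> C \<otimes>\<^bsub>EA\<^esub> D : carrier EA"
 "C : carrier EA ==> D : carrier EA ==> C \<oplus>\<^bsub>EA\<^esub> D : carrier EA"
 "C : carrier EA ==> r \<odot>\<^bsub>EA\<^esub> C : carrier EA"
 "e : form_exprs M U ==> cls e : carrier EA"
 by (auto simp: exterior_carrier exterior_mult exterior_add exterior_smult
   intro: form_exprs_simps(3-5)[THEN iffD2])

lemma ring_exterior: "ring EA" proof (rule ringI)
 show "abelian_group EA" proof (rule abelian_groupI)
  show "C \<oplus>\<^bsub>EA\<^esub> D : carrier EA" if "C : carrier EA" "D : carrier EA" for C D
   using that by (rule exterior_closed)
  show "\<zero>\<^bsub>EA\<^esub> : carrier EA" unfolding exterior_zero by (rule exterior_closed) simp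
  show "(C \<oplus>\<^bsub>EA\<^esub> D) \<oplus>\<^bsub>EA\<^esub> E = C \<oplus>\<^bsub>EA\<^esub> (D \<oplus>\<^bsub>EA\<^esub> E)"
   if "C : carrier EA" "D : carrier EA" "E : carrier EA" for C D E
   using that by (clarsimp simp: exterior_carrier exterior_add, intro expr_class_eqI expr_eq.Add_assoc) simp
  show "C \<oplus>\<^bsub>EA\<^esub> D = D \<oplus>\<^bsub>EA\<^esub> C" if "C : carrier EA" "D : carrier EA" for C D
   using that by (clarsimp simp: exterior_carrier exterior_add, intro expr_class_eqI expr_eq.Add_commute) simp
  fix C assume "C : carrier EA"
  then obtain e where e: "e : form_exprs M U" "C = cls e" unfolding exterior_carrier by blast
  then show "\<zero>\<^bsub>EA\<^esub> \<oplus>\<^bsub>EA\<^esub> C = C"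
   by (simp add: exterior_zero exterior_add expr_class_eqI expr_eq.Add_zero)
  show "EX D:carrier EA. D \<oplus>\<^bsub>EA\<^esub> C = \<zero>\<^bsub>EA\<^esub>" proof
   have "cls (Add (Scal (- 1) e) e) = cls (Add e (Scal (- 1) e))"
   using e by (intro expr_class_eqI expr_eq.Add_commute) simp
   also have "... = cls (Fun \<zero>\<^bsub>A U\<^esub>)" using e by (intro expr_class_eqI expr_eq.Add_minus)
   finally show "cls (Scal (- 1) e) \<oplus>\<^bsub>EA\<^esub> C = \<zero>\<^bsub>EA\<^esub>"
   using e by (simp add: exterior_add exterior_zero)
   show "cls (Scal (- 1) e) : carrier EA" using e by (intro exterior_closed) simp
  qed
 qed
 show "Group.monoid EA" proof (rule monoidI)
  show "C \<otimes>\<^bsub>EA\<^esub> D : carrier EA" if "C : carrier EA" "D : carrier EA" for C D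
   using that by (rule exterior_closed)
  show "\<one>\<^bsub>EA\<^esub> : carrier EA" unfolding exterior_one by (rule exterior_closed) simp
  show "(C \<otimes>\<^bsub>EA\<^esub> D) \<otimes>\<^bsub>EA\<^esub> E = C \<otimes>\<^bsub>EA\<^esub> (D \<otimes>\<^bsub>EA\<^esub> E)"
   if "C : carrier EA" "D : carrier EA" "E : carrier EA" for C D E
   using that by (clarsimp simp: exterior_carrier exterior_mult, intro expr_class_eqI expr_eq.Mul_assoc) simp
  show "\<one>\<^bsub>EA\<^esub> \<otimes>\<^bsub>EA\<^esub> C = C" if "C : carrier EA" for C
   using that by (clarsimp simp: exterior_carrier exterior_one exterior_mult,
   intro expr_class_eqI expr_eq.Mul_one_left)
  show "C \<otimes>\<^bsub>EA\<^esub> \<one>\<^bsub>EA\<^esub> = C" if "C : carrier EA" for C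
   using that by (clarsimp simp: exterior_carrier exterior_one exterior_mult,
   intro expr_class_eqI expr_eq.Mul_one_right)
 qed
 show "(C \<oplus>\<^bsub>EA\<^esub> D) \<otimes>\<^bsub>EA\<^esub> E = C \<otimes>\<^bsub>EA\<^esub> E \<oplus>\<^bsub>EA\<^esub> D \<otimes>\<^bsub>EA\<^esub> E"
  if "C : carrier EA" "D : carrier EA" "E : carrier EA" for C D E
  using that by (clarsimp simp: exterior_carrier exterior_mult exterior_add,
   intro expr_class_eqI expr_eq.Mul_Add_left) simp
 show "E \<otimes>\<^bsub>EA\<^esub> (C \<oplus>\<^bsub>EA\<^esub> D) = E \<otimes>\<^bsub>EA\<^esub> C \<oplus>\<^bsub>EA\<^esub> E \<otimes>\<^bsub>EA\<^esub> D"
  if "C : carrier EA" "D : carrier EA" "E : carrier EA" for C D E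
  using that by (clarsimp simp: exterior_carrier exterior_mult exterior_add,
   intro expr_class_eqI expr_eq.Mul_Add_right) simp
qed

lemma exterior_smult_laws:
 assumes "C : carrier EA" "D : carrier EA"
 shows "r \<odot>\<^bsub>EA\<^esub> (C \<oplus>\<^bsub>EA\<^esub> D) = r \<odot>\<^bsub>EA\<^esub> C \<oplus>\<^bsub>EA\<^esub> r \<odot>\<^bsub>EA\<^esub> D"
  "(r + s) \<odot>\<^bsub>EA\<^esub> C = r \<odot>\<^bsub>EA\<^esub> C \<oplus>\<^bsub>EA\<^esub> s \<odot>\<^bsub>EA\<^esub> C"
  "r \<odot>\<^bsub>EA\<^esub> (s \<odot>\<^bsub>EA\<^esub> C) = (r * s) \<odot>\<^bsub>EA\<^esub> C"
  "1 \<odot>\<^bsub>EA\<^esub> C = C"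
  "(r \<odot>\<^bsub>EA\<^esub> C) \<otimes>\<^bsub>EA\<^esub> D = r \<odot>\<^bsub>EA\<^esub> (C \<otimes>\<^bsub>EA\<^esub> D)"
  "C \<otimes>\<^bsub>EA\<^esub> (r \<odot>\<^bsub>EA\<^esub> D) = r \<odot>\<^bsub>EA\<^esub> (C \<otimes>\<^bsub>EA\<^esub> D)"
proof -
 obtain e f where e: "e : form_exprs M U" "C = cls e" and f: "f : form_exprs M U" "D = cls f"
  using assms unfolding exterior_carrier by blast
 note simps = exterior_mult exterior_add exterior_smult
 show "r \<odot>\<^bsub>EA\<^esub> (C \<oplus>\<^bsub>EA\<^esub> D) = r \<odot>\<^bsub>EA\<^esub> C \<oplus>\<^bsub>EA\<^esub> r \<odot>\<^bsub>EA\<^esub> D"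
  using e f by (simp add: simps expr_class_eqI expr_eq.Scal_Add)
 show "(r + s) \<odot>\<^bsub>EA\<^esub> C = r \<odot>\<^bsub>EA\<^esub> C \<oplus>\<^bsub>EA\<^esub> s \<odot>\<^bsub>EA\<^esub> C"
  using e by (simp add: simps expr_class_eqI expr_eq.Scal_plus)
 show "r \<odot>\<^bsub>EA\<^esub> (s \<odot>\<^bsub>EA\<^esub> C) = (r * s) \<odot>\<^bsub>EA\<^esub> C"
  using e by (simp add: simps expr_class_eqI expr_eq.Scal_Scal)
 show "1 \<odot>\<^bsub>EA\<^esub> C = C" using e by (simp add: simps expr_class_eqI expr_eq.Scal_one)
 show "(r \<odot>\<^bsub>EA\<^esub> C) \<otimes>\<^bsub>EA\<^esub> D = r \<odot>\<^bsub>EA\<^esub> (C \<otimes>\<^bsub>EA\<^esub> D)"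
  using e f by (simp add: simps expr_class_eqI expr_eq.Mul_Scal_left)
 show "C \<otimes>\<^bsub>EA\<^esub> (r \<odot>\<^bsub>EA\<^esub> D) = r \<odot>\<^bsub>EA\<^esub> (C \<otimes>\<^bsub>EA\<^esub> D)"
  using e f by (simp add: simps expr_class_eqI expr_eq.Mul_Scal_right)
qed

text \<open>No relation identifies the zero form with the zero function outright. It equals its own
  multiple by the function 0, however, and \<open>Form_scale\<close> turns this into a product with
  zero.\<close>

lemma cls_zero_form: "cls (Form (zero_form U)) = \<zero>\<^bsub>EA\<^esub>" proof -
 interpret ring EA by (rule ring_exterior)
 have "one_form_scale M U (zero_form U) \<zero>\<^bsub>A U\<^esub> = zero_form U"
 proof (rule one_form_eqI[OF one_form_scale_closed[OF U zero_form_closed AU.zero_closed] zero_form_closed])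
  fix V D assume V: "V : opens M U" and D: "D : derivations M V"
  interpret A: graded_comm_algebra "A V"
   using graded_A V by blast
  show "one_form_scale M U (zero_form U) \<zero>\<^bsub>A U\<^esub> V D = zero_form U V D"
   using V D by (simp add: one_form_scale_def zero_form_def res_zero[OF U V])
 qed
 then have "cls (Form (zero_form U)) = cls (Mul (Form (zero_form U)) (Fun \<zero>\<^bsub>A U\<^esub>))"
  using expr_class_eqI[OF expr_eq.Form_scale[OF zero_form_closed AU.zero_closed]] by simp
 also have "... = cls (Form (zero_form U)) \<otimes>\<^bsub>EA\<^esub> \<zero>\<^bsub>EA\<^esub>"
  unfolding exterior_zero by (rule exterior_mult[symmetric]) (auto simp: zero_form_closed)
 also have "... = \<zero>\<^bsub>EA\<^esub>" by (rule r_null) (rule exterior_closed, simp add: zero_form_closed)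
 finally show ?thesis .
qed

lemma exterior_gcomp: "C : gcomp EA d \<longleftrightarrow> (EX e:form_exprs M U. has_bidegree M U e d & C = cls e)"
 by (auto simp: exterior_algebra_def)

lemma exterior_power_iff:
 "C : ExtPow M U k \<longleftrightarrow> (EX e:form_exprs M U. has_form_degree e k & C = cls e)"
 by (auto simp: exterior_power_def)

text \<open>The form degree enters a bidegree only modulo 2, so functions and 1-forms already meet
  every bidegree.\<close>

lemma bidegree_surj: "EX gm. d = bidegree 0 gm | d = bidegree 1 gm" proof -
 have "d = bidegree (if d $ 1 = 0 then 0 else 1) (\<chi> i. d $ 2)"
  unfolding vec_eq_iff forall_2 by (simp add: bidegree_def)
 then show ?thesis by (metis (full_types))
qed

text \<open>\<open>has_bidegree\<close> is a property of expressions and not of their values, so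
  each closure property needs a representative of the right shape.\<close>

lemma exterior_gcomp_closed:
 "C : gcomp EA d ==> C : carrier EA"
 "\<zero>\<^bsub>EA\<^esub> : gcomp EA d"
 "C : gcomp EA d ==> D : gcomp EA d ==> C \<oplus>\<^bsub>EA\<^esub> D : gcomp EA d"
 "C : gcomp EA d ==> r \<odot>\<^bsub>EA\<^esub> C : gcomp EA d"
 "C : gcomp EA d ==> D : gcomp EA d' ==> C \<otimes>\<^bsub>EA\<^esub> D : gcomp EA (d + d')" proof -
 show "C : gcomp EA d ==> C : carrier EA" by (auto simp: exterior_gcomp exterior_carrier)
 show "\<zero>\<^bsub>EA\<^esub> : gcomp EA d" proof -
  \<comment> \<open>Zero needs a representative in every bidegree: the zero function if the first
    component is 0, the zero form if it is 1.\<close>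
  obtain gm where "d = bidegree 0 gm | d = bidegree 1 gm" using bidegree_surj by blast
  then show ?thesis proof
   assume d: "d = bidegree 0 gm"
   show ?thesis unfolding exterior_gcomp exterior_zero
   by (rule bexI[of _ "Fun \<zero>\<^bsub>A U\<^esub>"]) (use d AU.gcomp_zero in auto)
  next
   assume d: "d = bidegree 1 gm"
   show ?thesis unfolding exterior_gcomp by (rule bexI[of _ "Form (zero_form U)"])
   (use d zero_form_homogeneous cls_zero_form zero_form_closed in auto)
  qed
 qed
 show "C : gcomp EA d ==> D : gcomp EA d ==> C \<oplus>\<^bsub>EA\<^esub> D : gcomp EA d"
  unfolding exterior_gcomp by (metis exterior_add form_exprs_simps(4) has_bidegree.simps(4))
 show "C : gcomp EA d ==> r \<odot>\<^bsub>EA\<^esub> C : gcomp EA d"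
  unfolding exterior_gcomp by (metis exterior_smult form_exprs_simps(3) has_bidegree.simps(3))
 show "C : gcomp EA d ==> D : gcomp EA d' ==> C \<otimes>\<^bsub>EA\<^esub> D : gcomp EA (d + d')"
  unfolding exterior_gcomp by (metis exterior_mult form_exprs_simps(5) has_bidegree.simps(5))
qed

lemma exterior_power_closed:
 "C : ExtPow M U k ==> C : carrier EA"
 "\<zero>\<^bsub>EA\<^esub> : ExtPow M U k"
 "C : ExtPow M U k ==> D : ExtPow M U k ==> C \<oplus>\<^bsub>EA\<^esub> D : ExtPow M U k"
 "C : ExtPow M U k ==> r \<odot>\<^bsub>EA\<^esub> C : ExtPow M U k"
 "C : ExtPow M U k ==> D : ExtPow M U l ==> C \<otimes>\<^bsub>EA\<^esub> D : ExtPow M U (k + l)" proof -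
 interpret ring EA by (rule ring_exterior)
 show "C : ExtPow M U k ==> C : carrier EA" by (auto simp: exterior_power_iff exterior_carrier)
 show add: "C : ExtPow M U k ==> D : ExtPow M U k ==> C \<oplus>\<^bsub>EA\<^esub> D : ExtPow M U k"
  unfolding exterior_power_iff by (metis exterior_add form_exprs_simps(4) has_form_degree.simps(4))
 show "C : ExtPow M U k ==> r \<odot>\<^bsub>EA\<^esub> C : ExtPow M U k"
  unfolding exterior_power_iff by (metis exterior_smult form_exprs_simps(3) has_form_degree.simps(3))
 show mult: "C : ExtPow M U k ==> D : ExtPow M U l ==> C \<otimes>\<^bsub>EA\<^esub> D : ExtPow M U (k + l)" for C D k l
  unfolding exterior_power_iff by (metis exterior_mult form_exprs_simps(5) has_form_degree.simps(5))
 show "\<zero>\<^bsub>EA\<^esub> : ExtPow M U k" proof (induction k)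
  case 0
  show ?case unfolding exterior_power_iff exterior_zero by (rule bexI[of _ "Fun \<zero>\<^bsub>A U\<^esub>"]) auto
 next
  \<comment> \<open>In form degree \<open>Suc k\<close>, zero is represented by the zero form times
    a representative in degree \<open>k\<close>.\<close>
  case (Suc k)
  have "cls (Form (zero_form U)) : ExtPow M U 1"
   unfolding exterior_power_iff by (rule bexI[of _ "Form (zero_form U)"]) (auto simp: zero_form_closed)
  from mult[OF this Suc] show ?case by (simp add: cls_zero_form)
 qed
qed

end

section \<open>Restriction of expressions and the exterior presheaf\<close>

definition res_expr :: "'m set => 'm set => ('m, 'b) form_expr => ('m, 'b) form_expr" where
 "res_expr U V = map_expr (res M U V) (%om. restrict om (opens M V))"

lemma res_expr_simps [simp]:
 "res_expr U V (Fun a) = Fun (res M U V a)"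
 "res_expr U V (Form om) = Form (restrict om (opens M V))"
 "res_expr U V (Scal r e) = Scal r (res_expr U V e)"
 "res_expr U V (Add e f) = Add (res_expr U V e) (res_expr U V f)"
 "res_expr U V (Mul e f) = Mul (res_expr U V e) (res_expr U V f)" by (simp_all add: res_expr_def)

lemma res_expr_closed:
 assumes "openin (base M) U" "V : opens M U" "e : form_exprs M U" shows "res_expr U V e : form_exprs M V"
 using assms(3) proof (induction e)
 case (Form om)
 then show ?case using one_form_restrict[OF _ assms(2)] by (simp only: res_expr_simps form_exprs_simps)
qed (simp_all add: res_closed[OF assms(1,2)])

text \<open>Every relation over \<open>U\<close> restricts to a relation of the same kind over
  \<open>V\<close>, so restriction is well defined on classes.\<close>

lemma res_expr_eq:
 assumes U: "openin (base M) U" and V: "V : opens M U" and eq: "expr_eq M U e f"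
 shows "expr_eq M V (res_expr U V e) (res_expr U V f)" using eq proof induction
 case (refl e)
 then show ?case by (intro expr_eq.refl res_expr_closed[OF U V])
next
 case (sym e f)
 then show ?case by (intro expr_eq.sym[OF sym.IH])
next
 case (trans e f g)
 then show ?case by (intro expr_eq.trans[OF trans.IH])
next
 case (cong_Scal e e' r)
 then show ?case by (simp add: expr_eq.cong_Scal)
next
 case (cong_Add e e' f f')
 then show ?case by (simp add: expr_eq.cong_Add)
next
 case (cong_Mul e e' f f')
 then show ?case by (simp add: expr_eq.cong_Mul)
next
 case (Add_assoc e f g)
 then show ?case using res_expr_closed[OF U V] by (simp add: expr_eq.Add_assoc)
next
 case (Add_commute e f)
 then show ?case using res_expr_closed[OF U V] by (simp add: expr_eq.Add_commute)
next
 case (Add_zero e)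
 then show ?case using res_expr_closed[OF U V] by (simp add: expr_eq.Add_zero res_zero[OF U V])
next
 case (Add_minus e)
 then show ?case using res_expr_closed[OF U V] by (simp add: expr_eq.Add_minus res_zero[OF U V])
next
 case (Scal_Add e f r)
 then show ?case using res_expr_closed[OF U V] by (simp add: expr_eq.Scal_Add)
next
 case (Scal_plus e r s)
 then show ?case using res_expr_closed[OF U V] by (simp add: expr_eq.Scal_plus)
next
 case (Scal_Scal e r s)
 then show ?case using res_expr_closed[OF U V] by (simp add: expr_eq.Scal_Scal)
next
 case (Scal_one e)
 then show ?case using res_expr_closed[OF U V] by (simp add: expr_eq.Scal_one)
next
 case (Mul_assoc e f g)
 then show ?case using res_expr_closed[OF U V] by (simp add: expr_eq.Mul_assoc)
next
 case (Mul_one_left e)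
 then show ?case using res_expr_closed[OF U V] by (simp add: expr_eq.Mul_one_left res_one[OF U V])
next
 case (Mul_one_right e)
 then show ?case using res_expr_closed[OF U V] by (simp add: expr_eq.Mul_one_right res_one[OF U V])
next
 case (Mul_Add_left e f g)
 then show ?case using res_expr_closed[OF U V] by (simp add: expr_eq.Mul_Add_left)
next
 case (Mul_Add_right e f g)
 then show ?case using res_expr_closed[OF U V] by (simp add: expr_eq.Mul_Add_right)
next
 case (Mul_Scal_left e f r)
 then show ?case using res_expr_closed[OF U V] by (simp add: expr_eq.Mul_Scal_left)
next
 case (Mul_Scal_right e f r)
 then show ?case using res_expr_closed[OF U V] by (simp add: expr_eq.Mul_Scal_right)
next
 case (Fun_add a b)
 then show ?case using res_closed[OF U V] by (simp add: expr_eq.Fun_add res_add[OF U V])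
next
 case (Fun_smult a r)
 then show ?case using res_closed[OF U V] by (simp add: expr_eq.Fun_smult res_smult[OF U V])
next
 case (Fun_mult a b)
 then show ?case using res_closed[OF U V] by (simp add: expr_eq.Fun_mult res_mult[OF U V])
next
 case (Form_add om et)
 then show ?case
  using one_form_restrict[OF _ V] by (simp only: res_expr_simps one_form_add_restrict[OF V] expr_eq.Form_add insert_subset empty_subsetI simp_thms)
next
 case (Form_scale om a)
 then show ?case using one_form_restrict[OF _ V] res_closed[OF U V]
  by (simp only: res_expr_simps one_form_scale_restrict[OF U V] expr_eq.Form_scale)
next
 case (Fun_Form a gm om dl)
 then show ?case using homogeneous_one_form_restrict[OF _ V] res_gcomp[OF U V]
  by (simp only: res_expr_simps expr_eq.Fun_Form)
next
 case (Form_Form om gm et dl)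
 then show ?case using homogeneous_one_form_restrict[OF _ V] by (simp only: res_expr_simps expr_eq.Form_Form)
qed

lemma exterior_presheaf_simps [simp]:
 "base (ExtP M) = base M"
 "sections (ExtP M) = Ext M" by (simp_all add: exterior_presheaf_def)

lemma exterior_res:
 assumes U: "openin (base M) U" and V: "V : opens M U" and e: "e : form_exprs M U"
 shows "res (ExtP M) U V (expr_class M U e) = expr_class M V (res_expr U V e)" proof -
 have "(\<Union>e'\<in>expr_class M U e. expr_class M V (res_expr U V e')) = expr_class M V (res_expr U V e)"
 proof (rule Union_eq_const[OF expr_class_self[OF U e]])
  fix e' assume "e' : expr_class M U e"
  then show "expr_class M V (res_expr U V e') = expr_class M V (res_expr U V e)"
   by (intro expr_class_eqI[OF opens_open[OF V]] res_expr_eq[OF U V] expr_eq.sym[OF expr_class_mem[OF U]])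
 qed
 then show ?thesis by (simp add: exterior_presheaf_def res_expr_def)
qed

lemma res_expr_id:
 assumes U: "openin (base M) U" and e: "e : form_exprs M U" shows "res_expr U U e = e" proof -
 have "res_expr U U e = map_expr id id e" unfolding res_expr_def proof (rule expr.map_cong0)
  show "res M U U a = id a" if "a : set1_expr e" for a using that e res_id[OF U] by (auto simp: form_exprs_def)
  show "restrict om (opens M U) = id om" if "om : set2_expr e" for om proof -
   have "om : one_forms M U" using that e by (auto simp: form_exprs_def)
   from extensional_restrict[OF one_formD(1)[OF this]] show ?thesis by simp
  qed
 qed
 then show ?thesis by (simp add: expr.map_id)
qed

lemma res_expr_res_expr:
 assumes U: "openin (base M) U" and V: "V : opens M U" and W: "W : opens M V" and e: "e : form_exprs M U"
 shows "res_expr V W (res_expr U V e) = res_expr U W e" proof -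
 have "opens M V Int opens M W = opens M W" using W by auto
 moreover have "set1_expr e <= carrier (A U)" using e by (simp add: form_exprs_def)
 ultimately show ?thesis unfolding res_expr_def expr.map_comp
  by (intro expr.map_cong0) (auto simp: res_res[OF U V W] restrict_restrict)
qed

lemma presheaf_of_rings_exterior: "presheaf_of_rings (ExtP M)"
proof (rule presheaf_of_rings.intro, unfold exterior_presheaf_simps)
 fix U assume U: "openin (base M) U"
 show "ring (Ext M U)" by (rule ring_exterior[OF U])
 show "r \<odot>\<^bsub>Ext M U\<^esub> s : carrier (Ext M U)" if "s : carrier (Ext M U)" for s r
  using that by (rule exterior_closed[OF U])
 show "res (ExtP M) U U s = s" if "s : carrier (Ext M U)" for s
  using that U unfolding exterior_carrier[OF U] by (auto simp: exterior_res[OF U] res_expr_id[OF U])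
 fix V assume V: "V : opens M U"
 note oV = opens_open[OF V]
 note simps = exterior_mult exterior_add exterior_smult
 show "res (ExtP M) U V : ring_hom (Ext M U) (Ext M V)" proof (rule ring_hom_memI)
  fix C assume "C : carrier (Ext M U)"
  then obtain e where e: "e : form_exprs M U" "C = expr_class M U e" unfolding exterior_carrier[OF U] by blast
  note e' = res_expr_closed[OF U V e(1)]
  show "res (ExtP M) U V C : carrier (Ext M V)"
   unfolding e(2) exterior_res[OF U V e(1)] by (rule exterior_closed(4)[OF oV e'])
  fix D assume "D : carrier (Ext M U)"
  then obtain f where f: "f : form_exprs M U" "D = expr_class M U f" unfolding exterior_carrier[OF U] by blast
  note f' = res_expr_closed[OF U V f(1)]
  have m: "Mul e f : form_exprs M U" "Add e f : form_exprs M U" using e f by auto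
  show "res (ExtP M) U V (C \<otimes>\<^bsub>Ext M U\<^esub> D) =
   res (ExtP M) U V C \<otimes>\<^bsub>Ext M V\<^esub> res (ExtP M) U V D"
   unfolding e(2) f(2) exterior_mult[OF U e(1) f(1)] exterior_res[OF U V e(1)] exterior_res[OF U V f(1)]
   exterior_res[OF U V m(1)] exterior_mult[OF oV e' f'] by simp
  show "res (ExtP M) U V (C \<oplus>\<^bsub>Ext M U\<^esub> D) =
   res (ExtP M) U V C \<oplus>\<^bsub>Ext M V\<^esub> res (ExtP M) U V D"
   unfolding e(2) f(2) exterior_add[OF U e(1) f(1)] exterior_res[OF U V e(1)] exterior_res[OF U V f(1)]
   exterior_res[OF U V m(2)] exterior_add[OF oV e' f'] by simp
 next
  have "Fun \<one>\<^bsub>A U\<^esub> : form_exprs M U" using ring.ring_simprules(6)[OF ring_sections[OF U]] by simp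
  from exterior_res[OF U V this]
  show "res (ExtP M) U V \<one>\<^bsub>Ext M U\<^esub> = \<one>\<^bsub>Ext M V\<^esub>"
   by (simp add: exterior_one[OF U] exterior_one[OF oV] res_one[OF U V])
 qed
 show "res (ExtP M) U V (r \<odot>\<^bsub>Ext M U\<^esub> s) =
   r \<odot>\<^bsub>Ext M V\<^esub> res (ExtP M) U V s" if s: "s : carrier (Ext M U)" for s r proof -
  obtain e where e: "e : form_exprs M U" "s = expr_class M U e" using s unfolding exterior_carrier[OF U] by blast
  have m: "Scal r e : form_exprs M U" using e by simp
  show ?thesis unfolding e(2) exterior_smult[OF U e(1)] exterior_res[OF U V e(1)] exterior_res[OF U V m]
   exterior_smult[OF oV res_expr_closed[OF U V e(1)]] by simp
 qed
 fix W assume W: "W : opens M V"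
 show "res (ExtP M) V W (res (ExtP M) U V s) = res (ExtP M) U W s" if s: "s : carrier (Ext M U)" for s proof -
  obtain e where e: "e : form_exprs M U" "s = expr_class M U e" using s unfolding exterior_carrier[OF U] by blast
  have WU: "W : opens M U" using V W by auto
  show ?thesis unfolding e(2) exterior_res[OF U V e(1)] exterior_res[OF U WU e(1)]
   exterior_res[OF oV W res_expr_closed[OF U V e(1)]] res_expr_res_expr[OF U V W e(1)] ..
 qed
qed

end

section \<open>Coordinate frames\<close>

text \<open>A chart in abstract form: coordinates \<open>z j\<close>, dual derivations
  \<open>e j\<close>, and in \<open>kill\<close> the uniqueness that Hadamard's lemma will provide.
  The structure of derivations and 1-forms follows from these data without looking at power
  series.\<close>

locale framed = exterior M for M :: "('m, 'b, 1) ringed_space" +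
 fixes U0 :: "'m set" and m :: nat and gm :: "nat => bit ^ 1" and z :: "nat => 'b"
  and e :: "nat => ('m, 'b) derivation"
 assumes U0: "openin (base M) U0" and z_gcomp: "j < m ==> z j : gcomp (sections M U0) (gm j)"
  and e_homogeneous: "j < m ==> e j : HDer M U0 (gm j)" and e_z: "i < m ==> j < m ==>
   e i U0 (z j) = (if i = j then \<one>\<^bsub>sections M U0\<^esub> else \<zero>\<^bsub>sections M U0\<^esub>)"
  and kill: "W : opens M U0 ==> E : HDer M W dl ==>
   (!!j. j < m ==> E W (res M U0 W (z j)) = \<zero>\<^bsub>sections M W\<^esub>) ==>
   a : carrier (sections M W) ==> E W a = \<zero>\<^bsub>sections M W\<^esub>"
begin

abbreviation coord :: "'m set => nat => 'b" where
 "coord W j \<equiv> res M U0 W (z j)"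

abbreviation frame :: "'m set => nat => ('m, 'b) derivation" where
 "frame W j \<equiv> restrict (e j) (opens M W)"

lemma open_sub: "W : opens M U0 ==> openin (base M) W" by simp

lemma opens_sub: "W : opens M U0 ==> V : opens M W ==> V : opens M U0" by auto

lemma z_closed: "j < m ==> z j : carrier (A U0)" using graded_comm_algebra.gcomp_closed[OF graded_A[OF U0] z_gcomp] .

lemma coord_gcomp: "W : opens M U0 ==> j < m ==> coord W j : gcomp (A W) (gm j)"
 using res_gcomp[OF U0 _ z_gcomp] by blast

lemma coord_closed: "W : opens M U0 ==> j < m ==> coord W j : carrier (A W)"
 using res_closed[OF U0 _ z_closed] by blast

lemma res_coord: "W : opens M U0 ==> V : opens M W ==> j < m ==> res M W V (coord W j) = coord V j"
 using res_res[OF U0 _ _ z_closed] by blast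

lemma frame_homogeneous: "W : opens M U0 ==> j < m ==> frame W j : HDer M W (gm j)"
 using hder_restrict[OF e_homogeneous] by blast

lemma frame_derivation: "W : opens M U0 ==> j < m ==> frame W j : derivations M W"
 using hder_derivation[OF open_sub frame_homogeneous] .

lemma frame_coord:
 assumes "W : opens M U0" "i < m" "j < m"
 shows "e i W (coord W j) = (if i = j then \<one>\<^bsub>A W\<^esub> else \<zero>\<^bsub>A W\<^esub>)" proof -
 have "e i W (coord W j) = res M U0 W (e i U0 (z j))"
  using hderD(8)[OF e_homogeneous[OF assms(2)] opens_self[OF U0] assms(1) z_closed[OF assms(3)]] ..
 then show ?thesis using e_z[OF assms(2,3)] res_one[OF U0 assms(1)] res_zero[OF U0 assms(1)] by simp
qed

lemma e_closed:
 assumes "W : opens M U0" "j < m" "a : carrier (A W)" shows "e j W a : carrier (A W)"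
 by (rule hderD(3)[OF e_homogeneous[OF assms(2)] assms(1,3)])

text \<open>Subtracting the sum from \<open>E\<close> leaves a derivation that is again homogeneous
  of degree \<open>dl\<close> and vanishes on the coordinates, so \<open>kill\<close> applies. The
  induction on \<open>n\<close> removes one coordinate direction at a time and keeps the difference
  a derivation.\<close>

lemma homogeneous_expansion:
 assumes W: "W : opens M U0" and E: "E : HDer M W dl" and a: "a : carrier (A W)"
 shows "E W a = (\<Oplus>\<^bsub>A W\<^esub>j\<in>{..<m}. E W (coord W j) \<otimes>\<^bsub>A W\<^esub> e j W a)"
proof -
 note oW = open_sub[OF W] and WW = opens_self[OF open_sub[OF W]]
 interpret A: graded_comm_algebra "A W"
  by (rule graded_A[OF oW])
 have Ec: "E W (coord W j) : gcomp (A W) (dl + gm j)" if "j < m" for j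
  by (rule hderD(6)[OF E WW coord_gcomp[OF W that]])
 have Ecc: "E W (coord W j) : carrier (A W)" if "j < m" for j using A.gcomp_closed[OF Ec[OF that]] .
 have tm: "E W (coord W j) \<otimes>\<^bsub>A W\<^esub> e j W b : carrier (A W)" if "j < m" "b : carrier (A W)" for j b
  using Ecc e_closed[OF W] that by simp
 have "EX S:HDer M W dl. ALL b:carrier (A W).
   S W b = E W b \<ominus>\<^bsub>A W\<^esub> (\<Oplus>\<^bsub>A W\<^esub>j\<in>{..<n}. E W (coord W j) \<otimes>\<^bsub>A W\<^esub> e j W b)" if "n \<le> m" for n
  using that proof (induction n)
  case 0
  have "E W b = E W b \<ominus>\<^bsub>A W\<^esub> (\<Oplus>\<^bsub>A W\<^esub>j\<in>{..<0}. E W (coord W j) \<otimes>\<^bsub>A W\<^esub> e j W b)"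
   if "b : carrier (A W)" for b using hderD(3)[OF E WW that] by (simp add: A.minus_eq)
  then show ?case using E by blast
 next
  case (Suc n)
  then obtain S where S: "S : HDer M W dl" "!!b. b : carrier (A W) ==>
   S W b = E W b \<ominus>\<^bsub>A W\<^esub> (\<Oplus>\<^bsub>A W\<^esub>j\<in>{..<n}. E W (coord W j) \<otimes>\<^bsub>A W\<^esub> e j W b)"
   by auto
  have n: "n < m" using Suc by simp
  let ?f = "\<ominus>\<^bsub>A W\<^esub> E W (coord W n)"
  let ?S = "dadd M W S (dscale M W ?f (frame W n))"
  have "dscale M W ?f (frame W n) : HDer M W (dl + gm n + gm n)"
   by (rule hder_scale[OF oW A.gcomp_minus[OF Ec[OF n]] frame_homogeneous[OF W n]])
  \<comment> \<open>The value of \<open>E\<close> on the coordinate has degree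
    \<open>dl + gm n\<close>, the frame vector has degree \<open>gm n\<close>, and the two copies of
    \<open>gm n\<close> cancel modulo 2.\<close>
  then have "?S : HDer M W dl" by (intro hder_add[OF oW S(1)]) (simp add: add.assoc)
  moreover have "?S W b = E W b \<ominus>\<^bsub>A W\<^esub> (\<Oplus>\<^bsub>A W\<^esub>j\<in>{..<Suc n}. E W (coord W j) \<otimes>\<^bsub>A W\<^esub> e j W b)"
   if b: "b : carrier (A W)" for b proof -
   have fs: "(%j. E W (coord W j) \<otimes>\<^bsub>A W\<^esub> e j W b) : {..<n} \<rightarrow> carrier (A W)"
   using tm[OF _ b] n by auto
   have c: "E W b : carrier (A W)" "E W (coord W n) : carrier (A W)" "e n W b : carrier (A W)"
   using hderD(3)[OF E WW b] Ecc[OF n] e_closed[OF W n b] by auto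
   have r: "res M W W ?f = ?f" using c by (intro res_id[OF oW]) simp
   have "?S W b = (E W b \<ominus>\<^bsub>A W\<^esub> (\<Oplus>\<^bsub>A W\<^esub>j\<in>{..<n}. E W (coord W j) \<otimes>\<^bsub>A W\<^esub> e j W b)) \<oplus>\<^bsub>A W\<^esub>
   ?f \<otimes>\<^bsub>A W\<^esub> e n W b"
   unfolding derivation_add_apply[OF WW b] derivation_scale_apply[OF WW b] r S(2)[OF b] using WW by simp
   also have "... = E W b \<ominus>\<^bsub>A W\<^esub> (E W (coord W n) \<otimes>\<^bsub>A W\<^esub> e n W b \<oplus>\<^bsub>A W\<^esub>
   (\<Oplus>\<^bsub>A W\<^esub>j\<in>{..<n}. E W (coord W j) \<otimes>\<^bsub>A W\<^esub> e j W b))"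
   using c A.finsum_closed[OF fs] by (simp add: A.minus_eq A.minus_add A.l_minus A.add.m_ac)
   also have "... = E W b \<ominus>\<^bsub>A W\<^esub> (\<Oplus>\<^bsub>A W\<^esub>j\<in>{..<Suc n}. E W (coord W j) \<otimes>\<^bsub>A W\<^esub> e j W b)"
   using fs c by (simp add: lessThan_Suc)
   finally show ?thesis .
  qed
  ultimately show ?case by blast
 qed
 from this[OF order.refl] obtain S where S: "S : HDer M W dl" "!!b. b : carrier (A W) ==>
   S W b = E W b \<ominus>\<^bsub>A W\<^esub> (\<Oplus>\<^bsub>A W\<^esub>j\<in>{..<m}. E W (coord W j) \<otimes>\<^bsub>A W\<^esub> e j W b)"
  by blast
 have "S W (coord W i) = \<zero>\<^bsub>A W\<^esub>" if i: "i < m" for i proof -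
  have "(\<Oplus>\<^bsub>A W\<^esub>j\<in>{..<m}. E W (coord W j) \<otimes>\<^bsub>A W\<^esub> e j W (coord W i)) =
   (\<Oplus>\<^bsub>A W\<^esub>j\<in>{..<m}. if i = j then E W (coord W j) else \<zero>\<^bsub>A W\<^esub>)"
   by (rule A.finsum_cong') (use frame_coord[OF W _ i] Ecc in auto)
  also have "... = E W (coord W i)" by (rule A.finsum_singleton) (use i Ecc in auto)
  finally show ?thesis using Ecc[OF i] by (simp add: S(2)[OF coord_closed[OF W i]] A.minus_eq A.r_neg)
 qed
 from kill[OF W S(1) this a] have "E W a \<ominus>\<^bsub>A W\<^esub> (\<Oplus>\<^bsub>A W\<^esub>j\<in>{..<m}. E W (coord W j) \<otimes>\<^bsub>A W\<^esub> e j W a) = \<zero>\<^bsub>A W\<^esub>"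
  by (simp add: S(2)[OF a])
 moreover have "(\<Oplus>\<^bsub>A W\<^esub>j\<in>{..<m}. E W (coord W j) \<otimes>\<^bsub>A W\<^esub> e j W a) : carrier (A W)"
  using tm[OF _ a] by (intro A.finsum_closed) auto
 moreover have "x = y" if "x \<ominus>\<^bsub>A W\<^esub> y = \<zero>\<^bsub>A W\<^esub>" "x : carrier (A W)" "y : carrier (A W)" for x y
 proof -
  have "x = (x \<ominus>\<^bsub>A W\<^esub> y) \<oplus>\<^bsub>A W\<^esub> y"
   using that(2,3) by (simp add: A.minus_eq A.add.m_assoc A.l_neg)
  then show ?thesis using that by simp
 qed
 ultimately show ?thesis using hderD(3)[OF E WW a] by blast
qed

lemma derivation_expansion:
 assumes W: "W : opens M U0" and D: "D : derivations M W" and V: "V : opens M W" and a: "a : carrier (A V)"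
 shows "D V a = (\<Oplus>\<^bsub>A V\<^esub>j\<in>{..<m}. D V (coord V j) \<otimes>\<^bsub>A V\<^esub> e j V a)"
proof -
 note V0 = opens_sub[OF W V]
 interpret A: graded_comm_algebra "A V"
  using graded_A V by blast
 from open_sub[OF W] D show ?thesis proof (induction rule: derivations_induct)
  case (homogeneous dl D)
  have "V : opens M V" using V by simp
  then show ?case using homogeneous_expansion[OF V0 hder_restrict[OF homogeneous V] a] by simp
 next
  case (add D E)
  have c: "D V (coord V j) \<otimes>\<^bsub>A V\<^esub> e j V a : carrier (A V)" "E V (coord V j) \<otimes>\<^bsub>A V\<^esub> e j V a : carrier (A V)"
   "D V (coord V j) : carrier (A V)" "E V (coord V j) : carrier (A V)" "e j V a : carrier (A V)" if "j < m" for j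
   using derivationD(3)[OF open_sub[OF W] add(1) V coord_closed[OF V0 that]]
   derivationD(3)[OF open_sub[OF W] add(2) V coord_closed[OF V0 that]] e_closed[OF V0 that a] by auto
  have "(\<Oplus>\<^bsub>A V\<^esub>j\<in>{..<m}. dadd M W D E V (coord V j) \<otimes>\<^bsub>A V\<^esub> e j V a) =
   (\<Oplus>\<^bsub>A V\<^esub>j\<in>{..<m}. D V (coord V j) \<otimes>\<^bsub>A V\<^esub> e j V a \<oplus>\<^bsub>A V\<^esub> E V (coord V j) \<otimes>\<^bsub>A V\<^esub> e j V a)"
   by (rule A.finsum_cong')
   (use c in \<open>auto simp: derivation_add_apply[OF V coord_closed[OF V0]] A.l_distr\<close>)
  also have "... = (\<Oplus>\<^bsub>A V\<^esub>j\<in>{..<m}. D V (coord V j) \<otimes>\<^bsub>A V\<^esub> e j V a) \<oplus>\<^bsub>A V\<^esub>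
   (\<Oplus>\<^bsub>A V\<^esub>j\<in>{..<m}. E V (coord V j) \<otimes>\<^bsub>A V\<^esub> e j V a)"
   by (rule A.finsum_addf) (use c in auto)
  finally show ?case unfolding derivation_add_apply[OF V a] using add(3,4) by simp
 qed
qed

section \<open>The differentials of the coordinates as a basis of the 1-forms\<close>

definition diff :: "'m set => nat => ('m, 'b) one_form" where
 "diff W j = (\<lambda>V\<in>opens M W. \<lambda>D\<in>derivations M V. D V (coord V j))"

lemma diff_apply: "V : opens M W ==> D : derivations M V ==> diff W j V D = D V (coord V j)" by (simp add: diff_def)

lemma diff_one_form:
 assumes W: "W : opens M U0" and j: "j < m" shows "diff W j : one_forms M W" proof (rule one_formI)
 fix V assume V: "V : opens M W"
 note V0 = opens_sub[OF W V] and oV = opens_open[OF V] and VV = opens_self[OF opens_open[OF V]]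
 interpret A: graded_comm_algebra "A V"
  by (rule graded_A[OF oV])
 note c = coord_closed[OF V0 j]
 show "diff W j V : extensional (derivations M V)" using V by (simp add: diff_def)
 show "diff W j V D : carrier (A V)" if D: "D : derivations M V" for D
  unfolding diff_apply[OF V D] by (rule derivationD(3)[OF oV D VV c])
 show "diff W j V (dadd M V D E) = diff W j V D \<oplus>\<^bsub>A V\<^esub> diff W j V E"
  if D: "D : derivations M V" and E: "E : derivations M V" for D E
  unfolding diff_apply[OF V D] diff_apply[OF V E] diff_apply[OF V derivation_add_closed[OF oV D E]]
  by (rule derivation_add_apply[OF VV c])
 show "diff W j V (dscale M V f D) = f \<otimes>\<^bsub>A V\<^esub> diff W j V D"
  if f: "f : carrier (A V)" and D: "D : derivations M V" for f D
  unfolding diff_apply[OF V D] diff_apply[OF V derivation_scale_closed[OF oV f D]]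
   derivation_scale_apply[OF VV c] res_id[OF oV f] ..
 show "res M V X (diff W j V D) = diff W j X (restrict D (opens M X))"
  if X: "X : opens M V" and D: "D : derivations M V" for X D proof -
  have X': "X : opens M W" "X : opens M X" using V X by auto
  show ?thesis unfolding diff_apply[OF V D] diff_apply[OF X'(1) derivation_restrict[OF oV D X]]
   derivationD(4)[OF oV D VV X c] res_coord[OF V0 X j] using X'(2) by simp
 qed
qed (simp add: diff_def)

lemma diff_homogeneous:
 assumes W: "W : opens M U0" and j: "j < m" shows "diff W j : HForm M W (gm j)" proof -
 have "diff W j V D : gcomp (A V) (gm j + dl)" if V: "V : opens M W" and D: "D : HDer M V dl" for V D dl
  unfolding diff_apply[OF V hder_derivation[OF opens_open[OF V] D]]
  using hderD(6)[OF D opens_self[OF opens_open[OF V]] coord_gcomp[OF opens_sub[OF W V] j]]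
  by (simp add: add.commute)
 then show ?thesis using diff_one_form[OF W j] by (simp add: homogeneous_one_forms_def)
qed

lemma diff_frame:
 assumes W: "W : opens M U0" and i: "i < m" and j: "j < m"
 shows "diff W j W (frame W i) = (if i = j then \<one>\<^bsub>A W\<^esub> else \<zero>\<^bsub>A W\<^esub>)"
 unfolding diff_apply[OF opens_self[OF open_sub[OF W]] frame_derivation[OF W i]]
 using frame_coord[OF W i j] W by simp

lemma one_form_zero_derivation:
 assumes om: "om : one_forms M W" and V: "V : opens M W"
 shows "om V (zero_derivation V) = \<zero>\<^bsub>A V\<^esub>" proof -
 note oV = opens_open[OF V]
 interpret A: graded_comm_algebra "A V"
  by (rule graded_A[OF oV])
 have zd: "zero_derivation V : derivations M V"
  by (rule hder_derivation[OF oV zero_derivation_homogeneous[OF oV, of 0]])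
 have "dscale M V \<zero>\<^bsub>A V\<^esub> (zero_derivation V) = zero_derivation V" proof (rule derivation_eqI)
  fix X a assume X: "X : opens M V" and a: "a : carrier (A X)"
  interpret AX: graded_comm_algebra "A X"
   using graded_A X by blast
  show "dscale M V \<zero>\<^bsub>A V\<^esub> (zero_derivation V) X a = zero_derivation V X a"
   unfolding derivation_scale_apply[OF X a] using X a by (simp add: zero_derivation_def res_zero[OF oV X])
 qed (auto simp: derivation_scale_def zero_derivation_def)
 then show ?thesis using one_formD(5)[OF om V A.zero_closed zd] one_formD(3)[OF om V zd] by simp
qed

text \<open>The form is applied to the expansion of \<open>D\<close> in the frame. As 1-forms
  respect only sums and multiples of derivations, the partial sums of the expansion are constructed
  as derivations together with the value of the form on them.\<close>

lemma one_form_expansion: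
 assumes W: "W : opens M U0" and om: "om : one_forms M W" and V: "V : opens M W" and D: "D : derivations M V"
 shows "om V D = (\<Oplus>\<^bsub>A V\<^esub>j\<in>{..<m}. D V (coord V j) \<otimes>\<^bsub>A V\<^esub> res M W V (om W (frame W j)))"
proof -
 note V0 = opens_sub[OF W V] and oV = opens_open[OF V] and VV = opens_self[OF opens_open[OF V]]
 interpret A: graded_comm_algebra "A V"
  by (rule graded_A[OF oV])
 have fr: "res M W V (om W (frame W j)) = om V (frame V j)" if "j < m" for j proof -
  have "opens M W Int opens M V = opens M V" using V by auto
  then show ?thesis using one_formD(6)[OF om opens_self[OF open_sub[OF W]] V frame_derivation[OF W that]]
   by (simp add: restrict_restrict)
 qed
 have c: "D V (coord V j) : carrier (A V)" "om V (frame V j) : carrier (A V)" if "j < m" for j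
  using derivationD(3)[OF oV D VV coord_closed[OF V0 that]] one_formD(3)[OF om V frame_derivation[OF V0 that]] .
 have "EX S:derivations M V. (ALL X:opens M V. ALL a:carrier (A X).
   S X a = (\<Oplus>\<^bsub>A X\<^esub>j\<in>{..<n}. res M V X (D V (coord V j)) \<otimes>\<^bsub>A X\<^esub> e j X a)) \<and>
   om V S = (\<Oplus>\<^bsub>A V\<^esub>j\<in>{..<n}. D V (coord V j) \<otimes>\<^bsub>A V\<^esub> om V (frame V j))" if "n \<le> m" for n
  using that proof (induction n)
  case 0
  have zd: "zero_derivation V : derivations M V"
   by (rule hder_derivation[OF oV zero_derivation_homogeneous[OF oV, of 0]])
  have "zero_derivation V X a = (\<Oplus>\<^bsub>A X\<^esub>j\<in>{..<0}. res M V X (D V (coord V j)) \<otimes>\<^bsub>A X\<^esub> e j X a)"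
   if X: "X : opens M V" and a: "a : carrier (A X)" for X a proof -
   interpret AX: graded_comm_algebra "A X"
   using graded_A X by blast
   show ?thesis using X a by (simp add: zero_derivation_def)
  qed
  then show ?case using zd one_form_zero_derivation[OF om V] by (intro bexI[of _ "zero_derivation V"]) auto
 next
  case (Suc n)
  from Suc.IH[OF Suc_leD[OF Suc.prems]] obtain S where S: "S : derivations M V" "!!X a. X : opens M V ==> a : carrier (A X) ==>
   S X a = (\<Oplus>\<^bsub>A X\<^esub>j\<in>{..<n}. res M V X (D V (coord V j)) \<otimes>\<^bsub>A X\<^esub> e j X a)"
   "om V S = (\<Oplus>\<^bsub>A V\<^esub>j\<in>{..<n}. D V (coord V j) \<otimes>\<^bsub>A V\<^esub> om V (frame V j))"
   by blast
  have n: "n < m" using Suc by simp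
  let ?T = "dscale M V (D V (coord V n)) (frame V n)"
  have T: "?T : derivations M V" by (rule derivation_scale_closed[OF oV c(1)[OF n] frame_derivation[OF V0 n]])
  have "dadd M V ?T S X a = (\<Oplus>\<^bsub>A X\<^esub>j\<in>{..<Suc n}. res M V X (D V (coord V j)) \<otimes>\<^bsub>A X\<^esub> e j X a)"
   if X: "X : opens M V" and a: "a : carrier (A X)" for X a proof -
   interpret AX: graded_comm_algebra "A X"
   using graded_A X by blast
   have X0: "X : opens M U0" by (rule opens_sub[OF V0 X])
   have "res M V X (D V (coord V j)) \<otimes>\<^bsub>A X\<^esub> e j X a : carrier (A X)" if "j < m" for j
   using res_closed[OF oV X c(1)[OF that]] e_closed[OF X0 that a] by simp
   then have "(%j. res M V X (D V (coord V j)) \<otimes>\<^bsub>A X\<^esub> e j X a) : {..<n} \<rightarrow> carrier (A X)"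
   "res M V X (D V (coord V n)) \<otimes>\<^bsub>A X\<^esub> e n X a : carrier (A X)" using n by auto
   then show ?thesis unfolding derivation_add_apply[OF X a] derivation_scale_apply[OF X a] S(2)[OF X a]
   using X by (simp add: lessThan_Suc)
  qed
  moreover have "om V (dadd M V ?T S) = (\<Oplus>\<^bsub>A V\<^esub>j\<in>{..<Suc n}. D V (coord V j) \<otimes>\<^bsub>A V\<^esub> om V (frame V j))"
  proof -
   have "(%j. D V (coord V j) \<otimes>\<^bsub>A V\<^esub> om V (frame V j)) : {..<n} \<rightarrow> carrier (A V)"
   "D V (coord V n) \<otimes>\<^bsub>A V\<^esub> om V (frame V n) : carrier (A V)" using n c by auto
   then show ?thesis
   unfolding one_formD(4)[OF om V T S(1)] one_formD(5)[OF om V c(1)[OF n] frame_derivation[OF V0 n]] S(3)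
   by (simp add: lessThan_Suc)
  qed
  ultimately show ?case using derivation_add_closed[OF oV T S(1)] by blast
 qed
 from this[OF order.refl] obtain S where S: "S : derivations M V" "!!X a. X : opens M V ==> a : carrier (A X) ==>
   S X a = (\<Oplus>\<^bsub>A X\<^esub>j\<in>{..<m}. res M V X (D V (coord V j)) \<otimes>\<^bsub>A X\<^esub> e j X a)"
  "om V S = (\<Oplus>\<^bsub>A V\<^esub>j\<in>{..<m}. D V (coord V j) \<otimes>\<^bsub>A V\<^esub> om V (frame V j))"
  by blast
 have "S = D" proof (rule derivation_eqI[OF derivationD(1)[OF oV S(1)] derivationD(1)[OF oV D]
   derivationD(2)[OF oV S(1)] derivationD(2)[OF oV D]])
  fix X a assume X: "X : opens M V" and a: "a : carrier (A X)"
  interpret AX: graded_comm_algebra "A X"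
   using graded_A X by blast
  have X0: "X : opens M U0" by (rule opens_sub[OF V0 X])
  have "S X a = (\<Oplus>\<^bsub>A X\<^esub>j\<in>{..<m}. D X (coord X j) \<otimes>\<^bsub>A X\<^esub> e j X a)"
   unfolding S(2)[OF X a] proof (rule AX.finsum_cong'[OF HOL.refl])
   show "(%j. D X (coord X j) \<otimes>\<^bsub>A X\<^esub> e j X a) : {..<m} \<rightarrow> carrier (A X)"
   using derivationD(3)[OF oV D X coord_closed[OF X0]] e_closed[OF X0 _ a] by auto
   show "res M V X (D V (coord V j)) \<otimes>\<^bsub>A X\<^esub> e j X a = D X (coord X j) \<otimes>\<^bsub>A X\<^esub> e j X a" if "j : {..<m}" for j
   using derivationD(4)[OF oV D VV X coord_closed[OF V0]] res_coord[OF V0 X] that by simp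
  qed
  also have "... = D X a" by (rule derivation_expansion[OF V0 D X a, symmetric])
  finally show "S X a = D X a" .
 qed auto
 then have "om V D = (\<Oplus>\<^bsub>A V\<^esub>j\<in>{..<m}. D V (coord V j) \<otimes>\<^bsub>A V\<^esub> om V (frame V j))"
  using S(3) by simp
 also have "... = (\<Oplus>\<^bsub>A V\<^esub>j\<in>{..<m}. D V (coord V j) \<otimes>\<^bsub>A V\<^esub> res M W V (om W (frame W j)))"
  by (rule A.finsum_cong') (use c fr in auto)
 finally show ?thesis .
qed

text \<open>The partial sums of the expansion are built as actual 1-forms, since
  \<open>Form_add\<close> and \<open>Form_scale\<close> translate operations on 1-forms into
  operations on classes. \<open>one_form_expansion\<close> identifies the last partial sum with the
  given form.\<close>

lemma class_one_form:
 assumes W: "W : opens M U0" and om: "om : one_forms M W"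
 shows "expr_class M W (Form om) = (\<Oplus>\<^bsub>Ext M W\<^esub>j\<in>{..<m}.
  expr_class M W (Form (diff W j)) \<otimes>\<^bsub>Ext M W\<^esub> expr_class M W (Fun (om W (frame W j))))"
proof -
 note oW = open_sub[OF W] and WW = opens_self[OF open_sub[OF W]]
 interpret R: ring "Ext M W"
  by (rule ring_exterior[OF oW])
 define a where "a j = om W (frame W j)" for j
 have a: "a j : carrier (A W)" if "j < m" for j
  unfolding a_def by (rule one_formD(3)[OF om WW frame_derivation[OF W that]])
 let ?t = "%j. expr_class M W (Form (diff W j)) \<otimes>\<^bsub>Ext M W\<^esub> expr_class M W (Fun (a j))"
 have t: "?t j : carrier (Ext M W)" if "j < m" for j
  using a[OF that] diff_one_form[OF W that] by (intro exterior_closed[OF oW]) auto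
 have "EX et:one_forms M W. (ALL V:opens M W. ALL D:derivations M V.
   et V D = (\<Oplus>\<^bsub>A V\<^esub>j\<in>{..<n}. D V (coord V j) \<otimes>\<^bsub>A V\<^esub> res M W V (a j))) \<and>
   expr_class M W (Form et) = (\<Oplus>\<^bsub>Ext M W\<^esub>j\<in>{..<n}. ?t j)" if "n \<le> m" for n using that
 proof (induction n)
  case 0
  have "zero_form W V D = (\<Oplus>\<^bsub>A V\<^esub>j\<in>{..<0}. D V (coord V j) \<otimes>\<^bsub>A V\<^esub> res M W V (a j))"
   if V: "V : opens M W" and D: "D : derivations M V" for V D proof -
   interpret AV: graded_comm_algebra "A V"
   using graded_A V by blast
   show ?thesis using V D by (simp add: zero_form_def)
  qed
  then show ?case using zero_form_closed cls_zero_form[OF oW] by (intro bexI[of _ "zero_form W"]) auto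
 next
  case (Suc n)
  then obtain et where et: "et : one_forms M W" "!!V D. V : opens M W ==> D : derivations M V ==>
   et V D = (\<Oplus>\<^bsub>A V\<^esub>j\<in>{..<n}. D V (coord V j) \<otimes>\<^bsub>A V\<^esub> res M W V (a j))"
   "expr_class M W (Form et) = (\<Oplus>\<^bsub>Ext M W\<^esub>j\<in>{..<n}. ?t j)" by auto
  have n: "n < m" using Suc by simp
  let ?th = "one_form_scale M W (diff W n) (a n)"
  have th: "?th : one_forms M W" by (rule one_form_scale_closed[OF oW diff_one_form[OF W n] a[OF n]])
  have "one_form_add M W ?th et V D = (\<Oplus>\<^bsub>A V\<^esub>j\<in>{..<Suc n}. D V (coord V j) \<otimes>\<^bsub>A V\<^esub> res M W V (a j))"
   if V: "V : opens M W" and D: "D : derivations M V" for V D proof -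
   interpret AV: graded_comm_algebra "A V"
   using graded_A V by blast
   note V0 = opens_sub[OF W V] and oV = opens_open[OF V] and VV = opens_self[OF opens_open[OF V]]
   have "D V (coord V j) \<otimes>\<^bsub>A V\<^esub> res M W V (a j) : carrier (A V)" if "j < m" for j
   using derivationD(3)[OF oV D VV coord_closed[OF V0 that]] res_closed[OF oW V a[OF that]] by simp
   then have "(%j. D V (coord V j) \<otimes>\<^bsub>A V\<^esub> res M W V (a j)) : {..<n} \<rightarrow> carrier (A V)"
   "D V (coord V n) \<otimes>\<^bsub>A V\<^esub> res M W V (a n) : carrier (A V)" using n by auto
   then show ?thesis
   using V D by (simp add: one_form_add_def one_form_scale_def et(2)[OF V D] diff_apply[OF V D] lessThan_Suc)
  qed
  moreover have "expr_class M W (Form (one_form_add M W ?th et)) = (\<Oplus>\<^bsub>Ext M W\<^esub>j\<in>{..<Suc n}. ?t j)"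
  proof -
   have "expr_class M W (Form (one_form_add M W ?th et)) = expr_class M W (Add (Form ?th) (Form et))"
   using th et(1) by (intro expr_class_eqI[OF oW] expr_eq.Form_add) simp
   also have "... = expr_class M W (Form ?th) \<oplus>\<^bsub>Ext M W\<^esub> expr_class M W (Form et)"
   using th et(1) by (intro exterior_add[OF oW, symmetric]) auto
   also have "expr_class M W (Form ?th) = expr_class M W (Mul (Form (diff W n)) (Fun (a n)))"
   using diff_one_form[OF W n] a[OF n] by (intro expr_class_eqI[OF oW] expr_eq.Form_scale)
   also have "... = ?t n" using diff_one_form[OF W n] a[OF n] by (intro exterior_mult[OF oW, symmetric]) auto
   finally have eq: "expr_class M W (Form (one_form_add M W ?th et)) =
   ?t n \<oplus>\<^bsub>Ext M W\<^esub> expr_class M W (Form et)" .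
   have "?t : {..<n} \<rightarrow> carrier (Ext M W)" "?t n : carrier (Ext M W)" using t n by auto
   then show ?thesis unfolding eq et(3) by (simp add: lessThan_Suc)
  qed
  ultimately show ?case using one_form_add_closed[OF th et(1)] by blast
 qed
 from this[OF order.refl] obtain et where et: "et : one_forms M W" "!!V D. V : opens M W ==> D : derivations M V ==>
   et V D = (\<Oplus>\<^bsub>A V\<^esub>j\<in>{..<m}. D V (coord V j) \<otimes>\<^bsub>A V\<^esub> res M W V (a j))"
  "expr_class M W (Form et) = (\<Oplus>\<^bsub>Ext M W\<^esub>j\<in>{..<m}. ?t j)" by blast
 have "et = om" by (rule one_form_eqI[OF et(1) om]) (simp add: et(2) one_form_expansion[OF W om] a_def)
 then show ?thesis using et(3) by (simp add: a_def)
qed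

end

subsection \<open>Ordered monomials\<close>

text \<open>For an arbitrary ring, so that the same monomial can be formed in the exterior algebra
  and in a model of it, and compared by a homomorphism.\<close>

primrec ordered_monom :: "('a, 'c) ring_scheme => (nat => 'a) => (nat => nat) => nat => 'a" where
 "ordered_monom R d mu 0 = \<one>\<^bsub>R\<^esub>"
| "ordered_monom R d mu (Suc k) = ordered_monom R d mu k \<otimes>\<^bsub>R\<^esub> (d k [^]\<^bsub>R\<^esub> mu k)"

lemma ordered_monom_closed:
 assumes "ring R" "!!j. j < k ==> d j : carrier R" shows "ordered_monom R d mu k : carrier R" proof -
 interpret ring R by fact
 show ?thesis using assms(2) by (induction k) auto
qed

lemma ordered_monom_cong: "(!!j. j < k ==> mu j = nu j) ==> ordered_monom R d mu k = ordered_monom R d nu k"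
 by (induction k) auto

lemma ordered_monom_hom:
 assumes h: "h : ring_hom R S" and R: "ring R" and S: "ring S" and d: "!!j. j < k ==> d j : carrier R"
 shows "h (ordered_monom R d mu k) = ordered_monom S (%j. h (d j)) mu k" proof -
 interpret R: ring R by fact
 interpret S: ring S by fact
 have pow: "h (x [^]\<^bsub>R\<^esub> n) = h x [^]\<^bsub>S\<^esub> n" if "x : carrier R" for x and n :: nat
  using that by (induction n) (simp_all add: ring_hom_mult[OF h] ring_hom_one[OF h])
 show ?thesis using d by (induction k)
   (simp_all add: ring_hom_mult[OF h] ring_hom_one[OF h] pow ordered_monom_closed[OF R])
qed

text \<open>The exponents of the differentials in a normal form: the differential of an even
  coordinate squares to zero, that of an odd coordinate may occur to any power.\<close>

definition admissible :: "nat => (nat => bit ^ 1) => (nat => nat) set" where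
 "admissible m gm = {mu. (\<forall>j\<ge>m. mu j = 0) & (\<forall>j<m. gm j = 0 --> mu j \<le> 1)}"

lemma koszul_bidegree:
 "koszul (bidegree k gm) (bidegree l dl) = bsign (of_nat (k * l)) * koszul gm dl" proof -
 have "(\<Sum>i\<in>UNIV. bidegree k gm $ i * bidegree l dl $ i) = of_nat (k * l) + gm $ 1 * dl $ 1"
  unfolding sum_2 of_nat_mult by (simp add: bidegree_def)
 then show ?thesis unfolding koszul_bsign[of "bidegree k gm"] koszul_bsign[of gm] sum_1 by (simp only: bsign_add)
qed

lemma bidegree_add: "bidegree k gm + bidegree l dl = bidegree (k + l) (gm + dl)"
 unfolding vec_eq_iff forall_2 vector_add_component bidegree_def vec_lambda_beta of_nat_add by simp

lemma koszul_bidegree_one_zero: "koszul (bidegree 1 0) (bidegree 1 0) = - 1" by (simp add: koszul_bidegree bsign_def)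

context framed
begin

context
 fixes W :: "'m set"
 assumes W: "W : opens M U0"
begin

interpretation AW: graded_comm_algebra "A W"
 by (rule graded_A[OF open_sub[OF W]])

abbreviation "R \<equiv> Ext M W"

interpretation R: ring R
 by (rule ring_exterior[OF open_sub[OF W]])

definition Fn :: "'b => ('m, 'b) form_expr set" where
 "Fn a = expr_class M W (Fun a)"

definition Dz :: "nat => ('m, 'b) form_expr set" where
 "Dz j = expr_class M W (Form (diff W j))"

abbreviation monom :: "(nat => nat) => nat => ('m, 'b) form_expr set" where
 "monom \<equiv> ordered_monom R Dz"

lemma Fn_closed: "a : carrier (A W) ==> Fn a : carrier R"
 unfolding Fn_def by (rule exterior_closed[OF open_sub[OF W]]) simp

lemma Dz_closed: "j < m ==> Dz j : carrier R"
 unfolding Dz_def by (rule exterior_closed[OF open_sub[OF W]]) (simp add: diff_one_form[OF W])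

lemma monom_closed: "k \<le> m ==> monom mu k : carrier R"
 by (rule ordered_monom_closed[OF R.ring_axioms]) (use Dz_closed in auto)

lemma smult_R_closed: "x : carrier R ==> r \<odot>\<^bsub>R\<^esub> x : carrier R"
 by (rule exterior_closed(3)[OF open_sub[OF W]])

lemmas smult_R_laws = exterior_smult_laws[OF open_sub[OF W]]

lemma Fn_mult: "a : carrier (A W) ==> b : carrier (A W) ==> Fn (a \<otimes>\<^bsub>A W\<^esub> b) = Fn a \<otimes>\<^bsub>R\<^esub> Fn b"
 unfolding Fn_def using expr_class_eqI[OF open_sub[OF W] expr_eq.Fun_mult, of a b]
 by (simp add: exterior_mult[OF open_sub[OF W]])

lemma Fn_add: "a : carrier (A W) ==> b : carrier (A W) ==> Fn (a \<oplus>\<^bsub>A W\<^esub> b) = Fn a \<oplus>\<^bsub>R\<^esub> Fn b"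
 unfolding Fn_def using expr_class_eqI[OF open_sub[OF W] expr_eq.Fun_add, of a b]
 by (simp add: exterior_add[OF open_sub[OF W]])

lemma Fn_smult: "a : carrier (A W) ==> Fn (r \<odot>\<^bsub>A W\<^esub> a) = r \<odot>\<^bsub>R\<^esub> Fn a"
 unfolding Fn_def using expr_class_eqI[OF open_sub[OF W] expr_eq.Fun_smult, of a r]
 by (simp add: exterior_smult[OF open_sub[OF W]])

lemma Fn_one: "Fn \<one>\<^bsub>A W\<^esub> = \<one>\<^bsub>R\<^esub>" and Fn_zero: "Fn \<zero>\<^bsub>A W\<^esub> = \<zero>\<^bsub>R\<^esub>"
 by (simp_all add: Fn_def exterior_one[OF open_sub[OF W]] exterior_zero[OF open_sub[OF W]])

text \<open>For a spanning argument some scalar suffices, which keeps the signs out of the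
  inductions on normal forms.\<close>

lemma Dz_Fn:
 assumes a: "a : gcomp (A W) dl" and j: "j < m"
 shows "EX r. Dz j \<otimes>\<^bsub>R\<^esub> Fn a = r \<odot>\<^bsub>R\<^esub> (Fn a \<otimes>\<^bsub>R\<^esub> Dz j)"
proof
 let ?k = "koszul (bidegree 0 dl) (bidegree 1 (gm j))"
 have ac: "a : carrier (A W)" using a by (rule AW.gcomp_closed)
 have "Fn a \<otimes>\<^bsub>R\<^esub> Dz j = ?k \<odot>\<^bsub>R\<^esub> (Dz j \<otimes>\<^bsub>R\<^esub> Fn a)"
  using expr_class_eqI[OF open_sub[OF W] expr_eq.Fun_Form[OF a diff_homogeneous[OF W j]]] ac diff_one_form[OF W j]
  by (simp add: Fn_def Dz_def exterior_mult[OF open_sub[OF W]] exterior_smult[OF open_sub[OF W]])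
 then show "Dz j \<otimes>\<^bsub>R\<^esub> Fn a = ?k \<odot>\<^bsub>R\<^esub> (Fn a \<otimes>\<^bsub>R\<^esub> Dz j)"
  using Fn_closed[OF ac] Dz_closed[OF j] by (simp add: smult_R_laws(3,4)[of _ "\<zero>\<^bsub>R\<^esub>"])
qed

lemma Dz_Dz:
 assumes i: "i < m" and j: "j < m"
 shows "Dz i \<otimes>\<^bsub>R\<^esub> Dz j = koszul (bidegree 1 (gm i)) (bidegree 1 (gm j)) \<odot>\<^bsub>R\<^esub> (Dz j \<otimes>\<^bsub>R\<^esub> Dz i)"
 using expr_class_eqI[OF open_sub[OF W] expr_eq.Form_Form[OF diff_homogeneous[OF W i] diff_homogeneous[OF W j]]]
  diff_one_form[OF W i] diff_one_form[OF W j]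
 by (simp add: Dz_def exterior_mult[OF open_sub[OF W]] exterior_smult[OF open_sub[OF W]])

lemma Dz_pow:
 assumes i: "i < m" and j: "j < m"
 shows "EX r. Dz j \<otimes>\<^bsub>R\<^esub> (Dz i [^]\<^bsub>R\<^esub> (n::nat)) = r \<odot>\<^bsub>R\<^esub> ((Dz i [^]\<^bsub>R\<^esub> n) \<otimes>\<^bsub>R\<^esub> Dz j)"
proof (induction n)
 case 0
 show ?case using Dz_closed[OF j] by (intro exI[of _ 1]) (simp add: smult_R_laws(4)[of _ "\<zero>\<^bsub>R\<^esub>"])
next
 case (Suc n)
 then obtain r where r: "Dz j \<otimes>\<^bsub>R\<^esub> (Dz i [^]\<^bsub>R\<^esub> n) = r \<odot>\<^bsub>R\<^esub> ((Dz i [^]\<^bsub>R\<^esub> n) \<otimes>\<^bsub>R\<^esub> Dz j)"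
  by blast
 let ?p = "Dz i [^]\<^bsub>R\<^esub> n" and ?s = "koszul (bidegree 1 (gm j)) (bidegree 1 (gm i))"
 have c: "?p : carrier R" "Dz i : carrier R" "Dz j : carrier R" using Dz_closed i j by auto
 have "Dz j \<otimes>\<^bsub>R\<^esub> (?p \<otimes>\<^bsub>R\<^esub> Dz i) = (r \<odot>\<^bsub>R\<^esub> (?p \<otimes>\<^bsub>R\<^esub> Dz j)) \<otimes>\<^bsub>R\<^esub> Dz i"
  using c r by (simp add: R.m_assoc[symmetric])
 also have "... = r \<odot>\<^bsub>R\<^esub> (?p \<otimes>\<^bsub>R\<^esub> (Dz j \<otimes>\<^bsub>R\<^esub> Dz i))"
  using c by (simp add: smult_R_laws(5) R.m_assoc)
 also have "... = r \<odot>\<^bsub>R\<^esub> (?s \<odot>\<^bsub>R\<^esub> (?p \<otimes>\<^bsub>R\<^esub> (Dz i \<otimes>\<^bsub>R\<^esub> Dz j)))"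
  using c by (simp add: Dz_Dz[OF j i] smult_R_laws(6))
 also have "... = (r * ?s) \<odot>\<^bsub>R\<^esub> ((?p \<otimes>\<^bsub>R\<^esub> Dz i) \<otimes>\<^bsub>R\<^esub> Dz j)"
  using c by (simp add: smult_R_laws(3)[of _ "\<zero>\<^bsub>R\<^esub>"] R.m_assoc)
 finally show ?case by auto
qed

lemma Dz_monom_commute:
 assumes "k \<le> m" and j: "j < m"
 shows "EX r. Dz j \<otimes>\<^bsub>R\<^esub> monom mu k = r \<odot>\<^bsub>R\<^esub> (monom mu k \<otimes>\<^bsub>R\<^esub> Dz j)"
 using assms(1) proof (induction k)
 case 0
 show ?case using Dz_closed[OF j] by (intro exI[of _ 1]) (simp add: smult_R_laws(4)[of _ "\<zero>\<^bsub>R\<^esub>"])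
next
 case (Suc k)
 then obtain r where r: "Dz j \<otimes>\<^bsub>R\<^esub> monom mu k = r \<odot>\<^bsub>R\<^esub> (monom mu k \<otimes>\<^bsub>R\<^esub> Dz j)"
  by auto
 have k: "k < m" using Suc by simp
 let ?p = "Dz k [^]\<^bsub>R\<^esub> mu k"
 obtain s where s: "Dz j \<otimes>\<^bsub>R\<^esub> ?p = s \<odot>\<^bsub>R\<^esub> (?p \<otimes>\<^bsub>R\<^esub> Dz j)"
  using Dz_pow[OF k j] by blast
 have c: "?p : carrier R" "monom mu k : carrier R" "Dz j : carrier R" using Dz_closed j k monom_closed by auto
 have "Dz j \<otimes>\<^bsub>R\<^esub> (monom mu k \<otimes>\<^bsub>R\<^esub> ?p) = (r \<odot>\<^bsub>R\<^esub> (monom mu k \<otimes>\<^bsub>R\<^esub> Dz j)) \<otimes>\<^bsub>R\<^esub> ?p"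
  using c r by (simp add: R.m_assoc[symmetric])
 also have "... = r \<odot>\<^bsub>R\<^esub> (monom mu k \<otimes>\<^bsub>R\<^esub> (Dz j \<otimes>\<^bsub>R\<^esub> ?p))"
  using c by (simp add: smult_R_laws(5) R.m_assoc)
 also have "... = (r * s) \<odot>\<^bsub>R\<^esub> ((monom mu k \<otimes>\<^bsub>R\<^esub> ?p) \<otimes>\<^bsub>R\<^esub> Dz j)"
  using c by (simp add: s smult_R_laws(6) smult_R_laws(3)[of _ "\<zero>\<^bsub>R\<^esub>"] R.m_assoc)
 finally show ?case by auto
qed

lemma Dz_monom:
 assumes "k \<le> m" and "j < k"
 shows "EX r. Dz j \<otimes>\<^bsub>R\<^esub> monom mu k = r \<odot>\<^bsub>R\<^esub> monom (incr j mu) k"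
 using assms proof (induction k)
 case (Suc k)
 have k: "k < m" and j: "j < m" using Suc by auto
 let ?p = "Dz k [^]\<^bsub>R\<^esub> mu k"
 have c: "?p : carrier R" "monom mu k : carrier R" "monom (incr j mu) k : carrier R" "Dz j : carrier R"
  using Dz_closed j k monom_closed by auto
 show ?case proof (cases "j = k")
  case True
  obtain r where r: "Dz j \<otimes>\<^bsub>R\<^esub> monom mu k = r \<odot>\<^bsub>R\<^esub> (monom mu k \<otimes>\<^bsub>R\<^esub> Dz j)"
   using Dz_monom_commute[OF _ j] k by (meson less_imp_le)
  have "monom mu k = monom (incr j mu) k" by (rule ordered_monom_cong) (use True in auto)
  moreover have "Dz j \<otimes>\<^bsub>R\<^esub> (monom mu k \<otimes>\<^bsub>R\<^esub> ?p) = r \<odot>\<^bsub>R\<^esub> (monom mu k \<otimes>\<^bsub>R\<^esub> (Dz j \<otimes>\<^bsub>R\<^esub> ?p))"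
   using c r by (simp add: R.m_assoc[symmetric] smult_R_laws(5))
  moreover have "Dz j \<otimes>\<^bsub>R\<^esub> ?p = Dz k [^]\<^bsub>R\<^esub> (incr j mu) k"
   using True R.nat_pow_Suc2[OF Dz_closed[OF k]] by simp
  ultimately show ?thesis by auto
 next
  case False
  then obtain r where r: "Dz j \<otimes>\<^bsub>R\<^esub> monom mu k = r \<odot>\<^bsub>R\<^esub> monom (incr j mu) k"
   using Suc by (metis Suc_leD less_antisym)
  have "Dz j \<otimes>\<^bsub>R\<^esub> (monom mu k \<otimes>\<^bsub>R\<^esub> ?p) = r \<odot>\<^bsub>R\<^esub> (monom (incr j mu) k \<otimes>\<^bsub>R\<^esub> ?p)"
   using c r by (simp add: R.m_assoc[symmetric] smult_R_laws(5))
  then show ?thesis using False by auto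
 qed
qed simp

text \<open>The differential of an even coordinate commutes with itself up to the sign
  \<open>-1\<close>, so twice its square is zero; the real scalar \<open>1 / 2\<close> removes the
  factor.\<close>

lemma Dz_square:
 assumes "j < m" "gm j = 0" shows "Dz j \<otimes>\<^bsub>R\<^esub> Dz j = \<zero>\<^bsub>R\<^esub>" proof -
 let ?d = "Dz j \<otimes>\<^bsub>R\<^esub> Dz j"
 have c: "?d : carrier R" using Dz_closed assms by simp
 have "?d = (- 1) \<odot>\<^bsub>R\<^esub> ?d"
  using Dz_Dz[OF assms(1) assms(1)] assms(2) koszul_bidegree_one_zero by simp
 then have "?d \<oplus>\<^bsub>R\<^esub> ?d = (1 + (- 1)) \<odot>\<^bsub>R\<^esub> ?d"
  using smult_R_laws(2)[OF c c, of 1 "- 1"] smult_R_laws(4)[OF c c] by simp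
 also have "... = (0 + 0) \<odot>\<^bsub>R\<^esub> ?d" by simp
 finally have "(1 / 2) \<odot>\<^bsub>R\<^esub> (?d \<oplus>\<^bsub>R\<^esub> ?d) = 0 \<odot>\<^bsub>R\<^esub> ?d"
  using smult_R_laws(3)[OF c c, of "1 / 2" 0] by simp
 moreover have "(1 / 2) \<odot>\<^bsub>R\<^esub> (?d \<oplus>\<^bsub>R\<^esub> ?d) = (1 / 2 + 1 / 2) \<odot>\<^bsub>R\<^esub> ?d"
  unfolding smult_R_laws(1)[OF c c] smult_R_laws(2)[OF c c] ..
 moreover have "0 \<odot>\<^bsub>R\<^esub> ?d = \<zero>\<^bsub>R\<^esub>"
  using smult_R_laws(2)[OF c c, of 0 0] smult_R_closed[OF c, of 0] by (metis R.add.r_cancel_one' add_0)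
 ultimately show ?thesis using smult_R_laws(4)[OF c c] by simp
qed

lemma monom_not_admissible:
 assumes "j < k" "k \<le> m" "gm j = 0" "mu j \<ge> 2" shows "monom mu k = \<zero>\<^bsub>R\<^esub>" using assms(1,2)
proof (induction k)
 case (Suc k)
 have k: "k < m" using Suc by simp
 show ?case proof (cases "j = k")
  case True
  obtain n where n: "mu k = n + 2" using assms(4) True by (metis add.commute le_Suc_ex)
  have "Dz k [^]\<^bsub>R\<^esub> mu k = (Dz k [^]\<^bsub>R\<^esub> n) \<otimes>\<^bsub>R\<^esub> (Dz k \<otimes>\<^bsub>R\<^esub> Dz k)"
   unfolding n using Dz_closed[OF k] by (simp add: numeral_2_eq_2 R.m_assoc)
  also have "... = \<zero>\<^bsub>R\<^esub>" using Dz_square[OF k] Dz_closed[OF k] True assms(3) by simp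
  finally show ?thesis using monom_closed[of k] k by simp
 next
  case False
  then show ?thesis using Suc Dz_closed[OF k] by simp
 qed
qed simp

text \<open>Inductive rather than explicit finite sums: closure under left multiplication is then an
  induction, and a sum with one coefficient per monomial is produced only at the end, in
  \<open>normal_form\<close>.\<close>

inductive_set normal_forms :: "('m, 'b) form_expr set set" where
 monomial: "a : carrier (A W) ==> mu : admissible m gm ==> Fn a \<otimes>\<^bsub>R\<^esub> monom mu m : normal_forms"
| sum: "x : normal_forms ==> y : normal_forms ==> x \<oplus>\<^bsub>R\<^esub> y : normal_forms"

lemma normal_forms_closed: "x : normal_forms ==> x : carrier R"
 by (induction rule: normal_forms.induct) (auto simp: Fn_closed monom_closed)

lemma normal_forms_monom:
 assumes a: "a : carrier (A W)" shows "Fn a \<otimes>\<^bsub>R\<^esub> monom mu m : normal_forms"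
proof (cases "EX j<m. gm j = 0 & mu j \<ge> 2")
 case True
 have "monom mu m = \<zero>\<^bsub>R\<^esub>" using True monom_not_admissible by blast
 then have "Fn a \<otimes>\<^bsub>R\<^esub> monom mu m = Fn \<zero>\<^bsub>A W\<^esub> \<otimes>\<^bsub>R\<^esub> monom (%_. 0) m"
  using Fn_closed[OF a] monom_closed[of m] by (simp add: Fn_zero)
 also have "... : normal_forms" by (rule monomial) (auto simp: admissible_def)
 finally show ?thesis .
next
 case False
 let ?mu = "%j. if j < m then mu j else 0"
 have "monom mu m = monom ?mu m" by (rule ordered_monom_cong) simp
 moreover have "?mu : admissible m gm" using False by (auto simp: admissible_def not_le)
 ultimately show ?thesis using monomial[OF a] by simp
qed

lemma normal_forms_zero: "\<zero>\<^bsub>R\<^esub> : normal_forms"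
 using normal_forms_monom[OF AW.zero_closed, of "%_. 0"] monom_closed[of m] by (simp add: Fn_zero)

lemma normal_forms_finsum: "(!!i. i : X ==> f i : normal_forms) ==> finsum R f X : normal_forms"
proof (induction X rule: infinite_finite_induct)
 case (insert x X)
 then have "f : X \<rightarrow> carrier R" "f x : carrier R" using normal_forms_closed by auto
 with insert show ?case by (simp add: normal_forms.sum)
qed (simp_all add: normal_forms_zero)

lemma normal_forms_Fn:
 assumes "x : normal_forms" and b: "b : carrier (A W)" shows "Fn b \<otimes>\<^bsub>R\<^esub> x : normal_forms"
 using assms(1) proof induction
 case (monomial a mu)
 have "Fn b \<otimes>\<^bsub>R\<^esub> (Fn a \<otimes>\<^bsub>R\<^esub> monom mu m) = Fn (b \<otimes>\<^bsub>A W\<^esub> a) \<otimes>\<^bsub>R\<^esub> monom mu m"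
  using monomial(1) b Fn_closed monom_closed[of m] by (simp add: Fn_mult R.m_assoc)
 then show ?case
  using normal_forms.monomial[OF _ monomial(2), of "b \<otimes>\<^bsub>A W\<^esub> a"] monomial b by simp
next
 case (sum x y)
 then show ?case using normal_forms_closed Fn_closed[OF b] by (simp add: R.r_distr normal_forms.sum)
qed

lemma normal_forms_smult:
 assumes "x : normal_forms" shows "r \<odot>\<^bsub>R\<^esub> x : normal_forms" proof -
 have c: "x : carrier R" using assms by (rule normal_forms_closed)
 have "r \<odot>\<^bsub>R\<^esub> x = Fn (r \<odot>\<^bsub>A W\<^esub> \<one>\<^bsub>A W\<^esub>) \<otimes>\<^bsub>R\<^esub> x"
  using c by (simp add: Fn_smult Fn_one smult_R_laws(5))
 then show ?thesis using normal_forms_Fn[OF assms AW.smult_closed'[OF AW.one_closed]] by simp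
qed

text \<open>The coefficient is first split into homogeneous parts, since the sign rule moves a
  differential only past these.\<close>

lemma normal_forms_Dz:
 assumes "x : normal_forms" and j: "j < m" shows "Dz j \<otimes>\<^bsub>R\<^esub> x : normal_forms" using assms(1)
proof induction
 case (monomial a mu)
 from monomial(1) show ?case proof (induction rule: AW.homogeneous_induct)
  case (homogeneous dl a)
  obtain r where r: "Dz j \<otimes>\<^bsub>R\<^esub> Fn a = r \<odot>\<^bsub>R\<^esub> (Fn a \<otimes>\<^bsub>R\<^esub> Dz j)"
   using Dz_Fn[OF homogeneous j] by blast
  obtain s where s: "Dz j \<otimes>\<^bsub>R\<^esub> monom mu m = s \<odot>\<^bsub>R\<^esub> monom (incr j mu) m"
   using Dz_monom[OF order.refl j] by blast
  have c: "Dz j : carrier R" "Fn a : carrier R" "monom mu m : carrier R" "monom (incr j mu) m : carrier R"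
   using Dz_closed[OF j] Fn_closed[OF AW.gcomp_closed[OF homogeneous]] monom_closed by auto
  have "Dz j \<otimes>\<^bsub>R\<^esub> (Fn a \<otimes>\<^bsub>R\<^esub> monom mu m) = (r \<odot>\<^bsub>R\<^esub> (Fn a \<otimes>\<^bsub>R\<^esub> Dz j)) \<otimes>\<^bsub>R\<^esub> monom mu m"
   using c r by (simp add: R.m_assoc[symmetric])
  also have "... = r \<odot>\<^bsub>R\<^esub> (Fn a \<otimes>\<^bsub>R\<^esub> (Dz j \<otimes>\<^bsub>R\<^esub> monom mu m))"
   using c by (simp add: smult_R_laws(5) R.m_assoc)
  also have "... = r \<odot>\<^bsub>R\<^esub> (s \<odot>\<^bsub>R\<^esub> (Fn a \<otimes>\<^bsub>R\<^esub> monom (incr j mu) m))"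
   using c by (simp add: s smult_R_laws(6))
  finally show ?case
   using normal_forms_smult[OF normal_forms_smult[OF normal_forms_monom[OF AW.gcomp_closed[OF homogeneous]]]] by simp
 next
  case (add a b)
  have "Dz j \<otimes>\<^bsub>R\<^esub> (Fn (a \<oplus>\<^bsub>A W\<^esub> b) \<otimes>\<^bsub>R\<^esub> monom mu m) =
   Dz j \<otimes>\<^bsub>R\<^esub> (Fn a \<otimes>\<^bsub>R\<^esub> monom mu m) \<oplus>\<^bsub>R\<^esub> Dz j \<otimes>\<^bsub>R\<^esub> (Fn b \<otimes>\<^bsub>R\<^esub> monom mu m)"
   using add(1,2) Dz_closed[OF j] Fn_closed monom_closed[of m] by (simp add: Fn_add R.l_distr R.r_distr)
  then show ?case using add by (simp add: normal_forms.sum)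
 qed
next
 case (sum x y)
 then show ?case using normal_forms_closed Dz_closed[OF j] by (simp add: R.r_distr normal_forms.sum)
qed

text \<open>Stated for products with a normal form on the right so that the induction over
  expressions passes through \<open>Mul\<close>. Applied to the unit it brings every class into
  normal form.\<close>

lemma normal_forms_mult:
 assumes "f : form_exprs M W" "x : normal_forms" shows "expr_class M W f \<otimes>\<^bsub>R\<^esub> x : normal_forms"
 using assms proof (induction f arbitrary: x)
 case (Fun a)
 then show ?case using normal_forms_Fn by (simp add: Fn_def)
next
 case (Form om)
 then have om: "om : one_forms M W" by simp
 have a: "om W (frame W j) : carrier (A W)" if "j < m" for j
  by (rule one_formD(3)[OF om opens_self[OF open_sub[OF W]] frame_derivation[OF W that]])
 have c: "Dz j \<otimes>\<^bsub>R\<^esub> Fn (om W (frame W j)) : carrier R" if "j < m" for j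
  using Dz_closed[OF that] Fn_closed[OF a[OF that]] by simp
 have "expr_class M W (Form om) \<otimes>\<^bsub>R\<^esub> x = (\<Oplus>\<^bsub>R\<^esub>j\<in>{..<m}. Dz j \<otimes>\<^bsub>R\<^esub> Fn (om W (frame W j))) \<otimes>\<^bsub>R\<^esub> x"
  by (simp only: class_one_form[OF W om] Dz_def Fn_def)
 also have "... = (\<Oplus>\<^bsub>R\<^esub>j\<in>{..<m}. Dz j \<otimes>\<^bsub>R\<^esub> Fn (om W (frame W j)) \<otimes>\<^bsub>R\<^esub> x)"
  by (rule R.finsum_ldistr) (use c normal_forms_closed[OF Form(2)] in auto)
 also have "... : normal_forms" proof (rule normal_forms_finsum)
  fix j assume "j : {..<m}"
  then have j: "j < m" by simp
  have "Dz j \<otimes>\<^bsub>R\<^esub> Fn (om W (frame W j)) \<otimes>\<^bsub>R\<^esub> x = Dz j \<otimes>\<^bsub>R\<^esub> (Fn (om W (frame W j)) \<otimes>\<^bsub>R\<^esub> x)"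
   by (rule R.m_assoc[OF Dz_closed[OF j] Fn_closed[OF a[OF j]] normal_forms_closed[OF Form(2)]])
  also have "... : normal_forms" by (rule normal_forms_Dz[OF normal_forms_Fn[OF Form(2) a[OF j]] j])
  finally show "Dz j \<otimes>\<^bsub>R\<^esub> Fn (om W (frame W j)) \<otimes>\<^bsub>R\<^esub> x : normal_forms" .
 qed
 finally show ?case .
next
 case (Scal r f)
 then have f: "f : form_exprs M W" by simp
 show ?case unfolding exterior_smult[OF open_sub[OF W] f, symmetric]
   smult_R_laws(5)[OF exterior_closed(4)[OF open_sub[OF W] f] normal_forms_closed[OF Scal(3)]]
  by (rule normal_forms_smult[OF Scal(1)[OF f Scal(3)]])
next
 case (Add f g)
 then have f: "f : form_exprs M W" "g : form_exprs M W" by auto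
 note c = exterior_closed(4)[OF open_sub[OF W] f(1)] exterior_closed(4)[OF open_sub[OF W] f(2)]
 show ?case unfolding exterior_add[OF open_sub[OF W] f, symmetric] R.l_distr[OF c normal_forms_closed[OF Add(4)]]
  by (rule normal_forms.sum[OF Add(1)[OF f(1) Add(4)] Add(2)[OF f(2) Add(4)]])
next
 case (Mul f g)
 then have f: "f : form_exprs M W" "g : form_exprs M W" by auto
 note c = exterior_closed(4)[OF open_sub[OF W] f(1)] exterior_closed(4)[OF open_sub[OF W] f(2)]
 show ?case unfolding exterior_mult[OF open_sub[OF W] f, symmetric] R.m_assoc[OF c normal_forms_closed[OF Mul(4)]]
  by (rule Mul(1)[OF f(1) Mul(2)[OF f(2) Mul(4)]])
qed

lemma carrier_normal_forms:
 assumes "C : carrier R" shows "C : normal_forms" proof -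
 obtain f where f: "f : form_exprs M W" "C = expr_class M W f"
  using assms unfolding exterior_carrier[OF open_sub[OF W]] by blast
 have "ordered_monom R Dz (%_. 0) k = \<one>\<^bsub>R\<^esub>" for k by (induction k) auto
 then have "\<one>\<^bsub>R\<^esub> : normal_forms"
  using normal_forms_monom[OF AW.one_closed, of "%_. 0"] by (simp add: Fn_one)
 from normal_forms_mult[OF f(1) this] show ?thesis using assms f(2) by simp
qed

lemma normal_form:
 assumes "C : carrier R" shows "EX X c. finite X & X <= admissible m gm & (ALL mu. c mu : carrier (A W)) \<and>
  C = (\<Oplus>\<^bsub>R\<^esub>mu\<in>X. Fn (c mu) \<otimes>\<^bsub>R\<^esub> monom mu m)"
 using carrier_normal_forms[OF assms] proof induction
 case (monomial a mu)
 have "Fn a \<otimes>\<^bsub>R\<^esub> monom mu m = (\<Oplus>\<^bsub>R\<^esub>nu\<in>{mu}. Fn a \<otimes>\<^bsub>R\<^esub> monom nu m)"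
  using monomial Fn_closed monom_closed[of m] by simp
 moreover have "finite {mu}" "{mu} <= admissible m gm" "ALL nu. (%_::nat => nat. a) nu : carrier (A W)"
  using monomial by auto
 ultimately show ?case by (intro exI[of _ "{mu}"] exI[of _ "%_. a"] conjI)
next
 case (sum x y)
 from sum.IH(1) obtain X c where X': "finite X & X <= admissible m gm & (ALL mu. c mu : carrier (A W)) \<and>
   x = (\<Oplus>\<^bsub>R\<^esub>mu\<in>X. Fn (c mu) \<otimes>\<^bsub>R\<^esub> monom mu m)"
  by (elim exE) (rule that)
 from sum.IH(2) obtain Y d where Y': "finite Y & Y <= admissible m gm & (ALL mu. d mu : carrier (A W)) \<and>
   y = (\<Oplus>\<^bsub>R\<^esub>mu\<in>Y. Fn (d mu) \<otimes>\<^bsub>R\<^esub> monom mu m)"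
  by (elim exE) (rule that)
 have X: "finite X" "X <= admissible m gm" "!!mu. c mu : carrier (A W)"
   "x = (\<Oplus>\<^bsub>R\<^esub>mu\<in>X. Fn (c mu) \<otimes>\<^bsub>R\<^esub> monom mu m)"
  and Y: "finite Y" "Y <= admissible m gm" "!!mu. d mu : carrier (A W)"
   "y = (\<Oplus>\<^bsub>R\<^esub>mu\<in>Y. Fn (d mu) \<otimes>\<^bsub>R\<^esub> monom mu m)"
  using X' Y' by simp_all
 \<comment> \<open>Coefficients are extended by zero to the union of the two sets of monomials, so
   that both sums can be added term by term.\<close>
 define c' where "c' mu = (if mu : X then c mu else \<zero>\<^bsub>A W\<^esub>)" for mu
 define d' where "d' mu = (if mu : Y then d mu else \<zero>\<^bsub>A W\<^esub>)" for mu
 have cd: "c' mu : carrier (A W)" "d' mu : carrier (A W)" for mu using X Y by (auto simp: c'_def d'_def)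
 have t: "Fn a \<otimes>\<^bsub>R\<^esub> monom mu m : carrier R" if "a : carrier (A W)" for a mu
  using that Fn_closed monom_closed[of m] by simp
 have mc: "monom mu m : carrier R" for mu using monom_closed[of m] by simp
 have "x = (\<Oplus>\<^bsub>R\<^esub>mu\<in>X \<union> Y. Fn (c' mu) \<otimes>\<^bsub>R\<^esub> monom mu m)"
  unfolding X(4)
  by (rule R.add.finprod_mono_neutral_cong_left) (use X Y t mc in \<open>auto simp: c'_def Fn_zero\<close>)
 moreover have "y = (\<Oplus>\<^bsub>R\<^esub>mu\<in>X \<union> Y. Fn (d' mu) \<otimes>\<^bsub>R\<^esub> monom mu m)"
  unfolding Y(4)
  by (rule R.add.finprod_mono_neutral_cong_left) (use X Y t mc in \<open>auto simp: d'_def Fn_zero\<close>)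
 ultimately have "x \<oplus>\<^bsub>R\<^esub> y = (\<Oplus>\<^bsub>R\<^esub>mu\<in>X \<union> Y. Fn (c' mu) \<otimes>\<^bsub>R\<^esub> monom mu m \<oplus>\<^bsub>R\<^esub> Fn (d' mu) \<otimes>\<^bsub>R\<^esub> monom mu m)"
  using R.finsum_addf[of "%mu. Fn (c' mu) \<otimes>\<^bsub>R\<^esub> monom mu m" "X \<union> Y" "%mu. Fn (d' mu) \<otimes>\<^bsub>R\<^esub> monom mu m"] t cd
  by auto
 also have "... = (\<Oplus>\<^bsub>R\<^esub>mu\<in>X \<union> Y. Fn (c' mu \<oplus>\<^bsub>A W\<^esub> d' mu) \<otimes>\<^bsub>R\<^esub> monom mu m)"
  by (rule R.finsum_cong') (use cd mc Fn_closed in \<open>auto simp: Fn_add R.l_distr\<close>)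
 finally show ?case
  using X Y cd by (intro exI[of _ "X \<union> Y"] exI[of _ "%mu. c' mu \<oplus>\<^bsub>A W\<^esub> d' mu"]) auto
qed

end

end

subsection \<open>Concrete models of the exterior algebra\<close>

lemma ordered_monom_cong':
 "(!!j. j < k ==> d j = d' j) ==> ordered_monom R d mu k = ordered_monom R d' mu k" by (induction k) auto

text \<open>
 \<open>io\<close> embeds the functions into the model, \<open>v j\<close> is the image of the differential of the \<open>j\<close>-th
 coordinate, and \<open>Tdeg k\<close> is the part of form degree \<open>k\<close>.
\<close>

locale frame_target = framed M U0 m gm z e
 for M :: "('m, 'b, 1) ringed_space" and U0 :: "'m set" and m :: nat and gm :: "nat => bit ^ 1"
  and z :: "nat => 'b" and e :: "nat => ('m, 'b) derivation" +
 fixes T :: "'m set => ('t, 2) graded_algebra" and io :: "'m set => 'b => 't"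
  and v :: "'m set => nat => 't" and Tdeg :: "'m set => nat => 't set" and rh :: "'m set => 'm set => 't => 't"
 assumes T_graded: "W : opens M U0 ==> graded_comm_algebra (T W)"
  and io_closed: "W : opens M U0 ==> a : carrier (sections M W) ==> io W a : carrier (T W)"
  and io_mult: "W : opens M U0 ==> a : carrier (sections M W) ==> b : carrier (sections M W) ==>
   io W (a \<otimes>\<^bsub>sections M W\<^esub> b) = io W a \<otimes>\<^bsub>T W\<^esub> io W b"
  and io_add: "W : opens M U0 ==> a : carrier (sections M W) ==> b : carrier (sections M W) ==>
   io W (a \<oplus>\<^bsub>sections M W\<^esub> b) = io W a \<oplus>\<^bsub>T W\<^esub> io W b"
  and io_smult: "W : opens M U0 ==> a : carrier (sections M W) ==>
   io W (r \<odot>\<^bsub>sections M W\<^esub> a) = r \<odot>\<^bsub>T W\<^esub> io W a"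
  and io_one: "W : opens M U0 ==> io W \<one>\<^bsub>sections M W\<^esub> = \<one>\<^bsub>T W\<^esub>"
  and io_gcomp: "W : opens M U0 ==> a : gcomp (sections M W) dl ==> io W a : gcomp (T W) (bidegree 0 dl)"
  and v_gcomp: "W : opens M U0 ==> j < m ==> v W j : gcomp (T W) (bidegree 1 (gm j))"
  and independent: "W : opens M U0 ==> finite X ==> X <= admissible m gm ==>
   (!!mu. c mu : carrier (sections M W)) ==>
   (\<Oplus>\<^bsub>T W\<^esub>mu\<in>X. io W (c mu) \<otimes>\<^bsub>T W\<^esub> ordered_monom (T W) (v W) mu m) = \<zero>\<^bsub>T W\<^esub> ==>
   mu : X ==> c mu = \<zero>\<^bsub>sections M W\<^esub>"
  and Tdeg_zero: "W : opens M U0 ==> \<zero>\<^bsub>T W\<^esub> : Tdeg W k"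
  and Tdeg_add: "W : opens M U0 ==> s : Tdeg W k ==> t : Tdeg W k ==> s \<oplus>\<^bsub>T W\<^esub> t : Tdeg W k"
  and Tdeg_smult: "W : opens M U0 ==> s : Tdeg W k ==> r \<odot>\<^bsub>T W\<^esub> s : Tdeg W k"
  and Tdeg_mult: "W : opens M U0 ==> s : Tdeg W k ==> t : Tdeg W l ==> s \<otimes>\<^bsub>T W\<^esub> t : Tdeg W (k + l)"
  and io_Tdeg: "W : opens M U0 ==> a : carrier (sections M W) ==> io W a : Tdeg W 0"
  and v_Tdeg: "W : opens M U0 ==> j < m ==> v W j : Tdeg W 1"
  and rh_hom: "W : opens M U0 ==> V : opens M W ==> rh W V : graded_hom (T W) (T V)"
  and rh_io: "W : opens M U0 ==> V : opens M W ==> a : carrier (sections M W) ==>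
   rh W V (io W a) = io V (res M W V a)"
  and rh_v: "W : opens M U0 ==> V : opens M W ==> j < m ==> rh W V (v W j) = v V j"
begin

text \<open>The value on a 1-form is forced: by \<open>class_one_form\<close> it has to be the
  combination of the \<open>v W j\<close> with the values of the form on the frame as
  coefficients.\<close>

primrec Phi :: "'m set => ('m, 'b) form_expr => 't" where
 "Phi W (Fun a) = io W a"
| "Phi W (Form om) = (\<Oplus>\<^bsub>T W\<^esub>j\<in>{..<m}. v W j \<otimes>\<^bsub>T W\<^esub> io W (om W (frame W j)))"
| "Phi W (Scal r f) = r \<odot>\<^bsub>T W\<^esub> Phi W f"
| "Phi W (Add f g) = Phi W f \<oplus>\<^bsub>T W\<^esub> Phi W g"
| "Phi W (Mul f g) = Phi W f \<otimes>\<^bsub>T W\<^esub> Phi W g"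

text \<open>\<open>Phi\<close> turns out to be constant on each class, so the image of a class has
  exactly one element.\<close>

definition PhiC :: "'m set => ('m, 'b) form_expr set => 't" where
 "PhiC W C = the_elem (Phi W ` C)"

context
 fixes W :: "'m set"
 assumes W: "W : opens M U0"
begin

interpretation AW: graded_comm_algebra "A W"
 by (rule graded_A[OF open_sub[OF W]])

interpretation R: ring "Ext M W"
 by (rule ring_exterior[OF open_sub[OF W]])

interpretation T: graded_comm_algebra "T W"
 by (rule T_graded[OF W])

lemma io_zero: "io W \<zero>\<^bsub>A W\<^esub> = \<zero>\<^bsub>T W\<^esub>"
 using io_smult[OF W AW.zero_closed, of 0] io_closed[OF W AW.zero_closed]
 by (simp add: AW.smult_zero_left T.smult_zero_left)

lemma form_coeff_closed: "om : one_forms M W ==> j < m ==> om W (frame W j) : carrier (A W)"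
 using one_formD(3)[OF _ opens_self[OF open_sub[OF W]] frame_derivation[OF W]] .

lemma v_closed: "j < m ==> v W j : carrier (T W)" using T.gcomp_closed[OF v_gcomp[OF W]] .

lemma Phi_Form_term_closed:
 "om : one_forms M W ==> j < m ==> v W j \<otimes>\<^bsub>T W\<^esub> io W (om W (frame W j)) : carrier (T W)"
 using v_closed io_closed[OF W form_coeff_closed] by simp

lemma Phi_closed: "f : form_exprs M W ==> Phi W f : carrier (T W)" proof (induction f)
 case (Form om)
 then show ?case using Phi_Form_term_closed by (auto intro!: T.finsum_closed)
qed (auto simp: io_closed[OF W] T.smult_closed')

lemma Phi_gcomp: "f : form_exprs M W ==> has_bidegree M W f d ==> Phi W f : gcomp (T W) d"
proof (induction f arbitrary: d)
 case (Fun a)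
 then show ?case using io_gcomp[OF W] by auto
next
 case (Form om)
 then obtain dl where d: "d = bidegree 1 dl" and om: "om : HForm M W dl" by auto
 have "v W j \<otimes>\<^bsub>T W\<^esub> io W (om W (frame W j)) : gcomp (T W) (bidegree 1 dl)" if j: "j < m" for j
 proof -
  have "om W (frame W j) : gcomp (A W) (dl + gm j)"
   using om frame_homogeneous[OF W j] opens_self[OF open_sub[OF W]] unfolding homogeneous_one_forms_def by blast
  from T.mult_gcomp[OF v_gcomp[OF W j] io_gcomp[OF W this]]
  have "v W j \<otimes>\<^bsub>T W\<^esub> io W (om W (frame W j)) : gcomp (T W) (bidegree (1 + 0) (gm j + (dl + gm j)))"
   unfolding bidegree_add .
  \<comment> \<open>The frame vector shifts the degree of the coefficient by \<open>gm j\<close>,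
    and the differential shifts it back modulo 2.\<close>
  moreover have "gm j + (dl + gm j) = dl"
   using add_self_bit_vec[of "gm j"] by (metis add.commute add.left_commute add_0_right)
  ultimately show ?thesis by simp
 qed
 then show ?case unfolding d Phi.simps by (intro T.gcomp_finsum) simp
next
 case (Scal r f)
 then show ?case by (simp add: T.gcomp_smult)
next
 case (Add f g)
 then show ?case by (simp add: T.gcomp_add)
next
 case (Mul f g)
 then show ?case using T.mult_gcomp by fastforce
qed

lemma Phi_Tdeg: "f : form_exprs M W ==> has_form_degree f k ==> Phi W f : Tdeg W k" proof (induction f arbitrary: k)
 case (Fun a)
 then show ?case using io_Tdeg[OF W] by auto
next
 case (Form om)
 then have om: "om : one_forms M W" and k: "k = 1" by auto
 define t where "t j = v W j \<otimes>\<^bsub>T W\<^esub> io W (om W (frame W j))" for j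
 have t: "t j : Tdeg W 1" "t j : carrier (T W)" if j: "j < m" for j
  using Tdeg_mult[OF W v_Tdeg[OF W j] io_Tdeg[OF W form_coeff_closed[OF om j]]] Phi_Form_term_closed[OF om j]
  unfolding t_def by (simp_all only: add_0_right)
 have "(\<Oplus>\<^bsub>T W\<^esub>j\<in>{..<n}. t j) : Tdeg W 1" if "n \<le> m" for n using that proof (induction n)
  case 0
  then show ?case using Tdeg_zero[OF W] by simp
 next
  case (Suc n)
  then have "t : {..<n} \<rightarrow> carrier (T W)" "t n : carrier (T W)" using t by auto
  then show ?case using Suc Tdeg_add[OF W t(1)[of n]] by (simp add: lessThan_Suc)
 qed
 from this[OF order.refl] show ?case unfolding k Phi.simps t_def .
next
 case (Scal r f)
 then show ?case by (simp add: Tdeg_smult[OF W])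
next
 case (Add f g)
 then show ?case by (simp add: Tdeg_add[OF W])
next
 case (Mul f g)
 then show ?case using Tdeg_mult[OF W] by fastforce
qed

text \<open>All defining relations hold in the model. The relations of the module of 1-forms are
  checked on the frame coefficients, and the two sign rules are graded commutativity in the model,
  applicable because \<open>Phi\<close> respects bidegrees.\<close>

lemma Phi_expr_eq: "expr_eq M W f g ==> Phi W f = Phi W g" proof (induction rule: expr_eq.induct)
 case (Add_minus f)
 then show ?case using Phi_closed[of f] T.minus_eq_smult[of "Phi W f"] T.r_neg[of "Phi W f"] by (simp add: io_zero)
next
 case (Form_add om et)
 then have om: "om : one_forms M W" "et : one_forms M W" by auto
 note t = Phi_Form_term_closed[OF om(1)] Phi_Form_term_closed[OF om(2)]
 have "Phi W (Form (one_form_add M W om et)) = (\<Oplus>\<^bsub>T W\<^esub>j\<in>{..<m}.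
   v W j \<otimes>\<^bsub>T W\<^esub> io W (om W (frame W j)) \<oplus>\<^bsub>T W\<^esub> v W j \<otimes>\<^bsub>T W\<^esub> io W (et W (frame W j)))"
  unfolding Phi.simps proof (rule T.finsum_cong'[OF HOL.refl])
  fix j assume "j : {..<m}"
  then have j: "j < m" by simp
  have "one_form_add M W om et W (frame W j) = om W (frame W j) \<oplus>\<^bsub>A W\<^esub> et W (frame W j)"
   using frame_derivation[OF W j] opens_self[OF open_sub[OF W]] by (simp only: one_form_add_def restrict_apply if_True)
  then show "v W j \<otimes>\<^bsub>T W\<^esub> io W (one_form_add M W om et W (frame W j)) =
   v W j \<otimes>\<^bsub>T W\<^esub> io W (om W (frame W j)) \<oplus>\<^bsub>T W\<^esub> v W j \<otimes>\<^bsub>T W\<^esub> io W (et W (frame W j))"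
   using form_coeff_closed[OF om(1) j] form_coeff_closed[OF om(2) j] v_closed[OF j] io_closed[OF W]
   by (simp only: io_add[OF W] T.r_distr)
 qed (use t in auto)
 also have "... = Phi W (Add (Form om) (Form et))" unfolding Phi.simps by (rule T.finsum_addf) (use t in auto)
 finally show ?case .
next
 case (Form_scale om a)
 note t = Phi_Form_term_closed[OF Form_scale(1)]
 have "Phi W (Form (one_form_scale M W om a)) = (\<Oplus>\<^bsub>T W\<^esub>j\<in>{..<m}.
   (v W j \<otimes>\<^bsub>T W\<^esub> io W (om W (frame W j))) \<otimes>\<^bsub>T W\<^esub> io W a)"
  unfolding Phi.simps proof (rule T.finsum_cong'[OF HOL.refl])
  fix j assume "j : {..<m}"
  then have j: "j < m" by simp
  have "one_form_scale M W om a W (frame W j) = om W (frame W j) \<otimes>\<^bsub>A W\<^esub> res M W W a"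
   using frame_derivation[OF W j] opens_self[OF open_sub[OF W]] by (simp only: one_form_scale_def restrict_apply if_True)
  also have "res M W W a = a" by (rule res_id[OF open_sub[OF W] Form_scale(2)])
  finally show "v W j \<otimes>\<^bsub>T W\<^esub> io W (one_form_scale M W om a W (frame W j)) =
   v W j \<otimes>\<^bsub>T W\<^esub> io W (om W (frame W j)) \<otimes>\<^bsub>T W\<^esub> io W a"
   using form_coeff_closed[OF Form_scale(1) j] Form_scale(2) v_closed[OF j] io_closed[OF W]
   by (simp only: io_mult[OF W] T.m_assoc)
 qed (use t io_closed[OF W Form_scale(2)] in auto)
 also have "... = Phi W (Mul (Form om) (Fun a))"
  unfolding Phi.simps by (rule T.finsum_ldistr[symmetric]) (use t io_closed[OF W Form_scale(2)] in auto)
 finally show ?case .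
next
 case (Fun_Form a dl om kp)
 have "Phi W (Fun a) : gcomp (T W) (bidegree 0 dl)" "Phi W (Form om) : gcomp (T W) (bidegree 1 kp)"
  by (rule Phi_gcomp; use Fun_Form AW.gcomp_closed homogeneous_one_form_closed[OF open_sub[OF W]] in auto)+
 from T.graded_comm[OF this] show ?case by (simp only: Phi.simps)
next
 case (Form_Form om dl et kp)
 have "Phi W (Form om) : gcomp (T W) (bidegree 1 dl)" "Phi W (Form et) : gcomp (T W) (bidegree 1 kp)"
  by (rule Phi_gcomp; use Form_Form homogeneous_one_form_closed[OF open_sub[OF W]] in auto)+
 from T.graded_comm[OF this] show ?case by (simp only: Phi.simps)
qed (simp_all add: Phi_closed T.add.m_ac T.m_assoc T.l_distr T.r_distr T.smult_closed'
  T.smult_add_left T.smult_add_right T.smult_smult T.smult_one' T.smult_mult_left T.smult_mult_right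
  io_zero io_one[OF W] io_add[OF W] io_mult[OF W] io_smult[OF W])

lemma PhiC_cls:
 assumes "f : form_exprs M W" shows "PhiC W (expr_class M W f) = Phi W f" proof -
 have "Phi W ` expr_class M W f = {Phi W f}"
  using Phi_expr_eq expr_class_self[OF open_sub[OF W] assms] expr_class_mem[OF open_sub[OF W]] by fastforce
 then show ?thesis by (simp add: PhiC_def)
qed

lemma PhiC_ring_hom: "PhiC W : ring_hom (Ext M W) (T W)" proof (rule ring_hom_memI)
 note simps = exterior_mult[OF open_sub[OF W]] exterior_add[OF open_sub[OF W]]
 fix C assume "C : carrier (Ext M W)"
 then obtain f where f: "f : form_exprs M W" "C = expr_class M W f"
  unfolding exterior_carrier[OF open_sub[OF W]] by blast
 show "PhiC W C : carrier (T W)" using f by (simp add: PhiC_cls Phi_closed)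
 fix D assume "D : carrier (Ext M W)"
 then obtain g where g: "g : form_exprs M W" "D = expr_class M W g"
  unfolding exterior_carrier[OF open_sub[OF W]] by blast
 show "PhiC W (C \<otimes>\<^bsub>Ext M W\<^esub> D) = PhiC W C \<otimes>\<^bsub>T W\<^esub> PhiC W D"
  "PhiC W (C \<oplus>\<^bsub>Ext M W\<^esub> D) = PhiC W C \<oplus>\<^bsub>T W\<^esub> PhiC W D"
  using f g by (simp_all add: simps PhiC_cls)
next
 show "PhiC W \<one>\<^bsub>Ext M W\<^esub> = \<one>\<^bsub>T W\<^esub>"
  by (simp add: exterior_one[OF open_sub[OF W]] PhiC_cls io_one[OF W])
qed

lemma PhiC_closed: "C : carrier (Ext M W) ==> PhiC W C : carrier (T W)" using PhiC_ring_hom by (rule ring_hom_closed)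

lemma PhiC_smult:
 assumes "C : carrier (Ext M W)"
 shows "PhiC W (r \<odot>\<^bsub>Ext M W\<^esub> C) = r \<odot>\<^bsub>T W\<^esub> PhiC W C"
 using assms unfolding exterior_carrier[OF open_sub[OF W]] by (auto simp: exterior_smult[OF open_sub[OF W]] PhiC_cls)

lemma PhiC_zero: "PhiC W \<zero>\<^bsub>Ext M W\<^esub> = \<zero>\<^bsub>T W\<^esub>"
 by (rule ring_hom_zero[OF PhiC_ring_hom R.ring_axioms T.ring_axioms])

lemma PhiC_finsum:
 assumes "!!i. i : X ==> f i : carrier (Ext M W)"
 shows "PhiC W (\<Oplus>\<^bsub>Ext M W\<^esub>i\<in>X. f i) = (\<Oplus>\<^bsub>T W\<^esub>i\<in>X. PhiC W (f i))"
 using assms proof (induction X rule: infinite_finite_induct)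
 case (insert x X)
 then have "f : X \<rightarrow> carrier (Ext M W)" "f x : carrier (Ext M W)"
  "(%i. PhiC W (f i)) : X \<rightarrow> carrier (T W)" "PhiC W (f x) : carrier (T W)" using PhiC_closed by auto
 with insert show ?case by (simp add: ring_hom_add[OF PhiC_ring_hom])
qed (simp_all add: PhiC_zero)

lemma PhiC_Fn: "a : carrier (A W) ==> PhiC W (Fn W a) = io W a" by (simp add: Fn_def[OF W] PhiC_cls)

lemma PhiC_Dz:
 assumes j: "j < m" shows "PhiC W (Dz W j) = v W j" proof -
 have "PhiC W (Dz W j) = (\<Oplus>\<^bsub>T W\<^esub>i\<in>{..<m}. v W i \<otimes>\<^bsub>T W\<^esub> io W (diff W j W (frame W i)))"
  unfolding Dz_def[OF W] using diff_one_form[OF W j] by (simp only: PhiC_cls form_exprs_simps Phi.simps)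
 also have "... = (\<Oplus>\<^bsub>T W\<^esub>i\<in>{..<m}. if j = i then v W i else \<zero>\<^bsub>T W\<^esub>)"
 proof (rule T.finsum_cong'[OF HOL.refl])
  fix i assume "i : {..<m}"
  then have i: "i < m" by simp
  show "v W i \<otimes>\<^bsub>T W\<^esub> io W (diff W j W (frame W i)) = (if j = i then v W i else \<zero>\<^bsub>T W\<^esub>)"
   unfolding diff_frame[OF W i j] using v_closed[OF i] by (auto simp: io_one[OF W] io_zero)
 qed (use v_closed in auto)
 also have "... = v W j" by (rule T.finsum_singleton) (use j v_closed in auto)
 finally show ?thesis .
qed

lemma PhiC_monomial:
 assumes a: "a : carrier (A W)"
 shows "PhiC W (Fn W a \<otimes>\<^bsub>Ext M W\<^esub> monom W mu m) = io W a \<otimes>\<^bsub>T W\<^esub> ordered_monom (T W) (v W) mu m"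
proof -
 have "PhiC W (monom W mu m) = ordered_monom (T W) (%j. PhiC W (Dz W j)) mu m"
  by (rule ordered_monom_hom[OF PhiC_ring_hom R.ring_axioms T.ring_axioms Dz_closed[OF W]])
 also have "... = ordered_monom (T W) (v W) mu m" by (rule ordered_monom_cong') (rule PhiC_Dz)
 finally show ?thesis
  using a by (simp add: ring_hom_mult[OF PhiC_ring_hom Fn_closed[OF W a] monom_closed[OF W order.refl]] PhiC_Fn)
qed

text \<open>Here spanning and independence meet: the class is written in normal form, its image is
  the same combination in the model, and independence there makes all coefficients zero.\<close>

lemma PhiC_eq_zero:
 assumes C: "C : carrier (Ext M W)" and 0: "PhiC W C = \<zero>\<^bsub>T W\<^esub>"
 shows "C = \<zero>\<^bsub>Ext M W\<^esub>" proof -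
 obtain X c where X: "finite X" "X <= admissible m gm" and c: "!!mu. c mu : carrier (A W)"
  and Ceq: "C = (\<Oplus>\<^bsub>Ext M W\<^esub>mu\<in>X. Fn W (c mu) \<otimes>\<^bsub>Ext M W\<^esub> monom W mu m)"
  using normal_form[OF W C] by (elim exE conjE) (rule that, auto)
 have t: "Fn W (c mu) \<otimes>\<^bsub>Ext M W\<^esub> monom W mu m : carrier (Ext M W)" for mu
  using Fn_closed[OF W c] monom_closed[OF W order.refl] by simp
 have "(\<Oplus>\<^bsub>T W\<^esub>mu\<in>X. io W (c mu) \<otimes>\<^bsub>T W\<^esub> ordered_monom (T W) (v W) mu m) = PhiC W C"
  unfolding Ceq PhiC_finsum[OF t] PhiC_monomial[OF c] ..
 then have "c mu = \<zero>\<^bsub>A W\<^esub>" if "mu : X" for mu using independent[OF W X c _ that] 0 by simp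
 then have "C = (\<Oplus>\<^bsub>Ext M W\<^esub>mu\<in>X. \<zero>\<^bsub>Ext M W\<^esub>)"
  unfolding Ceq using monom_closed[OF W order.refl] by (intro R.finsum_cong') (auto simp: Fn_zero[OF W])
 then show ?thesis by simp
qed

lemma PhiC_inj: "inj_on (PhiC W) (carrier (Ext M W))" proof (rule inj_onI)
 fix C D assume C: "C : carrier (Ext M W)" and D: "D : carrier (Ext M W)" and eq: "PhiC W C = PhiC W D"
 let ?D = "(- 1) \<odot>\<^bsub>Ext M W\<^esub> D"
 have D': "?D : carrier (Ext M W)" by (rule exterior_closed(3)[OF open_sub[OF W] D])
 have "PhiC W (C \<oplus>\<^bsub>Ext M W\<^esub> ?D) = PhiC W D \<oplus>\<^bsub>T W\<^esub> (- 1) \<odot>\<^bsub>T W\<^esub> PhiC W D"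
  by (simp add: ring_hom_add[OF PhiC_ring_hom C D'] PhiC_smult[OF D] eq)
 also have "... = \<zero>\<^bsub>T W\<^esub>"
  using PhiC_closed[OF D] T.r_neg[of "PhiC W D"] by (simp add: T.minus_eq_smult)
 finally have CD: "C \<oplus>\<^bsub>Ext M W\<^esub> ?D = \<zero>\<^bsub>Ext M W\<^esub>"
  using C D' by (intro PhiC_eq_zero) auto
 have "PhiC W (D \<oplus>\<^bsub>Ext M W\<^esub> ?D) = PhiC W D \<oplus>\<^bsub>T W\<^esub> (- 1) \<odot>\<^bsub>T W\<^esub> PhiC W D"
  by (simp add: ring_hom_add[OF PhiC_ring_hom D D'] PhiC_smult[OF D])
 also have "... = \<zero>\<^bsub>T W\<^esub>"
  using PhiC_closed[OF D] T.r_neg[of "PhiC W D"] by (simp add: T.minus_eq_smult)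
 finally have "D \<oplus>\<^bsub>Ext M W\<^esub> ?D = \<zero>\<^bsub>Ext M W\<^esub>"
  using D D' by (intro PhiC_eq_zero) auto
 with CD show "C = D" using C D D' by (metis R.add.right_cancel)
qed

text \<open>Together with its counterpart for bidegrees, this will place the lift of a power series
  in the right exterior power and the right homogeneous part.\<close>

lemma monomial_exterior_power:
 assumes a: "a : carrier (A W)"
 shows "Fn W a \<otimes>\<^bsub>Ext M W\<^esub> monom W mu m : ExtPow M W (\<Sum>j<m. mu j)" proof -
 note closed = exterior_power_closed[OF open_sub[OF W]]
 have D: "Dz W j : ExtPow M W 1" if "j < m" for j unfolding Dz_def[OF W] exterior_power_iff[OF open_sub[OF W]]
  by (rule bexI[of _ "Form (diff W j)"]) (auto simp: diff_one_form[OF W that])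
 have F: "Fn W b : ExtPow M W 0" if "b : carrier (A W)" for b
  unfolding Fn_def[OF W] exterior_power_iff[OF open_sub[OF W]] by (rule bexI[of _ "Fun b"]) (auto simp: that)
 have one: "\<one>\<^bsub>Ext M W\<^esub> : ExtPow M W 0" using F[OF AW.one_closed] by (simp add: Fn_one[OF W])
 have pow: "Dz W j [^]\<^bsub>Ext M W\<^esub> n : ExtPow M W n" if "j < m" for j and n :: nat
  using closed(5)[OF _ D[OF that]] one by (induction n) auto
 have "monom W mu k : ExtPow M W (\<Sum>j<k. mu j)" if "k \<le> m" for k
  using that closed(5)[OF _ pow] one by (induction k) auto
 from closed(5)[OF F[OF a] this[OF order.refl]] show ?thesis by simp
qed

lemma monomial_exterior_gcomp:
 assumes a: "a : gcomp (A W) dl" shows "Fn W a \<otimes>\<^bsub>Ext M W\<^esub> monom W mu m \<in>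
  gcomp (Ext M W) (bidegree 0 dl + (\<Sum>j<m. \<Sum>_<mu j. bidegree 1 (gm j)))" proof -
 note closed = exterior_gcomp_closed[OF open_sub[OF W]]
 have D: "Dz W j : gcomp (Ext M W) (bidegree 1 (gm j))" if "j < m" for j
  unfolding Dz_def[OF W] exterior_gcomp[OF open_sub[OF W]]
  by (rule bexI[of _ "Form (diff W j)"]) (auto simp: diff_one_form[OF W that] diff_homogeneous[OF W that])
 have F: "Fn W b : gcomp (Ext M W) (bidegree 0 kp)" if "b : gcomp (A W) kp" for b kp
  unfolding Fn_def[OF W] exterior_gcomp[OF open_sub[OF W]]
  by (rule bexI[of _ "Fun b"]) (use that AW.gcomp_closed in auto)
 have "bidegree 0 0 = 0" unfolding vec_eq_iff forall_2 by (simp add: bidegree_def)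
 then have one: "\<one>\<^bsub>Ext M W\<^esub> : gcomp (Ext M W) 0"
  using F[OF AW.one_gcomp] by (simp add: Fn_one[OF W])
 have pow: "Dz W j [^]\<^bsub>Ext M W\<^esub> n : gcomp (Ext M W) (\<Sum>_<n. bidegree 1 (gm j))"
  if "j < m" for j and n :: nat proof (induction n)
  case (Suc n)
  from closed(5)[OF Suc D[OF that]] show ?case by (simp only: nat_pow_Suc sum.lessThan_Suc)
 qed (simp add: one)
 have "monom W mu k : gcomp (Ext M W) (\<Sum>j<k. \<Sum>_<mu j. bidegree 1 (gm j))" if "k \<le> m" for k using that
 proof (induction k)
  case (Suc k)
  then have "monom W mu k : gcomp (Ext M W) (\<Sum>j<k. \<Sum>_<mu j. bidegree 1 (gm j))" "k < m" by auto
  from closed(5)[OF this(1) pow[OF this(2)]] show ?case by (simp only: ordered_monom.simps sum.lessThan_Suc)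
 qed (simp add: one)
 from closed(5)[OF F[OF a] this[OF order.refl]] show ?thesis .
qed

end

section \<open>Compatibility of the model with restriction\<close>

lemma rh_Phi:
 assumes W: "W : opens M U0" and V: "V : opens M W" and f: "f : form_exprs M W"
 shows "rh W V (Phi W f) = Phi V (res_expr W V f)" using f proof (induction f)
 case (Fun a)
 then show ?case by (simp add: rh_io[OF W V])
next
 case (Form om)
 then have om: "om : one_forms M W" by simp
 note V0 = opens_sub[OF W V]
 interpret TV: graded_comm_algebra "T V"
  by (rule T_graded[OF V0])
 have omV: "restrict om (opens M V) V (frame V j) = res M W V (om W (frame W j))" if "j < m" for j proof -
  have "opens M W Int opens M V = opens M V" "V : opens M V" using V by auto
  then show ?thesis using one_formD(6)[OF om opens_self[OF open_sub[OF W]] V frame_derivation[OF W that]]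
   by (simp add: restrict_restrict)
 qed
 have "rh W V (Phi W (Form om)) = (\<Oplus>\<^bsub>T V\<^esub>j\<in>{..<m}. rh W V (v W j \<otimes>\<^bsub>T W\<^esub> io W (om W (frame W j))))"
  unfolding Phi.simps by (rule graded_hom_finsum[OF rh_hom[OF W V] T_graded[OF W] T_graded[OF V0]])
   (use Phi_Form_term_closed[OF W om] in auto)
 also have "... = (\<Oplus>\<^bsub>T V\<^esub>j\<in>{..<m}. v V j \<otimes>\<^bsub>T V\<^esub> io V (restrict om (opens M V) V (frame V j)))"
 proof (rule TV.finsum_cong'[OF HOL.refl])
  have om': "restrict om (opens M V) : one_forms M V" by (rule one_form_restrict[OF om V])
  show "(%j. v V j \<otimes>\<^bsub>T V\<^esub> io V (restrict om (opens M V) V (frame V j))) : {..<m} \<rightarrow> carrier (T V)"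
   using Phi_Form_term_closed[OF V0 om'] by (simp only: Pi_iff lessThan_iff) blast
  fix j assume "j : {..<m}"
  then have j: "j < m" by simp
  show "rh W V (v W j \<otimes>\<^bsub>T W\<^esub> io W (om W (frame W j))) =
   v V j \<otimes>\<^bsub>T V\<^esub> io V (restrict om (opens M V) V (frame V j))"
   unfolding graded_hom_simps(2)[OF rh_hom[OF W V] v_closed[OF W j] io_closed[OF W form_coeff_closed[OF W om j]]]
   rh_v[OF W V j] rh_io[OF W V form_coeff_closed[OF W om j]] omV[OF j] ..
 qed
 finally show ?case by (simp only: res_expr_simps Phi.simps)
qed (simp_all add: graded_hom_simps[OF rh_hom[OF W V]] Phi_closed[OF W])

lemma rh_PhiC:
 assumes W: "W : opens M U0" and V: "V : opens M W" and C: "C : carrier (Ext M W)"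
 shows "rh W V (PhiC W C) = PhiC V (res (ExtP M) W V C)" proof -
 obtain f where f: "f : form_exprs M W" "C = expr_class M W f"
  using C unfolding exterior_carrier[OF open_sub[OF W]] by blast
 show ?thesis unfolding f(2) PhiC_cls[OF W f(1)] exterior_res[OF open_sub[OF W] V f(1)]
   PhiC_cls[OF opens_sub[OF W V] res_expr_closed[OF open_sub[OF W] V f(1)]] by (rule rh_Phi[OF W V f(1)])
qed

end

section \<open>Power series in coordinates and their differentials\<close>

abbreviation odegs :: "nat => (bit ^ 1) list" where
 "odegs q \<equiv> replicate q 1"

text \<open>
 The variables are \<open>\<xi>\<^sup>a\<close>, \<open>dx\<^sup>j\<close>, \<open>d\<xi>\<^sup>b\<close>, in this order, so that the differential of the
 \<open>j\<close>-th coordinate has index \<open>q + j\<close>.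
\<close>

definition tdegs :: "nat => nat => (bit ^ 2) list" where
 "tdegs p q = replicate q (bidegree 0 1) @ replicate p (bidegree 1 0) @ replicate q (bidegree 1 1)"

text \<open>The exponents of the first \<open>k\<close> differentials, moved to their places behind
  the \<open>q\<close> variables \<open>xi\<close>. A multi-index is the sum of its
  \<open>head_index\<close>, which holds the exponents of the \<open>xi\<close>, and of such a tail
  for \<open>k = p + q\<close>.\<close>

definition tail_index :: "nat => nat => (nat => nat) => nat => nat" where
 "tail_index q k mu = (%b. if q \<le> b & b < q + k then mu (b - q) else 0)"

definition head_index :: "nat => (nat => nat) => nat => nat" where
 "head_index q rh = (%b. if b < q then rh b else 0)"

definition head_only :: "nat => (nat => nat) => bool" where
 "head_only q mu \<longleftrightarrow> (\<forall>b\<ge>q. mu b = 0)"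

lemma head_only_zero [simp]: "head_only q (%_. 0)" by (simp add: head_only_def)

text \<open>A superfunction on the base, regarded as a power series free of the
  differentials.\<close>

definition series_embed ::
 "nat => nat => (nat => real) set => series => series" where
 "series_embed p q V F = (\<lambda>mu\<in>MI (tdegs p q). \<lambda>x\<in>V. if head_only q mu then F mu x else 0)"

section \<open>Signs and degrees of the variables of the tangent bundle\<close>

lemma koszul_odd: "koszul (1 :: bit ^ 1) 1 = - 1" unfolding koszul_bsign sum_1 by (simp add: bsign_def)

lemma coord_degree_odd: "j < p + q ==> coord_degree p (odegs q) j = (if j < p then 0 else 1)"
 by (simp add: coord_degree_def)

lemma length_tdegs [simp]: "length (tdegs p q) = q + (p + q)" by (simp add: tdegs_def)

lemma tdegs_nth:
 "a < q ==> tdegs p q ! a = bidegree 0 1"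
 "j < p + q ==> tdegs p q ! (q + j) = bidegree 1 (coord_degree p (odegs q) j)"
 by (auto simp: tdegs_def nth_append coord_degree_odd)

lemma koszul_tangent_odd: "a < q ==> b < q ==>
  koszul (tdegs p q ! a) (tdegs p q ! b) = koszul (1 :: bit ^ 1) 1"
 by (simp add: tdegs_nth koszul_bidegree bsign_def)

lemma koszul_tangent_diff: "j < p + q ==>
  koszul (tdegs p q ! (q + j)) (tdegs p q ! (q + j)) = (if j < p then - 1 else 1)"
 by (simp add: tdegs_nth koszul_bidegree bsign_def coord_degree_odd koszul_odd)

text \<open>The variables \<open>xi\<close> and \<open>dx\<close> have sign -1 with themselves and
  come first; \<open>d xi\<close> has sign +1, so the last \<open>q\<close> exponents are
  unbounded.\<close>

lemma mi_tangent:
 "rh : MI (tdegs p q) \<longleftrightarrow> (\<forall>b\<ge>q + (p + q). rh b = 0) & (\<forall>b<q + p. rh b \<le> 1)"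
proof -
 have "(\<forall>b<q + (p + q). koszul (tdegs p q ! b) (tdegs p q ! b) = - 1 --> rh b \<le> 1) \<longleftrightarrow>
   (\<forall>b<q + p. rh b \<le> 1)" proof -
  have "koszul (tdegs p q ! b) (tdegs p q ! b) = - 1 \<longleftrightarrow> b < q + p" if b: "b < q + (p + q)" for b
  proof (cases "b < q")
   case True
   then show ?thesis using koszul_tangent_odd[OF True True] koszul_odd by simp
  next
   case False
   then have "b = q + (b - q)" "b - q < p + q" using b by auto
   then show ?thesis using koszul_tangent_diff[of "b - q" p q] False by auto
  qed
  then show ?thesis by auto
 qed
 then show ?thesis by (simp add: multi_indices_def)
qed

lemma mi_odd:
 "mu : MI (odegs q) \<longleftrightarrow> (\<forall>b\<ge>q. mu b = 0) & (\<forall>b<q. mu b \<le> 1)"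
 by (auto simp: multi_indices_def koszul_odd)

lemma mi_odd_tangent:
 "mu : MI (odegs q) \<longleftrightarrow> mu : MI (tdegs p q) & head_only q mu" proof -
 have "rh b \<le> 1" if "\<forall>b<q. rh b \<le> 1" "\<forall>b\<ge>q. rh b = 0" for b and rh :: "nat => nat"
  using that by (cases "b < q") auto
 then show ?thesis unfolding mi_odd mi_tangent head_only_def by auto
qed

lemma admissible_coord_degree:
 "admissible (p + q) (coord_degree p (odegs q)) = {mu. (\<forall>j\<ge>p + q. mu j = 0) & (\<forall>j<p. mu j \<le> 1)}"
 by (auto simp: admissible_def coord_degree_odd)

lemma add_tail_index:
 assumes "ap : MI (odegs q)" "mu : admissible (p + q) (coord_degree p (odegs q))"
 shows "(%b. ap b + tail_index q (p + q) mu b) : MI (tdegs p q)"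
 using assms unfolding mi_odd mi_tangent admissible_coord_degree by (auto simp: tail_index_def)

text \<open>The condition says that the two monomials are already in order, so that no variable has
  to move past another.\<close>

lemma monomial_sign_eq_one:
 assumes "!!a b. b < a ==> mu a = 0 | nu b = 0" shows "msign ds mu nu = 1" unfolding monomial_sign_alt
proof (intro prod.neutral ballI)
 fix a b
 show "(if b < a then koszul (ds ! a) (ds ! b) ^ (mu a * nu b) else 1) = 1"
  using assms[of b a] by (cases "b < a") auto
qed

lemma monomial_sign_tangent:
 assumes "head_only q mu" "head_only q nu" shows "msign (tdegs p q) mu nu = msign (odegs q) mu nu" proof -
 let ?n = "q + (p + q)" and ?K = "%a b. koszul (tdegs p q ! a) (tdegs p q ! b) ^ (mu a * nu b)"
 have "msign (tdegs p q) mu nu = (\<Prod>b<?n. \<Prod>a<?n. if b < a then ?K a b else 1)"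
  by (simp add: monomial_sign_alt)
 also have "... = (\<Prod>b<q. \<Prod>a<?n. if b < a then ?K a b else 1)"
  by (rule prod.mono_neutral_right) (use assms in \<open>auto simp: head_only_def intro!: prod.neutral\<close>)
 also have "... = (\<Prod>b<q. \<Prod>a<q. if b < a then ?K a b else 1)"
  by (intro prod.cong HOL.refl prod.mono_neutral_right) (use assms in \<open>auto simp: head_only_def\<close>)
 also have "... = (\<Prod>b<q. \<Prod>a<q. if b < a then koszul (odegs q ! a) (odegs q ! b) ^ (mu a * nu b) else 1)"
  by (intro prod.cong HOL.refl) (auto simp: koszul_tangent_odd)
 also have "... = msign (odegs q) mu nu" by (simp add: monomial_sign_alt)
 finally show ?thesis .
qed

lemma bidegree_zero: "bidegree 0 0 = 0" unfolding vec_eq_iff forall_2 by (simp add: bidegree_def)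

lemma bidegree_sum: "(\<Sum>a\<in>X. bidegree 0 (f a)) = bidegree 0 (\<Sum>a\<in>X. f a)"
proof (induction X rule: infinite_finite_induct)
 case (insert x X)
 then show ?case using bidegree_add[of 0 "f x" 0 "\<Sum>a\<in>X. f a"] by simp
qed (simp_all add: bidegree_zero)

lemma monomial_degree_tangent:
 assumes "head_only q mu" shows "mdeg (tdegs p q) mu = bidegree 0 (mdeg (odegs q) mu)" proof -
 have "mdeg (tdegs p q) mu = (\<Sum>a<q. \<Sum>_<mu a. tdegs p q ! a)"
  unfolding monomial_degree_def by (rule sum.mono_neutral_right) (use assms in \<open>auto simp: head_only_def\<close>)
 also have "... = (\<Sum>a<q. bidegree 0 (\<Sum>_<mu a. odegs q ! a))"
  unfolding bidegree_sum[symmetric] by (intro sum.cong HOL.refl) (simp add: tdegs_nth)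
 also have "... = bidegree 0 (mdeg (odegs q) mu)" unfolding bidegree_sum monomial_degree_def by simp
 finally show ?thesis .
qed

lemma monomial_degree_tail_index:
 "mdeg (tdegs p q) (tail_index q (p + q) mu) =
  (\<Sum>j<p + q. \<Sum>_<mu j. bidegree 1 (coord_degree p (odegs q) j))" proof -
 have "mdeg (tdegs p q) (tail_index q (p + q) mu) =
   (\<Sum>a\<in>{q..<q + (p + q)}. \<Sum>_<tail_index q (p + q) mu a. tdegs p q ! a)"
  unfolding monomial_degree_def by (rule sum.mono_neutral_right) (auto simp: tail_index_def)
 also have "... = (\<Sum>j<p + q. \<Sum>_<tail_index q (p + q) mu (q + j). tdegs p q ! (q + j))"
  by (rule sum.reindex_bij_witness[where i="%j. q + j" and j="%a. a - q"]) auto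
 also have "... = (\<Sum>j<p + q. \<Sum>_<mu j. bidegree 1 (coord_degree p (odegs q) j))"
  by (intro sum.cong) (auto simp: tail_index_def tdegs_nth)
 finally show ?thesis .
qed

text \<open>Single exponents of \<open>d xi\<close> are unbounded, but a fixed total degree bounds
  them. This finiteness makes each part of fixed form degree a polynomial in the
  differentials.\<close>

lemma finite_admissible_degree:
 "finite {mu : admissible m gm. (\<Sum>j<m. mu j) = k}" proof -
 have "(%mu. restrict mu {..<m}) ` {mu : admissible m gm. (\<Sum>j<m. mu j) = k} <= (\<Pi>\<^sub>E j\<in>{..<m}. {..k})"
 proof (rule image_subsetI)
  fix mu assume "mu : {mu : admissible m gm. (\<Sum>j<m. mu j) = k}"
  then have "mu j \<le> k" if "j < m" for j using member_le_sum[of j "{..<m}" mu] that by simp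
  then show "restrict mu {..<m} : (\<Pi>\<^sub>E j\<in>{..<m}. {..k})" by auto
 qed
 then have "finite ((%mu. restrict mu {..<m}) ` {mu : admissible m gm. (\<Sum>j<m. mu j) = k})"
  by (rule finite_subset) (auto intro: finite_PiE)
 moreover have "inj_on (%mu. restrict mu {..<m}) {mu : admissible m gm. (\<Sum>j<m. mu j) = k}" proof (rule inj_onI)
  fix mu nu :: "nat => nat"
  assume *: "mu : {mu : admissible m gm. (\<Sum>j<m. mu j) = k}" "nu : {mu : admissible m gm. (\<Sum>j<m. mu j) = k}"
   "restrict mu {..<m} = restrict nu {..<m}"
  show "mu = nu" proof
   fix j
   show "mu j = nu j" using *(1,2) fun_cong[OF *(3), of j] by (cases "j < m") (auto simp: admissible_def)
  qed
 qed
 ultimately show ?thesis by (rule finite_imageD)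
qed

section \<open>Superfunctions and differentials among the power series of the tangent bundle\<close>

context
 fixes p q :: nat and V :: "(nat => real) set"
 assumes V: "openin (Euclidean_space p) V"
begin

abbreviation "OV \<equiv> PSA p (odegs q) V"
abbreviation "TV \<equiv> PSA p (tdegs p q) V"
abbreviation "I' \<equiv> MI (tdegs p q)"

interpretation O: graded_comm_algebra OV
 by (rule graded_comm_algebra_power_series[OF V])

interpretation T: graded_comm_algebra TV
 by (rule graded_comm_algebra_power_series[OF V])

lemma series_embed_closed:
 assumes "F : carrier OV" shows "series_embed p q V F : carrier TV" unfolding series_embed_def
proof (rule ps_memI[OF V])
 fix mu assume "mu : I'"
 then show "smooth p V (%x. if head_only q mu then F mu x else 0)"
  using ps_smooth[OF V assms, of mu] smooth_const[OF V, of 0] mi_odd_tangent[of mu q p]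
  by (cases "head_only q mu") auto
qed

lemma series_embed_apply:
 "mu : I' ==> x : V ==> series_embed p q V F mu x = (if head_only q mu then F mu x else 0)"
 by (simp add: series_embed_def)

lemma series_embed_mult:
 assumes F: "F : carrier OV" and G: "G : carrier OV"
 shows "series_embed p q V (F \<otimes>\<^bsub>OV\<^esub> G) = series_embed p q V F \<otimes>\<^bsub>TV\<^esub> series_embed p q V G"
proof (rule ps_eqI[of _ p "tdegs p q" V])
 fix rh x assume *: "rh : I'" "x : V"
 show "series_embed p q V (F \<otimes>\<^bsub>OV\<^esub> G) rh x = (series_embed p q V F \<otimes>\<^bsub>TV\<^esub> series_embed p q V G) rh x"
 proof (cases "head_only q rh")
  case True
  then have rh: "rh : MI (odegs q)" using *(1) mi_odd_tangent by blast
  have "conv (tdegs p q) (%mu. series_embed p q V F mu x) (%mu. series_embed p q V G mu x) rh =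
   conv (odegs q) (%mu. F mu x) (%mu. G mu x) rh" unfolding conv_splits
  proof (rule sum.cong[OF HOL.refl], clarify)
   fix mu nu assume s: "(mu, nu) : splits rh"
   then have I: "mu : MI (odegs q)" "nu : MI (odegs q)" using splits_multi_indices[OF rh] by auto
   then have "mu : I'" "nu : I'" "head_only q mu" "head_only q nu" using mi_odd_tangent by blast+
   then show "msign (tdegs p q) mu nu * series_embed p q V F mu x * series_embed p q V G nu x =
   msign (odegs q) mu nu * F mu x * G nu x" using *(2) by (simp add: series_embed_apply monomial_sign_tangent)
  qed
  then show ?thesis using True by (simp add: series_embed_apply[OF *] ps_apply[OF V *] ps_apply[OF V rh *(2)])
 next
  case False
  have "conv (tdegs p q) (%mu. series_embed p q V F mu x) (%mu. series_embed p q V G mu x) rh = 0"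
   unfolding conv_splits proof (rule sum.neutral, clarify)
   fix mu nu assume s: "(mu, nu) : splits rh"
   have I: "mu : I'" "nu : I'" using splits_multi_indices[OF *(1) s] by auto
   have "\<not> head_only q mu | \<not> head_only q nu" using s False by (auto simp: splits_def head_only_def)
   then show "msign (tdegs p q) mu nu * series_embed p q V F mu x * series_embed p q V G nu x = 0"
   using I *(2) by (auto simp: series_embed_apply)
  qed
  then show ?thesis using False by (simp add: series_embed_apply[OF *] ps_apply[OF V *])
 qed
qed (use assms in \<open>auto intro: series_embed_closed\<close>)

lemma series_embed_add:
 assumes F: "F : carrier OV" and G: "G : carrier OV"
 shows "series_embed p q V (F \<oplus>\<^bsub>OV\<^esub> G) = series_embed p q V F \<oplus>\<^bsub>TV\<^esub> series_embed p q V G"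
proof (rule ps_eqI[of _ p "tdegs p q" V])
 fix rh x assume *: "rh : I'" "x : V"
 then show "series_embed p q V (F \<oplus>\<^bsub>OV\<^esub> G) rh x = (series_embed p q V F \<oplus>\<^bsub>TV\<^esub> series_embed p q V G) rh x"
  using ps_apply(2)[OF V _ *(2), of rh "odegs q" F G] mi_odd_tangent[of rh q p]
  by (simp add: series_embed_apply[OF *] ps_apply[OF V *])
qed (use assms in \<open>auto intro: series_embed_closed\<close>)

lemma series_embed_smult:
 assumes F: "F : carrier OV"
 shows "series_embed p q V (r \<odot>\<^bsub>OV\<^esub> F) = r \<odot>\<^bsub>TV\<^esub> series_embed p q V F"
proof (rule ps_eqI[of _ p "tdegs p q" V])
 fix rh x assume *: "rh : I'" "x : V"
 then show "series_embed p q V (r \<odot>\<^bsub>OV\<^esub> F) rh x = (r \<odot>\<^bsub>TV\<^esub> series_embed p q V F) rh x"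
  using ps_apply(3)[OF V _ *(2), of rh "odegs q" r F] mi_odd_tangent[of rh q p]
  by (simp add: series_embed_apply[OF *] ps_apply[OF V *])
qed (use assms in \<open>auto intro: series_embed_closed O.smult_closed' T.smult_closed'\<close>)

lemma series_embed_one: "series_embed p q V \<one>\<^bsub>OV\<^esub> = \<one>\<^bsub>TV\<^esub>"
proof (rule ps_eqI[of _ p "tdegs p q" V])
 fix rh x assume *: "rh : I'" "x : V"
 then show "series_embed p q V \<one>\<^bsub>OV\<^esub> rh x = \<one>\<^bsub>TV\<^esub> rh x"
  using ps_apply(4)[OF V _ *(2), of rh "odegs q"] mi_odd_tangent[of rh q p]
  by (auto simp: series_embed_apply[OF *] ps_apply[OF V *])
qed (auto intro: series_embed_closed)

lemma series_embed_gcomp: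
 assumes "F : gcomp OV dl" shows "series_embed p q V F : gcomp TV (bidegree 0 dl)" proof -
 have "series_embed p q V F mu x = 0"
  if *: "mu : I'" "x : V" and deg: "mdeg (tdegs p q) mu ~= bidegree 0 dl" for mu x proof (cases "head_only q mu")
  case True
  then have "mdeg (odegs q) mu ~= dl" using deg monomial_degree_tangent[OF True] by auto
  moreover have "mu : MI (odegs q)" using * True mi_odd_tangent by blast
  ultimately show ?thesis using assms *(2) by (simp add: gcomp_ps series_embed_apply[OF *])
 qed (simp add: series_embed_apply[OF *])
 then show ?thesis using series_embed_closed assms by (simp add: gcomp_ps)
qed

text \<open>The condition puts the variables of the first factor before those of the second or level
  with them, so the product carries no sign.\<close>

lemma series_monom_mult:
 assumes "!!a b. b < a ==> ap a = 0 | bt b = 0"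
 shows "series_monom (tdegs p q) V ap \<otimes>\<^bsub>TV\<^esub> series_monom (tdegs p q) V bt =
  series_monom (tdegs p q) V (%b. ap b + bt b)" proof (rule ps_eqI[of _ p "tdegs p q" V])
 let ?m = "series_monom (tdegs p q) V"
 show "?m ap \<otimes>\<^bsub>TV\<^esub> ?m bt : carrier TV" "?m (%b. ap b + bt b) : carrier TV"
  using series_monom_gcomp[OF V] T.gcomp_closed by blast+
 fix rh x assume *: "rh : I'" "x : V"
 have "(%b. rh b - bt b) = ap \<longleftrightarrow> rh = (%b. ap b + bt b)" if "bt \<le> rh" proof
  assume "(%b. rh b - bt b) = ap"
  then show "rh = (%b. ap b + bt b)" using that by (auto simp: le_fun_def)
 qed auto
 moreover have "bt \<le> rh" if "rh = (%b. ap b + bt b)" unfolding that by (simp add: le_fun_def)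
 moreover have "(%b. rh b - bt b) : I'" by (rule mi_mono[OF *(1)]) (simp add: le_fun_def)
 moreover have "msign (tdegs p q) ap bt = 1" using assms by (rule monomial_sign_eq_one)
 moreover have "(?m ap \<otimes>\<^bsub>TV\<^esub> ?m bt) rh x =
   (if bt \<le> rh then msign (tdegs p q) (%b. rh b - bt b) bt * ?m ap (%b. rh b - bt b) x else 0)"
  unfolding ps_apply(1)[OF V *] conv_series_monom[OF *] ..
 ultimately show "(?m ap \<otimes>\<^bsub>TV\<^esub> ?m bt) rh x = ?m (%b. ap b + bt b) rh x"
  using * by (auto simp: series_monom_def)
qed

lemma ordered_monom_series:
 "ordered_monom TV (%j. series_monom (tdegs p q) V (unit_index (q + j))) mu k =
  series_monom (tdegs p q) V (tail_index q k mu)" proof (induction k)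
 case 0
 have "tail_index q 0 mu = (%_. 0)" by (auto simp: tail_index_def fun_eq_iff)
 then show ?case by (simp add: series_monom_def ps_simps)
next
 case (Suc k)
 let ?m = "series_monom (tdegs p q) V"
 have pow: "?m (unit_index (q + k)) [^]\<^bsub>TV\<^esub> n = ?m (%b. if b = q + k then n else 0)" for n :: nat
 proof (induction n)
  case 0
  show ?case by (simp add: series_monom_def ps_simps)
 next
  case (Suc n)
  have "?m (unit_index (q + k)) [^]\<^bsub>TV\<^esub> Suc n = ?m (%b. if b = q + k then n else 0) \<otimes>\<^bsub>TV\<^esub> ?m (unit_index (q + k))"
   using Suc by simp
  also have "... = ?m (%b. (if b = q + k then n else 0) + unit_index (q + k) b)" by (rule series_monom_mult) auto
  also have "(%b. (if b = q + k then n else 0) + unit_index (q + k) b) = (%b. if b = q + k then Suc n else 0)"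
   by auto
  finally show ?case .
 qed
 have "ordered_monom TV (%j. ?m (unit_index (q + j))) mu (Suc k) =
   ?m (tail_index q k mu) \<otimes>\<^bsub>TV\<^esub> ?m (%b. if b = q + k then mu k else 0)"
  unfolding ordered_monom.simps Suc pow ..
 also have "... = ?m (%b. tail_index q k mu b + (if b = q + k then mu k else 0))"
  by (rule series_monom_mult) (auto simp: tail_index_def)
 also have "(%b. tail_index q k mu b + (if b = q + k then mu k else 0)) = tail_index q (Suc k) mu"
  by (auto simp: tail_index_def fun_eq_iff)
 finally show ?case .
qed

lemma head_tail_index: "rh : I' ==> (%b. head_index q rh b + tail_index q (p + q) (%j. rh (q + j)) b) = rh"
 by (auto simp: head_index_def tail_index_def mi_tangent fun_eq_iff)

lemma head_multi_index: "rh : I' ==> head_index q rh : MI (odegs q)" by (auto simp: head_index_def mi_odd mi_tangent)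

lemma tail_admissible:
 "rh : I' ==> (%j. rh (q + j)) : admissible (p + q) (coord_degree p (odegs q))"
 by (auto simp: admissible_coord_degree mi_tangent)

text \<open>The \<open>xi\<close> precede the differentials, so a function times an ordered monomial
  carries no sign. Its coefficient at \<open>rh\<close> is therefore found by cutting
  \<open>rh\<close> into head and tail; this is what allows coefficients of normal forms to be read
  off.\<close>

lemma embed_monom_apply:
 assumes mu: "mu : admissible (p + q) (coord_degree p (odegs q))" and *: "rh : I'" "x : V"
 shows "(series_embed p q V F \<otimes>\<^bsub>TV\<^esub> ordered_monom TV
   (%j. series_monom (tdegs p q) V (unit_index (q + j))) mu (p + q)) rh x =
  (if (%j. rh (q + j)) = mu then F (head_index q rh) x else 0)" proof -
 let ?ta = "tail_index q (p + q) mu"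
 have "(series_embed p q V F \<otimes>\<^bsub>TV\<^esub> ordered_monom TV
   (%j. series_monom (tdegs p q) V (unit_index (q + j))) mu (p + q)) rh x =
  (if ?ta \<le> rh then msign (tdegs p q) (%b. rh b - ?ta b) ?ta *
   series_embed p q V F (%b. rh b - ?ta b) x else 0)"
  unfolding ordered_monom_series ps_apply(1)[OF V *] conv_series_monom[OF *] ..
 also have "... = (if (%j. rh (q + j)) = mu then F (head_index q rh) x else 0)" proof (cases "(%j. rh (q + j)) = mu")
  case True
  have rh: "rh b = head_index q rh b + ?ta b" for b using head_tail_index[OF *(1)] True by (metis (no_types))
  have le: "?ta \<le> rh" by (simp add: le_fun_def rh)
  have eq: "(%b. rh b - ?ta b) = head_index q rh" by (rule ext) (subst rh, simp)
  have "msign (tdegs p q) (head_index q rh) ?ta = 1"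
   by (rule monomial_sign_eq_one) (auto simp: head_index_def tail_index_def)
  moreover have "series_embed p q V F (head_index q rh) x = F (head_index q rh) x"
   using head_multi_index[OF *(1)] mi_odd_tangent[of "head_index q rh" q p] *(2) by (simp add: series_embed_apply)
  ultimately show ?thesis using True le by (simp add: eq)
 next
  case False
  have "series_embed p q V F (%b. rh b - ?ta b) x = 0" if le: "?ta \<le> rh" proof -
   have "\<not> head_only q (%b. rh b - ?ta b)" proof
   assume "head_only q (%b. rh b - ?ta b)"
   then have h: "\<forall>b\<ge>q. rh b - ?ta b = 0" by (simp add: head_only_def)
   have "rh (q + j) = mu j" for j proof (cases "j < p + q")
   case True
   then have "?ta (q + j) = mu j" by (simp add: tail_index_def)
   moreover have "rh (q + j) = ?ta (q + j)" using h le by (metis diff_is_0_eq le_add1 le_antisym le_fun_def)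
   ultimately show ?thesis by simp
   next
   case False
   then show ?thesis using *(1) mu by (simp add: mi_tangent admissible_coord_degree)
   qed
   then show False using \<open>(%j. rh (q + j)) ~= mu\<close> by auto
   qed
   moreover have "(%b. rh b - ?ta b) : I'" by (rule mi_mono[OF *(1)]) (simp add: le_fun_def)
   ultimately show ?thesis using *(2) by (auto simp: series_embed_apply)
  qed
  then show ?thesis using False by auto
 qed
 finally show ?thesis .
qed

definition degree_part :: "nat => series set" where
 "degree_part k = {F : carrier TV. ALL mu:I'. (\<Sum>j<p + q. mu (q + j)) ~= k --> (ALL x:V. F mu x = 0)}"

lemma degree_part_mult:
 assumes F: "F : degree_part k" and G: "G : degree_part l"
 shows "F \<otimes>\<^bsub>TV\<^esub> G : degree_part (k + l)" proof -
 have "(F \<otimes>\<^bsub>TV\<^esub> G) rh x = 0" if *: "rh : I'" "x : V" and deg: "(\<Sum>j<p + q. rh (q + j)) ~= k + l" for rh x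
  unfolding ps_apply(1)[OF V *] conv_splits proof (rule sum.neutral, clarify)
  fix mu nu assume s: "(mu, nu) : splits rh"
  have I: "mu : I'" "nu : I'" using splits_multi_indices[OF *(1) s] by auto
  have "(\<Sum>j<p + q. mu (q + j)) + (\<Sum>j<p + q. nu (q + j)) = (\<Sum>j<p + q. rh (q + j))"
   using s unfolding sum.distrib[symmetric] by (auto simp: splits_def)
  then have "(\<Sum>j<p + q. mu (q + j)) ~= k | (\<Sum>j<p + q. nu (q + j)) ~= l" using deg by auto
  then show "msign (tdegs p q) mu nu * F mu x * G nu x = 0" using F G I *(2) unfolding degree_part_def by auto
 qed
 then show ?thesis using F G by (simp add: degree_part_def)
qed

lemma degree_part_closed:
 "\<zero>\<^bsub>TV\<^esub> : degree_part k"
 "F : degree_part k ==> G : degree_part k ==> F \<oplus>\<^bsub>TV\<^esub> G : degree_part k"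
 "F : degree_part k ==> r \<odot>\<^bsub>TV\<^esub> F : degree_part k"
 by (auto simp: degree_part_def ps_apply[OF V] T.smult_closed')

lemma series_embed_degree_part: "F : carrier OV ==> series_embed p q V F : degree_part 0" proof -
 assume F: "F : carrier OV"
 have "series_embed p q V F mu x = 0" if "mu : I'" "x : V" "(\<Sum>j<p + q. mu (q + j)) ~= 0" for mu x
  using that by (auto simp: series_embed_apply head_only_def)
 then show ?thesis using series_embed_closed[OF F] by (simp add: degree_part_def)
qed

lemma series_monom_degree_part:
 assumes "j < p + q" shows "series_monom (tdegs p q) V (unit_index (q + j)) : degree_part 1" proof -
 have "(\<Sum>i<p + q. unit_index (q + j) (q + i)) = 1" using assms by simp
 then show ?thesis using T.gcomp_closed[OF series_monom_gcomp[OF V]] unfolding degree_part_def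
  by (auto simp: series_monom_def)
qed

end

section \<open>Charts\<close>

text \<open>A chart in the direction opposite to \<open>isomorphic_ringed_spaces\<close>:
  \<open>kp\<close> leads from sections to power series, and everything is indexed by the open
  subsets of the chart domain in \<open>M\<close>, over which derivations and forms live.\<close>

locale superchart = exterior M for M :: "('m, 'b, 1) ringed_space" +
 fixes U0 :: "'m set" and p q :: nat and ph :: "'m => nat => real" and kp :: "'m set => 'b => series"
 assumes U0: "openin (base M) U0" and inj_ph: "inj_on ph U0"
  and open_image: "W : opens M U0 ==> openin (Euclidean_space p) (ph ` W)"
  and open_preimage: "openin (Euclidean_space p) Y ==> Y <= ph ` U0 ==> openin (base M) {x : U0. ph x : Y}"
  and kp_hom: "W : opens M U0 ==>
   kp W : graded_hom (sections M W) (PSA p (odegs q) (ph ` W))" and kp_bij: "W : opens M U0 ==>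
   bij_betw (kp W) (carrier (sections M W)) (carrier (PSA p (odegs q) (ph ` W)))"
  and kp_res: "W : opens M U0 ==> V : opens M W ==> a : carrier (sections M W) ==>
   kp V (res M W V a) = (\<lambda>mu\<in>MI (odegs q). restrict (kp W a mu) (ph ` V))"
begin

abbreviation SA :: "'m set => (series, 1) graded_algebra" where
 "SA W \<equiv> PSA p (odegs q) (ph ` W)"

definition kpinv :: "'m set => series => 'b" where
 "kpinv W = inv_into (carrier (A W)) (kp W)"

lemma odd_degrees_odd: "a < length (odegs q) ==> koszul (odegs q ! a) (odegs q ! a) = - 1" by (simp add: koszul_odd)

lemma graded_SA: "W : opens M U0 ==> graded_comm_algebra (SA W)"
 by (rule graded_comm_algebra_power_series[OF open_image])

lemma graded_AW: "W : opens M U0 ==> graded_comm_algebra (A W)" using graded_A by blast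

lemma kpinv_hom: "W : opens M U0 ==> kpinv W : graded_hom (SA W) (A W)"
 unfolding kpinv_def by (rule graded_hom_inverse[OF kp_hom graded_AW graded_SA kp_bij])

lemma kp_kpinv: "W : opens M U0 ==> F : carrier (SA W) ==> kp W (kpinv W F) = F"
 unfolding kpinv_def by (rule bij_betw_inv_into_right[OF kp_bij])

lemma kpinv_kp: "W : opens M U0 ==> a : carrier (A W) ==> kpinv W (kp W a) = a"
 unfolding kpinv_def by (rule bij_betw_inv_into_left[OF kp_bij])

lemma kp_closed: "W : opens M U0 ==> a : carrier (A W) ==> kp W a : carrier (SA W)"
 by (rule graded_hom_simps(1)[OF kp_hom])

lemma kpinv_closed: "W : opens M U0 ==> F : carrier (SA W) ==> kpinv W F : carrier (A W)"
 by (rule graded_hom_simps(1)[OF kpinv_hom])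

lemma opens_sub0: "W : opens M U0 ==> V : opens M W ==> V : opens M U0" by auto

lemma res_kpinv:
 assumes W: "W : opens M U0" and V: "V : opens M W" and F: "F : carrier (SA W)"
 shows "res M W V (kpinv W F) = kpinv V (\<lambda>mu\<in>MI (odegs q). restrict (F mu) (ph ` V))" proof -
 have V0: "V : opens M U0" and oW: "openin (base M) W" using W V by auto
 have "kp V (res M W V (kpinv W F)) = (\<lambda>mu\<in>MI (odegs q). restrict (F mu) (ph ` V))"
  unfolding kp_res[OF W V kpinv_closed[OF W F]] kp_kpinv[OF W F] ..
 then show ?thesis using kpinv_kp[OF V0 res_closed[OF oW V kpinv_closed[OF W F]]] by simp
qed

definition z :: "nat => 'b" where
 "z j = kpinv U0 (series_coord p (odegs q) (ph ` U0) j)"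

definition e :: "nat => ('m, 'b) derivation" where
 "e j = (\<lambda>V\<in>opens M U0. \<lambda>a\<in>carrier (A V).
  kpinv V (series_deriv p (odegs q) (ph ` V) j (kp V a)))"

abbreviation m :: nat where
 "m \<equiv> p + q"

abbreviation gm :: "nat => bit ^ 1" where
 "gm \<equiv> coord_degree p (odegs q)"

lemma series_coord_closed: "W : opens M U0 ==> j < m ==> series_coord p (odegs q) (ph ` W) j : gcomp (SA W) (gm j)"
 by (rule series_coord_gcomp[OF open_image odd_degrees_odd]) auto

lemma series_coord_closed': "W : opens M U0 ==> j < m ==> series_coord p (odegs q) (ph ` W) j : carrier (SA W)"
 using series_coord_closed by (simp add: gcomp_ps)

lemma kp_coord:
 assumes W: "W : opens M U0" and j: "j < m" shows "kp W (res M U0 W (z j)) = series_coord p (odegs q) (ph ` W) j"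
proof -
 have U: "U0 : opens M U0" using U0 by simp
 have "ph ` W <= ph ` U0" using W by auto
 then show ?thesis unfolding z_def kp_res[OF U W kpinv_closed[OF U series_coord_closed'[OF U j]]]
   kp_kpinv[OF U series_coord_closed'[OF U j]] by (rule series_coord_restrict)
qed

lemma j_less: "j < m ==> j < p + length (odegs q)" by simp

context
 fixes W :: "'m set" and j :: nat
 assumes W: "W : opens M U0" and j: "j < m"
begin

lemma deriv_closed: "F : carrier (SA W) ==> series_deriv p (odegs q) (ph ` W) j F : carrier (SA W)"
 by (rule series_deriv_closed[OF open_image[OF W] odd_degrees_odd _ j_less[OF j]])

lemma e_apply: "a : carrier (A W) ==> e j W a = kpinv W (series_deriv p (odegs q) (ph ` W) j (kp W a))"
 using W by (simp add: e_def)

lemma kp_e: "a : carrier (A W) ==> kp W (e j W a) = series_deriv p (odegs q) (ph ` W) j (kp W a)"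
 unfolding e_apply by (rule kp_kpinv[OF W deriv_closed]) (auto intro: kp_closed[OF W])

lemma e_closed': "a : carrier (A W) ==> e j W a : carrier (A W)"
 unfolding e_apply by (rule kpinv_closed[OF W deriv_closed]) (auto intro: kp_closed[OF W])

lemma kp_inject: "a : carrier (A W) ==> b : carrier (A W) ==> kp W a = kp W b ==> a = b"
 using kp_bij[OF W] by (meson bij_betw_imp_inj_on inj_onD)

end

text \<open>\<open>kp\<close> is injective and turns \<open>e j\<close> into a partial derivative of
  power series, so the identities are checked there.\<close>

lemma e_homogeneous':
 assumes j: "j < m" shows "e j : HDer M U0 (gm j)" proof (rule hderI)
 fix V assume V: "V : opens M U0"
 interpret AV: graded_comm_algebra "A V"
  by (rule graded_AW[OF V])
 note hom = graded_hom_simps[OF kp_hom[OF V]]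
 note kin = kp_inject[OF V j]
 note ke = kp_e[OF V j]
 note ec = e_closed'[OF V j]
 have ser: "F : carrier (SA V) ==> G : carrier (SA V) ==>
   series_deriv p (odegs q) (ph ` V) j (F \<oplus>\<^bsub>SA V\<^esub> G) =
   series_deriv p (odegs q) (ph ` V) j F \<oplus>\<^bsub>SA V\<^esub> series_deriv p (odegs q) (ph ` V) j G"
  "F : carrier (SA V) ==> series_deriv p (odegs q) (ph ` V) j (r \<odot>\<^bsub>SA V\<^esub> F) =
   r \<odot>\<^bsub>SA V\<^esub> series_deriv p (odegs q) (ph ` V) j F" for F G r
  by (rule series_deriv_add[OF open_image[OF V] odd_degrees_odd _ _ j_less[OF j]]; assumption)
   (rule series_deriv_smult[OF open_image[OF V] odd_degrees_odd _ j_less[OF j]]; assumption)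
 show "e j V : extensional (carrier (A V))" using V by (simp add: e_def)
 show "e j V a : carrier (A V)" if "a : carrier (A V)" for a by (rule ec[OF that])
 show "e j V (a \<oplus>\<^bsub>A V\<^esub> b) = e j V a \<oplus>\<^bsub>A V\<^esub> e j V b"
  if a: "a : carrier (A V)" and b: "b : carrier (A V)" for a b
  by (rule kin) (use a b ec hom(1) in \<open>simp_all add: hom(3) ke ser\<close>)
 show "e j V (r \<odot>\<^bsub>A V\<^esub> a) = r \<odot>\<^bsub>A V\<^esub> e j V a" if a: "a : carrier (A V)" for r a
  by (rule kin) (use a ec hom(1) in \<open>simp_all add: hom(5) ke ser AV.smult_closed'\<close>)
 show "e j V a : gcomp (A V) (gm j + dl)" if a: "a : gcomp (A V) dl" for dl a
  unfolding e_apply[OF V j AV.gcomp_closed[OF a]] by (rule graded_hom_simps(6)[OF kpinv_hom[OF V]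
   series_deriv_gcomp[OF open_image[OF V] odd_degrees_odd hom(6)[OF a] j_less[OF j]]])
 show "e j V (a \<otimes>\<^bsub>A V\<^esub> b) = (e j V a \<otimes>\<^bsub>A V\<^esub> b) \<oplus>\<^bsub>A V\<^esub> (koszul (gm j) dl \<odot>\<^bsub>A V\<^esub> (a \<otimes>\<^bsub>A V\<^esub> e j V b))"
  if a: "a : gcomp (A V) dl" and b: "b : carrier (A V)" for dl a b proof (rule kin)
  note ac = AV.gcomp_closed[OF a]
  show "kp V (e j V (a \<otimes>\<^bsub>A V\<^esub> b)) =
   kp V ((e j V a \<otimes>\<^bsub>A V\<^esub> b) \<oplus>\<^bsub>A V\<^esub> (koszul (gm j) dl \<odot>\<^bsub>A V\<^esub> (a \<otimes>\<^bsub>A V\<^esub> e j V b)))"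
   using ac b ec hom(1) series_deriv_mult[OF open_image[OF V] odd_degrees_odd hom(6)[OF a] hom(1)[OF b] j_less[OF j]]
   by (simp add: hom(2,3,5) ke AV.smult_closed')
 qed (use AV.gcomp_closed[OF a] b ec in \<open>simp_all add: AV.smult_closed'\<close>)
 show "res M V W (e j V a) = e j W (res M V W a)" if W: "W : opens M V" and a: "a : carrier (A V)" for W a proof -
  note W0 = opens_sub0[OF V W]
  have oV: "openin (base M) V" using V by simp
  have sub: "ph ` W <= ph ` V" using W by auto
  show ?thesis unfolding e_apply[OF V j a] e_apply[OF W0 j res_closed[OF oV W a]] kp_res[OF V W a]
   res_kpinv[OF V W deriv_closed[OF V j kp_closed[OF V a]]]
   by (rule arg_cong[OF HOL.sym[OF series_deriv_restrict[OF open_image[OF V] odd_degrees_odd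
   kp_closed[OF V a] j_less[OF j] open_image[OF W0] sub]]])
 qed
qed (simp add: e_def)

lemma framed: "framed M U0 m gm z e" proof unfold_locales
 have U: "U0 : opens M U0" using U0 by simp
 show "openin (base M) U0" by (rule U0)
 show "z j : gcomp (A U0) (gm j)" if "j < m" for j
  unfolding z_def by (rule graded_hom_simps(6)[OF kpinv_hom[OF U] series_coord_closed[OF U that]])
 show "e j : HDer M U0 (gm j)" if "j < m" for j by (rule e_homogeneous'[OF that])
 show "e i U0 (z j) = (if i = j then \<one>\<^bsub>A U0\<^esub> else \<zero>\<^bsub>A U0\<^esub>)" if i: "i < m" and j: "j < m" for i j
 proof -
  note c = series_coord_closed'[OF U j]
  have "e i U0 (z j) = kpinv U0 (series_deriv p (odegs q) (ph ` U0) i (series_coord p (odegs q) (ph ` U0) j))"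
   unfolding e_apply[OF U i kpinv_closed[OF U c, folded z_def]] by (simp add: z_def kp_kpinv[OF U c])
  also have "... = kpinv U0 (if i = j then \<one>\<^bsub>SA U0\<^esub> else \<zero>\<^bsub>SA U0\<^esub>)"
   by (subst series_deriv_coord[OF open_image[OF U] odd_degrees_odd j_less[OF i] j_less[OF j]]) auto
  also have "... = (if i = j then \<one>\<^bsub>A U0\<^esub> else \<zero>\<^bsub>A U0\<^esub>)"
   using graded_hom_simps(4)[OF kpinv_hom[OF U]] graded_hom_zero[OF kpinv_hom[OF U] graded_SA[OF U] graded_AW[OF U]]
   by simp
  finally show ?thesis .
 qed
 show "E W a = \<zero>\<^bsub>A W\<^esub>" if W: "W : opens M U0" and E: "E : HDer M W dl"
   and kill: "!!j. j < m ==> E W (res M U0 W (z j)) = \<zero>\<^bsub>A W\<^esub>" and a: "a : carrier (A W)" for W E dl a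
 proof -
  have oW: "openin (base M) W" using W by simp
  \<comment> \<open>\<open>P V\<close> is the part of \<open>W\<close> over \<open>V\<close>. It
    makes open subsets of \<open>M\<close> out of open sets in Euclidean space, so that
    \<open>E\<close> becomes a family \<open>D\<close> of derivations of power series and
    \<open>series_derivation_eq_zero\<close> applies.\<close>
  define P where "P V = {x : W. ph x : V}" for V
  have WU: "W <= U0" using W by simp
  have P: "P V : opens M W" "ph ` P V = V" if V: "openin (Euclidean_space p) V" "V <= ph ` W" for V proof -
   have "P V = {x : U0. ph x : V}" using V(2) WU inj_ph by (auto simp: P_def inj_on_def)
   moreover have "V <= ph ` U0" using V(2) WU by auto
   ultimately show "P V : opens M W" using open_preimage[OF V(1)] by (auto simp: P_def)
   show "ph ` P V = V" using V(2) by (auto simp: P_def)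
  qed
  have PW: "P (ph ` W) = W" by (auto simp: P_def)
  have P0: "P V : opens M U0" if "openin (Euclidean_space p) V" "V <= ph ` W" for V using P(1)[OF that] W by auto
  define D where "D V F = kp (P V) (E (P V) (kpinv (P V) F))" for V F
  have SAP: "SA (P V) = PSA p (odegs q) V" if "openin (Euclidean_space p) V" "V <= ph ` W" for V
   using P(2)[OF that] by simp
  note ED = hderD[OF E]
  have DWz: "D (ph ` W) (kp W a) = \<zero>\<^bsub>PSA p (odegs q) (ph ` W)\<^esub>"
  proof (rule series_derivation_eq_zero[where ds="odegs q" and D=D and gm=dl])
   show "koszul (odegs q ! a) (odegs q ! a) = - 1" if "a < length (odegs q)" for a
   using that by (rule odd_degrees_odd)
   show "openin (Euclidean_space p) (ph ` W)" by (rule open_image[OF W])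
   show "kp W a : carrier (PSA p (odegs q) (ph ` W))" by (rule kp_closed[OF W a])
   fix V assume V: "openin (Euclidean_space p) V" "V <= ph ` W"
   let ?S = "PSA p (odegs q) V"
   note PV = P(1)[OF V] and PV0 = P0[OF V]
   interpret AP: graded_comm_algebra "A (P V)"
   by (rule graded_AW[OF PV0])
   have kc: "kpinv (P V) F : carrier (A (P V))" if "F : carrier ?S" for F
   using kpinv_closed[OF PV0] that unfolding SAP[OF V] .
   have Ec: "E (P V) (kpinv (P V) F) : carrier (A (P V))" if "F : carrier ?S" for F
   by (rule ED(3)[OF PV kc[OF that]])
   note hi = graded_hom_simps[OF kpinv_hom[OF PV0], unfolded SAP[OF V]]
   note h = graded_hom_simps[OF kp_hom[OF PV0], unfolded SAP[OF V]]
   show "D V F : carrier ?S" if "F : carrier ?S" for F unfolding D_def by (rule h(1)[OF Ec[OF that]])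
   show "D V (F \<oplus>\<^bsub>?S\<^esub> G) = D V F \<oplus>\<^bsub>?S\<^esub> D V G" if "F : carrier ?S" "G : carrier ?S" for F G
   unfolding D_def using that kc Ec by (simp add: hi(3) h(3) ED(4)[OF PV])
   show "D V (r \<odot>\<^bsub>?S\<^esub> F) = r \<odot>\<^bsub>?S\<^esub> D V F" if "F : carrier ?S" for r F
   unfolding D_def using that kc Ec by (simp add: hi(5) h(5) ED(5)[OF PV])
   show "D V (F \<otimes>\<^bsub>?S\<^esub> G) = (D V F \<otimes>\<^bsub>?S\<^esub> G) \<oplus>\<^bsub>?S\<^esub> (koszul dl d \<odot>\<^bsub>?S\<^esub> (F \<otimes>\<^bsub>?S\<^esub> D V G))"
   if F: "F : gcomp ?S d" and G: "G : carrier ?S" for d F G proof -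
   have Fc: "F : carrier ?S" using F by (simp add: gcomp_ps)
   have kk: "kp (P V) (kpinv (P V) H) = H" if "H : carrier ?S" for H
   using kp_kpinv[OF PV0] that unfolding SAP[OF V] .
   show ?thesis unfolding D_def hi(2)[OF Fc G] ED(7)[OF PV hi(6)[OF F] kc[OF G]]
   using kc Ec Fc G by (simp add: h(2,3,5) AP.smult_closed' kk)
   qed
   show "D V (\<lambda>mu\<in>MI (odegs q). restrict (F mu) V) =
   (\<lambda>mu\<in>MI (odegs q). restrict (D (ph ` W) F mu) V)"
   if F: "F : carrier (PSA p (odegs q) (ph ` W))" for F proof -
   have WW: "W : opens M W" using oW by simp
   have Fc: "kpinv W F : carrier (A W)" by (rule kpinv_closed[OF W F])
   have "kpinv (P V) (\<lambda>mu\<in>MI (odegs q). restrict (F mu) V) = res M W (P V) (kpinv W F)"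
   using res_kpinv[OF W PV F] unfolding P(2)[OF V] by simp
   then have "D V (\<lambda>mu\<in>MI (odegs q). restrict (F mu) V) = kp (P V) (res M W (P V) (E W (kpinv W F)))"
   unfolding D_def ED(8)[OF WW PV Fc] by simp
   also have "... = (\<lambda>mu\<in>MI (odegs q). restrict (D (ph ` W) F mu) V)"
   unfolding kp_res[OF W PV ED(3)[OF WW Fc]] P(2)[OF V] D_def PW ..
   finally show ?thesis .
   qed
  next
   fix j assume "j < p + length (odegs q)"
   then have j: "j < m" by simp
   have "kpinv W (series_coord p (odegs q) (ph ` W) j) = res M U0 W (z j)"
   using kpinv_kp[OF W res_closed[OF U0 W, of "z j"]] kp_coord[OF W j]
   kpinv_closed[OF U series_coord_closed'[OF U j]] by (simp add: z_def)
   then show "D (ph ` W) (series_coord p (odegs q) (ph ` W) j) = \<zero>\<^bsub>PSA p (odegs q) (ph ` W)\<^esub>"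
   unfolding D_def PW using kill[OF j] graded_hom_zero[OF kp_hom[OF W] graded_AW[OF W] graded_SA[OF W]] by simp
  qed
  have WW: "W : opens M W" using oW by simp
  interpret AW: graded_comm_algebra "A W"
   by (rule graded_AW[OF W])
  have "kp W (E W a) = kp W \<zero>\<^bsub>A W\<^esub>"
   using DWz graded_hom_zero[OF kp_hom[OF W] graded_AW[OF W] graded_SA[OF W]]
   unfolding D_def PW kpinv_kp[OF W a] by simp
  moreover have "inj_on (kp W) (carrier (A W))" using kp_bij[OF W] by (rule bij_betw_imp_inj_on)
  ultimately show ?thesis using ED(3)[OF WW a] AW.zero_closed by (meson inj_onD)
 qed
qed

end

subsection \<open>The exterior algebra of a chart\<close>

context superchart
begin

abbreviation TS :: "'m set => (series, 2) graded_algebra" where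
 "TS W \<equiv> PSA p (tdegs p q) (ph ` W)"

abbreviation I :: "(nat => nat) set" where
 "I \<equiv> MI (tdegs p q)"

abbreviation form_degree :: "(nat => nat) => nat" where
 "form_degree mu \<equiv> \<Sum>j<p + q. mu (q + j)"

definition fn :: "'m set => 'b => series" where
 "fn W a = series_embed p q (ph ` W) (kp W a)"

definition dz :: "'m set => nat => series" where
 "dz W j = series_monom (tdegs p q) (ph ` W) (unit_index (q + j))"

definition rs :: "'m set => series => series" where
 "rs V F = (\<lambda>mu\<in>I. restrict (F mu) (ph ` V))"

lemma graded_TS: "W : opens M U0 ==> graded_comm_algebra (TS W)"
 by (rule graded_comm_algebra_power_series[OF open_image])

lemma rs_hom: "W : opens M U0 ==> V : opens M W ==> rs V : graded_hom (TS W) (TS V)"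
 using ps_restrict_hom[OF open_image open_image[OF opens_sub0], of W W V] by (auto simp: rs_def[abs_def] image_mono)

lemma term_apply:
 assumes "W : opens M U0" "mu : admissible m gm" "rh : I" "x : W"
 shows "(fn W a \<otimes>\<^bsub>TS W\<^esub> ordered_monom (TS W) (dz W) mu m) rh (ph x) =
  (if (%j. rh (q + j)) = mu then kp W a (head_index q rh) (ph x) else 0)" unfolding fn_def dz_def[abs_def]
 by (rule embed_monom_apply[OF open_image[OF assms(1)] assms(2,3)]) (use assms(4) in auto)

lemma term_closed:
 assumes "W : opens M U0" "a : carrier (A W)"
 shows "fn W a \<otimes>\<^bsub>TS W\<^esub> ordered_monom (TS W) (dz W) mu m : carrier (TS W)" proof -
 interpret T: graded_comm_algebra "TS W"
  by (rule graded_TS[OF assms(1)])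
 have "fn W a : carrier (TS W)"
  unfolding fn_def by (rule series_embed_closed[OF open_image[OF assms(1)] kp_closed[OF assms]])
 moreover have "ordered_monom (TS W) (dz W) mu m : carrier (TS W)"
  using T.gcomp_closed[OF series_monom_gcomp[OF open_image[OF assms(1)]]]
  by (intro ordered_monom_closed T.ring_axioms) (auto simp: dz_def)
 ultimately show ?thesis by simp
qed

lemma TS_eqI:
 assumes "F : carrier (TS W)" "G : carrier (TS W)"
  "!!mu x. mu : I ==> x : W ==> F mu (ph x) = G mu (ph x)" shows "F = G"
 by (rule ps_eqI[OF assms(1,2)]) (use assms(3) in auto)

lemma finsum_TS_apply:
 assumes "W : opens M U0" "!!i. i : X ==> f i : carrier (TS W)" "mu : I" "x : W"
 shows "(\<Oplus>\<^bsub>TS W\<^esub>i\<in>X. f i) mu (ph x) = (\<Sum>i\<in>X. f i mu (ph x))"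
 by (rule finsum_power_series_apply[OF open_image[OF assms(1)] assms(2,3)]) (use assms(4) in auto)

text \<open>The power series in coordinates and differentials are a model, because the degrees of
  the variables are the bidegrees of what they stand for.\<close>

lemma frame_target: "frame_target M U0 m gm z e TS fn dz (%W. degree_part p q (ph ` W)) (%W. rs)"
proof (rule frame_target.intro[OF framed], rule frame_target_axioms.intro)
 fix W assume W: "W : opens M U0"
 note oi = open_image[OF W]
 note h = graded_hom_simps[OF kp_hom[OF W]]
 interpret T: graded_comm_algebra "TS W"
  by (rule graded_TS[OF W])
 show "graded_comm_algebra (TS W)" by (rule graded_TS[OF W])
 show "fn W a : carrier (TS W)" if "a : carrier (A W)" for a
  unfolding fn_def by (rule series_embed_closed[OF oi h(1)[OF that]])
 show "fn W (a \<otimes>\<^bsub>A W\<^esub> b) = fn W a \<otimes>\<^bsub>TS W\<^esub> fn W b" "fn W (a \<oplus>\<^bsub>A W\<^esub> b) = fn W a \<oplus>\<^bsub>TS W\<^esub> fn W b"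
  if "a : carrier (A W)" "b : carrier (A W)" for a b unfolding fn_def h(2)[OF that] h(3)[OF that]
  by (rule series_embed_mult[OF oi] series_embed_add[OF oi]; rule h(1); rule that)+
 show "fn W (r \<odot>\<^bsub>A W\<^esub> a) = r \<odot>\<^bsub>TS W\<^esub> fn W a" if "a : carrier (A W)" for r a
  unfolding fn_def h(5)[OF that] by (rule series_embed_smult[OF oi h(1)[OF that]])
 show "fn W \<one>\<^bsub>A W\<^esub> = \<one>\<^bsub>TS W\<^esub>"
  unfolding fn_def h(4) by (rule series_embed_one[OF oi])
 show "fn W a : gcomp (TS W) (bidegree 0 dl)" if "a : gcomp (A W) dl" for a dl
  unfolding fn_def by (rule series_embed_gcomp[OF oi h(6)[OF that]])
 show "dz W j : gcomp (TS W) (bidegree 1 (gm j))" if j: "j < m" for j proof -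
  have "tail_index q m (unit_index j) = unit_index (q + j)" using j by (auto simp: tail_index_def fun_eq_iff)
  moreover have "(\<Sum>i<m. \<Sum>_<unit_index j i. bidegree 1 (gm i)) = bidegree 1 (gm j)"
   using j sum.remove[of "{..<m}" j "%i. \<Sum>_<unit_index j i. bidegree 1 (gm i)"] by simp
  ultimately show ?thesis using series_monom_gcomp[OF oi, of "tdegs p q" "unit_index (q + j)"]
   monomial_degree_tail_index[of p q "unit_index j"] by (simp add: dz_def)
 qed
 show "c mu = \<zero>\<^bsub>A W\<^esub>"
  if X: "finite X" "X <= admissible m gm" and c: "!!mu. c mu : carrier (A W)" and
   0: "(\<Oplus>\<^bsub>TS W\<^esub>mu\<in>X. fn W (c mu) \<otimes>\<^bsub>TS W\<^esub> ordered_monom (TS W) (dz W) mu m) = \<zero>\<^bsub>TS W\<^esub>" and mu: "mu : X"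
  for X c mu proof -
  interpret AW: graded_comm_algebra "A W"
   by (rule graded_AW[OF W])
  have "kp W (c mu) = \<zero>\<^bsub>SA W\<^esub>" proof (rule ps_eqI[OF h(1)[OF c] ps_closed(5)[OF oi]])
   fix ap y assume ap: "ap : MI (odegs q)" and y: "y : ph ` W"
   then obtain x where x: "x : W" "y = ph x" by auto
   \<comment> \<open>At this index, with head \<open>ap\<close> and tail \<open>mu\<close>, every
     summand except that of \<open>mu\<close> vanishes, and that one has as its value the
     coefficient of \<open>kp W (c mu)\<close> at \<open>ap\<close>.\<close>
   let ?rh = "%b. ap b + tail_index q m mu b"
   have I: "?rh : I" using add_tail_index[OF ap] X(2) mu by auto
   have t: "(%j. ?rh (q + j)) = mu"
   using ap X(2) mu by (auto simp: tail_index_def mi_odd admissible_def fun_eq_iff)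
   have hd: "head_index q ?rh = ap" using ap by (auto simp: tail_index_def head_index_def mi_odd fun_eq_iff)
   have "0 = (\<Sum>nu\<in>X. (fn W (c nu) \<otimes>\<^bsub>TS W\<^esub> ordered_monom (TS W) (dz W) nu m) ?rh y)"
   using finsum_TS_apply[OF W _ I x(1), of X "%nu. fn W (c nu) \<otimes>\<^bsub>TS W\<^esub> ordered_monom (TS W) (dz W) nu m"]
   term_closed[OF W c] ps_apply(5)[OF oi I y] 0 by (simp add: x(2))
   also have "... = (\<Sum>nu\<in>X. if mu = nu then kp W (c nu) ap y else 0)"
   using X(2) by (intro sum.cong HOL.refl) (auto simp: x(2) term_apply[OF W _ I x(1)] t hd)
   also have "... = kp W (c mu) ap y" using X(1) mu by simp
   finally show "kp W (c mu) ap y = \<zero>\<^bsub>SA W\<^esub> ap y" using ps_apply(5)[OF oi ap y] by simp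
  qed
  then have "kp W (c mu) = kp W \<zero>\<^bsub>A W\<^esub>"
   using graded_hom_zero[OF kp_hom[OF W] graded_AW[OF W] graded_SA[OF W]] by simp
  then show ?thesis using kp_bij[OF W] c AW.zero_closed by (meson bij_betw_imp_inj_on inj_onD)
 qed
 show "\<zero>\<^bsub>TS W\<^esub> : degree_part p q (ph ` W) k" for k by (rule degree_part_closed[OF oi])
 show "s \<oplus>\<^bsub>TS W\<^esub> t : degree_part p q (ph ` W) k"
  if "s : degree_part p q (ph ` W) k" "t : degree_part p q (ph ` W) k" for s t k
  by (rule degree_part_closed(2)[OF oi that])
 show "r \<odot>\<^bsub>TS W\<^esub> s : degree_part p q (ph ` W) k" if "s : degree_part p q (ph ` W) k" for r s k
  by (rule degree_part_closed(3)[OF oi that])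
 show "s \<otimes>\<^bsub>TS W\<^esub> t : degree_part p q (ph ` W) (k + l)"
  if "s : degree_part p q (ph ` W) k" "t : degree_part p q (ph ` W) l" for s t k l
  by (rule degree_part_mult[OF oi that])
 show "fn W a : degree_part p q (ph ` W) 0" if "a : carrier (A W)" for a
  unfolding fn_def by (rule series_embed_degree_part[OF oi h(1)[OF that]])
 show "dz W j : degree_part p q (ph ` W) 1" if "j < m" for j
  unfolding dz_def by (rule series_monom_degree_part[OF oi that])
 fix V assume V: "V : opens M W"
 show "rs V : graded_hom (TS W) (TS V)" by (rule rs_hom[OF W V])
 have sub: "ph ` V <= ph ` W" using V by auto
 show "rs V (fn W a) = fn V (res M W V a)" if a: "a : carrier (A W)" for a unfolding fn_def kp_res[OF W V a]
  by (intro ext) (use sub mi_odd_tangent[of _ q p] in \<open>auto simp: rs_def series_embed_def restrict_def\<close>)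
 show "rs V (dz W j) = dz V j" for j
  by (intro ext) (use sub in \<open>auto simp: rs_def dz_def series_monom_def restrict_def\<close>)
qed

end

sublocale superchart \<subseteq> E: frame_target M U0 m gm z e TS fn dz "%W. degree_part p q (ph ` W)" "%W. rs"
 by (rule frame_target)

context superchart
begin

abbreviation EP :: "('m, ('m, 'b) form_expr set, 2) ringed_space" where
 "EP \<equiv> ExtP M"

lemma exterior_power_image:
 assumes W: "W : opens M U0" and C: "C : ExtPow M W k" shows "E.PhiC W C : degree_part p q (ph ` W) k" proof -
 have "openin (base M) W" using W by simp
 then obtain f where "f : form_exprs M W" "has_form_degree f k" "C = expr_class M W f"
  using C unfolding exterior_power_iff[OF \<open>openin (base M) W\<close>] by blast
 then show ?thesis using E.Phi_Tdeg[OF W] by (simp add: E.PhiC_cls[OF W])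
qed

lemma exterior_gcomp_image:
 assumes W: "W : opens M U0" and C: "C : gcomp (EA W) d" shows "E.PhiC W C : gcomp (TS W) d" proof -
 have "openin (base M) W" using W by simp
 then obtain f where "f : form_exprs M W" "has_bidegree M W f d" "C = expr_class M W f"
  using C unfolding exterior_gcomp[OF \<open>openin (base M) W\<close>] by blast
 then show ?thesis using E.Phi_gcomp[OF W] by (simp add: E.PhiC_cls[OF W])
qed

text \<open>Surjectivity in each form degree. Only finitely many monomials in the differentials have
  degree \<open>k\<close>; \<open>G mu\<close> collects the coefficients of one of them, and the sum
  of the corresponding classes is the lift. One lift serves all degrees \<open>d\<close>, since
  every term is either homogeneous of the degree \<open>d\<close> or zero.\<close>

lemma degree_part_lift:
 assumes W: "W : opens M U0" and F: "F : degree_part p q (ph ` W) k"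
 shows "EX C:ExtPow M W k. E.PhiC W C = F & (ALL d. F : gcomp (TS W) d --> C : gcomp (EA W) d)" proof -
 have oW: "openin (base M) W" using W by simp
 note oi = open_image[OF W]
 interpret R: ring "EA W"
  by (rule ring_exterior[OF oW])
 interpret AW: graded_comm_algebra "A W"
  by (rule graded_AW[OF W])
 have Fc: "F : carrier (TS W)" using F by (simp add: degree_part_def[OF oi])
 define X where "X = {mu : admissible m gm. (\<Sum>j<m. mu j) = k}"
 have fin: "finite X" unfolding X_def by (rule finite_admissible_degree)
 define G :: "(nat => nat) => series" where
  "G mu = (\<lambda>ap\<in>MI (odegs q). \<lambda>x\<in>ph ` W. if mu : X then F (%b. ap b + tail_index q m mu b) x else 0)" for mu
 have Gc: "G mu : carrier (SA W)" for mu unfolding G_def proof (rule ps_memI[OF oi])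
  fix ap assume "ap : MI (odegs q)"
  then have "smooth p (ph ` W) (F (%b. ap b + tail_index q m mu b))" if "mu : X"
   using ps_smooth[OF oi Fc add_tail_index] that by (simp add: X_def)
  then show "smooth p (ph ` W) (%x. if mu : X then F (%b. ap b + tail_index q m mu b) x else 0)"
   using smooth_const[OF oi, of 0] by (cases "mu : X") auto
 qed
 define t where "t mu = E.Fn W (kpinv W (G mu)) \<otimes>\<^bsub>EA W\<^esub> E.monom W mu m" for mu
 note ac = kpinv_closed[OF W Gc]
 have tp: "t mu : ExtPow M W k" if "mu : X" for mu
  using E.monomial_exterior_power[OF W ac[of mu], of mu] that by (simp add: t_def X_def)
 have Pt: "E.PhiC W (t mu) = fn W (kpinv W (G mu)) \<otimes>\<^bsub>TS W\<^esub> ordered_monom (TS W) (dz W) mu m" for mu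
  unfolding t_def by (rule E.PhiC_monomial[OF W ac])
 \<comment> \<open>One induction for both targets of the lift, the exterior power and the
   homogeneous part.\<close>
 have sum_closed: "(\<Oplus>\<^bsub>EA W\<^esub>mu\<in>Y. t mu) : S"
  if "\<zero>\<^bsub>EA W\<^esub> : S" "!!C D. C : S ==> D : S ==> C \<oplus>\<^bsub>EA W\<^esub> D : S" "S <= carrier (EA W)" "!!mu. mu : Y ==> t mu : S"
  for S Y using that(4) proof (induction Y rule: infinite_finite_induct)
  case (insert x Y)
  then have "t : Y \<rightarrow> carrier (EA W)" "t x : carrier (EA W)" using that(3) by auto
  with insert that(2) show ?case by simp
 qed (use that(1) in simp_all)
 have eq: "E.PhiC W (\<Oplus>\<^bsub>EA W\<^esub>mu\<in>X. t mu) = F" proof (rule TS_eqI[OF _ Fc])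
  have tc: "t mu : carrier (EA W)" if "mu : X" for mu using exterior_power_closed(1)[OF oW tp[OF that]] .
  show "E.PhiC W (\<Oplus>\<^bsub>EA W\<^esub>mu\<in>X. t mu) : carrier (TS W)"
   using tc by (intro E.PhiC_closed[OF W] R.finsum_closed) auto
  fix rh x assume *: "rh : I" "x : W"
  then have y: "ph x : ph ` W" by auto
  let ?ta = "%j. rh (q + j)"
  have "E.PhiC W (\<Oplus>\<^bsub>EA W\<^esub>mu\<in>X. t mu) rh (ph x) = (\<Sum>mu\<in>X. E.PhiC W (t mu) rh (ph x))"
   using finsum_TS_apply[OF W _ *, of X "%mu. E.PhiC W (t mu)"] E.PhiC_closed[OF W tc]
   by (simp add: E.PhiC_finsum[OF W tc])
  also have "... = (\<Sum>mu\<in>X. if ?ta = mu then G mu (head_index q rh) (ph x) else 0)"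
   unfolding Pt by (intro sum.cong HOL.refl) (auto simp: X_def term_apply[OF W _ *] kp_kpinv[OF W Gc])
  also have "... = (if ?ta : X then G ?ta (head_index q rh) (ph x) else 0)" using fin by simp
  also have "... = F rh (ph x)" proof (cases "?ta : X")
   case True
   then show ?thesis using head_multi_index[OF oi *(1)] y head_tail_index[OF oi *(1)] by (simp add: G_def)
  next
   case False
   then have "form_degree rh ~= k" using tail_admissible[OF oi *(1)] by (simp add: X_def)
   then show ?thesis using F * False y by (simp add: degree_part_def[OF oi])
  qed
  finally show "E.PhiC W (\<Oplus>\<^bsub>EA W\<^esub>mu\<in>X. t mu) rh (ph x) = F rh (ph x)" .
 qed
 have "(\<Oplus>\<^bsub>EA W\<^esub>mu\<in>X. t mu) : gcomp (EA W) d" if Fd: "F : gcomp (TS W) d" for d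
 proof (rule sum_closed)
  fix mu assume mu: "mu : X"
  let ?s = "\<Sum>j<m. \<Sum>_<mu j. bidegree 1 (gm j)"
  note z = exterior_gcomp_closed(2)[OF oW]
  have md: "mdeg (tdegs p q) (%b. ap b + tail_index q m mu b) =
   bidegree 0 (mdeg (odegs q) ap) + ?s" if ap: "ap : MI (odegs q)" for ap proof -
   have "mdeg (tdegs p q) (%b. ap b + tail_index q m mu b) =
   mdeg (tdegs p q) ap + mdeg (tdegs p q) (tail_index q m mu)" by (rule monomial_degree_add)
   then show ?thesis
   using ap mi_odd_tangent[of ap q p] by (simp add: monomial_degree_tangent monomial_degree_tail_index)
  qed
  have GF: "G mu ap y = F (%b. ap b + tail_index q m mu b) y" if "ap : MI (odegs q)" "y : ph ` W" for ap y
   using that mu by (simp add: G_def)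
  have F0: "F rh y = 0" if "rh : I" "mdeg (tdegs p q) rh ~= d" "y : ph ` W" for rh y
   using Fd that by (auto simp: gcomp_ps)
  have adm: "mu : admissible m gm" using mu by (simp add: X_def)
  \<comment> \<open>Either some parity of the coefficient complements the degree of the monomial to
    \<open>d\<close>, or nothing of degree \<open>d\<close> contains this monomial and its
    coefficient is zero.\<close>
  show "t mu : gcomp (EA W) d" proof (cases "EX dl. bidegree 0 dl + ?s = d")
   case True
   then obtain dl where dl: "bidegree 0 dl + ?s = d" ..
   have "G mu : gcomp (SA W) dl" unfolding gcomp_ps proof (intro conjI Gc ballI impI)
   fix ap y assume ap: "ap : MI (odegs q)" "mdeg (odegs q) ap ~= dl" and y: "y : ph ` W"
   have "bidegree 0 (mdeg (odegs q) ap) ~= bidegree 0 dl"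
   using ap(2) by (auto simp: bidegree_def vec_eq_iff forall_2)
   then show "G mu ap y = 0"
   unfolding GF[OF ap(1) y] using dl md[OF ap(1)] by (intro F0 add_tail_index[OF ap(1) adm] y) auto
   qed
   from E.monomial_exterior_gcomp[OF W graded_hom_simps(6)[OF kpinv_hom[OF W] this]] show ?thesis
   unfolding t_def dl[symmetric] .
  next
   case False
   have "G mu = \<zero>\<^bsub>SA W\<^esub>" proof (rule ps_eqI[OF Gc ps_closed(5)[OF oi]])
   fix ap y assume ap: "ap : MI (odegs q)" and y: "y : ph ` W"
   show "G mu ap y = \<zero>\<^bsub>SA W\<^esub> ap y" unfolding GF[OF ap y] ps_apply(5)[OF oi ap y]
   using False md[OF ap] by (intro F0 add_tail_index[OF ap adm] y) auto
   qed
   then have "kpinv W (G mu) = \<zero>\<^bsub>A W\<^esub>"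
   using graded_hom_zero[OF kpinv_hom[OF W] graded_SA[OF W] graded_AW[OF W]] by simp
   then have "t mu = \<zero>\<^bsub>EA W\<^esub>"
   using E.monom_closed[OF W order.refl] by (simp add: t_def E.Fn_zero[OF W])
   then show ?thesis using z by simp
  qed
 qed (use exterior_gcomp_closed[OF oW] in auto)
 moreover have "(\<Oplus>\<^bsub>EA W\<^esub>mu\<in>X. t mu) : ExtPow M W k"
  by (rule sum_closed) (use exterior_power_closed[OF oW] tp in auto)
 ultimately show ?thesis using eq by blast
qed

end

subsection \<open>Completed forms on a chart\<close>

lemma cf_simps:
 "s : carrier (completed_forms M U) \<longleftrightarrow> (ALL k. s k : exterior_power_sheaf M k U)"
 "s \<otimes>\<^bsub>completed_forms M U\<^esub> t = (%k. \<lambda>x\<in>U. \<Oplus>\<^bsub>stalk (ExtP M) x\<^esub>i\<in>{..k}.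
  s i x \<otimes>\<^bsub>stalk (ExtP M) x\<^esub> t (k - i) x)"
 "\<one>\<^bsub>completed_forms M U\<^esub> = (%k. \<lambda>x\<in>U.
  if k = 0 then \<one>\<^bsub>stalk (ExtP M) x\<^esub> else \<zero>\<^bsub>stalk (ExtP M) x\<^esub>)"
 "\<zero>\<^bsub>completed_forms M U\<^esub> = (%k. \<lambda>x\<in>U. \<zero>\<^bsub>stalk (ExtP M) x\<^esub>)"
 "s \<oplus>\<^bsub>completed_forms M U\<^esub> t = (%k. \<lambda>x\<in>U. s k x \<oplus>\<^bsub>stalk (ExtP M) x\<^esub> t k x)"
 "r \<odot>\<^bsub>completed_forms M U\<^esub> s = (%k. \<lambda>x\<in>U. r \<odot>\<^bsub>stalk (ExtP M) x\<^esub> s k x)"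
 "s : gcomp (completed_forms M U) d \<longleftrightarrow> s : carrier (completed_forms M U) \<and>
  (ALL k. ALL x:U. s k x : gcomp (stalk (ExtP M) x) d)" by (simp_all add: completed_forms_def Let_def)

lemma (in exterior) exterior_gcomp_res:
 assumes U: "openin (base M) U" and V: "V : opens M U" and C: "C : gcomp (EA U) d"
 shows "res (ExtP M) U V C : gcomp (EA V) d" proof -
 have oV: "openin (base M) V" using V by simp
 have "has_bidegree M U f d ==> has_bidegree M V (res_expr U V f) d" for f proof (induction f arbitrary: d)
  case (Fun a)
  then show ?case using res_gcomp[OF U V] by (simp only: res_expr_simps has_bidegree.simps) blast
 next
  case (Form om)
  then show ?case
   using homogeneous_one_form_restrict[OF _ V] by (simp only: res_expr_simps has_bidegree.simps) blast
 qed (simp_all, metis)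
 moreover obtain f where f: "f : form_exprs M U" "has_bidegree M U f d" "C = expr_class M U f"
  using C unfolding exterior_gcomp[OF U] by blast
 ultimately show ?thesis unfolding exterior_gcomp[OF oV] f(3) exterior_res[OF U V f(1)]
  using res_expr_closed[OF U V f(1)] by blast
qed

context superchart
begin

interpretation P: presheaf_of_rings EP
 by (rule presheaf_of_rings_exterior)

abbreviation CF :: "'m set => (('m, 'b) completed_form, 2) graded_algebra" where
 "CF \<equiv> completed_forms M"

definition part :: "'m set => nat => series => series" where
 "part W k F = (\<lambda>mu\<in>I. \<lambda>x\<in>ph ` W. if form_degree mu = k then F mu x else 0)"

text \<open>The class exists by \<open>degree_part_lift\<close> and is unique because
  \<open>PhiC\<close> is injective. Uniqueness is what makes lifts compatible with the operations
  and with restriction.\<close>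

definition lift :: "'m set => nat => series => ('m, 'b) form_expr set" where
 "lift W k F = inv_into (carrier (EA W)) (E.PhiC W) (part W k F)"

text \<open>The comparison map. Over a chart it will be shown to be an isomorphism from the power
  series to the completed forms.\<close>

definition psi :: "'m set => series => ('m, 'b) completed_form" where
 "psi W F k = (\<lambda>y\<in>W. germ EP y W (lift W k F))"

lemma part_apply: "mu : I ==> x : W ==> part W k F mu (ph x) = (if form_degree mu = k then F mu (ph x) else 0)"
 by (simp add: part_def)

lemma rs_apply: "mu : I ==> x : V ==> rs V F mu (ph x) = F mu (ph x)" by (simp add: rs_def)

text \<open>The coefficients of a germ at its base point do not depend on the representative. This
  allows a power series to be recovered from a family of germs, point by point.\<close>

lemma germ_value:
 assumes V: "V : opens M U0" "y : V" "C : carrier (EA V)" and V': "V' : opens M U0" "y : V'" "C' : carrier (EA V')"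
  and eq: "germ EP y V C = germ EP y V' C'" and mu: "mu : I" shows "E.PhiC V C mu (ph y) = E.PhiC V' C' mu (ph y)"
proof -
 have "P.local_section y V C" "P.local_section y V' C'" using V V' by (auto simp: P.local_section_def)
 from P.germ_eq_iff[OF this] eq obtain X where X: "openin (base M) X" "X <= V Int V'" "y : X"
   "res EP V X C = res EP V' X C'" by auto
 then have o: "X : opens M V" "X : opens M V'" by auto
 show ?thesis using E.rh_PhiC[OF V(1) o(1) V(3)] E.rh_PhiC[OF V'(1) o(2) V'(3)] X(4) rs_apply[OF mu X(3)] by metis
qed

context
 fixes W :: "'m set"
 assumes W: "W : opens M U0"
begin

lemma oW: "openin (base M) W" using W by simp

interpretation T: graded_comm_algebra "TS W"
 by (rule graded_TS[OF W])

interpretation R: ring "EA W"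
 by (rule ring_exterior[OF oW])

lemma PhiC_eqD: "C : carrier (EA W) ==> D : carrier (EA W) ==> E.PhiC W C = E.PhiC W D ==> C = D"
 by (rule inj_onD[OF E.PhiC_inj[OF W]])

lemma part_mem:
 assumes "F : carrier (TS W)" shows "part W k F : degree_part p q (ph ` W) k" proof -
 have "part W k F : carrier (TS W)" unfolding part_def proof (rule ps_memI[OF open_image[OF W]])
  fix mu assume "mu : I"
  then show "smooth p (ph ` W) (%x. if form_degree mu = k then F mu x else 0)"
   using ps_smooth[OF open_image[OF W] assms] smooth_const[OF open_image[OF W], of 0]
   by (cases "form_degree mu = k") auto
 qed
 then show ?thesis unfolding degree_part_def[OF open_image[OF W]] by (auto simp: part_apply)
qed

lemma lift_eqI: "C : carrier (EA W) ==> E.PhiC W C = part W k F ==> lift W k F = C"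
 unfolding lift_def using inv_into_f_f[OF E.PhiC_inj[OF W]] by metis

lemma lift:
 assumes "F : carrier (TS W)"
 shows "lift W k F : ExtPow M W k" "lift W k F : carrier (EA W)" "E.PhiC W (lift W k F) = part W k F"
  "F : gcomp (TS W) d ==> lift W k F : gcomp (EA W) d" proof -
 obtain C where C: "C : ExtPow M W k" "E.PhiC W C = part W k F"
  "!!d. part W k F : gcomp (TS W) d ==> C : gcomp (EA W) d" using degree_part_lift[OF W part_mem[OF assms]] by metis
 have l: "lift W k F = C" by (rule lift_eqI[OF exterior_power_closed(1)[OF oW C(1)] C(2)])
 show "lift W k F : ExtPow M W k" "lift W k F : carrier (EA W)" "E.PhiC W (lift W k F) = part W k F"
  using C l exterior_power_closed(1)[OF oW] by auto
 show "lift W k F : gcomp (EA W) d" if "F : gcomp (TS W) d"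
  using that part_mem[OF assms, of k] unfolding l degree_part_def[OF open_image[OF W]]
  by (intro C(3)) (auto simp: gcomp_ps part_apply)
qed

lemma local_lift: "F : carrier (TS W) ==> y : W ==> P.local_section y W (lift W k F)"
 using lift(2) oW by (simp add: P.local_section_def)

lemma psi_apply: "y : W ==> psi W F k y = germ EP y W (lift W k F)" by (simp add: psi_def)

lemma psi_closed: "F : carrier (TS W) ==> psi W F : carrier (CF W)"
 unfolding cf_simps exterior_power_sheaf_def using lift(1) oW by (auto simp: psi_def intro!: exI[of _ W])

text \<open>The coefficient at \<open>mu\<close> sits in the component of \<open>psi W F\<close> of
  form degree \<open>form_degree mu\<close>, and any representative of the germ there reveals
  it.\<close>

lemma psi_value:
 assumes "F : carrier (TS W)" "y : W" "mu : I" and V: "V : opens M U0" "y : V" "C : carrier (EA V)"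
  and "psi W F (form_degree mu) y = germ EP y V C" shows "F mu (ph y) = E.PhiC V C mu (ph y)"
 using germ_value[OF W assms(2) lift(2)[OF assms(1)] V _ assms(3), of "form_degree mu"] assms(7)
 unfolding psi_apply[OF assms(2)] lift(3)[OF assms(1)] part_apply[OF assms(3,2)] by auto

text \<open>By uniqueness of lifts it suffices to exhibit, for each point, some class with the
  required image whose germ is the given one.\<close>

lemma psi_eqI:
 assumes "F : carrier (TS W)" "s : extensional W"
  "!!y. y : W ==> EX C:carrier (EA W). E.PhiC W C = part W k F & s y = germ EP y W C" shows "psi W F k = s" proof
 fix y
 show "psi W F k y = s y" proof (cases "y : W")
  case True
  then show ?thesis using assms(3) lift_eqI psi_apply by metis
 qed (use assms(2) in \<open>simp add: psi_def extensional_def\<close>)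
qed

lemma psi_inj:
 assumes F: "F : carrier (TS W)" and G: "G : carrier (TS W)" and eq: "psi W F = psi W G" shows "F = G"
proof (rule TS_eqI[OF F G])
 fix mu x assume *: "mu : I" "x : W"
 show "F mu (ph x) = G mu (ph x)" using psi_value[OF F *(2,1) W *(2) lift(2)[OF G], of "form_degree mu"] *
  by (simp add: eq psi_apply lift(3)[OF G] part_apply)
qed

lemma psi_add:
 assumes F: "F : carrier (TS W)" and G: "G : carrier (TS W)"
 shows "psi W (F \<oplus>\<^bsub>TS W\<^esub> G) = psi W F \<oplus>\<^bsub>CF W\<^esub> psi W G" proof
 fix k
 show "psi W (F \<oplus>\<^bsub>TS W\<^esub> G) k = (psi W F \<oplus>\<^bsub>CF W\<^esub> psi W G) k"
 proof (rule psi_eqI)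
  fix y assume y: "y : W"
  have "E.PhiC W (lift W k F \<oplus>\<^bsub>EA W\<^esub> lift W k G) = part W k (F \<oplus>\<^bsub>TS W\<^esub> G)"
   unfolding ring_hom_add[OF E.PhiC_ring_hom[OF W] lift(2)[OF F] lift(2)[OF G]] lift(3)[OF F] lift(3)[OF G]
   by (auto simp: ps_simps part_def fun_eq_iff restrict_def)
  then show "EX C:carrier (EA W). E.PhiC W C = part W k (F \<oplus>\<^bsub>TS W\<^esub> G) \<and>
   (psi W F \<oplus>\<^bsub>CF W\<^esub> psi W G) k y = germ EP y W C"
   using lift(2)[OF F] lift(2)[OF G] P.stalk_add[OF local_lift[OF F y] local_lift[OF G y]] y
   by (intro bexI[of _ "lift W k F \<oplus>\<^bsub>EA W\<^esub> lift W k G"]) (auto simp: cf_simps psi_apply)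
 qed (use F G in \<open>auto simp: cf_simps(5)\<close>)
qed

lemma psi_smult:
 assumes F: "F : carrier (TS W)"
 shows "psi W (r \<odot>\<^bsub>TS W\<^esub> F) = r \<odot>\<^bsub>CF W\<^esub> psi W F" proof
 fix k
 show "psi W (r \<odot>\<^bsub>TS W\<^esub> F) k = (r \<odot>\<^bsub>CF W\<^esub> psi W F) k" proof (rule psi_eqI)
  fix y assume y: "y : W"
  have "E.PhiC W (r \<odot>\<^bsub>EA W\<^esub> lift W k F) = part W k (r \<odot>\<^bsub>TS W\<^esub> F)"
   unfolding E.PhiC_smult[OF W lift(2)[OF F]] lift(3)[OF F]
   by (auto simp: ps_simps part_def fun_eq_iff restrict_def)
  then show "EX C:carrier (EA W). E.PhiC W C = part W k (r \<odot>\<^bsub>TS W\<^esub> F) \<and>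
   (r \<odot>\<^bsub>CF W\<^esub> psi W F) k y = germ EP y W C"
   using exterior_closed(3)[OF oW lift(2)[OF F]] P.stalk_smult[OF local_lift[OF F y]] y
   by (intro bexI[of _ "r \<odot>\<^bsub>EA W\<^esub> lift W k F"]) (auto simp: cf_simps psi_apply)
 qed (use F T.smult_closed' in \<open>auto simp: cf_simps(6)\<close>)
qed

lemma part_const:
 "part W k \<zero>\<^bsub>TS W\<^esub> = \<zero>\<^bsub>TS W\<^esub>" "part W k \<one>\<^bsub>TS W\<^esub> = (if k = 0 then \<one>\<^bsub>TS W\<^esub> else \<zero>\<^bsub>TS W\<^esub>)"
 by (auto simp: ps_simps part_def fun_eq_iff restrict_def)

lemma psi_zero: "psi W \<zero>\<^bsub>TS W\<^esub> = \<zero>\<^bsub>CF W\<^esub>" proof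
 fix k
 show "psi W \<zero>\<^bsub>TS W\<^esub> k = \<zero>\<^bsub>CF W\<^esub> k"
  by (rule psi_eqI) (use P.stalk_zero[of W] oW E.PhiC_zero[OF W] in
   \<open>auto simp: cf_simps(4) part_const intro!: bexI[of _ "\<zero>\<^bsub>EA W\<^esub>"]\<close>)
qed

lemma psi_one: "psi W \<one>\<^bsub>TS W\<^esub> = \<one>\<^bsub>CF W\<^esub>" proof
 fix k
 show "psi W \<one>\<^bsub>TS W\<^esub> k = \<one>\<^bsub>CF W\<^esub> k"
  by (rule psi_eqI) (use P.stalk_one[of W] P.stalk_zero[of W] oW E.PhiC_zero[OF W] ring_hom_one[OF E.PhiC_ring_hom[OF W]] in
   \<open>auto simp: cf_simps(3) part_const
   intro!: bexI[of _ "if k = 0 then \<one>\<^bsub>EA W\<^esub> else \<zero>\<^bsub>EA W\<^esub>"]\<close>)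
qed

text \<open>Form degrees add up in a splitting of a multi-index. Each splitting of an index of form
  degree \<open>k\<close> is therefore counted once on the right, for \<open>i\<close> the form
  degree of its first part.\<close>

lemma part_mult:
 assumes F: "F : carrier (TS W)" and G: "G : carrier (TS W)"
 shows "part W k (F \<otimes>\<^bsub>TS W\<^esub> G) = (\<Oplus>\<^bsub>TS W\<^esub>i\<in>{..k}. part W i F \<otimes>\<^bsub>TS W\<^esub> part W (k - i) G)"
proof (rule TS_eqI[where W=W])
 have pc: "part W i H : carrier (TS W)" if "H : carrier (TS W)" for i H
  using part_mem[OF that] by (simp add: degree_part_def[OF open_image[OF W]])
 show "part W k (F \<otimes>\<^bsub>TS W\<^esub> G) : carrier (TS W)" by (rule pc) (use F G in auto)
 show "(\<Oplus>\<^bsub>TS W\<^esub>i\<in>{..k}. part W i F \<otimes>\<^bsub>TS W\<^esub> part W (k - i) G) : carrier (TS W)"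
  using pc F G by (intro T.finsum_closed) auto
 fix rh x assume *: "rh : I" "x : W"
 then have y: "ph x : ph ` W" by auto
 have deg: "form_degree mu + form_degree nu = form_degree rh" if "(mu, nu) : splits rh" for mu nu
  using that unfolding sum.distrib[symmetric] by (auto simp: splits_def)
 let ?t = "%(mu, nu). msign (tdegs p q) mu nu * F mu (ph x) * G nu (ph x)"
 have "(\<Oplus>\<^bsub>TS W\<^esub>i\<in>{..k}. part W i F \<otimes>\<^bsub>TS W\<^esub> part W (k - i) G) rh (ph x) =
   (\<Sum>i\<in>{..k}. (part W i F \<otimes>\<^bsub>TS W\<^esub> part W (k - i) G) rh (ph x))"
  by (rule finsum_TS_apply[OF W _ *]) (use pc F G in auto)
 also have "... = (\<Sum>i\<in>{..k}. \<Sum>z\<in>splits rh. if i = form_degree (fst z) then if form_degree rh = k then ?t z else 0 else 0)"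
  unfolding ps_apply(1)[OF open_image[OF W] *(1) y] conv_splits proof (intro sum.cong HOL.refl)
  fix i z assume i: "i : {..k}" and "z : splits rh"
  moreover obtain mu nu where z: "z = (mu, nu)" by (cases z)
  ultimately have s: "(mu, nu) : splits rh" by simp
  then have "mu : I" "nu : I" using splits_multi_indices[OF *(1)] by auto
  moreover have "form_degree rh = k \<longleftrightarrow> form_degree nu = k - i" if "form_degree mu = i"
   using deg[OF s] that i by auto
  ultimately show "(case z of (mu, nu) =>
   msign (tdegs p q) mu nu * part W i F mu (ph x) * part W (k - i) G nu (ph x)) =
   (if i = form_degree (fst z) then if form_degree rh = k then ?t z else 0 else 0)"
   unfolding z fst_conv prod.case using *(2) by (simp only: part_apply) auto
 qed
 also have "... = (\<Sum>z\<in>splits rh. if form_degree rh = k then ?t z else 0)"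
 proof (subst sum.swap, rule sum.cong[OF HOL.refl])
  fix z assume "z : splits rh"
  then have "form_degree (fst z) + form_degree (snd z) = form_degree rh" using deg[of "fst z" "snd z"] by simp
  then have "form_degree (fst z) : {..k}" if "form_degree rh = k" using that by simp
  then show "(\<Sum>i\<in>{..k}. if i = form_degree (fst z) then if form_degree rh = k then ?t z else 0 else 0) =
   (if form_degree rh = k then ?t z else 0)" by (cases "form_degree rh = k") simp_all
 qed
 also have "... = part W k (F \<otimes>\<^bsub>TS W\<^esub> G) rh (ph x)"
  unfolding part_apply[OF *] ps_apply(1)[OF open_image[OF W] *(1) y] conv_splits by simp
 finally show "part W k (F \<otimes>\<^bsub>TS W\<^esub> G) rh (ph x) =
   (\<Oplus>\<^bsub>TS W\<^esub>i\<in>{..k}. part W i F \<otimes>\<^bsub>TS W\<^esub> part W (k - i) G) rh (ph x)" ..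
qed

lemma psi_mult:
 assumes F: "F : carrier (TS W)" and G: "G : carrier (TS W)"
 shows "psi W (F \<otimes>\<^bsub>TS W\<^esub> G) = psi W F \<otimes>\<^bsub>CF W\<^esub> psi W G" proof
 fix k
 let ?C = "%i. lift W i F \<otimes>\<^bsub>EA W\<^esub> lift W (k - i) G"
 show "psi W (F \<otimes>\<^bsub>TS W\<^esub> G) k = (psi W F \<otimes>\<^bsub>CF W\<^esub> psi W G) k"
 proof (rule psi_eqI)
  fix y assume y: "y : W"
  have C: "?C i : carrier (EA W)" for i using lift(2)[OF F] lift(2)[OF G] by simp
  have "E.PhiC W (\<Oplus>\<^bsub>EA W\<^esub>i\<in>{..k}. ?C i) = (\<Oplus>\<^bsub>TS W\<^esub>i\<in>{..k}. E.PhiC W (?C i))"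
   by (rule E.PhiC_finsum[OF W C])
  also have "... = part W k (F \<otimes>\<^bsub>TS W\<^esub> G)"
   unfolding ring_hom_mult[OF E.PhiC_ring_hom[OF W] lift(2)[OF F] lift(2)[OF G]] lift(3)[OF F] lift(3)[OF G]
   part_mult[OF F G] ..
  finally have 1: "E.PhiC W (\<Oplus>\<^bsub>EA W\<^esub>i\<in>{..k}. ?C i) = part W k (F \<otimes>\<^bsub>TS W\<^esub> G)" .
  have "germ EP y W (\<Oplus>\<^bsub>EA W\<^esub>i\<in>{..k}. ?C i) = (\<Oplus>\<^bsub>stalk EP y\<^esub>i\<in>{..k}. germ EP y W (?C i))"
   using P.germ_finsum[of W y "{..k}" ?C] C oW y by simp
  also have "... = (psi W F \<otimes>\<^bsub>CF W\<^esub> psi W G) k y"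
   using y P.stalk_mult[OF local_lift[OF F y] local_lift[OF G y]] by (simp add: cf_simps psi_apply)
  finally show "EX C:carrier (EA W). E.PhiC W C = part W k (F \<otimes>\<^bsub>TS W\<^esub> G) \<and>
   (psi W F \<otimes>\<^bsub>CF W\<^esub> psi W G) k y = germ EP y W C"
   using 1 C by (intro bexI[of _ "\<Oplus>\<^bsub>EA W\<^esub>i\<in>{..k}. ?C i"]) auto
 qed (use F G in \<open>auto simp: cf_simps(2)\<close>)
qed

end

text \<open>The restricted class has the required image, and lifts over \<open>V\<close> are
  unique.\<close>

lemma lift_res:
 assumes W: "W : opens M U0" and V: "V : opens M W" and F: "F : carrier (TS W)"
 shows "lift V k (rs V F) = res EP W V (lift W k F)" proof (rule lift_eqI[OF opens_sub0[OF W V]])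
 show "res EP W V (lift W k F) : carrier (EA V)" using P.res_closed[of W V] oW[OF W] V lift(2)[OF W F] by simp
 have "rs V (part W k F) = part V k (rs V F)" using V by (auto simp: rs_def part_def fun_eq_iff restrict_def)
 then show "E.PhiC V (res EP W V (lift W k F)) = part V k (rs V F)"
  unfolding E.rh_PhiC[OF W V lift(2)[OF W F], symmetric] lift(3)[OF W F] .
qed

lemma psi_res:
 assumes W: "W : opens M U0" and V: "V : opens M W" and F: "F : carrier (TS W)"
 shows "psi V (rs V F) = (%k. restrict (psi W F k) V)" proof (intro ext)
 fix k y
 show "psi V (rs V F) k y = restrict (psi W F k) V y" proof (cases "y : V")
  case True
  then show ?thesis
   using P.germ_restrict[OF local_lift[OF W F], of y V k] V by (auto simp: psi_def lift_res[OF W V F])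
 qed (simp add: psi_def)
qed

text \<open>Homogeneity of a completed form is a condition on germs. From left to right, a
  homogeneous representative near \<open>y\<close> has a homogeneous image in the model, and
  \<open>psi_value\<close> reads the coefficients of \<open>F\<close> at \<open>ph y\<close> from
  it. The other direction uses that lifts preserve degrees.\<close>

lemma psi_gcomp_iff:
 assumes W: "W : opens M U0" and F: "F : carrier (TS W)"
 shows "psi W F : gcomp (CF W) d \<longleftrightarrow> F : gcomp (TS W) d" proof
 assume "F : gcomp (TS W) d"
 then have "psi W F k y : gcomp (stalk EP y) d" if "y : W" for k y
  unfolding P.stalk_gcomp psi_apply[OF W that] using lift(4)[OF W F] oW[OF W] that by auto
 then show "psi W F : gcomp (CF W) d" unfolding cf_simps(7) using psi_closed[OF W F] by blast
next
 assume g: "psi W F : gcomp (CF W) d"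
 have "F mu (ph y) = 0" if mu: "mu : I" "mdeg (tdegs p q) mu ~= d" and y: "y : W" for mu y proof -
  have "psi W F (form_degree mu) y : gcomp (stalk EP y) d" using g y by (simp add: cf_simps(7))
  then obtain V C where V: "openin (base M) V" "y : V" "C : gcomp (EA V) d" "psi W F (form_degree mu) y = germ EP y V C"
   unfolding P.stalk_gcomp by auto
  let ?X = "V Int W"
  have X: "?X : opens M V" "?X : opens M U0" "y : ?X" using V W y by auto
  note C = exterior_gcomp_res[OF V(1) X(1) V(3)]
  have "psi W F (form_degree mu) y = germ EP y ?X (res EP V ?X C)"
   using P.germ_restrict[of y V C ?X] exterior_gcomp_closed(1)[OF V(1,3)] V X by (simp add: P.local_section_def)
  then have "F mu (ph y) = E.PhiC ?X (res EP V ?X C) mu (ph y)"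
   by (rule psi_value[OF W F y mu(1) X(2,3) exterior_gcomp_closed(1)[OF oW[OF X(2)] C]])
  then show ?thesis using exterior_gcomp_image[OF X(2) C] mu X(3) unfolding gcomp_ps by auto
 qed
 then show "F : gcomp (TS W) d" using F by (auto simp: gcomp_ps)
qed

text \<open>A section is given locally by classes, over neighbourhoods that depend on the point and
  on the form degree. Each coefficient of the wanted power series uses only one form degree, so it
  is obtained pointwise, and near each point it agrees with a coefficient of a single class; hence
  it is smooth.\<close>

lemma psi_surj:
 assumes W: "W : opens M U0" and s: "s : carrier (CF W)" shows "EX F:carrier (TS W). psi W F = s" proof -
 define Q where "Q k x Z \<longleftrightarrow> fst Z : opens M W & x : fst Z & snd Z : ExtPow M (fst Z) k \<and>
  (ALL y:fst Z. s k y = germ EP y (fst Z) (snd Z))" for k x Z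
 define V where "V k x = fst (SOME Z. Q k x Z)" for k x
 define C where "C k x = snd (SOME Z. Q k x Z)" for k x
 have "EX Z. Q k x Z" if "x : W" for k x
  using s that unfolding cf_simps exterior_power_sheaf_def Q_def by (simp add: Bex_def)
 then have Q: "Q k x (V k x, C k x)" if "x : W" for k x
  unfolding V_def C_def prod.collapse using that by (intro someI_ex[of "Q k x"])
 have V: "V k x : opens M W" "x : V k x" and C: "C k x : ExtPow M (V k x) k"
  and germ: "y : V k x ==> s k y = germ EP y (V k x) (C k x)" if "x : W" for k x y
  using Q[OF that] unfolding Q_def fst_conv snd_conv by blast+
 have V0: "V k x : opens M U0" if "x : W" for k x by (rule opens_sub0[OF W V(1)[OF that]])
 have VW: "y : W" if "x : W" "y : V k x" for k x y using V(1)[OF that(1)] that(2) by blast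
 have Cc: "C k x : carrier (EA (V k x))" if "x : W" for k x
  by (rule exterior_power_closed(1)[OF oW[OF V0[OF that]] C[OF that]])
 \<comment> \<open>The coefficient at \<open>mu\<close> is taken from the local class of form degree
   \<open>form_degree mu\<close> at its own base point; by \<open>germ_value\<close> the class
   chosen at a nearby point gives the same value.\<close>
 define val where "val mu x = E.PhiC (V (form_degree mu) x) (C (form_degree mu) x) mu (ph x)" for mu x
 define g where "g = inv_into W ph"
 have inj: "inj_on ph W" using inj_ph W by (auto intro: inj_on_subset)
 have g: "g (ph x) = x" if "x : W" for x unfolding g_def by (rule inv_into_f_f[OF inj that])
 define F :: series where "F = (\<lambda>mu\<in>I. \<lambda>z\<in>ph ` W. val mu (g z))"
 have val: "val mu y = E.PhiC (V (form_degree mu) x) (C (form_degree mu) x) mu (ph y)"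
  if "x : W" "y : V (form_degree mu) x" "mu : I" and y: "y : W" for mu x y unfolding val_def
 proof (rule germ_value[OF V0[OF y] V(2)[OF y] Cc[OF y] V0[OF that(1)] that(2) Cc[OF that(1)] _ that(3)])
  show "germ EP y (V (form_degree mu) y) (C (form_degree mu) y) =
   germ EP y (V (form_degree mu) x) (C (form_degree mu) x)"
   unfolding germ[OF that(1,2), symmetric] germ[OF y V(2)[OF y], symmetric] ..
 qed
 have F: "F : carrier (TS W)" unfolding F_def
 proof (rule ps_memI[OF open_image[OF W]], rule smooth_locally[OF open_image[OF W]])
  fix mu z assume mu: "mu : I" and "z : ph ` W"
  then obtain x where x: "x : W" "z = ph x" by blast
  let ?V = "V (form_degree mu) x"
  note o = open_image[OF V0[OF x(1)]]
  have "smooth p (ph ` ?V) (E.PhiC ?V (C (form_degree mu) x) mu)"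
   by (rule ps_smooth[OF o E.PhiC_closed[OF V0[OF x(1)] Cc[OF x(1)]] mu])
  then have "smooth p (ph ` ?V) (%z. val mu (g z))"
   by (rule smooth_cong[OF o]) (use val[OF x(1) _ mu VW[OF x(1)]] g VW[OF x(1)] in auto)
  then show "EX Y. openin (Euclidean_space p) Y & z : Y & Y <= ph ` W & smooth p Y (%z. val mu (g z))"
   using o x V(2)[OF x(1)] VW[OF x(1)] by (intro exI[of _ "ph ` ?V"]) auto
 qed
 have "psi W F k y = s k y" for k y proof (cases "y : W")
  case y: True
  let ?V = "V k y"
  note Vy = V(1)[OF y] and V0y = V0[OF y]
  have "res EP W ?V (lift W k F) = C k y" proof (rule PhiC_eqD[OF V0y _ Cc[OF y]])
   show rc: "res EP W ?V (lift W k F) : carrier (EA ?V)"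
   using P.res_closed[of W ?V] oW[OF W] Vy lift(2)[OF W F] by simp
   have *: "rs ?V (part W k F) = E.PhiC ?V (res EP W ?V (lift W k F))"
   unfolding E.rh_PhiC[OF W Vy lift(2)[OF W F], symmetric] lift(3)[OF W F] ..
   show "E.PhiC ?V (res EP W ?V (lift W k F)) = E.PhiC ?V (C k y)"
   proof (rule TS_eqI[OF E.PhiC_closed[OF V0y rc] E.PhiC_closed[OF V0y Cc[OF y]]])
   fix mu x assume mu: "mu : I" and x: "x : ?V"
   note xW = VW[OF y x]
   show "E.PhiC ?V (res EP W ?V (lift W k F)) mu (ph x) = E.PhiC ?V (C k y) mu (ph x)"
   proof (cases "form_degree mu = k")
   case True
   then show ?thesis unfolding *[symmetric] rs_apply[OF mu x] part_apply[OF mu xW]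
   using val[OF y _ mu xW] x mu xW g by (simp add: F_def)
   next
   \<comment> \<open>\<open>C k y\<close> has pure form degree \<open>k\<close>, so both sides
     vanish at this index.\<close>
   case False
   have "E.PhiC ?V (C k y) mu (ph x) = 0" using exterior_power_image[OF V0y C[OF y]] False mu x
   unfolding degree_part_def[OF open_image[OF V0y]] by auto
   then show ?thesis unfolding *[symmetric] rs_apply[OF mu x] part_apply[OF mu xW] using False by simp
   qed
   qed
  qed
  then show ?thesis using P.germ_restrict[OF local_lift[OF W F y], of ?V k] germ[OF y V(2)[OF y]] V(2)[OF y] Vy y
   by (simp add: psi_apply[OF W])
 next
  case False
  then show ?thesis using s unfolding cf_simps exterior_power_sheaf_def psi_def extensional_def by auto
 qed
 then show ?thesis using F by blast
qed

end

section \<open>The tangent bundle\<close>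

text \<open>
 The laws of a graded-commutative algebra are inherited along a jointly injective family of
 structure-preserving maps, provided that homogeneous components can be glued.
\<close>

lemma graded_comm_algebra_family:
 fixes B :: "('b, 'n::finite) graded_algebra" (structure) and A :: "'i => ('a, 'n) graded_algebra"
 assumes A: "!!i. i : X ==> graded_comm_algebra (A i)"
  and cl: "!!a b. a : carrier B ==> b : carrier B ==> a \<otimes> b : carrier B"
   "!!a b. a : carrier B ==> b : carrier B ==> a \<oplus> b : carrier B"
   "!!c a. a : carrier B ==> c \<odot> a : carrier B" "\<one> : carrier B" "\<zero> : carrier B"
  and r: "!!i a. i : X ==> a : carrier B ==> r i a : carrier (A i)"
   "!!i a b. i : X ==> a : carrier B ==> b : carrier B ==> r i (a \<otimes> b) = r i a \<otimes>\<^bsub>A i\<^esub> r i b"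
   "!!i a b. i : X ==> a : carrier B ==> b : carrier B ==> r i (a \<oplus> b) = r i a \<oplus>\<^bsub>A i\<^esub> r i b"
   "!!i c a. i : X ==> a : carrier B ==> r i (c \<odot> a) = c \<odot>\<^bsub>A i\<^esub> r i a"
   "!!i. i : X ==> r i \<one> = \<one>\<^bsub>A i\<^esub>" "!!i. i : X ==> r i \<zero> = \<zero>\<^bsub>A i\<^esub>"
  and eqI: "!!a b. a : carrier B ==> b : carrier B ==> (!!i. i : X ==> r i a = r i b) ==> a = b"
  and g: "!!a d. a : gcomp B d \<longleftrightarrow> a : carrier B & (ALL i:X. r i a : gcomp (A i) d)"
  and glue: "!!a d. a : carrier B ==>
   EX f:carrier B. ALL i:X. r i f = graded_comm_algebra.component (A i) d (r i a)" shows "graded_comm_algebra B"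
proof -
 have ringA: "ring (A i)" if "i : X" for i proof -
  interpret graded_comm_algebra "A i"
   by (rule A[OF that])
  show ?thesis by (rule ring_axioms)
 qed
 note simps = cl r ring.ring_simprules[OF ringA] Group.monoid.r_one[OF ring.is_monoid[OF ringA]]
 have ring: "ring B" proof (rule ringI)
  show "abelian_group B" proof (rule abelian_groupI)
   fix a assume a: "a : carrier B"
   have "(- 1) \<odot> a \<oplus> a = \<zero>" proof (rule eqI)
   fix i assume i: "i : X"
   interpret graded_comm_algebra "A i"
   by (rule A[OF i])
   show "r i ((- 1) \<odot> a \<oplus> a) = r i \<zero>" using a i by (simp add: simps flip: minus_eq_smult)
   qed (use a in \<open>simp_all add: cl\<close>)
   then show "EX y:carrier B. y \<oplus> a = \<zero>" using a cl(3) by blast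
  qed ((rule cl; assumption) | (rule eqI; simp add: simps))+
  show "Group.monoid B" by (rule monoidI) ((rule cl; assumption) | (rule eqI; simp add: simps))+
 qed (rule eqI; simp add: simps)+
 then interpret B: ring B .
 have rsum: "r i (\<Oplus>d\<in>Y. f d) = (\<Oplus>\<^bsub>A i\<^esub>d\<in>Y. r i (f d))" if i: "i : X" and f: "!!d. f d : carrier B" for i f Y
 proof -
  interpret graded_comm_algebra "A i"
   by (rule A[OF i])
  show ?thesis proof (induction Y rule: infinite_finite_induct)
   case (insert x F)
   then have "f : F \<rightarrow> carrier B" "(%d. r i (f d)) : F \<rightarrow> carrier (A i)"
   using f r(1)[OF i] by auto
   with insert show ?case using f r(1)[OF i] i by (simp add: r(3))
  qed (use i in \<open>simp_all add: r(6)\<close>)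
 qed
 have gc: "a : carrier B" if "a : gcomp B d" for a d using that g by blast
 show ?thesis proof (rule graded_comm_algebraI[OF ring])
  fix a assume a: "a : carrier B"
  have "ALL d. EX f:carrier B. ALL i:X. r i f = graded_comm_algebra.component (A i) d (r i a)"
   using glue[OF a] by blast
  from choice[OF this[unfolded Bex_def]] obtain f where f: "!!d. f d : carrier B"
   "!!d i. i : X ==> r i (f d) = graded_comm_algebra.component (A i) d (r i a)" by blast
  show "\<exists>!f. (ALL d. f d : gcomp B d) & a = (\<Oplus>d\<in>UNIV. f d)"
  proof (intro ex1I[of _ f] conjI allI ext)
   show "f d : gcomp B d" for d unfolding g using f graded_comm_algebra.component(1)[OF A r(1)[OF _ a]] by auto
   show "a = (\<Oplus>d\<in>UNIV. f d)"
   by (rule eqI) (use a f r(1) graded_comm_algebra.component(2)[OF A] in \<open>auto simp: rsum\<close>)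
   fix h d assume h: "(ALL d. h d : gcomp B d) & a = (\<Oplus>d\<in>UNIV. h d)"
   then have hc: "h d : carrier B" for d using gc by blast
   show "h d = f d" proof (rule eqI[OF hc f(1)])
   fix i assume i: "i : X"
   have "graded_comm_algebra.component (A i) d (r i a) = r i (h d)"
   by (rule graded_comm_algebra.component_unique[OF A[OF i]])
   (use h i hc in \<open>auto simp: g rsum[OF i]\<close>)
   then show "r i (h d) = r i (f d)" using f(2)[OF i] by simp
   qed
  qed
 next
  show "\<zero> : gcomp B d" for d unfolding g using cl(5) r(6) graded_comm_algebra.gcomp_zero[OF A] by auto
  show "\<one> : gcomp B 0" unfolding g using cl(4) r(5) graded_comm_algebra.one_gcomp[OF A] by auto
  show "a \<oplus> b : gcomp B d" if "a : gcomp B d" "b : gcomp B d" for a b d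
   using that graded_comm_algebra.gcomp_add[OF A] unfolding g by (auto simp: cl r(3))
  show "c \<odot> a : gcomp B d" if "a : gcomp B d" for a c d
   using that graded_comm_algebra.gcomp_smult[OF A] unfolding g by (auto simp: cl r(4))
  show "a \<otimes> b : gcomp B (i + j)" if "a : gcomp B i" "b : gcomp B j" for a b i j
   using that graded_comm_algebra.mult_gcomp[OF A] unfolding g by (auto simp: cl r(2))
  show "a \<otimes> b = koszul i j \<odot> (b \<otimes> a)" if "a : gcomp B i" "b : gcomp B j" for a b i j
   by (rule eqI) (use that graded_comm_algebra.graded_comm[OF A] in \<open>auto simp: g cl r(2,4)\<close>)
 qed (use gc in \<open>auto intro!: eqI simp: cl r graded_comm_algebra.smult_add_left[OF A]
   graded_comm_algebra.smult_add_right[OF A] graded_comm_algebra.smult_smult[OF A]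
   graded_comm_algebra.smult_one'[OF A] graded_comm_algebra.smult_mult_left[OF A]
   graded_comm_algebra.smult_mult_right[OF A]\<close>)
qed

text \<open>The inverse of \<open>psi\<close> is one injective structure-preserving map into a
  graded algebra, so the preceding lemma applies with a single index.\<close>

lemma (in superchart) graded_CF_chart:
 assumes W: "W : opens M U0" shows "graded_comm_algebra (CF W)" proof -
 interpret T: graded_comm_algebra "TS W"
  by (rule graded_TS[OF W])
 define r where "r = inv_into (carrier (TS W)) (psi W)"
 have r_psi: "r (psi W F) = F" if "F : carrier (TS W)" for F
  unfolding r_def using that psi_inj[OF W] by (intro inv_into_f_f inj_onI) auto
 have ex: "EX F. F : carrier (TS W) & s = psi W F" if "s : carrier (CF W)" for s using psi_surj[OF W that] by blast
 note ops = psi_mult[OF W, symmetric] psi_add[OF W, symmetric] psi_smult[OF W, symmetric]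
  psi_one[OF W, symmetric] psi_zero[OF W, symmetric] psi_closed[OF W] r_psi T.smult_closed'
 show ?thesis proof (rule graded_comm_algebra_family[where X="{()}" and A="%_. TS W" and r="%_. r"])
  show "graded_comm_algebra (TS W)" by (rule graded_TS[OF W])
  show "a : gcomp (CF W) d \<longleftrightarrow> a : carrier (CF W) & (ALL i:{()}. r a : gcomp (TS W) d)" for a d
  proof -
   have "a : gcomp (CF W) d ==> a : carrier (CF W)" by (simp add: cf_simps(7))
   then show ?thesis using ex[of a] psi_gcomp_iff[OF W] by (auto simp: r_psi)
  qed
  show "EX f:carrier (CF W). ALL i:{()}. r f = T.component d (r a)" if "a : carrier (CF W)" for a d
   using ex[OF that] T.component_closed by (auto simp: r_psi intro!: bexI[of _ "psi W (T.component d (r a))"] psi_closed[OF W])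
 qed (auto dest!: ex simp: ops)
qed

lemma (in exterior) exterior_power_res:
 assumes U: "openin (base M) U" and V: "V : opens M U" and C: "C : ExtPow M U k"
 shows "res (ExtP M) U V C : ExtPow M V k" proof -
 have oV: "openin (base M) V" using V by simp
 have "has_form_degree f k ==> has_form_degree (res_expr U V f) k" for f
  by (induction f arbitrary: k) (simp_all, metis)
 moreover obtain f where f: "f : form_exprs M U" "has_form_degree f k" "C = expr_class M U f"
  using C unfolding exterior_power_iff[OF U] by blast
 ultimately show ?thesis unfolding exterior_power_iff[OF oV] f(3) exterior_res[OF U V f(1)]
  using res_expr_closed[OF U V f(1)] by blast
qed

locale atlas = exterior M for M :: "('m, 'b, 1) ringed_space" +
 fixes p q :: nat
 assumes charts: "x : topspace (base M) ==> EX U0 ph kp. x : U0 & superchart M U0 p q ph kp"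
begin

interpretation P: presheaf_of_rings "ExtP M"
 by (rule presheaf_of_rings_exterior)

abbreviation CM :: "'m set => (('m, 'b) completed_form, 2) graded_algebra" where
 "CM \<equiv> completed_forms M"

definition cut :: "'m set => ('m, 'b) completed_form => ('m, 'b) completed_form" where
 "cut V s = (%k. restrict (s k) V)"

text \<open>Open sets small enough for the comparison with power series; they are closed under
  passing to open subsets and form a basis.\<close>

definition chart_open :: "'m set => bool" where
 "chart_open W \<longleftrightarrow> openin (base M) W & (EX U0 ph kp. W <= U0 & superchart M U0 p q ph kp)"

lemma graded_chart_open: "chart_open W ==> graded_comm_algebra (CM W)"
 unfolding chart_open_def using superchart.graded_CF_chart by blast

lemma chart_open_sub: "chart_open W ==> openin (base M) V ==> V <= W ==> chart_open V"
 unfolding chart_open_def by blast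

lemma chart_open_nbhd:
 assumes U: "openin (base M) U" and x: "x : U" shows "EX W. chart_open W & x : W & W <= U" proof -
 obtain U0 ph kp where c: "x : U0" "superchart M U0 p q ph kp" using charts openin_subset[OF U] x by blast
 then have "openin (base M) (U Int U0)" using U superchart.U0 by blast
 then show ?thesis using c x unfolding chart_open_def by (intro exI[of _ "U Int U0"]) blast
qed

lemma cut_apply: "x : V ==> cut V s k x = s k x" by (simp add: cut_def)

lemma cut_cut: "V <= W ==> cut V (cut W s) = cut V s" by (auto simp: cut_def fun_eq_iff)

lemma CM_extensional: "s : carrier (CM U) ==> s k : extensional U" by (simp add: cf_simps(1) exterior_power_sheaf_def)

lemma CM_eqI:
 assumes "s : carrier (CM U)" "t : carrier (CM U)" "!!k x. x : U ==> s k x = t k x" shows "s = t" proof (intro ext)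
 fix k x
 show "s k x = t k x"
  using assms(3) extensional_arb[OF CM_extensional[OF assms(1)]] extensional_arb[OF CM_extensional[OF assms(2)]]
  by (cases "x : U") simp_all
qed

lemma CM_rep:
 assumes "s : carrier (CM U)" "x : U"
 shows "EX W:opens M U. x : W & (EX C:ExtPow M W k. ALL y:W. s k y = germ (ExtP M) y W C)" proof -
 have "s k : exterior_power_sheaf M k U" using assms(1) by (simp only: cf_simps(1))
 then show ?thesis using assms(2) unfolding exterior_power_sheaf_def by (simp only: mem_Collect_eq)
qed

lemma cut_ops:
 assumes "V <= U"
 shows "cut V (s \<otimes>\<^bsub>CM U\<^esub> t) = cut V s \<otimes>\<^bsub>CM V\<^esub> cut V t" "cut V (s \<oplus>\<^bsub>CM U\<^esub> t) = cut V s \<oplus>\<^bsub>CM V\<^esub> cut V t"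
  "cut V (r \<odot>\<^bsub>CM U\<^esub> s) = r \<odot>\<^bsub>CM V\<^esub> cut V s" "cut V \<one>\<^bsub>CM U\<^esub> = \<one>\<^bsub>CM V\<^esub>" "cut V \<zero>\<^bsub>CM U\<^esub> = \<zero>\<^bsub>CM V\<^esub>"
 using assms by (auto simp: cut_def cf_simps fun_eq_iff subset_iff)

lemma cut_closed:
 assumes s: "s : carrier (CM U)" and V: "openin (base M) V" "V <= U" shows "cut V s : carrier (CM V)"
 unfolding cf_simps(1) exterior_power_sheaf_def proof (intro allI CollectI conjI ballI)
 fix k x assume x: "x : V"
 have xU: "x : U" using x V by blast
 from CM_rep[OF s xU, of k] obtain W C where W: "openin (base M) W" "W <= U" "x : W" "C : ExtPow M W k"
   "ALL y:W. s k y = germ (ExtP M) y W C" by (elim bexE conjE CollectE) (rule that)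
 let ?X = "W Int V"
 have X: "?X : opens M W" "?X : opens M V" using W V by auto
 note Cc = exterior_power_closed(1)[OF W(1,4)]
 have "cut V s k y = germ (ExtP M) y ?X (res (ExtP M) W ?X C)" if "y : ?X" for y
  using that P.germ_restrict[of y W C ?X] Cc W X by (simp add: cut_def P.local_section_def)
 then show "EX X:opens M V. x : X & (EX C:ExtPow M X k. ALL y:X. cut V s k y = germ (ExtP M) y X C)"
  using X(2) x W(3) exterior_power_res[OF W(1) X(1) W(4)] by blast
qed (simp add: cut_def)

lemma CM_local:
 assumes "!!k. s k : extensional U" and loc: "!!x. x : U ==> EX V:opens M U. x : V & cut V s : carrier (CM V)"
 shows "s : carrier (CM U)" unfolding cf_simps(1) exterior_power_sheaf_def
proof (intro allI CollectI conjI ballI assms(1))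
 fix k x assume "x : U"
 then obtain V where V: "V : opens M U" "x : V" "cut V s : carrier (CM V)" using loc by blast
 from CM_rep[OF V(3,2), of k] obtain W C where W: "openin (base M) W" "W <= V" "x : W" "C : ExtPow M W k"
   "ALL y:W. cut V s k y = germ (ExtP M) y W C" by (elim bexE conjE CollectE) (rule that)
 moreover have "cut V s k y = s k y" if "y : W" for y using that W(2) by (auto simp: cut_def)
 ultimately have "ALL y:W. s k y = germ (ExtP M) y W C" by metis
 then show "EX X:opens M U. x : X & (EX C:ExtPow M X k. ALL y:X. s k y = germ (ExtP M) y X C)"
  using V(1) W(1-4) by (intro bexI[of _ W] conjI bexI[of _ C]) auto
qed

lemma CM_chart_local:
 assumes U: "openin (base M) U" and "!!k. s k : extensional U"
  and loc: "!!V. chart_open V ==> V <= U ==> cut V s : carrier (CM V)" shows "s : carrier (CM U)"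
 using chart_open_nbhd[OF U] loc by (intro CM_local assms(2)) (metis (lifting) chart_open_def mem_Collect_eq)

lemma cut_gcomp:
 assumes "s : gcomp (CM U) d" and V: "openin (base M) V" "V <= U" shows "cut V s : gcomp (CM V) d"
 using assms cut_closed[OF _ V] by (auto simp: cf_simps(7) cut_apply subset_iff)

lemma cut_hom:
 assumes V: "openin (base M) V" "V <= U" shows "cut V : graded_hom (CM U) (CM V)" unfolding graded_hom_def
 using cut_ops[OF V(2)] cut_closed[OF _ V] cut_gcomp[OF _ V] by (auto intro!: ring_hom_memI)

text \<open>At each point the member belonging to the chosen neighbourhood of that very point is
  used; the second condition on \<open>f\<close> says that the choice does not affect the
  values.\<close>

lemma glue:
 assumes U: "openin (base M) U" and N: "!!x. x : U ==> x : N x & N x <= U"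
  and f: "!!x. x : U ==> f (N x) : carrier (CM (N x))" "!!x k y. x : U ==> y : U ==> y : N x ==> f (N x) k y = f (N y) k y"
  and oN: "!!x. x : U ==> openin (base M) (N x)" shows "(%k. \<lambda>x\<in>U. f (N x) k x) : carrier (CM U)"
proof (rule CM_local)
 fix x assume x: "x : U"
 have "cut (N x) (%k. \<lambda>x\<in>U. f (N x) k x) = f (N x)" proof (intro ext)
  fix k y
  show "cut (N x) (%k. \<lambda>x\<in>U. f (N x) k x) k y = f (N x) k y"
   using N[OF x] f(2)[OF x] CM_extensional[OF f(1)[OF x]] by (cases "y : N x") (auto simp: cut_def extensional_def)
 qed
 then show "EX V:opens M U. x : V & cut V (%k. \<lambda>x\<in>U. f (N x) k x) : carrier (CM V)"
  using N[OF x] oN[OF x] f(1)[OF x] by (intro bexI[of _ "N x"]) auto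
qed simp

text \<open>Over a general open set there is no chart. Laws are tested over the chart domains inside
  it, which determine a section, and homogeneous components are glued from the components over these
  domains.\<close>

lemma graded_CM:
 assumes U: "openin (base M) U" shows "graded_comm_algebra (CM U)" proof -
 define X where "X = {W. chart_open W & W <= U}"
 have XD: "chart_open W" "W <= U" "openin (base M) W" if "W : X" for W
  using that by (auto simp: X_def chart_open_def)
 have gW: "graded_comm_algebra (CM W)" if "W : X" for W by (rule graded_chart_open[OF XD(1)[OF that]])
 have ring: "ring (CM W)" if "W : X" for W proof -
  interpret graded_comm_algebra "CM W"
   by (rule gW[OF that])
  show ?thesis by (rule ring_axioms)
 qed
 have nb: "EX W:X. x : W" if "x : U" for x using chart_open_nbhd[OF U that] by (auto simp: X_def)
 have cc: "cut W s : carrier (CM W)" if "W : X" "s : carrier (CM U)" for W s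
  using cut_closed[OF that(2)] XD[OF that(1)] by blast
 have local: "s : carrier (CM U)" if "!!k. s k : extensional U" "!!W. W : X ==> cut W s : carrier (CM W)" for s
  by (rule CM_chart_local[OF U that(1)]) (use that(2) in \<open>auto simp: X_def\<close>)
 show ?thesis proof (rule graded_comm_algebra_family[where X=X and A=CM and r=cut])
  show "a \<otimes>\<^bsub>CM U\<^esub> b : carrier (CM U)" "a \<oplus>\<^bsub>CM U\<^esub> b : carrier (CM U)"
   if "a : carrier (CM U)" "b : carrier (CM U)" for a b
   by (rule local; use that cut_ops[OF XD(2)] cc ring.ring_simprules(1,5)[OF ring] in \<open>simp add: cf_simps(2,5)\<close>)+
  show "c \<odot>\<^bsub>CM U\<^esub> a : carrier (CM U)" if "a : carrier (CM U)" for c a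
   by (rule local) (use that cut_ops[OF XD(2)] cc graded_comm_algebra.smult_closed'[OF gW] in \<open>simp_all add: cf_simps(6)\<close>)
  show "\<one>\<^bsub>CM U\<^esub> : carrier (CM U)" "\<zero>\<^bsub>CM U\<^esub> : carrier (CM U)"
   by (rule local; use cut_ops[OF XD(2)] ring.ring_simprules(2,6)[OF ring] in \<open>simp add: cf_simps(3,4)\<close>)+
  show "a = b" if "a : carrier (CM U)" "b : carrier (CM U)" "!!W. W : X ==> cut W a = cut W b" for a b
  proof (rule CM_eqI[OF that(1,2)])
   fix k x assume "x : U"
   then show "a k x = b k x" using nb that(3) cut_apply by metis
  qed
  show "a : gcomp (CM U) d \<longleftrightarrow> a : carrier (CM U) & (ALL W:X. cut W a : gcomp (CM W) d)" for a d
  proof (intro iffI conjI ballI)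
   show "a : gcomp (CM U) d" if *: "a : carrier (CM U) & (ALL W:X. cut W a : gcomp (CM W) d)" unfolding cf_simps(7)
   proof (intro conjI allI ballI)
   fix k x assume "x : U"
   then obtain W where W: "W : X" "x : W" using nb by blast
   then have "cut W a : gcomp (CM W) d" using * by blast
   then have "cut W a k x : gcomp (stalk (ExtP M) x) d" using W(2) by (simp only: cf_simps(7))
   then show "a k x : gcomp (stalk (ExtP M) x) d" by (simp only: cut_apply[OF W(2)])
   qed (use * in blast)
  qed (use XD cut_gcomp in \<open>auto simp: cf_simps(7)\<close>)
  show "EX f:carrier (CM U). ALL W:X. cut W f = graded_comm_algebra.component (CM W) d (cut W a)"
   if a: "a : carrier (CM U)" for a d proof -
   define f where "f W = graded_comm_algebra.component (CM W) d (cut W a)" for W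
   have fc: "f W : carrier (CM W)" if "W : X" for W
   unfolding f_def using graded_comm_algebra.component_closed[OF gW[OF that] cc[OF that a]] .
   \<comment> \<open>Restriction commutes with taking components, so two local components agree on
     the intersection of their domains, which is again in \<open>X\<close>.\<close>
   have fs: "f V k x = f W k x" if "W : X" "V : X" "x : V" "x : W" for V W k x proof -
   have sub: "cut Y (f V) = f Y" if "V : X" "Y : X" "Y <= V" for V Y unfolding f_def
   using graded_hom_component[OF cut_hom[OF XD(3)[OF that(2)] that(3)] gW[OF that(1)] gW[OF that(2)] cc[OF that(1) a]]
   by (simp add: cut_cut[OF that(3)])
   have "openin (base M) (V Int W)" using XD(3) that by blast
   then have Y: "V Int W : X" using XD[OF that(2)] chart_open_sub[of V "V Int W"] by (auto simp: X_def)
   show ?thesis using cut_apply[of x "V Int W" "f V" k] cut_apply[of x "V Int W" "f W" k] that(3,4)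
   by (simp add: sub[OF that(2) Y] sub[OF that(1) Y])
   qed
   define N where "N x = (SOME W. W : X & x : W)" for x
   have N: "N x : X" "x : N x" if "x : U" for x
   using someI_ex[of "%W. W : X & x : W"] nb[OF that] unfolding N_def by blast+
   have "(%k. \<lambda>x\<in>U. f (N x) k x) : carrier (CM U)" proof (rule glue[OF U])
   show "x : N x & N x <= U" "f (N x) : carrier (CM (N x))" "openin (base M) (N x)" if "x : U" for x
   using N(2)[OF that] XD[OF N(1)[OF that]] fc[OF N(1)[OF that]] by auto
   show "f (N x) k y = f (N y) k y" if "x : U" "y : U" "y : N x" for x y k
   by (rule fs[OF N(1)[OF that(2)] N(1)[OF that(1)] that(3) N(2)[OF that(2)]])
   qed
   moreover have "cut W (%k. \<lambda>x\<in>U. f (N x) k x) = f W" if W: "W : X" for W proof (intro ext)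
   fix k y
   show "cut W (%k. \<lambda>x\<in>U. f (N x) k x) k y = f W k y"
   using XD(2)[OF W] fs[OF W N(1) N(2)] CM_extensional[OF fc[OF W]]
   by (cases "y : W") (auto simp: cut_def extensional_def)
   qed
   ultimately show ?thesis unfolding f_def by blast
  qed
 qed (use gW cc cut_ops[OF XD(2)] in auto)
qed

section \<open>The sheaf of completed forms\<close>

abbreviation TM :: "('m, ('m, 'b) completed_form, 2) ringed_space" where
 "TM \<equiv> tangent_bundle M"

lemma TM_simps [simp]: "base TM = base M" "sections TM = CM" "res TM U V = cut V"
 by (simp_all add: tangent_bundle_def cut_def[abs_def])

lemma presheaf_TM: "presheaf_of_algebras TM" proof -
 have "cut U s = s" if "s : carrier (CM U)" for U s
  using CM_extensional[OF that] by (auto simp: cut_def fun_eq_iff extensional_def)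
 then show ?thesis unfolding presheaf_of_algebras_def TM_simps using graded_CM cut_hom cut_cut by auto
qed

text \<open>Sections are sequences of functions with values in germs, so a compatible family is
  glued by choosing a member of the cover at each point.\<close>

lemma sheaf_TM: "sheaf_of_algebras TM" unfolding sheaf_of_algebras_def TM_simps
proof (intro conjI presheaf_TM allI impI, elim conjE)
 fix \<U> s
 assume s: "ALL V:\<U>. openin (base M) V & s V : carrier (CM V)"
  and eq: "ALL V:\<U>. ALL W:\<U>. cut (V Int W) (s V) = cut (V Int W) (s W)"
 define N where "N x = (SOME W. W : \<U> & x : W)" for x
 have N: "N x : \<U>" "x : N x" if "x : \<Union>\<U>" for x
  using someI_ex[of "%W. W : \<U> & x : W"] that unfolding N_def by blast+
 have eq': "s V k x = s W k x" if "V : \<U>" "W : \<U>" "x : V" "x : W" for V W k x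
  using eq that cut_apply[of x "V Int W"] by (metis IntI)
 let ?t = "%k. \<lambda>x\<in>\<Union>\<U>. s (N x) k x"
 have "openin (base M) (\<Union>\<U>)" using s by blast
 then have t: "?t : carrier (CM (\<Union>\<U>))" proof (rule glue)
  show "s (N x) k y = s (N y) k y" if "x : \<Union>\<U>" "y : \<Union>\<U>" "y : N x" for x y k
   by (rule eq'[OF N(1)[OF that(1)] N(1)[OF that(2)] that(3) N(2)[OF that(2)]])
 qed (use N s in blast)+
 have ts: "cut V ?t = s V" if V: "V : \<U>" for V proof (intro ext)
  fix k y
  have "s V : carrier (CM V)" using s V by blast
  from CM_extensional[OF this] show "cut V ?t k y = s V k y"
   using V eq'[OF N(1) V N(2)] by (cases "y : V") (auto simp: cut_def extensional_def)
 qed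
 show "\<exists>!t. t : carrier (CM (\<Union>\<U>)) & (ALL V:\<U>. cut V t = s V)"
 proof (intro ex1I[of _ ?t] conjI t ballI ts)
  fix t assume t': "t : carrier (CM (\<Union>\<U>)) & (ALL V:\<U>. cut V t = s V)"
  show "t = ?t" proof (rule CM_eqI[OF conjunct1[OF t'] t])
   fix k x assume x: "x : \<Union>\<U>"
   have "cut (N x) t = s (N x)" using t' N(1)[OF x] by blast
   from fun_cong[OF fun_cong[OF this, of k], of x] show "t k x = ?t k x"
   unfolding cut_apply[OF N(2)[OF x]] restrict_apply'[OF x] .
  qed
 qed
qed

end

subsection \<open>Stalks are local\<close>

text \<open>The kernel \<open>N\<close> of \<open>ev\<close> is a homogeneous ideal. A proper
  homogeneous ideal contains with an element also its component of degree 0; were \<open>ev\<close>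
  nonzero there, that component would be invertible. As \<open>ev\<close> sees only the component of
  degree 0, the ideal lies in \<open>N\<close>, so \<open>N\<close> is the only maximal one.\<close>

lemma graded_local_criterion:
 fixes A :: "('b, 'n::finite) graded_algebra" (structure) and ev :: "'b => real"
 assumes "ring A" and gc: "!!d. gcomp A d <= carrier A"
  and add: "!!a b. a : carrier A ==> b : carrier A ==> ev (a \<oplus> b) = ev a + ev b"
  and mult: "!!a b. a : carrier A ==> b : carrier A ==> ev (a \<otimes> b) = ev a * ev b" and one: "ev \<one> = 1"
  and deg: "!!a d. a : gcomp A d ==> d ~= 0 ==> ev a = 0"
  and dec: "!!a. a : carrier A ==> EX f. (ALL d. f d : gcomp A d) & a = (\<Oplus>d\<in>UNIV. f d)"
  and inv: "!!a. a : gcomp A 0 ==> ev a ~= 0 ==> EX b:carrier A. a \<otimes> b = \<one>" shows "graded_local A"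
proof -
 interpret ring A by fact
 have zero: "ev \<zero> = 0" using add[of \<zero> \<zero>] by simp
 have neg: "ev (\<ominus> a) = - ev a" if "a : carrier A" for a
  using add[of a "\<ominus> a"] that zero by (simp add: r_neg)
 have sum: "ev (\<Oplus>d\<in>X. f d) = (\<Sum>d\<in>X. ev (f d))" if "!!d. f d : carrier A" for X and f :: "bit ^ 'n => 'b"
  using that proof (induction X rule: infinite_finite_induct)
  case (insert x F)
  then show ?case by (simp add: add Pi_iff)
 qed (simp_all add: zero)
 have ev_sum: "ev (\<Oplus>d\<in>UNIV. f d) = ev (f 0)" if "!!d. f d : gcomp A d" for f proof -
  have "ev (\<Oplus>d\<in>UNIV. f d) = (\<Sum>d\<in>UNIV. ev (f d))" using that gc by (intro sum) blast
  also have "... = (\<Sum>d\<in>{0}. ev (f d))" by (rule sum.mono_neutral_right) (use deg that in auto)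
  finally show ?thesis by simp
 qed
 define N where "N = {a : carrier A. ev a = 0}"
 have "ideal N A" proof (rule idealI)
  show "subgroup N (add_monoid A)"
   by (rule add.subgroupI) (auto simp: N_def add neg zero a_inv_def[symmetric] intro!: exI[of _ \<zero>])
 qed (auto simp: N_def mult ring_axioms)
 moreover have "f d : N" if "!!d. f d : gcomp A d" "(\<Oplus>d\<in>UNIV. f d) : N" for f d proof -
  have "ev (f d) = 0" using that(2) ev_sum[OF that(1)] deg[OF that(1), of d] by (cases "d = 0") (auto simp: N_def)
  then show ?thesis using gc that(1) by (auto simp: N_def)
 qed
 ultimately have homN: "homogeneous_ideal N A" unfolding homogeneous_ideal_def by blast
 have NA: "N ~= carrier A"
  using one one_closed unfolding N_def by (metis (mono_tags, lifting) mem_Collect_eq zero_neq_one)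
 have sub: "J <= N" if J: "homogeneous_ideal J A" "J ~= carrier A" for J proof
  fix a assume a: "a : J"
  interpret J: ideal J A
   using J by (simp add: homogeneous_ideal_def)
  have ac: "a : carrier A" using a by (rule J.Icarr)
  obtain f where f: "!!d. f d : gcomp A d" "a = (\<Oplus>d\<in>UNIV. f d)" using dec[OF ac] by blast
  have "f 0 : J" using J(1) a f unfolding homogeneous_ideal_def by blast
  have "ev (f 0) = 0" proof (rule ccontr)
   assume "ev (f 0) ~= 0"
   then obtain b where "b : carrier A" "f 0 \<otimes> b = \<one>" using inv f(1) by blast
   then have "\<one> : J" using J.I_r_closed[OF \<open>f 0 : J\<close>] by metis
   then show False using J.one_imp_carrier J(2) by blast
  qed
  then show "a : N" using ac ev_sum[OF f(1)] f(2) by (simp add: N_def)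
 qed
 show ?thesis unfolding graded_local_def maximal_homogeneous_ideal_def
  by (rule ex1I[of _ N]) (use homN NA sub in blast)+
qed

text \<open>The equation \<open>F G = 1\<close> solved for the coefficient of \<open>G\<close> at
  \<open>rh\<close>, with the term of the constant monomial of \<open>F\<close> isolated. The other
  terms involve \<open>G\<close> only at indices of smaller total degree, so the number
  \<open>n\<close> of steps is a bound on the depth. The factor \<open>- 1\<close> replaces a
  subtraction, in accordance with the closure properties of smooth functions.\<close>

primrec inverse_coeff ::
 "(bit ^ 'n::finite) list => series => nat => (nat => nat) => (nat => real) => real" where
 "inverse_coeff ds F 0 rh x = 0"
| "inverse_coeff ds F (Suc n) rh x = inverse (F (%_. 0) x) * ((if rh = (%_. 0) then 1 else 0) +
  (- 1) * (\<Sum>mu | mu \<le> rh & mu ~= (%_. 0).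
   msign ds mu (%a. rh a - mu a) * F mu x * inverse_coeff ds F n (%a. rh a - mu a) x))"

lemma size_diff_less:
 assumes "rh : MI ds" "mu \<le> rh" "mu ~= (%_. 0)"
 shows "(\<Sum>a<length ds. rh a - mu a) < (\<Sum>a<length ds. rh a)" proof (rule sum_strict_mono_ex1)
 obtain a where a: "mu a ~= 0" using assms(3) by auto
 then have "rh a ~= 0" using assms(2) by (metis bot_nat_0.extremum_uniqueI le_fun_def)
 moreover from this have "\<not> length ds \<le> a" using assms(1) by (auto simp: multi_indices_def)
 ultimately show "EX a:{..<length ds}. rh a - mu a < rh a" using a by (intro bexI[of _ a]) auto
qed auto

text \<open>The total degree drops with each step, so every depth beyond it reaches the same end of
  the recursion.\<close>

lemma inverse_coeff_stable:
 assumes "rh : MI ds" "(\<Sum>a<length ds. rh a) < n" "(\<Sum>a<length ds. rh a) < k"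
 shows "inverse_coeff ds F n rh x = inverse_coeff ds F k rh x" using assms proof (induction n arbitrary: k rh)
 case (Suc n)
 obtain l where k: "k = Suc l" using Suc.prems(3) by (cases k) auto
 have "inverse_coeff ds F n (%a. rh a - mu a) x = inverse_coeff ds F l (%a. rh a - mu a) x"
  if "mu \<le> rh & mu ~= (%_. 0)" for mu using size_diff_less[OF Suc.prems(1), of mu] that Suc.prems k
  by (intro Suc.IH mi_mono[OF Suc.prems(1)]) (auto simp: le_fun_def)
 then show ?case unfolding k inverse_coeff.simps
  by (intro arg_cong2[where f="(*)"] arg_cong2[where f="(+)"] sum.cong HOL.refl) simp
qed simp

lemma ps_inverse:
 assumes V: "openin (Euclidean_space p) V" and F: "F : carrier (PSA p ds V)"
  and nz: "!!x. x : V ==> F (%_. 0) x ~= 0"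
 shows "EX G:carrier (PSA p ds V). F \<otimes>\<^bsub>PSA p ds V\<^esub> G = \<one>\<^bsub>PSA p ds V\<^esub>"
proof -
 let ?I = "MI ds"
 \<comment> \<open>One step more than the total degree of \<open>rh\<close>, because depth 0 returns
   the default value 0.\<close>
 define G :: series where "G = (\<lambda>rh\<in>?I. \<lambda>x\<in>V. inverse_coeff ds F (Suc (\<Sum>a<length ds. rh a)) rh x)"
 have sub: "(%a. rh a - mu a) : ?I" if "rh : ?I" for rh mu by (rule mi_mono[OF that]) (simp add: le_fun_def)
 have fin: "finite {mu. mu \<le> rh & mu ~= (%_. 0)}" if "rh : ?I" for rh
  using finite_le_multi_index[OF that] by (rule rev_finite_subset) auto
 have smooth: "smooth p V (%x. inverse_coeff ds F n rh x)" if "rh : ?I" for n rh using that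
 proof (induction n arbitrary: rh)
  case 0
  then show ?case by (simp add: smooth_const[OF V])
 next
  case (Suc n)
  have "smooth p V (%x. msign ds mu (%a. rh a - mu a) * F mu x * inverse_coeff ds F n (%a. rh a - mu a) x)"
   if "mu \<le> rh" for mu by (intro smooth_mult[OF V] smooth_const[OF V] Suc.IH sub Suc.prems
   ps_smooth[OF V F] mi_mono[OF Suc.prems that])
  then show ?case unfolding inverse_coeff.simps
   by (intro smooth_mult[OF V smooth_inverse[OF V ps_smooth[OF V F mi_zero]]
   smooth_add[OF V smooth_const[OF V] smooth_mult[OF V smooth_const[OF V] smooth_sum[OF V]]]])
   (use nz in auto)
 qed
 have G: "G : carrier (PSA p ds V)" unfolding G_def by (rule ps_memI[OF V smooth])
 moreover have "F \<otimes>\<^bsub>PSA p ds V\<^esub> G = \<one>\<^bsub>PSA p ds V\<^esub>"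
 proof (rule ps_eqI[of _ p ds V, OF ps_closed(1)[OF V F G] ps_closed(4)[OF V]])
  fix rh x assume *: "rh : ?I" "x : V"
  let ?n = "\<Sum>a<length ds. rh a"
  let ?t = "%mu. msign ds mu (%a. rh a - mu a) * F mu x * G (%a. rh a - mu a) x"
  have "{mu. mu \<le> rh} = insert (%_. 0) {mu. mu \<le> rh & mu ~= (%_. 0)}" by (auto simp: le_fun_def)
  then have "(F \<otimes>\<^bsub>PSA p ds V\<^esub> G) rh x = ?t (%_. 0) + (\<Sum>mu | mu \<le> rh & mu ~= (%_. 0). ?t mu)"
   unfolding ps_apply(1)[OF V *] conv_def using fin[OF *(1)] by simp
  also have "(\<Sum>mu | mu \<le> rh & mu ~= (%_. 0). ?t mu) = (\<Sum>mu | mu \<le> rh & mu ~= (%_. 0).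
   msign ds mu (%a. rh a - mu a) * F mu x * inverse_coeff ds F ?n (%a. rh a - mu a) x)"
  proof (rule sum.cong[OF HOL.refl])
   fix mu assume mu: "mu : {mu. mu \<le> rh & mu ~= (%_. 0)}"
   have "G (%a. rh a - mu a) x = inverse_coeff ds F (Suc (\<Sum>a<length ds. rh a - mu a)) (%a. rh a - mu a) x"
   unfolding G_def using sub[OF *(1)] *(2) by simp
   also have "... = inverse_coeff ds F ?n (%a. rh a - mu a) x"
   by (rule inverse_coeff_stable[OF sub[OF *(1)]]) (use size_diff_less[OF *(1), of mu] mu in auto)
   finally show "?t mu = msign ds mu (%a. rh a - mu a) * F mu x * inverse_coeff ds F ?n (%a. rh a - mu a) x"
   by simp
  qed
  \<comment> \<open>The only term that contains the coefficient of \<open>G\<close> at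
    \<open>rh\<close> itself; the recursion is solved for it.\<close>
  also have "?t (%_. 0) = F (%_. 0) x * inverse_coeff ds F (Suc ?n) rh x"
   using * by (simp add: G_def monomial_sign_zero del: inverse_coeff.simps)
  finally show "(F \<otimes>\<^bsub>PSA p ds V\<^esub> G) rh x = \<one>\<^bsub>PSA p ds V\<^esub> rh x"
   using nz[OF *(2)] ps_apply(4)[OF V *] by (simp add: field_simps)
 qed
 ultimately show ?thesis by blast
qed

locale atlas_chart = superchart M U0 p q ph kp + atlas M p q
 for M :: "('m, 'b, 1) ringed_space" and U0 p q ph kp
begin

interpretation TP: presheaf_of_rings TM
 by (rule presheaf_of_rings_if_presheaf_of_algebras[OF presheaf_TM])

lemma psi_cut: "W : opens M U0 ==> V : opens M W ==> F : carrier (TS W) ==> cut V (psi W F) = psi V (rs V F)"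
 unfolding cut_def by (rule psi_res[symmetric])

context
 fixes x :: 'm
 assumes x: "x : U0"
begin

abbreviation \<S> :: "(('m set \<times> ('m, 'b) completed_form) set, 2) graded_algebra" where
 "\<S> \<equiv> stalk TM x"

definition represents :: "'m set => series => ('m set \<times> ('m, 'b) completed_form) set => bool" where
 "represents W F g \<longleftrightarrow> W : opens M U0 & x : W & F : carrier (TS W) & g = germ TM x W (psi W F)"

text \<open>The value at \<open>x\<close> of the constant term. It is independent of the
  representing series by \<open>ev_represents\<close>, which justifies the description.\<close>

definition ev :: "('m set \<times> ('m, 'b) completed_form) set => real" where
 "ev g = (THE r. EX W F. represents W F g & r = F (%_. 0) (ph x))"

lemma zero_index: "(%_. 0) : I" by (rule mi_zero)

lemma represents_local: "represents W F g ==> TP.local_section x W (psi W F)"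
 unfolding represents_def using psi_closed by (auto simp: TP.local_section_def)

lemma represents_restrict:
 assumes "represents W F g" "V : opens M W" "x : V" shows "represents V (rs V F) g" proof -
 have W: "W : opens M U0" and F: "F : carrier (TS W)" and g: "g = germ TM x W (psi W F)"
  using assms(1) by (auto simp: represents_def)
 have "g = germ TM x V (psi V (rs V F))"
  using TP.germ_restrict[OF represents_local[OF assms(1)], of V] assms(2,3) psi_cut[OF W assms(2) F] by (simp add: g)
 then show ?thesis
  using opens_sub0[OF W assms(2)] assms(3) graded_hom_simps(1)[OF rs_hom[OF W assms(2)] F] by (simp add: represents_def)
qed

text \<open>Two representing series give the same completed form on a smaller neighbourhood, and
  \<open>psi\<close> is injective there.\<close>

lemma ev_represents:
 assumes F: "represents W F g" shows "ev g = F (%_. 0) (ph x)" unfolding ev_def proof (rule the_equality)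
 show "EX W' F'. represents W' F' g & F (%_. 0) (ph x) = F' (%_. 0) (ph x)" using F by blast
 fix r assume "EX V G. represents V G g & r = G (%_. 0) (ph x)"
 then obtain V G where G: "represents V G g" and r: "r = G (%_. 0) (ph x)" by blast
 have "germ TM x W (psi W F) = germ TM x V (psi V G)" using F G by (simp add: represents_def)
 then obtain X where X: "openin (base M) X" "X <= W Int V" "x : X" "cut X (psi W F) = cut X (psi V G)"
  unfolding TP.germ_eq_iff[OF represents_local[OF F] represents_local[OF G]] by auto
 then have o: "X : opens M W" "X : opens M V" by auto
 have W: "W : opens M U0" "F : carrier (TS W)" "V : opens M U0" "G : carrier (TS V)"
  using F G by (auto simp: represents_def)
 have "rs X F = rs X G" using X(4) psi_cut[OF W(1) o(1) W(2)] psi_cut[OF W(3) o(2) W(4)]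
  by (intro psi_inj[OF opens_sub0[OF W(1) o(1)]] graded_hom_simps(1)[OF rs_hom[OF W(1) o(1)] W(2)]
   graded_hom_simps(1)[OF rs_hom[OF W(3) o(2)] W(4)]) simp
 then show "r = F (%_. 0) (ph x)" unfolding r using rs_apply[OF zero_index X(3)] by metis
qed

text \<open>Shrinking the neighbourhood into the chart makes \<open>psi_surj\<close> applicable, and
  homogeneity carries over by \<open>psi_gcomp_iff\<close>.\<close>

lemma ex_represents:
 assumes U: "openin (base M) U" "x : U" and s: "s : carrier (CM U)"
 shows "EX W F. represents W F (germ TM x U s) & (ALL d. s : gcomp (CM U) d --> F : gcomp (TS W) d)" proof -
 let ?W = "U Int U0"
 have oW: "openin (base M) ?W" using U U0 by blast
 then have W: "?W : opens M U0" "x : ?W" using U x by auto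
 obtain F where F: "F : carrier (TS ?W)" "psi ?W F = cut ?W s" using psi_surj[OF W(1) cut_closed[OF s oW]] by auto
 have "germ TM x U s = germ TM x ?W (psi ?W F)"
  using TP.germ_restrict[of x U s ?W] U s oW W F(2) by (simp add: TP.local_section_def)
 then have "represents ?W F (germ TM x U s)" using W F(1) by (simp add: represents_def)
 moreover have "F : gcomp (TS ?W) d" if "s : gcomp (CM U) d" for d
  using cut_gcomp[OF that oW] psi_gcomp_iff[OF W(1) F(1)] F(2) by simp
 ultimately show ?thesis by blast
qed

lemma common_represents:
 assumes "g : carrier \<S>" "h : carrier \<S>"
 obtains W F G where "represents W F g" "represents W G h" proof -
 obtain U s V t where "TP.local_section x U s" "g = germ TM x U s" "TP.local_section x V t" "h = germ TM x V t"
  using assms unfolding TP.stalk_carrier by blast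
 then obtain W F W' G where F: "represents W F g" and G: "represents W' G h"
  using ex_represents unfolding TP.local_section_def TM_simps by metis
 have o: "W Int W' : opens M W" "W Int W' : opens M W'" "x : W Int W'" using F G by (auto simp: represents_def)
 show ?thesis using that represents_restrict[OF F o(1,3)] represents_restrict[OF G o(2,3)] by blast
qed

lemma graded_local_chart: "graded_local \<S>" proof (rule graded_local_criterion[where ev=ev])
 have xt: "x : topspace (base TM)" using x openin_subset[OF U0] by auto
 show ring: "ring \<S>" by (rule TP.ring_stalk[OF xt])
 show "gcomp \<S> d <= carrier \<S>" for d unfolding TP.stalk_carrier TP.stalk_gcomp subset_iff
  using graded_comm_algebra.gcomp_closed[OF graded_CM] by (auto simp: TP.local_section_def) blast
 show "ev (g \<oplus>\<^bsub>\<S>\<^esub> h) = ev g + ev h" "ev (g \<otimes>\<^bsub>\<S>\<^esub> h) = ev g * ev h"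
  if gh: "g : carrier \<S>" "h : carrier \<S>" for g h proof -
  obtain W F G where F: "represents W F g" and G: "represents W G h" using common_represents[OF gh] .
  have W: "W : opens M U0" "x : W" "F : carrier (TS W)" "G : carrier (TS W)"
   and g: "g = germ TM x W (psi W F)" "h = germ TM x W (psi W G)" using F G by (auto simp: represents_def)
  interpret T: graded_comm_algebra "TS W"
   by (rule graded_TS[OF W(1)])
  have y: "ph x : ph ` W" using W by auto
  have "represents W (F \<oplus>\<^bsub>TS W\<^esub> G) (g \<oplus>\<^bsub>\<S>\<^esub> h)" "represents W (F \<otimes>\<^bsub>TS W\<^esub> G) (g \<otimes>\<^bsub>\<S>\<^esub> h)"
   using W TP.stalk_add[OF represents_local[OF F] represents_local[OF G]]
   TP.stalk_mult[OF represents_local[OF F] represents_local[OF G]]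
   by (simp_all add: represents_def g psi_add[OF W(1)] psi_mult[OF W(1)])
  \<comment> \<open>The zero index has only the trivial splitting, so the constant term of a product
    is the product of the constant terms.\<close>
  moreover have "{mu. mu \<le> (%_. 0)} = {%_::nat. 0::nat}" by (auto simp: le_fun_def)
  ultimately show "ev (g \<oplus>\<^bsub>\<S>\<^esub> h) = ev g + ev h" "ev (g \<otimes>\<^bsub>\<S>\<^esub> h) = ev g * ev h"
   using ps_apply(1,2)[OF open_image[OF W(1)] zero_index y]
   by (simp_all add: ev_represents[OF F] ev_represents[OF G] ev_represents conv_def monomial_sign_zero)
 qed
 have U: "U0 : opens M U0" using U0 by simp
 have "represents U0 \<one>\<^bsub>TS U0\<^esub> \<one>\<^bsub>\<S>\<^esub>"
  using TP.stalk_one[of U0 x] U0 x U psi_one[OF U] ps_closed(4)[OF open_image[OF U]] by (simp add: represents_def)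
 then show "ev \<one>\<^bsub>\<S>\<^esub> = 1"
  using ps_apply(4)[OF open_image[OF U] zero_index, of "ph x"] x by (simp add: ev_represents)
 have hom: "EX W F. represents W F g & F : gcomp (TS W) d" if "g : gcomp \<S> d" for g d proof -
  obtain U s where "openin (base M) U" "x : U" "s : gcomp (CM U) d" "g = germ TM x U s"
   using \<open>g : gcomp \<S> d\<close> unfolding TP.stalk_gcomp TM_simps by blast
  then show ?thesis using ex_represents graded_comm_algebra.gcomp_closed[OF graded_CM] by metis
 qed
 \<comment> \<open>The constant monomial has degree 0 and does not occur in any other
   degree.\<close>
 show "ev g = 0" if g: "g : gcomp \<S> d" and d: "d ~= 0" for g d proof -
  obtain W F where F: "represents W F g" "F : gcomp (TS W) d" using hom[OF g] by blast
  then have "ph x : ph ` W" by (auto simp: represents_def)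
  then show ?thesis
   using F(2) d zero_index unfolding ev_represents[OF F(1)] gcomp_ps by (auto simp: monomial_degree_zero)
 qed
 show "EX f. (ALL d. f d : gcomp \<S> d) & g = (\<Oplus>\<^bsub>\<S>\<^esub>d\<in>UNIV. f d)" if g: "g : carrier \<S>" for g
 proof -
  obtain U s where U: "openin (base M) U" "x : U" "s : carrier (CM U)" "g = germ TM x U s"
   using g unfolding TP.stalk_carrier TP.local_section_def TM_simps by blast
  interpret C: graded_comm_algebra "CM U"
   by (rule graded_CM[OF U(1)])
  have "(\<Oplus>\<^bsub>\<S>\<^esub>d\<in>UNIV. germ TM x U (C.component d s)) = g"
   using TP.germ_finsum[of U x UNIV "%d. C.component d s"] U C.component_closed C.component(2) by simp
  moreover have "germ TM x U (C.component d s) : gcomp \<S> d" for d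
   unfolding TP.stalk_gcomp TM_simps using U C.component(1) by blast
  ultimately show ?thesis by (intro exI[of _ "%d. germ TM x U (C.component d s)"]) auto
 qed
 show "EX h:carrier \<S>. g \<otimes>\<^bsub>\<S>\<^esub> h = \<one>\<^bsub>\<S>\<^esub>" if g: "g : gcomp \<S> 0" and nz: "ev g ~= 0" for g
 proof -
  obtain W F where F: "represents W F g" using hom[OF g] by blast
  have W: "W : opens M U0" "x : W" "F : carrier (TS W)" using F by (auto simp: represents_def)
  note oi = open_image[OF W(1)]
  \<comment> \<open>The constant term is continuous and nonzero at \<open>ph x\<close>, hence
    nonzero on an open neighbourhood, over which \<open>ps_inverse\<close> inverts the
    series.\<close>
  define Y where "Y = {y : ph ` W. F (%_. 0) y ~= 0}"
  have "F (%_. 0) : smooth_functions p (ph ` W)" using W(3) zero_index unfolding ps_simps(1) by (rule PiE_mem)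
  then have "continuous_map (subtopology (Euclidean_space p) (ph ` W)) euclideanreal (F (%_. 0))"
   unfolding smooth_functions_def by (auto dest: spec[of _ "[]"])
  then have "openin (subtopology (Euclidean_space p) (ph ` W))
   {y : topspace (subtopology (Euclidean_space p) (ph ` W)). F (%_. 0) y : - {0}}"
   by (rule openin_continuous_map_preimage) (simp add: open_Compl)
  moreover have "topspace (subtopology (Euclidean_space p) (ph ` W)) = ph ` W"
   using openin_subset[OF oi] by (auto simp: topspace_subtopology)
  ultimately have "openin (Euclidean_space p) Y"
   using openin_trans_full[OF _ oi] by (simp only: Y_def Compl_iff singleton_iff)
  moreover have "Y <= ph ` U0" using W(1) by (auto simp: Y_def)
  ultimately have "openin (base M) {z : U0. ph z : Y}" by (rule open_preimage)
  moreover define X where "X = {z : U0. ph z : Y}"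
  moreover have XW: "X <= W" using W(1) inj_ph unfolding X_def Y_def inj_on_def by blast
  moreover have xX: "x : X" using x W(2) nz ev_represents[OF F] by (auto simp: X_def Y_def)
  ultimately have X: "X : opens M W" by simp
  note X0 = opens_sub0[OF W(1) X] and FX = represents_restrict[OF F X xX]
  have Fc: "rs X F : carrier (TS X)" using FX by (simp add: represents_def)
  have "rs X F (%_. 0) y ~= 0" if y: "y : ph ` X" for y proof -
   obtain z where z: "z : X" "y = ph z" using y by blast
   then have "F (%_. 0) (ph z) ~= 0" by (simp add: X_def Y_def)
   then show ?thesis unfolding z(2) rs_apply[OF zero_index z(1)] .
  qed
  from ps_inverse[OF open_image[OF X0] Fc this]
  obtain G where G: "G : carrier (TS X)" "rs X F \<otimes>\<^bsub>TS X\<^esub> G = \<one>\<^bsub>TS X\<^esub>"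
   by blast
  then have Gr: "represents X G (germ TM x X (psi X G))" using X0 xX by (simp add: represents_def)
  have "g = germ TM x X (psi X (rs X F))" using FX by (simp add: represents_def)
  then have "g \<otimes>\<^bsub>\<S>\<^esub> germ TM x X (psi X G) = germ TM x X (psi X \<one>\<^bsub>TS X\<^esub>)"
   using TP.stalk_mult[OF represents_local[OF FX] represents_local[OF Gr]] psi_mult[OF X0 Fc G(1)] G(2) by simp
  also have "... = \<one>\<^bsub>\<S>\<^esub>" using TP.stalk_one[of X x] X0 xX psi_one[OF X0] by simp
  finally show ?thesis using TP.germ_closed[OF represents_local[OF Gr]] by blast
 qed
qed

end

end

lemma (in atlas) graded_local_stalk:
 assumes "x : topspace (base M)" shows "graded_local (stalk (tangent_bundle M) x)" proof -
 obtain U0 ph kp where c: "x : U0" "superchart M U0 p q ph kp" using charts[OF assms] by blast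
 interpret superchart M U0 p q ph kp
  by (rule c(2))
 have "atlas_chart M U0 p q ph kp" by (intro atlas_chart.intro c(2) atlas_axioms)
 from atlas_chart.graded_local_chart[OF this c(1)] show ?thesis .
qed

subsection \<open>Local triviality\<close>

text \<open>\<open>psi\<close> leads from the power series over \<open>V\<close> to the completed
  forms over the preimage of \<open>V\<close>, which is the direction that
  \<open>isomorphic_ringed_spaces\<close> asks for.\<close>

lemma (in superchart) tangent_isomorphic:
 "isomorphic_ringed_spaces (open_subspace (tangent_bundle M) U0) (superdomain p (tdegs p q) (ph ` U0))" proof -
 let ?X = "subtopology (base M) U0" and ?Y = "subtopology (Euclidean_space p) (ph ` U0)"
 have U: "U0 : opens M U0" using U0 by simp
 note oi = open_image[OF U]
 have X: "topspace ?X = U0" "topspace ?Y = ph ` U0" using openin_subset[OF U0] openin_subset[OF oi] by auto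
 have sub: "openin ?X W \<longleftrightarrow> W : opens M U0" "openin ?Y V \<longleftrightarrow> openin (Euclidean_space p) V & V <= ph ` U0" for W V
  using openin_open_subtopology[OF U0] openin_open_subtopology[OF oi] by auto
 define pre where "pre V = {x : U0. ph x : V}" for V
 have pre: "pre V : opens M U0" "ph ` pre V = V" if "openin ?Y V" for V
  using that open_preimage unfolding sub pre_def by auto
 have homeo: "homeomorphic_map ?X ?Y ph" proof (rule bijective_open_imp_homeomorphic_map)
  show "continuous_map ?X ?Y ph" unfolding continuous_map_def X sub(1) using pre(1) by (auto simp: pre_def)
  show "open_map ?X ?Y ph" unfolding open_map_def sub using open_image by auto
 qed (use X inj_ph in simp_all)
 have simps: "base (open_subspace (tangent_bundle M) U0) = ?X" "sections (open_subspace (tangent_bundle M) U0) = CF"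
  "base (superdomain p (tdegs p q) (ph ` U0)) = ?Y"
  "sections (superdomain p (tdegs p q) (ph ` U0)) = PSA p (tdegs p q)"
  by (simp_all add: open_subspace_def tangent_bundle_def superdomain_def)
 have TS: "TS (pre V) = PSA p (tdegs p q) V" if "openin ?Y V" for V using pre(2)[OF that] by simp
 have hom: "psi (pre V) : graded_hom (PSA p (tdegs p q) V) (CF (pre V))" if V: "openin ?Y V" for V proof -
  note W = pre(1)[OF V]
  have "psi (pre V) F : gcomp (CF (pre V)) d" if "F : gcomp (TS (pre V)) d" for F d
   using that psi_gcomp_iff[OF W] by (simp add: gcomp_ps)
  then have "psi (pre V) : graded_hom (TS (pre V)) (CF (pre V))" unfolding graded_hom_def
   using psi_closed[OF W] psi_mult[OF W] psi_add[OF W] psi_smult[OF W] psi_one[OF W] by (auto intro!: ring_hom_memI)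
  then show ?thesis unfolding TS[OF V] .
 qed
 have bij: "bij_betw (psi (pre V)) (carrier (PSA p (tdegs p q) V)) (carrier (CF (pre V)))" if V: "openin ?Y V" for V
 proof -
  note W = pre(1)[OF V]
  have "bij_betw (psi (pre V)) (carrier (TS (pre V))) (carrier (CF (pre V)))"
   unfolding bij_betw_def using psi_inj[OF W] psi_closed[OF W] psi_surj[OF W] by (auto intro!: inj_onI) blast
  then show ?thesis unfolding TS[OF V] .
 qed
 have nat: "psi (pre W) (res (superdomain p (tdegs p q) (ph ` U0)) V W F) =
   res (open_subspace (tangent_bundle M) U0) (pre V) (pre W) (psi (pre V) F)"
  if V: "openin ?Y V" and W: "openin ?Y W" "W <= V" and F: "F : carrier (PSA p (tdegs p q) V)" for V W F proof -
  have "pre W : opens M (pre V)" using pre(1)[OF W(1)] W(2) by (auto simp: pre_def)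
  from psi_res[OF pre(1)[OF V] this F[folded TS[OF V]]] show ?thesis
   using pre(2)[OF W(1)] by (simp add: rs_def superdomain_def open_subspace_def tangent_bundle_def)
 qed
 show ?thesis unfolding isomorphic_ringed_spaces_def Let_def simps X(1) using homeo hom bij nat unfolding pre_def
  by (intro exI[of _ ph] exI[of _ "%V. psi {x : U0. ph x : V}"] conjI allI impI ballI) auto
qed

text \<open>A change of indexing: the isomorphism is indexed by open sets of Euclidean space and
  ends in the sections of \<open>M\<close>, whereas a \<open>superchart\<close> is indexed by open
  sets of \<open>M\<close> and starts there. Hence the maps are inverted over the images of open
  sets.\<close>

lemma superchart_of_isomorphic:
 fixes M :: "('m, 'b, 1) ringed_space"
 assumes M: "presheaf_of_algebras M" and U: "openin (base M) U" and V: "openin (Euclidean_space p) V"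
  and iso: "isomorphic_ringed_spaces (open_subspace M U) (superdomain p (odegs q) V)"
 shows "EX ph kp. superchart M U p q ph kp" proof -
 let ?X = "subtopology (base M) U" and ?Y = "subtopology (Euclidean_space p) V"
 let ?P = "PSA p (odegs q)"
 have X: "topspace ?X = U" "topspace ?Y = V" using openin_subset[OF U] openin_subset[OF V] by auto
 have subY: "openin ?Y W \<longleftrightarrow> openin (Euclidean_space p) W & W <= V" for W
  using openin_open_subtopology[OF V] by auto
 have simps: "base (open_subspace M U) = ?X" "sections (open_subspace M U) = sections M" "res (open_subspace M U) = res M"
  "base (superdomain p (odegs q) V) = ?Y" "sections (superdomain p (odegs q) V) = ?P"
  by (simp_all add: open_subspace_def superdomain_def)
 define pre where "pre ph W = {x : U. ph x : W}" for ph :: "'m => nat => real" and W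
 obtain ph \<psi> where homeo: "homeomorphic_map ?X ?Y ph"
  and 1: "ALL W. openin ?Y W --> \<psi> W : graded_hom (?P W) (sections M (pre ph W)) \<and>
   bij_betw (\<psi> W) (carrier (?P W)) (carrier (sections M (pre ph W)))"
  and 2: "ALL W. openin ?Y W --> (ALL W':{W'. openin ?Y W' & W' <= W}. ALL f:carrier (?P W).
   \<psi> W' (res (superdomain p (odegs q) V) W W' f) = res M (pre ph W) (pre ph W') (\<psi> W f))"
  using iso unfolding isomorphic_ringed_spaces_def Let_def simps X(1) pre_def[symmetric]
  by (elim exE conjE) (rule that)
 note hom = 1[rule_format, THEN conjunct1] and bij = 1[rule_format, THEN conjunct2]
 have nat: "\<psi> W' (res (superdomain p (odegs q) V) W W' f) = res M (pre ph W) (pre ph W') (\<psi> W f)"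
  if "openin ?Y W" "openin ?Y W'" "W' <= W" "f : carrier (?P W)" for W W' f
  by (rule 2[rule_format, OF that(1) _ that(4)]) (use that in simp)
 have inj: "inj_on ph U" and im: "ph ` U = V"
  using homeomorphic_imp_injective_map[OF homeo] homeomorphic_imp_surjective_map[OF homeo] X by auto
 have W: "openin ?Y (ph ` W)" "pre ph (ph ` W) = W" if "W : opens M U" for W proof -
  have "openin ?X W" using that openin_open_subtopology[OF U] by auto
  then show "openin ?Y (ph ` W)" using homeomorphic_imp_open_map[OF homeo] by (simp add: open_map_def)
  show "pre ph (ph ` W) = W" using that inj unfolding pre_def inj_on_def by blast
 qed
 have gM: "graded_comm_algebra (sections M W)" if "W : opens M U" for W
  using M that by (simp add: presheaf_of_algebras_def)
 have gP: "graded_comm_algebra (?P (ph ` W))" if "W : opens M U" for W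
  using W(1)[OF that] by (intro graded_comm_algebra_power_series) (simp add: subY)
 define kp where "kp W = inv_into (carrier (?P (ph ` W))) (\<psi> (ph ` W))" for W
 have h: "\<psi> (ph ` W) : graded_hom (?P (ph ` W)) (sections M W)"
  and b: "bij_betw (\<psi> (ph ` W)) (carrier (?P (ph ` W))) (carrier (sections M W))" if "W : opens M U" for W
  using hom[OF W(1)[OF that]] bij[OF W(1)[OF that]] unfolding W(2)[OF that] by auto
 have "superchart M U p q ph kp"
 proof (intro superchart.intro exterior.intro algebra_presheaf.intro superchart_axioms.intro M U inj)
  show "openin (Euclidean_space p) (ph ` W)" if "W : opens M U" for W using W(1)[OF that] by (simp add: subY)
  show "openin (base M) {x : U. ph x : Y}" if "openin (Euclidean_space p) Y" "Y <= ph ` U" for Y proof -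
   have "openin ?Y Y" using that im by (simp add: subY)
   then have "openin ?X {x : topspace ?X. ph x : Y}"
   by (rule openin_continuous_map_preimage[OF homeomorphic_imp_continuous_map[OF homeo]])
   then show ?thesis unfolding X(1) using openin_trans_full[OF _ U] by blast
  qed
  show "kp W : graded_hom (sections M W) (?P (ph ` W))" if "W : opens M U" for W
   unfolding kp_def by (rule graded_hom_inverse[OF h[OF that] gP[OF that] gM[OF that] b[OF that]])
  show "bij_betw (kp W) (carrier (sections M W)) (carrier (?P (ph ` W)))" if "W : opens M U" for W
   unfolding kp_def by (rule bij_betw_inv_into[OF b[OF that]])
  show "kp W' (res M W W' a) = (\<lambda>mu\<in>MI (odegs q). restrict (kp W a mu) (ph ` W'))"
   if W0: "W : opens M U" and W': "W' : opens M W" and a: "a : carrier (sections M W)" for W W' a proof -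
   have W'0: "W' : opens M U" using W0 W' by auto
   have sub: "ph ` W' <= ph ` W" using W' by auto
   let ?f = "kp W a" and ?r = "res (superdomain p (odegs q) V) (ph ` W) (ph ` W')"
   have f: "?f : carrier (?P (ph ` W))" "\<psi> (ph ` W) ?f = a"
   unfolding kp_def using bij_betwE[OF bij_betw_inv_into[OF b[OF W0]]] a bij_betw_inv_into_right[OF b[OF W0] a] by auto
   have r: "?r ?f = (\<lambda>mu\<in>MI (odegs q). restrict (?f mu) (ph ` W'))" by (simp add: superdomain_def)
   have "?r ?f : carrier (?P (ph ` W'))"
   unfolding r using graded_hom_simps(1)[OF ps_restrict_hom[of p "ph ` W" "ph ` W'"] f(1)]
   W(1)[OF W0] W(1)[OF W'0] sub by (simp add: subY)
   moreover have "\<psi> (ph ` W') (?r ?f) = res M W W' a"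
   using nat[OF W(1)[OF W0] W(1)[OF W'0] sub f(1)] unfolding f(2) W(2)[OF W0] W(2)[OF W'0] .
   ultimately show ?thesis
   unfolding r[symmetric] using bij_betw_inv_into_left[OF b[OF W'0]] unfolding kp_def by metis
  qed
 qed
 then show ?thesis by blast
qed

text \<open>For \<open>n = 1\<close> there is just one nonzero degree, so the list of degrees is
  determined by its length.\<close>

lemma nonzero_degrees_odd:
 fixes ds :: "(bit ^ 1) list"
 assumes "0 \<notin> set ds" shows "ds = odegs (count_list ds 1)" using assms proof (induction ds)
 case (Cons d ds)
 have "d $ 1 = 1" using Cons.prems by (cases "d $ 1") (auto simp: vec_eq_iff)
 then have "d = 1" by (simp add: vec_eq_iff)
 with Cons show ?case by simp
qed simp

theorem proposition5p3:
 fixes M :: "('m, 'b, 1) ringed_space"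
 assumes "supermanifold M" shows "supermanifold (tangent_bundle M)" proof -
 obtain p Q where M: "supermanifold_of_dim p Q M" using assms unfolding supermanifold_def by blast
 let ?q = "Q 1"
 have presheaf: "presheaf_of_algebras M" using M unfolding supermanifold_of_dim_def sheaf_of_algebras_def by blast
 have charts: "EX U0 ph kp. x : U0 & superchart M U0 p ?q ph kp" if "x : topspace (base M)" for x proof -
  obtain U V ds where *: "openin (base M) U" "x : U" "openin (Euclidean_space p) V" "0 \<notin> set ds"
   "ALL d. count_list ds d = Q d" "isomorphic_ringed_spaces (open_subspace M U) (superdomain p ds V)"
   using M \<open>x : topspace (base M)\<close> unfolding supermanifold_of_dim_def by blast
  then have "ds = odegs ?q" using nonzero_degrees_odd[OF *(4)] by simp
  then show ?thesis using superchart_of_isomorphic[OF presheaf *(1,3)] * by blast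
 qed
 interpret atlas M p ?q
  by (intro atlas.intro exterior.intro algebra_presheaf.intro atlas_axioms.intro presheaf charts)
 have "bidegree 0 1 ~= 0" "bidegree 1 0 ~= 0" "bidegree 1 1 ~= 0"
  unfolding vec_eq_iff forall_2 by (simp_all add: bidegree_def)
 then have nz: "0 \<notin> set (tdegs p ?q)" by (auto simp: tdegs_def)
 \<comment> \<open>The formal variables are the old \<open>xi\<close> in degree (0,1), one
   \<open>dx\<close> for each even coordinate in degree (1,0) and one \<open>d xi\<close> for each
   odd coordinate in degree (1,1).\<close>
 have "supermanifold_of_dim p (%d. count_list (tdegs p ?q) d) (tangent_bundle M)"
  unfolding supermanifold_of_dim_def TM_simps(1) proof (intro conjI ballI sheaf_TM graded_local_stalk)
  show "Hausdorff_space (base M)" "second_countable (base M)" using M unfolding supermanifold_of_dim_def by blast+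
  fix x assume "x : topspace (base M)"
  then obtain U0 ph kp where c: "x : U0" "superchart M U0 p ?q ph kp" using charts by blast
  interpret c: superchart M U0 p ?q ph kp
   by (rule c(2))
  have "openin (Euclidean_space p) (ph ` U0)" using c.open_image c.U0 by simp
  then show "EX U V ds. openin (base M) U & x : U & openin (Euclidean_space p) V & 0 \<notin> set ds \<and>
   (ALL d. count_list ds d = count_list (tdegs p ?q) d) \<and>
   isomorphic_ringed_spaces (open_subspace (tangent_bundle M) U) (superdomain p ds V)"
   using c.U0 c(1) nz c.tangent_isomorphic by blast
 qed
 then show ?thesis unfolding supermanifold_def by blast
qed

end
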